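(* Let $n\ge1$, let $\{G_k\}_{k\in\mathbb{N}}$ be a sequence in $\mathfrak{G}_n$, and let $G_0\in\mathfrak{G}_n$. Then $\{G_k\}_{k\in\mathbb{N}}\to G_0$ in the topology of $\mathfrak{G}_n$ if and only if $\{G_k\}_{k\in\mathbb{N}}$ converges to $G_0$ uniformly on compact subsets of $\{x_3=0\}$.
   Context: **Surfaces.** $\mathbb{L}^3$ is $\mathbb{R}^3$ with the metric $dx_1^2+dx_2^2-dx_3^2$; $\langle(1,0,0)\rangle$ is the cyclic group generated by translation by $(1,0,0)$. A maximal surface is a spacelike surface (Riemannian induced metric) of zero mean curvature. A maximal embedding with singular set $F$ of a smooth surface $M$ in a Lorentzian $3$-manifold is a topological embedding $X$ such that $F\subset M$ is closed and discrete, $X|_{M-F}$ is a maximal embedding, and the induced metric converges to zero at the points of $F$. (Around $p\in F$, $M-F$ is then conformally an annulus $\{r<|z|<1\}$, $r>0$, $X$ extends analytically to $\{|z|=1\}$ as the constant $X(p)$, and the metric vanishes on $\{|z|=1\}$.) A CMF surface is a complete embedded maximal surface with a finite set of singularities. **The spaces $\mathfrak{G}_n$, $\mathfrak{M}_n$.** $\mathfrak{G}_n$ is the set of CMF surfaces $S$ in $\mathbb{L}^3/\langle(1,0,0)\rangle$ that are graphs over the cylinder $\{x_3=0\}$, have exactly $n+1$ singularities, and have their end $E_1$ (the one over $x_2\to+\infty$) asymptotic, up to a vertical translation, to the half cylinder $\{x_3=0,x_2\ge0\}$ (i.e. with vertical limit normal). Each $S$ has exactly two ends, $E_1$ and $E_2$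 (over $x_2\to-\infty$), each asymptotic to a spacelike flat half cylinder; $S$ is oriented by the past directed unit normal. The limit normal at $E_2$ lies in $\{x_1^2+x_2^2-x_3^2=-1,\ x_3<0,\ x_1=0\}$, identified with $]-1,1[$ by the inverse of $t\mapsto\big(0,\frac{-2t}{t^2-1},\frac{t^2+1}{t^2-1}\big)$; $c\in]-1,1[$ denotes the corresponding number. A mark in $S$ is an ordering $\mathfrak{m}=(q_0,\dots,q_n)$ of its singular points, and $\mathfrak{M}_n$ is the set of pairs $(S,\mathfrak{m})$, $S\in\mathfrak{G}_n$, $\mathfrak{m}$ a mark in $S$. **Topology of $\mathfrak{G}_n$.** The map $\mathfrak{s}_2:\mathfrak{M}_n\to(\mathbb{L}^3/\langle(1,0,0)\rangle)^{n+1}\times]-1,1[$, $(S,\mathfrak{m})\mapsto(\mathfrak{m},c)$, is injective with open image, and $\mathfrak{M}_n$ carries the (analytic) manifold structure making $\mathfrak{s}_2$ a diffeomorphism onto its image. $\mathfrak{G}_n$ is the quotient of $\mathfrak{M}_n$ by the action of the permutations of $n+1$ elements on marks, and carries the quotient manifold structure, for which $(S,\mathfrak{m})\mapsto S$ is an $(n+1)!$-sheeted covering; the topology of $\mathfrak{G}_n$ is the underlying one. **Uniform convergence of graphs.** If $u_k:\{x_3=0\}\subset\mathbb{L}^3/\langle(1,0,0)\rangle\to\mathbb{R}$ is the function whose graph is $G_k$ ($k\ge0$), $\{G_k\}$ converges to $G_0$ uniformly on compact subsets of $\{x_3=0\}$ if $u_k\to u_0$ uniformly on each compact subset of the cylinder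 $\{x_3=0\}$. *)

theory Defs
  imports "HOL-Analysis.Analysis"
begin

section \<open>The Lorentzian manifold $L^3/\langle(1,0,0)\rangle$\<close>

definition lorentz :: "real^3 \<Rightarrow> real^3 \<Rightarrow> real" where
  "lorentz v w = v$1 * w$1 + v$2 * w$2 - v$3 * w$3"

quotient_type l3quot =
  "real^3" / "\<lambda>x y. \<exists>k::int. y = x + vector [of_int k, 0, 0]"
  morphisms rep_l3quot proj
proof (rule equivpI)
  show "reflp (\<lambda>x y::real^3. \<exists>k::int. y = x + vector [of_int k, 0, 0])"
    by (rule reflpI) (rule exI[of _ 0], simp add: vec_eq_iff forall_3)
  show "symp (\<lambda>x y::real^3. \<exists>k::int. y = x + vector [of_int k, 0, 0])"
  proof (rule sympI)
    fix x y :: "real^3" assume "\<exists>k::int. y = x + vector [of_int k, 0, 0]"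
    then obtain k :: int where "y = x + vector [of_int k, 0, 0]" by blast
    then have "x = y + vector [of_int (- k), 0, 0]" by (simp add: vec_eq_iff forall_3)
    then show "\<exists>k::int. x = y + vector [of_int k, 0, 0]" by blast
  qed
  show "transp (\<lambda>x y::real^3. \<exists>k::int. y = x + vector [of_int k, 0, 0])"
  proof (rule transpI)
    fix x y z :: "real^3"
    assume "\<exists>k::int. y = x + vector [of_int k, 0, 0]" "\<exists>k::int. z = y + vector [of_int k, 0, 0]"
    then obtain k l :: int where
      "y = x + vector [of_int k, 0, 0]" "z = y + vector [of_int l, 0, 0]" by blast
    then have "z = x + vector [of_int (k + l), 0, 0]" by (simp add: vec_eq_iff forall_3)
    then show "\<exists>k::int. z = x + vector [of_int k, 0, 0]" by blast
  qed
qed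

instantiation l3quot :: topological_space
begin

definition open_l3quot :: "l3quot set \<Rightarrow> bool" where
  "open_l3quot U \<longleftrightarrow> open (proj -` U)"

instance
proof
  show "open (UNIV :: l3quot set)" by (simp add: open_l3quot_def)
  show "open (S \<inter> T)" if "open S" "open T" for S T :: "l3quot set"
    using that by (auto simp: open_l3quot_def vimage_Int)
  show "open (\<Union>K)" if "\<forall>S\<in>K. open S" for K :: "l3quot set set"
    using that by (auto simp: open_l3quot_def vimage_Union)
qed

end

lift_definition x2 :: "l3quot \<Rightarrow> real" is "\<lambda>x. x$2" by auto
lift_definition x3 :: "l3quot \<Rightarrow> real" is "\<lambda>x. x$3" by auto

lift_definition vshift :: "l3quot \<Rightarrow> real \<Rightarrow> l3quot" is "\<lambda>x t. x + vector [0, 0, t]"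
proof -
  fix x y :: "real^3" and t :: real
  assume "\<exists>k::int. y = x + vector [of_int k, 0, 0]"
  then show "\<exists>k::int. y + vector [0, 0, t] = x + vector [0, 0, t] + vector [of_int k, 0, 0]"
    by (auto simp: algebra_simps)
qed

definition cylinder :: "l3quot set" where
  "cylinder = {q. x3 q = 0}"

definition graph_over_cylinder :: "l3quot set \<Rightarrow> bool" where
  "graph_over_cylinder S \<longleftrightarrow> (\<forall>q\<in>cylinder. \<exists>!t. vshift q t \<in> S)"

definition graph_fun :: "l3quot set \<Rightarrow> l3quot \<Rightarrow> real" where
  "graph_fun S q = (THE t. vshift q t \<in> S)"


section \<open>Spacelike and maximal surfaces\<close>

primrec Ck_on :: "nat \<Rightarrow> 'a::real_normed_vector set \<Rightarrow> ('a \<Rightarrow> 'b::real_normed_vector) \<Rightarrow> bool" where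
  "Ck_on 0 U f \<longleftrightarrow> continuous_on U f"
| "Ck_on (Suc k) U f \<longleftrightarrow>
     f differentiable_on U \<and> (\<forall>v. Ck_on k U (\<lambda>x. frechet_derivative f (at x) v))"

text \<open>Used for open domains only.\<close>

definition smooth_on :: "'a::real_normed_vector set \<Rightarrow> ('a \<Rightarrow> 'b::real_normed_vector) \<Rightarrow> bool" where
  "smooth_on U f \<longleftrightarrow> (\<forall>k. Ck_on k U f)"

text \<open>Parameter domains are open subsets of the complex plane, regarded as the real plane;
  \<open>dir X w z\<close> is the directional derivative of \<open>X\<close> at \<open>z\<close> along \<open>w\<close>, so \<open>dir X 1\<close> and
  \<open>dir X \<i>\<close> are the partial derivatives. Local parametrizations of a subset of the quotient
  are given by local lifts to Lorentz-Minkowski space.\<close>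

definition dir :: "(complex \<Rightarrow> real^3) \<Rightarrow> complex \<Rightarrow> complex \<Rightarrow> real^3" where
  "dir X w z = frechet_derivative X (at z) w"

definition spacelike_patch :: "l3quot set \<Rightarrow> complex set \<Rightarrow> (complex \<Rightarrow> real^3) \<Rightarrow> bool" where
  "spacelike_patch S U X \<longleftrightarrow>
     open U \<and> smooth_on U X \<and>
     (\<forall>z\<in>U. \<forall>w. w \<noteq> 0 \<longrightarrow> lorentz (dir X w z) (dir X w z) > 0) \<and>
     openin (top_of_set S) ((proj \<circ> X) ` U) \<and>
     (\<exists>Y. homeomorphism U ((proj \<circ> X) ` U) (proj \<circ> X) Y)"

definition unit_normal :: "(complex \<Rightarrow> real^3) \<Rightarrow> complex \<Rightarrow> real^3 \<Rightarrow> bool" where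
  "unit_normal X z \<nu> \<longleftrightarrow> lorentz \<nu> \<nu> = -1 \<and> (\<forall>w. lorentz \<nu> (dir X w z) = 0)"

definition mean_curvature :: "(complex \<Rightarrow> real^3) \<Rightarrow> complex \<Rightarrow> real^3 \<Rightarrow> real" where
  "mean_curvature X z \<nu> =
    (let E = lorentz (dir X 1 z) (dir X 1 z);
         F = lorentz (dir X 1 z) (dir X \<i> z);
         G = lorentz (dir X \<i> z) (dir X \<i> z);
         e = lorentz (dir (dir X 1) 1 z) \<nu>;
         f = lorentz (dir (dir X 1) \<i> z) \<nu>;
         g = lorentz (dir (dir X \<i>) \<i> z) \<nu>
     in (e * G - 2 * f * F + g * E) / (2 * (E * G - F\<^sup>2)))"

definition maximal_surface :: "l3quot set \<Rightarrow> bool" where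
  "maximal_surface S \<longleftrightarrow>
     (\<forall>p\<in>S. \<exists>U X. spacelike_patch S U X \<and> p \<in> (proj \<circ> X) ` U \<and>
        (\<forall>z\<in>U. \<forall>\<nu>. unit_normal X z \<nu> \<longrightarrow> mean_curvature X z \<nu> = 0))"

text \<open>By uniformization, a small punctured disc around an isolated singularity is conformally
  either an annulus, the puncture corresponding to $|z| \to 1$, or a punctured disc, the puncture
  corresponding to $z \to 0$. The metric $\lambda |dz|^2$ converges to zero at the singularity if
  $\lambda$ tends to $0$ along this end. This does not depend on the conformal coordinate, whereas
  an arbitrary smooth chart at the singularity would be meaningless: its smooth structure
  can be changed there at will. (For embedded maximal surfaces only annuli actually occur.)\<close>

definition punctured_disc_models :: "(complex set \<times> complex filter) set" where
  "punctured_disc_models =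
     insert ({z. 0 < norm z \<and> norm z < 1}, at 0)
       {({z. r < norm z \<and> norm z < 1}, filtercomap norm (at_left 1)) | r. 0 < r \<and> r < 1}"

definition conformal_on :: "complex set \<Rightarrow> (complex \<Rightarrow> real^3) \<Rightarrow> bool" where
  "conformal_on U X \<longleftrightarrow>
     (\<forall>z\<in>U. lorentz (dir X 1 z) (dir X 1 z) = lorentz (dir X \<i> z) (dir X \<i> z) \<and>
             lorentz (dir X 1 z) (dir X \<i> z) = 0)"

definition metric_vanishes_at :: "l3quot set \<Rightarrow> l3quot set \<Rightarrow> l3quot \<Rightarrow> bool" where
  "metric_vanishes_at S F p \<longleftrightarrow>
     (\<exists>(A, \<F>)\<in>punctured_disc_models. \<exists>X.
        spacelike_patch (S - F) A X \<and> conformal_on A X \<and>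
        openin (top_of_set S) (insert p ((proj \<circ> X) ` A)) \<and>
        ((proj \<circ> X) \<longlongrightarrow> p) \<F> \<and>
        ((\<lambda>z. lorentz (dir X 1 z) (dir X 1 z)) \<longlongrightarrow> 0) \<F>)"

definition topological_surface :: "l3quot set \<Rightarrow> bool" where
  "topological_surface S \<longleftrightarrow>
     (\<forall>p\<in>S. \<exists>V. p \<in> V \<and> openin (top_of_set S) V \<and> V homeomorphic (ball 0 1 :: complex set))"

text \<open>\<open>S\<close> is the image of a maximal embedding and \<open>F\<close> the image of its singular set. The first
  three conjuncts say that \<open>F\<close> is a closed discrete subset of \<open>S\<close>.\<close>

definition maximal_with_singularities :: "l3quot set \<Rightarrow> l3quot set \<Rightarrow> bool" where
  "maximal_with_singularities S F \<longleftrightarrow>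
     F \<subseteq> S \<and> closedin (top_of_set S) F \<and>
     (\<forall>p\<in>F. \<exists>V. open V \<and> V \<inter> F = {p}) \<and>
     topological_surface S \<and>
     maximal_surface (S - F) \<and>
     (\<forall>p\<in>F. metric_vanishes_at S F p)"

text \<open>Completeness: divergent curves have infinite length. For finite \<open>F\<close> a divergent curve
  eventually avoids \<open>F\<close>, so it suffices to consider curves in \<open>S - F\<close>; they are given by lifts.
  Piecewise $C^1$ curves become $C^1$ after reparametrization.\<close>

definition complete_surface :: "l3quot set \<Rightarrow> l3quot set \<Rightarrow> bool" where
  "complete_surface S F \<longleftrightarrow>
     (\<forall>\<gamma> :: real \<Rightarrow> real^3.
        \<gamma> C1_differentiable_on {0..} \<and> (\<forall>t\<ge>0. proj (\<gamma> t) \<in> S - F) \<and>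
        (\<forall>K\<subseteq>S. compact K \<longrightarrow> eventually (\<lambda>t. proj (\<gamma> t) \<notin> K) at_top) \<longrightarrow>
        (\<integral>\<^sup>+t\<in>{0..}. ennreal (sqrt (lorentz (vector_derivative \<gamma> (at t))
           (vector_derivative \<gamma> (at t)))) \<partial>lborel) = \<infinity>)"

definition CMF :: "l3quot set \<Rightarrow> l3quot set \<Rightarrow> bool" where
  "CMF S F \<longleftrightarrow> finite F \<and> maximal_with_singularities S F \<and> complete_surface S F"


section \<open>The ends\<close>

definition past_unit_normal :: "l3quot set \<Rightarrow> l3quot \<Rightarrow> real^3 \<Rightarrow> bool" where
  "past_unit_normal S p \<nu> \<longleftrightarrow>
     \<nu>$3 < 0 \<and> (\<exists>U X z. spacelike_patch S U X \<and> z \<in> U \<and> proj (X z) = p \<and> unit_normal X z \<nu>)"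

definition E1_asymptotic_horizontal :: "l3quot set \<Rightarrow> bool" where
  "E1_asymptotic_horizontal S \<longleftrightarrow>
     (\<exists>b. \<forall>\<epsilon>>0. \<exists>R. \<forall>p\<in>S. x2 p > R \<longrightarrow> \<bar>x3 p - b\<bar> < \<epsilon>)"

definition E2_limit_normal :: "l3quot set \<Rightarrow> real^3 \<Rightarrow> bool" where
  "E2_limit_normal S \<nu> \<longleftrightarrow>
     (\<forall>\<epsilon>>0. \<exists>R. \<forall>p\<in>S. x2 p < R \<longrightarrow> (\<forall>\<nu>'. past_unit_normal S p \<nu>' \<longrightarrow> dist \<nu>' \<nu> < \<epsilon>))"

definition normal_of_param :: "real \<Rightarrow> real^3" where
  "normal_of_param t = vector [0, - 2 * t / (t\<^sup>2 - 1), (t\<^sup>2 + 1) / (t\<^sup>2 - 1)]"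

definition c_param :: "l3quot set \<Rightarrow> real" where
  "c_param S = (THE t. t \<in> {-1<..<1} \<and> E2_limit_normal S (normal_of_param t))"


section \<open>The moduli spaces and their topologies\<close>

definition GG :: "nat \<Rightarrow> l3quot set set" where
  "GG n = {S. graph_over_cylinder S \<and> E1_asymptotic_horizontal S \<and>
              (\<exists>F. CMF S F \<and> card F = n + 1)}"

text \<open>Marks are extensional functions, hence points of the product topology over \<open>{..n}\<close>.\<close>

definition MM :: "nat \<Rightarrow> (l3quot set \<times> (nat \<Rightarrow> l3quot)) set" where
  "MM n = {(S, m). S \<in> GG n \<and> m \<in> extensional {..n} \<and> (\<exists>F. CMF S F \<and> bij_betw m {..n} F)}"

definition s2 :: "l3quot set \<times> (nat \<Rightarrow> l3quot) \<Rightarrow> (nat \<Rightarrow> l3quot) \<times> real" where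
  "s2 = (\<lambda>(S, m). (m, c_param S))"

definition MM_topology :: "nat \<Rightarrow> (l3quot set \<times> (nat \<Rightarrow> l3quot)) topology" where
  "MM_topology n =
     pullback_topology (MM n) s2
       (prod_topology (product_topology (\<lambda>_. euclidean) {..n}) (top_of_set {-1<..<1}))"

text \<open>The quotient topology along \<open>(S, m) \<mapsto> S\<close>.\<close>

definition GG_topology :: "nat \<Rightarrow> l3quot set topology" where
  "GG_topology n =
     topology (\<lambda>W. W \<subseteq> GG n \<and> openin (MM_topology n) {x \<in> MM n. fst x \<in> W})"

lemma openin_GG_topology:
  "openin (GG_topology n) W \<longleftrightarrow> W \<subseteq> GG n \<and> openin (MM_topology n) {x \<in> MM n. fst x \<in> W}"
proof -
  let ?P = "\<lambda>W. W \<subseteq> GG n \<and> openin (MM_topology n) {x \<in> MM n. fst x \<in> W}"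
  have "istopology ?P"
    unfolding istopology_def
  proof (intro conjI allI impI)
    fix A B assume A: "?P A" and B: "?P B"
    have "{x \<in> MM n. fst x \<in> A \<inter> B} = {x \<in> MM n. fst x \<in> A} \<inter> {x \<in> MM n. fst x \<in> B}"
      by auto
    then show "openin (MM_topology n) {x \<in> MM n. fst x \<in> A \<inter> B}"
      using A B by (simp add: openin_Int)
    show "A \<inter> B \<subseteq> GG n" using A by auto
  next
    fix K assume K: "\<forall>A\<in>K. ?P A"
    have "{x \<in> MM n. fst x \<in> \<Union>K} = (\<Union>A\<in>K. {x \<in> MM n. fst x \<in> A})"
      by auto
    then show "openin (MM_topology n) {x \<in> MM n. fst x \<in> \<Union>K}"
      using K by auto
    show "\<Union>K \<subseteq> GG n" using K by auto
  qed
  then show ?thesis by (simp add: GG_topology_def)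
qed

definition graphs_converge_on_compacts :: "(nat \<Rightarrow> l3quot set) \<Rightarrow> l3quot set \<Rightarrow> bool" where
  "graphs_converge_on_compacts G G0 \<longleftrightarrow>
     (\<forall>K\<subseteq>cylinder. compact K \<longrightarrow>
        uniform_limit K (\<lambda>k. graph_fun (G k)) (graph_fun G0) sequentially)"

end

(*
Lift a surface to a 1-periodic solution u of the maximal surface equation over the plane, with finitely
many singularities modulo the period. The flux p / sqrt (1 - |p|^2) is monotone in the gradient p, which
gives comparison and energy estimates that do not see the singularities.

If marks and limit normals converge, test the difference of two solutions with a truncation that vanishes
near the singularities: the Dirichlet energy of the truncated difference tends to zero, and a Lipschitz
function with small energy that vanishes at a point is small on compact sets.

Conversely let the graphs converge. If the approximating solutions were regular near a singularity of the
limit, comparison of their translates would bound the gradient of the limit away from 1 near it. Then Lewy's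
transformation, a conformal coordinate of the graph comparable to the induced metric, would be the primitive
of a holomorphic function that vanishes at the singularity together with the metric: identically zero on an
annulus, and not injective on a disc. Hence singularities persist, and by their number they converge; slopes
of the ends are read off from the growth of u at a bounded distance.
*)

theory Submission
  imports Defs "HOL-Complex_Analysis.Complex_Analysis" "HOL-Real_Asymp.Real_Asymp"
begin

no_notation fps_nth (infixl "$" 75)

section \<open>Divergence theorem and small gradients on rectangles\<close>

text \<open>No estimate may use the gradient near a singularity, where nothing uniform is known
  about it. What survives is that every graph is 1-Lipschitz: closeness at the singular points
  spreads to small neighbourhoods, so the difference, truncated above its values there, is
  identically zero near them, and \<open>C^1\<close> test fields on whole rectangles suffice. The
  ends are the other obstacle. Graphs with different limit normals have different fluxes at infinity
  and their difference has infinite energy, so the reference graph is first bent to the new slope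
  and its flux field is corrected by a multiple of an explicit ramp. This needs a decay rate of the
  gradient along the ends, which the definition of the surfaces does not provide; it comes from the
  Gauss map, a bounded holomorphic function on a punctured disc. Finally, membership in the moduli
  space only asserts that some singular set exists. That the surface determines it rests on the same
  fact that keeps singularities from disappearing in a limit.\<close>

definition has_grad :: "(complex \<Rightarrow> real) \<Rightarrow> real \<Rightarrow> real \<Rightarrow> complex \<Rightarrow> bool" where
  "has_grad f a b z \<longleftrightarrow> (f has_derivative (\<lambda>h. a * Re h + b * Im h)) (at z)"

lemma has_grad_add: "has_grad f a b z \<Longrightarrow> has_grad g c d z \<Longrightarrow> has_grad (\<lambda>z. f z + g z) (a + c) (b + d) z"
  unfolding has_grad_def by (auto intro!: derivative_eq_intros simp: algebra_simps)

lemma has_grad_diff: "has_grad f a b z \<Longrightarrow> has_grad g c d z \<Longrightarrow> has_grad (\<lambda>z. f z - g z) (a - c) (b - d) z"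
  unfolding has_grad_def by (auto intro!: derivative_eq_intros simp: algebra_simps)

lemma has_grad_uminus: "has_grad f a b z \<Longrightarrow> has_grad (\<lambda>z. - f z) (- a) (- b) z"
  unfolding has_grad_def by (auto intro!: derivative_eq_intros simp: algebra_simps)

lemma has_grad_const: "has_grad (\<lambda>z. c) 0 0 z"
  unfolding has_grad_def by auto

lemma has_grad_mult:
  "has_grad f a b z \<Longrightarrow> has_grad g c d z \<Longrightarrow> has_grad (\<lambda>z. f z * g z) (a * g z + f z * c) (b * g z + f z * d) z"
  unfolding has_grad_def by (auto intro!: derivative_eq_intros simp: algebra_simps)

lemma has_grad_compose:
  assumes "has_grad v a b z" "(\<phi> has_real_derivative c) (at (v z))"
  shows "has_grad (\<lambda>z. \<phi> (v z)) (c * a) (c * b) z"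
proof -
  have "(\<phi> has_derivative (\<lambda>x. c * x)) (at (v z))"
    using assms(2) by (simp add: has_field_derivative_def)
  from has_derivative_compose[OF assms(1)[unfolded has_grad_def] this]
  show ?thesis unfolding has_grad_def by (simp add: algebra_simps)
qed

lemma has_grad_Im:
  assumes "(\<phi> has_real_derivative c) (at (Im z))"
  shows "has_grad (\<lambda>z. \<phi> (Im z)) 0 c z"
  using has_grad_compose[of Im 0 1 z \<phi> c] assms
  by (simp add: has_grad_def bounded_linear_imp_has_derivative bounded_linear_Im)

lemma has_grad_transform:
  assumes "has_grad f a b z" "eventually (\<lambda>z. f z = g z) (nhds z)"
  shows "has_grad g a b z"
proof -
  have "f z = g z" using assms(2) by (rule eventually_nhds_x_imp_x)
  then show ?thesis
    using assms unfolding has_grad_def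
    by (metis (mono_tags, lifting) eventually_nhds_conv_at has_derivative_transform_eventually UNIV_I)
qed

lemma has_grad_translate:
  assumes "has_grad f a b (z + h)"
  shows "has_grad (\<lambda>z. f (z + h)) a b z"
proof -
  have "((\<lambda>z. z + h) has_derivative (\<lambda>k. k)) (at z)"
    by (auto intro!: derivative_eq_intros)
  from has_derivative_compose[OF this assms[unfolded has_grad_def]]
  show ?thesis unfolding has_grad_def .
qed

lemma has_grad_unique:
  assumes "has_grad f a b z" "has_grad f c d z"
  shows "a = c" "b = d"
proof -
  have "(\<lambda>h. a * Re h + b * Im h) = (\<lambda>h. c * Re h + d * Im h)"
    using assms unfolding has_grad_def by (rule has_derivative_unique)
  from fun_cong[OF this, of 1] fun_cong[OF this, of \<i>] show "a = c" "b = d" by auto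
qed

lemma has_grad_imp_isCont: "has_grad f a b z \<Longrightarrow> isCont f z"
  unfolding has_grad_def by (rule has_derivative_continuous)

lemma has_grad_Re_line:
  assumes "has_grad f a b (Complex x y)"
  shows "((\<lambda>x. f (Complex x y)) has_real_derivative a) (at x within S)"
proof -
  have "((\<lambda>x. Complex x y) has_derivative (\<lambda>h. of_real h)) (at x)"
    unfolding Complex_eq by (auto intro!: derivative_eq_intros)
  from has_derivative_compose[OF this assms[unfolded has_grad_def]]
  have "((\<lambda>x. f (Complex x y)) has_derivative (\<lambda>h. a * h)) (at x)" by simp
  then show ?thesis by (simp add: has_field_derivative_def has_derivative_at_withinI)
qed

lemma has_grad_Im_line:
  assumes "has_grad f a b (Complex x y)"
  shows "((\<lambda>y. f (Complex x y)) has_real_derivative b) (at y within S)"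
proof -
  have "((\<lambda>y. Complex x y) has_derivative (\<lambda>h. \<i> * of_real h)) (at y)"
    unfolding Complex_eq by (auto intro!: derivative_eq_intros)
  from has_derivative_compose[OF this assms[unfolded has_grad_def]]
  have "((\<lambda>y. f (Complex x y)) has_derivative (\<lambda>h. b * h)) (at y)" by simp
  then show ?thesis by (simp add: has_field_derivative_def has_derivative_at_withinI)
qed

section \<open>Rectangles and iterated integrals\<close>

definition rect :: "real \<Rightarrow> real \<Rightarrow> real \<Rightarrow> real \<Rightarrow> complex set" where
  "rect x0 x1 a b = {z. x0 \<le> Re z \<and> Re z \<le> x1 \<and> a \<le> Im z \<and> Im z \<le> b}"

text \<open>The integral is taken over pairs of reals instead of complex numbers, because Fubini's
  theorem for continuous functions is available in that form.\<close>

definition rint :: "real \<Rightarrow> real \<Rightarrow> real \<Rightarrow> real \<Rightarrow> (complex \<Rightarrow> real) \<Rightarrow> real" where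
  "rint x0 x1 a b f = integral (cbox (x0, a) (x1, b)) (\<lambda>(x, y). f (Complex x y))"

lemma continuous_on_rect_pair:
  assumes "continuous_on (rect x0 x1 a b) f"
  shows "continuous_on (cbox (x0, a) (x1, b)) (\<lambda>(x, y). f (Complex x y))"
  unfolding split_beta
  by (rule continuous_on_compose2[OF assms])
     (auto simp: rect_def cbox_Pair_eq Complex_eq intro!: continuous_intros)

lemma rect_eq_cbox: "rect x0 x1 a b = cbox (Complex x0 a) (Complex x1 b)"
  by (auto simp: rect_def in_cbox_complex_iff)

lemma rint_mono:
  assumes "continuous_on (rect x0 x1 a b) f" "continuous_on (rect x0 x1 a b) g"
    and "\<And>z. z \<in> rect x0 x1 a b \<Longrightarrow> f z \<le> g z"
  shows "rint x0 x1 a b f \<le> rint x0 x1 a b g"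
  unfolding rint_def
  by (intro integral_le integrable_continuous continuous_on_rect_pair assms)
     (use assms(3) in \<open>auto simp: rect_def cbox_Pair_eq\<close>)

lemma rint_add:
  assumes "continuous_on (rect x0 x1 a b) f" "continuous_on (rect x0 x1 a b) g"
  shows "rint x0 x1 a b (\<lambda>z. f z + g z) = rint x0 x1 a b f + rint x0 x1 a b g"
  unfolding rint_def split_beta
  using continuous_on_rect_pair[OF assms(1)] continuous_on_rect_pair[OF assms(2)]
  by (intro integral_add integrable_continuous) (auto simp: split_beta)

lemma rint_cmul: "rint x0 x1 a b (\<lambda>z. c * f z) = c * rint x0 x1 a b f"
  unfolding rint_def split_beta by simp

lemma rint_const: "x0 \<le> x1 \<Longrightarrow> a \<le> b \<Longrightarrow> rint x0 x1 a b (\<lambda>z. c) = (x1 - x0) * (b - a) * c"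
  unfolding rint_def split_beta by (simp add: content_Pair)

lemma rint_iterated:
  fixes f :: "complex \<Rightarrow> real"
  assumes "continuous_on (rect x0 x1 a b) f"
  shows "rint x0 x1 a b f = integral {x0..x1} (\<lambda>x. integral {a..b} (\<lambda>y. f (Complex x y)))"
    and "rint x0 x1 a b f = integral {a..b} (\<lambda>y. integral {x0..x1} (\<lambda>x. f (Complex x y)))"
proof -
  note c = continuous_on_rect_pair[OF assms]
  show 1: "rint x0 x1 a b f = integral {x0..x1} (\<lambda>x. integral {a..b} (\<lambda>y. f (Complex x y)))"
    unfolding rint_def using integral_prod_continuous[OF c] by simp
  show "rint x0 x1 a b f = integral {a..b} (\<lambda>y. integral {x0..x1} (\<lambda>x. f (Complex x y)))"
    unfolding 1 using integral_swap_continuous[OF c] by simp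
qed

lemma continuous_on_rect_lines:
  assumes "continuous_on (rect x0 x1 a b) f"
  shows "x \<in> {x0..x1} \<Longrightarrow> continuous_on {a..b} (\<lambda>y. f (Complex x y))"
    and "y \<in> {a..b} \<Longrightarrow> continuous_on {x0..x1} (\<lambda>x. f (Complex x y))"
  by (rule continuous_on_compose2[OF assms];
      auto simp: rect_def Complex_eq intro!: continuous_intros)+

lemma continuous_on_rect_integrals:
  fixes f :: "complex \<Rightarrow> real"
  assumes "continuous_on (rect x0 x1 a b) f"
  shows "continuous_on {x0..x1} (\<lambda>x. integral {a..b} (\<lambda>y. f (Complex x y)))"
    and "continuous_on {a..b} (\<lambda>y. integral {x0..x1} (\<lambda>x. f (Complex x y)))"
proof -
  have "continuous_on ({x0..x1} \<times> cbox a b) (\<lambda>(x, y). f (Complex x y))"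
    using continuous_on_rect_pair[OF assms] by (simp add: cbox_Pair_eq)
  from integral_continuous_on_param[OF this]
  show "continuous_on {x0..x1} (\<lambda>x. integral {a..b} (\<lambda>y. f (Complex x y)))" by simp
  have "continuous_on ({a..b} \<times> cbox x0 x1) (\<lambda>(y, x). f (Complex x y))"
    unfolding split_beta
    by (rule continuous_on_compose2[OF assms])
       (auto simp: rect_def Complex_eq intro!: continuous_intros)
  from integral_continuous_on_param[OF this]
  show "continuous_on {a..b} (\<lambda>y. integral {x0..x1} (\<lambda>x. f (Complex x y)))" by simp
qed

text \<open>Fubini and the fundamental theorem in each variable. The hypothesis on \<open>V1\<close>
  cancels the vertical sides; it covers periodic fields as well as fields that vanish there, the two
  cases that occur.\<close>

lemma divergence_rect:
  assumes "x0 \<le> x1" "a \<le> b"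
    and V1: "\<And>z. z \<in> rect x0 x1 a b \<Longrightarrow> has_grad V1 (V1x z) (V1y z) z"
    and V2: "\<And>z. z \<in> rect x0 x1 a b \<Longrightarrow> has_grad V2 (V2x z) (V2y z) z"
    and c1: "continuous_on (rect x0 x1 a b) V1x" and c2: "continuous_on (rect x0 x1 a b) V2y"
    and side: "\<And>y. a \<le> y \<Longrightarrow> y \<le> b \<Longrightarrow> V1 (Complex x0 y) = V1 (Complex x1 y)"
  shows "rint x0 x1 a b (\<lambda>z. V1x z + V2y z) =
    integral {x0..x1} (\<lambda>x. V2 (Complex x b)) - integral {x0..x1} (\<lambda>x. V2 (Complex x a))"
proof -
  have V2c: "continuous_on (rect x0 x1 a b) V2"
    by (intro continuous_at_imp_continuous_on ballI has_grad_imp_isCont[OF V2])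
  have i1: "integral {x0..x1} (\<lambda>x. V1x (Complex x y)) = 0" if "y \<in> {a..b}" for y
  proof -
    have "((\<lambda>x. V1x (Complex x y)) has_integral V1 (Complex x1 y) - V1 (Complex x0 y)) {x0..x1}"
      by (rule fundamental_theorem_of_calculus[OF assms(1)])
         (use that in \<open>auto simp: rect_def simp flip: has_real_derivative_iff_has_vector_derivative
           intro!: has_grad_Re_line[OF V1]\<close>)
    then show ?thesis using side that by (simp add: integral_unique)
  qed
  have i2: "integral {a..b} (\<lambda>y. V2y (Complex x y)) = V2 (Complex x b) - V2 (Complex x a)"
    if "x \<in> {x0..x1}" for x
  proof -
    have "((\<lambda>y. V2y (Complex x y)) has_integral V2 (Complex x b) - V2 (Complex x a)) {a..b}"
      by (rule fundamental_theorem_of_calculus[OF assms(2)])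
         (use that in \<open>auto simp: rect_def simp flip: has_real_derivative_iff_has_vector_derivative
           intro!: has_grad_Im_line[OF V2]\<close>)
    then show ?thesis by (simp add: integral_unique)
  qed
  have "rint x0 x1 a b (\<lambda>z. V1x z + V2y z) = rint x0 x1 a b V1x + rint x0 x1 a b V2y"
    by (rule rint_add[OF c1 c2])
  also have "rint x0 x1 a b V1x = integral {a..b} (\<lambda>y. 0)"
    unfolding rint_iterated(2)[OF c1] by (rule integral_cong) (use i1 in simp)
  also have "rint x0 x1 a b V2y = integral {x0..x1} (\<lambda>x. V2 (Complex x b) - V2 (Complex x a))"
    unfolding rint_iterated(1)[OF c2] by (rule integral_cong) (use i2 in simp)
  also have "\<dots> = integral {x0..x1} (\<lambda>x. V2 (Complex x b)) - integral {x0..x1} (\<lambda>x. V2 (Complex x a))"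
    by (intro integral_diff integrable_continuous_real continuous_on_rect_lines(2)[OF V2c])
       (use assms in auto)
  finally show ?thesis by simp
qed

text \<open>The minimum over \<open>{c..d}\<close> is at most the mean. It selects a line close to a
  prescribed point on which the gradient has a small integral.\<close>

lemma exists_le_average:
  fixes A :: "real \<Rightarrow> real"
  assumes "continuous_on {a..b} A" "\<And>t. t \<in> {a..b} \<Longrightarrow> 0 \<le> A t"
    and "a \<le> c" "c < d" "d \<le> b"
  obtains t where "t \<in> {c..d}" "A t * (d - c) \<le> integral {a..b} A"
proof -
  have cd: "continuous_on {c..d} A"
    by (rule continuous_on_subset[OF assms(1)]) (use assms in auto)
  obtain t where t: "t \<in> {c..d}" "\<And>s. s \<in> {c..d} \<Longrightarrow> A t \<le> A s"
    using continuous_attains_inf[of "{c..d}" A] cd assms(4) by auto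
  have "A t * (d - c) = integral {c..d} (\<lambda>s. A t)"
    using assms(4) by simp
  also have "\<dots> \<le> integral {c..d} A"
    by (intro integral_le integrable_continuous_real cd) (use t in auto)
  also have "\<dots> \<le> integral {a..b} A"
    by (intro integral_subset_le integrable_continuous_real cd assms(1)) (use assms in auto)
  finally show thesis using that t(1) by blast
qed

lemma FTC_abs_le:
  fixes H :: "real \<Rightarrow> real"
  assumes "\<And>t. t \<in> {a..b} \<Longrightarrow> (H has_real_derivative H' t) (at t within {a..b})"
    and "continuous_on {a..b} H'" "c \<in> {a..b}" "d \<in> {a..b}"
  shows "\<bar>H c - H d\<bar> \<le> integral {a..b} (\<lambda>t. \<bar>H' t\<bar>)"
proof -
  have *: "\<bar>H d - H c\<bar> \<le> integral {a..b} (\<lambda>t. \<bar>H' t\<bar>)" if "c \<le> d" "c \<in> {a..b}" "d \<in> {a..b}" for c d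
  proof -
    have sub: "{c..d} \<subseteq> {a..b}" using that by auto
    have c': "continuous_on {c..d} H'" by (rule continuous_on_subset[OF assms(2) sub])
    have "(H' has_integral H d - H c) {c..d}"
      by (rule fundamental_theorem_of_calculus[OF that(1)])
         (use sub assms(1) in \<open>auto simp flip: has_real_derivative_iff_has_vector_derivative
            intro!: DERIV_subset[OF assms(1)]\<close>)
    then have "\<bar>H d - H c\<bar> = \<bar>integral {c..d} H'\<bar>" by (simp add: integral_unique)
    also have "\<dots> \<le> integral {c..d} (\<lambda>t. \<bar>H' t\<bar>)"
      using integral_norm_bound_integral[of H' "{c..d}" "\<lambda>t. \<bar>H' t\<bar>"]
        integrable_continuous_real[OF c'] integrable_continuous_real[OF continuous_on_rabs[OF c']]
      by simp
    also have "\<dots> \<le> integral {a..b} (\<lambda>t. \<bar>H' t\<bar>)"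
      by (rule integral_subset_le[OF sub integrable_continuous_real[OF continuous_on_rabs[OF c']]
            integrable_continuous_real[OF continuous_on_rabs[OF assms(2)]]]) simp
    finally show ?thesis .
  qed
  show ?thesis
    using *[of c d] *[of d c] assms(3,4) by (cases "c \<le> d") (auto simp: abs_minus_commute)
qed

lemma subinterval_containing:
  fixes a b :: real
  assumes "y \<in> {a..b}" "0 < \<rho>" "\<rho> \<le> b - a"
  obtains c where "a \<le> c" "c + \<rho> \<le> b" "\<And>t. t \<in> {c..c + \<rho>} \<Longrightarrow> \<bar>t - y\<bar> \<le> \<rho>"
proof -
  show thesis
    by (rule that[of "if y + \<rho> \<le> b then y else b - \<rho>"]) (use assms in \<open>auto split: if_splits\<close>)
qed

text \<open>The two points are joined by a staircase path through a horizontal and a vertical segment on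
  which the gradient has small mean.\<close>

lemma small_if_small_gradient:
  fixes x0 x1 a b h L :: real
  assumes "x0 < x1" "a < b" "0 < h" "0 < L"
  obtains \<epsilon> where "0 < \<epsilon>"
    "\<And>H H1 H2 z0 z. (\<And>z. z \<in> rect x0 x1 a b \<Longrightarrow> has_grad H (H1 z) (H2 z) z) \<Longrightarrow>
       continuous_on (rect x0 x1 a b) H1 \<Longrightarrow> continuous_on (rect x0 x1 a b) H2 \<Longrightarrow>
       (\<And>z. z \<in> rect x0 x1 a b \<Longrightarrow> \<bar>H1 z\<bar> \<le> L \<and> \<bar>H2 z\<bar> \<le> L) \<Longrightarrow>
       rint x0 x1 a b (\<lambda>z. (H1 z)\<^sup>2 + (H2 z)\<^sup>2) \<le> \<epsilon> \<Longrightarrow>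
       z0 \<in> rect x0 x1 a b \<Longrightarrow> H z0 = 0 \<Longrightarrow> z \<in> rect x0 x1 a b \<Longrightarrow> \<bar>H z\<bar> \<le> h"
proof -
  \<comment> \<open>The path from \<open>z\<close> to \<open>z0\<close> has two short pieces at its
    ends, of length at most \<rho>, which cost at most h/8 each by the bound \<open>L\<close>. The
    two long pieces may then cost h/2 together.\<close>
  define \<rho> where "\<rho> = min (h / (8 * L)) (min (x1 - x0) (b - a))"
  define Ar where "Ar = (x1 - x0) * (b - a)"
  \<comment> \<open>The weight in s <= \<kappa>/4 + s^2/\<kappa>. It makes the constant part
    \<kappa> * \<open>Ar\<close> equal to \<rho> h/4, the same as the energy part for the witness
    \<kappa> \<rho> h/4.\<close>
  define \<kappa> where "\<kappa> = \<rho> * h / (4 * Ar)"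
  have rho: "0 < \<rho>" "\<rho> \<le> x1 - x0" "\<rho> \<le> b - a" "\<rho> \<le> h / (8 * L)"
    using assms by (auto simp: \<rho>_def)
  have Ar: "0 < Ar" using assms by (simp add: Ar_def)
  have kap: "0 < \<kappa>" using rho Ar assms by (simp add: \<kappa>_def)
  show thesis
  proof (rule that[of "\<kappa> * \<rho> * h / 4"])
    show "0 < \<kappa> * \<rho> * h / 4" using rho kap assms by simp
    fix H H1 H2 z0 z
    assume H: "\<And>z. z \<in> rect x0 x1 a b \<Longrightarrow> has_grad H (H1 z) (H2 z) z"
      and c1: "continuous_on (rect x0 x1 a b) H1" and c2: "continuous_on (rect x0 x1 a b) H2"
      and L: "\<And>z. z \<in> rect x0 x1 a b \<Longrightarrow> \<bar>H1 z\<bar> \<le> L \<and> \<bar>H2 z\<bar> \<le> L"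
      and small: "rint x0 x1 a b (\<lambda>z. (H1 z)\<^sup>2 + (H2 z)\<^sup>2) \<le> \<kappa> * \<rho> * h / 4"
      and z0: "z0 \<in> rect x0 x1 a b" "H z0 = 0" and z: "z \<in> rect x0 x1 a b"
    define A where "A = (\<lambda>y. integral {x0..x1} (\<lambda>x. \<bar>H1 (Complex x y)\<bar>))"
    define B where "B = (\<lambda>x. integral {a..b} (\<lambda>y. \<bar>H2 (Complex x y)\<bar>))"
    have ca: "continuous_on (rect x0 x1 a b) (\<lambda>z. \<bar>H1 z\<bar>)" "continuous_on (rect x0 x1 a b) (\<lambda>z. \<bar>H2 z\<bar>)"
      by (intro continuous_intros c1 c2)+
    have csq: "continuous_on (rect x0 x1 a b) (\<lambda>z. (H1 z)\<^sup>2 + (H2 z)\<^sup>2)"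
      by (intro continuous_intros c1 c2)
    have sumAB: "integral {a..b} A + integral {x0..x1} B \<le> \<kappa> * Ar + 1 / \<kappa> * (\<kappa> * \<rho> * h / 4)"
    proof -
      have pt: "s + t \<le> \<kappa> + 1 / \<kappa> * (s\<^sup>2 + t\<^sup>2)" for s t :: real
      proof -
        have "s \<le> \<kappa> / 4 + 1 / \<kappa> * s\<^sup>2" "t \<le> \<kappa> / 4 + 1 / \<kappa> * t\<^sup>2"
          using kap zero_le_power2[of "s - \<kappa> / 2"] zero_le_power2[of "t - \<kappa> / 2"]
          by (auto simp: field_simps power2_eq_square)
        then show ?thesis using kap by (simp add: algebra_simps)
      qed
      have "integral {a..b} A + integral {x0..x1} B = rint x0 x1 a b (\<lambda>z. \<bar>H1 z\<bar>) + rint x0 x1 a b (\<lambda>z. \<bar>H2 z\<bar>)"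
        unfolding A_def B_def by (simp add: rint_iterated(2)[OF ca(1)] rint_iterated(1)[OF ca(2)])
      also have "\<dots> = rint x0 x1 a b (\<lambda>z. \<bar>H1 z\<bar> + \<bar>H2 z\<bar>)"
        by (rule rint_add[symmetric, OF ca])
      also have "\<dots> \<le> rint x0 x1 a b (\<lambda>z. \<kappa> + 1 / \<kappa> * ((H1 z)\<^sup>2 + (H2 z)\<^sup>2))"
        by (intro rint_mono continuous_intros c1 c2)
           (use pt[of "\<bar>H1 _\<bar>" "\<bar>H2 _\<bar>"] in simp)
      also have "\<dots> = \<kappa> * Ar + 1 / \<kappa> * rint x0 x1 a b (\<lambda>z. (H1 z)\<^sup>2 + (H2 z)\<^sup>2)"
        by (subst rint_add, intro continuous_intros, intro continuous_intros c1 c2, subst rint_cmul)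
           (use assms in \<open>simp add: rint_const Ar_def\<close>)
      also have "\<dots> \<le> \<kappa> * Ar + 1 / \<kappa> * (\<kappa> * \<rho> * h / 4)"
        using small kap by (intro add_mono mult_left_mono) auto
      finally show ?thesis .
    qed
    have kA: "\<kappa> * Ar + 1 / \<kappa> * (\<kappa> * \<rho> * h / 4) = \<rho> * h / 2"
      using kap Ar by (simp add: \<kappa>_def field_simps)
    have nonneg: "y \<in> {a..b} \<Longrightarrow> 0 \<le> A y" "x \<in> {x0..x1} \<Longrightarrow> 0 \<le> B x" for x y
      unfolding A_def B_def
      by (rule integral_nonneg;
          use continuous_on_rect_lines[OF ca(1)] continuous_on_rect_lines[OF ca(2)] in
            \<open>auto intro!: integrable_continuous_real\<close>)+
    \<comment> \<open>The horizontal piece runs at a height close to that of \<open>z\<close>, the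
      vertical one at an abscissa close to that of \<open>z0\<close>; which line is taken is decided
      by the mean of the gradient.\<close>
    obtain c where c: "a \<le> c" "c + \<rho> \<le> b" "\<And>t. t \<in> {c..c + \<rho>} \<Longrightarrow> \<bar>t - Im z\<bar> \<le> \<rho>"
      using subinterval_containing[of "Im z" a b \<rho>] z rho by (auto simp: rect_def)
    obtain d where d: "x0 \<le> d" "d + \<rho> \<le> x1" "\<And>t. t \<in> {d..d + \<rho>} \<Longrightarrow> \<bar>t - Re z0\<bar> \<le> \<rho>"
      using subinterval_containing[of "Re z0" x0 x1 \<rho>] z0 rho by (auto simp: rect_def)
    obtain y where y: "y \<in> {c..c + \<rho>}" "A y * \<rho> \<le> integral {a..b} A"
      using exists_le_average[of a b A c "c + \<rho>"] continuous_on_rect_integrals(2)[OF ca(1)] nonneg c rho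
      by (auto simp: A_def)
    obtain x where x: "x \<in> {d..d + \<rho>}" "B x * \<rho> \<le> integral {x0..x1} B"
      using exists_le_average[of x0 x1 B d "d + \<rho>"] continuous_on_rect_integrals(1)[OF ca(2)] nonneg d rho
      by (auto simp: B_def)
    have xin: "x \<in> {x0..x1}" and yin: "y \<in> {a..b}" using x y c d by auto
    have lip2: "\<bar>H (Complex s t) - H (Complex s t')\<bar> \<le> L * \<bar>t - t'\<bar>"
      if "s \<in> {x0..x1}" "t \<in> {a..b}" "t' \<in> {a..b}" for s t t'
    proof -
      have d: "((\<lambda>t. H (Complex s t)) has_real_derivative H2 (Complex s u)) (at u within {a..b})"
        if "u \<in> {a..b}" for u
        using \<open>s \<in> {x0..x1}\<close> that by (intro has_grad_Im_line[OF H]) (auto simp: rect_def)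
      have "norm (H2 (Complex s u)) \<le> L" if "u \<in> {a..b}" for u
        using L[of "Complex s u"] \<open>s \<in> {x0..x1}\<close> that by (auto simp: rect_def)
      from field_differentiable_bound[OF _ d this that(2,3)] show ?thesis by simp
    qed
    have lip1: "\<bar>H (Complex s t) - H (Complex s' t)\<bar> \<le> L * \<bar>s - s'\<bar>"
      if "t \<in> {a..b}" "s \<in> {x0..x1}" "s' \<in> {x0..x1}" for s s' t
    proof -
      have d: "((\<lambda>s. H (Complex s t)) has_real_derivative H1 (Complex u t)) (at u within {x0..x1})"
        if "u \<in> {x0..x1}" for u
        using \<open>t \<in> {a..b}\<close> that by (intro has_grad_Re_line[OF H]) (auto simp: rect_def)
      have "norm (H1 (Complex u t)) \<le> L" if "u \<in> {x0..x1}" for u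
        using L[of "Complex u t"] \<open>t \<in> {a..b}\<close> that by (auto simp: rect_def)
      from field_differentiable_bound[OF _ d this that(2,3)] show ?thesis by simp
    qed
    have zi: "Re z \<in> {x0..x1}" "Im z \<in> {a..b}" "Re z0 \<in> {x0..x1}" "Im z0 \<in> {a..b}"
      using z z0 by (auto simp: rect_def)
    have s1: "\<bar>H z - H (Complex (Re z) y)\<bar> \<le> L * \<rho>"
    proof -
      have "\<bar>Im z - y\<bar> \<le> \<rho>" using c(3)[OF y(1)] by linarith
      then have "L * \<bar>Im z - y\<bar> \<le> L * \<rho>" using assms(4) by simp
      with lip2[OF zi(1,2) yin] show ?thesis by simp
    qed
    have s2: "\<bar>H (Complex (Re z) y) - H (Complex x y)\<bar> \<le> A y"
      unfolding A_def
      by (rule FTC_abs_le[of x0 x1 "\<lambda>s. H (Complex s y)" "\<lambda>s. H1 (Complex s y)"])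
         (use zi xin yin in \<open>auto simp: rect_def intro!: has_grad_Re_line[OF H] continuous_on_rect_lines(2)[OF c1]\<close>)
    have s3: "\<bar>H (Complex x y) - H (Complex x (Im z0))\<bar> \<le> B x"
      unfolding B_def
      by (rule FTC_abs_le[of a b "\<lambda>t. H (Complex x t)" "\<lambda>t. H2 (Complex x t)"])
         (use zi xin yin in \<open>auto simp: rect_def intro!: has_grad_Im_line[OF H] continuous_on_rect_lines(1)[OF c2]\<close>)
    have s4: "\<bar>H (Complex x (Im z0)) - H z0\<bar> \<le> L * \<rho>"
    proof -
      have "L * \<bar>x - Re z0\<bar> \<le> L * \<rho>" using assms(4) d(3)[OF x(1)] by simp
      with lip1[OF zi(4) xin zi(3)] show ?thesis by simp
    qed
    have "(A y + B x) * \<rho> \<le> h / 2 * \<rho>"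
      using y(2) x(2) sumAB kA by (simp add: algebra_simps)
    then have AB: "A y + B x \<le> h / 2" using rho(1) by (rule mult_right_le_imp_le)
    have "L * \<rho> \<le> h / 8" using rho(4) assms(4) by (simp add: field_simps)
    then show "\<bar>H z\<bar> \<le> h"
      using s1 s2 s3 s4 AB z0(2) assms(3) by linarith
  qed
qed

text \<open>A convex \<open>C^1\<close> substitute for the positive part: it vanishes for
  nonpositive arguments, its derivative lies between 0 and 1, and it grows at most linearly, so that
  decaying fluxes beat it along the ends. For positive t, 1 - \<open>cut'\<close> t = 1/(1+t)^2, so
  it also serves to change the slope of an end with an integrable error.\<close>

definition cut :: "real \<Rightarrow> real" where
  "cut t = (if t \<le> 0 then 0 else t\<^sup>2 / (1 + t))"

definition cut' :: "real \<Rightarrow> real" where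
  "cut' t = (if t \<le> 0 then 0 else (t\<^sup>2 + 2 * t) / (1 + t)\<^sup>2)"

lemma cut'_nonneg: "0 \<le> cut' t"
  by (simp add: cut'_def)

lemma cut'_le_1: "cut' t \<le> 1"
proof (cases "t \<le> 0")
  case False
  then have "0 < (1 + t)\<^sup>2" by simp
  moreover have "t\<^sup>2 + 2 * t \<le> (1 + t)\<^sup>2" by (simp add: power2_eq_square algebra_simps)
  ultimately show ?thesis using False by (simp add: cut'_def)
qed (simp add: cut'_def)

lemma cut_nonneg: "0 \<le> cut t"
  by (simp add: cut_def)

lemma cut_le: "cut t \<le> \<bar>t\<bar>"
proof (cases "t \<le> 0")
  case False
  then have "t\<^sup>2 \<le> t * (1 + t)" by (simp add: power2_eq_square algebra_simps)
  then show ?thesis using False by (simp add: cut_def pos_divide_le_eq)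
qed (simp add: cut_def)

lemma cut_eq_0: "t \<le> 0 \<Longrightarrow> cut t = 0" and cut'_eq_0: "t \<le> 0 \<Longrightarrow> cut' t = 0"
  by (auto simp: cut_def cut'_def)

lemma isCont_cut': "isCont cut' t"
proof -
  have "continuous_on ({..0} \<union> {0..}) (\<lambda>t::real. if t \<le> 0 then 0 else (t\<^sup>2 + 2 * t) / (1 + t)\<^sup>2)"
    by (rule continuous_on_cases) (auto intro!: continuous_intros)
  moreover have "{..0} \<union> {0..} = (UNIV :: real set)" by auto
  ultimately show ?thesis
    unfolding cut'_def[abs_def] by (simp add: continuous_on_eq_continuous_at)
qed

lemma DERIV_cut: "(cut has_real_derivative cut' t) (at t)"
proof -
  consider "t < 0" | "0 < t" | "t = 0" by linarith
  then show ?thesis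
  proof cases
    case 1
    have "((\<lambda>t. 0) has_real_derivative cut' t) (at t)" using 1 by (simp add: cut'_def)
    moreover have "eventually (\<lambda>t. t \<in> {..<0}) (nhds t)"
      using 1 by (intro eventually_nhds_in_open) auto
    then have "eventually (\<lambda>t. 0 = cut t) (nhds t)" by eventually_elim (simp add: cut_def)
    ultimately show ?thesis by (rule DERIV_cong_ev[OF refl _ refl, THEN iffD1, rotated])
  next
    case 2
    have "((\<lambda>t. t\<^sup>2 / (1 + t)) has_real_derivative cut' t) (at t)"
    proof -
      have "(2 * t * (1 + t) - t\<^sup>2) / ((1 + t) * (1 + t)) = cut' t"
        using 2 by (simp add: cut'_def power2_eq_square algebra_simps)
      then show ?thesis
        using 2 by (auto intro!: derivative_eq_intros)
    qed
    moreover have "eventually (\<lambda>t. t \<in> {0<..}) (nhds t)"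
      using 2 by (intro eventually_nhds_in_open) auto
    then have "eventually (\<lambda>t. t\<^sup>2 / (1 + t) = cut t) (nhds t)" by eventually_elim (simp add: cut_def)
    ultimately show ?thesis by (rule DERIV_cong_ev[OF refl _ refl, THEN iffD1, rotated])
  next
    case 3
    have "((\<lambda>h. (cut (0 + h) - cut 0) / h) \<longlongrightarrow> 0) (at 0)"
    proof (rule Lim_null_comparison)
      show "eventually (\<lambda>h. norm ((cut (0 + h) - cut 0) / h) \<le> \<bar>h\<bar>) (at 0)"
        by (rule eventuallyI) (auto simp: cut_def power2_eq_square divide_simps)
      show "((\<lambda>h::real. \<bar>h\<bar>) \<longlongrightarrow> 0) (at 0)" by (auto intro!: tendsto_eq_intros)
    qed
    then show ?thesis using 3 by (simp add: DERIV_def cut'_def)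
  qed
qed

section \<open>The area functional\<close>

abbreviation wt :: "real \<Rightarrow> real \<Rightarrow> real" where
  "wt p q \<equiv> sqrt (1 - p\<^sup>2 - q\<^sup>2)"

text \<open>With A, B the reciprocals of the weights, the right side is (A+B)/2 |P-P'|^2 +
  (A-B)(|P|^2-|P'|^2)/2. Both A and B are at least 1, and the weight decreases with the length of
  the gradient, so the second term is nonnegative. The constant does not degenerate when the
  gradients approach length 1.\<close>

lemma flux_monotone:
  assumes "p\<^sup>2 + q\<^sup>2 < 1" "p'\<^sup>2 + q'\<^sup>2 < (1::real)"
  shows "(p - p')\<^sup>2 + (q - q')\<^sup>2 \<le>
    (p - p') * (p / wt p q - p' / wt p' q') + (q - q') * (q / wt p q - q' / wt p' q')"
proof -
  define A B where "A = 1 / wt p q" and "B = 1 / wt p' q'"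
  define m m' where "m = p\<^sup>2 + q\<^sup>2" and "m' = p'\<^sup>2 + q'\<^sup>2"
  have w: "0 < wt p q" "wt p q \<le> 1" "0 < wt p' q'" "wt p' q' \<le> 1"
    using assms by auto
  then have AB: "1 \<le> A" "1 \<le> B" by (auto simp: A_def B_def)
  have mon: "0 \<le> (A - B) * (m - m')"
  proof (cases "m' \<le> m")
    case True
    then have "wt p q \<le> wt p' q'" by (simp add: m_def m'_def)
    then have "B \<le> A" using w by (simp add: A_def B_def frac_le)
    with True show ?thesis by simp
  next
    case False
    then have "wt p' q' \<le> wt p q" by (simp add: m_def m'_def)
    then have "A \<le> B" using w by (simp add: A_def B_def frac_le)
    with False show ?thesis by (simp add: mult_nonpos_nonpos)
  qed
  define S where "S = (p - p')\<^sup>2 + (q - q')\<^sup>2"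
  have "0 \<le> ((A + B) / 2 - 1) * S"
    using AB by (simp add: S_def)
  moreover have "((A + B) / 2 - 1) * S = (A + B) / 2 * S - S"
    by (simp only: left_diff_distrib mult_1)
  moreover have "(p - p') * (A * p - B * p') + (q - q') * (A * q - B * q') =
      (A + B) / 2 * S + (A - B) * (m - m') / 2"
    unfolding m_def m'_def S_def by (simp add: field_simps power2_eq_square)
  moreover have "p / wt p q = A * p" "q / wt p q = A * q" "p' / wt p' q' = B * p'" "q' / wt p' q' = B * q'"
    by (simp_all add: A_def B_def)
  ultimately show ?thesis using mon unfolding S_def[symmetric] by simp
qed

text \<open>In contrast to monotonicity, this needs gradients bounded away from length 1 and is
  therefore applied only along the ends. The critical part is 1/w - 1/w' = (w'^2-w^2)/(w
  w'(w+w')).\<close>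

lemma flux_Lipschitz:
  assumes "p\<^sup>2 + q\<^sup>2 \<le> 1 - \<delta>" "p'\<^sup>2 + q'\<^sup>2 \<le> 1 - \<delta>" "0 < \<delta>"
  shows "\<bar>p / wt p q - p' / wt p' q'\<bar> \<le> 2 / (\<delta> * sqrt \<delta>) * (\<bar>p - p'\<bar> + \<bar>q - q'\<bar>)"
    and "\<bar>q / wt p q - q' / wt p' q'\<bar> \<le> 2 / (\<delta> * sqrt \<delta>) * (\<bar>p - p'\<bar> + \<bar>q - q'\<bar>)"
proof -
  have one: "\<bar>a\<bar> \<le> 1" "\<bar>b\<bar> \<le> 1" if "a\<^sup>2 + b\<^sup>2 \<le> 1 - \<delta>" for a b :: real
  proof -
    have "a\<^sup>2 \<le> 1" "b\<^sup>2 \<le> 1"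
      using that assms(3) zero_le_power2[of a] zero_le_power2[of b] by linarith+
    then show "\<bar>a\<bar> \<le> 1" "\<bar>b\<bar> \<le> 1" by (simp_all add: abs_square_le_1)
  qed
  have d1: "\<delta> \<le> 1" using assms(1) zero_le_power2[of p] zero_le_power2[of q] by linarith
  have sd: "0 < sqrt \<delta>" "\<delta> \<le> sqrt \<delta>" "sqrt \<delta> \<le> 1" "sqrt \<delta> * sqrt \<delta> = \<delta>"
    using assms(3) d1 real_sqrt_le_mono[of "\<delta>\<^sup>2" \<delta>] by (auto simp: power2_eq_square mult_left_le)
  define w w' where "w = wt p q" and "w' = wt p' q'"
  have w: "sqrt \<delta> \<le> w" "sqrt \<delta> \<le> w'" "w\<^sup>2 = 1 - p\<^sup>2 - q\<^sup>2" "w'\<^sup>2 = 1 - p'\<^sup>2 - q'\<^sup>2"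
    using assms by (auto simp: w_def w'_def)
  have wp: "0 < w" "0 < w'" using w sd by linarith+
  define D where "D = \<bar>p - p'\<bar> + \<bar>q - q'\<bar>"
  have sq: "\<bar>w'\<^sup>2 - w\<^sup>2\<bar> \<le> 2 * D"
  proof -
    have "w'\<^sup>2 - w\<^sup>2 = (p - p') * (p + p') + (q - q') * (q + q')"
      unfolding w by (simp add: power2_eq_square algebra_simps)
    then have "\<bar>w'\<^sup>2 - w\<^sup>2\<bar> \<le> \<bar>p - p'\<bar> * \<bar>p + p'\<bar> + \<bar>q - q'\<bar> * \<bar>q + q'\<bar>"
      by (metis abs_mult abs_triangle_ineq)
    also have "\<dots> \<le> \<bar>p - p'\<bar> * 2 + \<bar>q - q'\<bar> * 2"
      using one[OF assms(1)] one[OF assms(2)] by (intro add_mono mult_left_mono) auto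
    finally show ?thesis by (simp add: D_def)
  qed
  have inv: "\<bar>1 / w - 1 / w'\<bar> \<le> D / (\<delta> * sqrt \<delta>)"
  proof -
    have "(w'\<^sup>2 - w\<^sup>2) / (w * w' * (w + w')) = (w' - w) * (w + w') / (w * w' * (w + w'))"
      by (simp add: power2_eq_square algebra_simps)
    also have "\<dots> = (w' - w) / (w * w')" using wp by simp
    also have "\<dots> = 1 / w - 1 / w'" using wp by (simp add: field_simps)
    finally have "1 / w - 1 / w' = (w'\<^sup>2 - w\<^sup>2) / (w * w' * (w + w'))" ..
    then have "\<bar>1 / w - 1 / w'\<bar> = \<bar>w'\<^sup>2 - w\<^sup>2\<bar> / (w * w' * (w + w'))"
      using wp by (simp add: abs_divide abs_mult)
    also have "\<dots> \<le> 2 * D / (sqrt \<delta> * sqrt \<delta> * (sqrt \<delta> + sqrt \<delta>))"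
      using sq w sd wp by (intro frac_le mult_mono add_mono) (auto simp: D_def)
    also have "\<dots> = D / (\<delta> * sqrt \<delta>)" unfolding sd(4) using sd by (simp add: field_simps)
    finally show ?thesis .
  qed
  have main: "\<bar>a / w - a' / w'\<bar> \<le> 2 / (\<delta> * sqrt \<delta>) * D" if "\<bar>a - a'\<bar> \<le> D" "\<bar>a'\<bar> \<le> 1" for a a'
  proof -
    have "a / w - a' / w' = (a - a') / w + a' * (1 / w - 1 / w')"
      using wp by (simp add: field_simps)
    then have "\<bar>a / w - a' / w'\<bar> \<le> \<bar>a - a'\<bar> / w + \<bar>a'\<bar> * \<bar>1 / w - 1 / w'\<bar>"
      using wp by (metis abs_divide abs_mult abs_of_pos abs_triangle_ineq)
    also have "\<bar>a - a'\<bar> / w \<le> D / (\<delta> * sqrt \<delta>)"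
    proof (rule frac_le)
      have "\<delta> * sqrt \<delta> \<le> 1 * sqrt \<delta>" using d1 sd by (intro mult_right_mono) auto
      then show "\<delta> * sqrt \<delta> \<le> w" using w(1) by simp
    qed (use that sd assms(3) in \<open>auto simp: D_def\<close>)
    also have "\<bar>a'\<bar> * \<bar>1 / w - 1 / w'\<bar> \<le> 1 * (D / (\<delta> * sqrt \<delta>))"
      by (rule mult_mono) (use that inv in auto)
    finally show ?thesis by (simp add: algebra_simps)
  qed
  show "\<bar>p / wt p q - p' / wt p' q'\<bar> \<le> 2 / (\<delta> * sqrt \<delta>) * (\<bar>p - p'\<bar> + \<bar>q - q'\<bar>)"
    using main[of p p'] one[OF assms(2)] by (simp add: D_def w_def w'_def)
  show "\<bar>q / wt p q - q' / wt p' q'\<bar> \<le> 2 / (\<delta> * sqrt \<delta>) * (\<bar>p - p'\<bar> + \<bar>q - q'\<bar>)"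
    using main[of q q'] one[OF assms(2)] by (simp add: D_def w_def w'_def)
qed

text \<open>The derivatives are explicit arguments, so that translates and reflections carry their
  own along. The second order equation is the maximal surface equation in non-divergence
  form.\<close>

definition max_graph ::
  "complex set \<Rightarrow> (complex \<Rightarrow> real) \<Rightarrow> (complex \<Rightarrow> real) \<Rightarrow> (complex \<Rightarrow> real) \<Rightarrow>
   (complex \<Rightarrow> real) \<Rightarrow> (complex \<Rightarrow> real) \<Rightarrow> (complex \<Rightarrow> real) \<Rightarrow> bool" where
  "max_graph \<Omega> u p q r s t \<longleftrightarrow> open \<Omega> \<and>
     (\<forall>z\<in>\<Omega>. has_grad u (p z) (q z) z \<and> has_grad p (r z) (s z) z \<and> has_grad q (s z) (t z) z \<and>
        (p z)\<^sup>2 + (q z)\<^sup>2 < 1 \<and>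
        (1 - (q z)\<^sup>2) * r z + 2 * p z * q z * s z + (1 - (p z)\<^sup>2) * t z = 0) \<and>
     continuous_on \<Omega> r \<and> continuous_on \<Omega> s \<and> continuous_on \<Omega> t"

lemma max_graphD:
  assumes "max_graph \<Omega> u p q r s t"
  shows "open \<Omega>" "z \<in> \<Omega> \<Longrightarrow> has_grad u (p z) (q z) z" "z \<in> \<Omega> \<Longrightarrow> has_grad p (r z) (s z) z"
    "z \<in> \<Omega> \<Longrightarrow> has_grad q (s z) (t z) z" "z \<in> \<Omega> \<Longrightarrow> (p z)\<^sup>2 + (q z)\<^sup>2 < 1"
    "z \<in> \<Omega> \<Longrightarrow> (1 - (q z)\<^sup>2) * r z + 2 * p z * q z * s z + (1 - (p z)\<^sup>2) * t z = 0"
    "continuous_on \<Omega> r" "continuous_on \<Omega> s" "continuous_on \<Omega> t"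
  using assms by (auto simp: max_graph_def)

lemma max_graph_continuous:
  assumes "max_graph \<Omega> u p q r s t"
  shows "continuous_on \<Omega> u" "continuous_on \<Omega> p" "continuous_on \<Omega> q"
  using max_graphD[OF assms] has_grad_imp_isCont
  by (metis continuous_at_imp_continuous_on)+

lemma max_graph_translate:
  assumes "max_graph \<Omega> u p q r s t"
  shows "max_graph ((\<lambda>z. z + h) -` \<Omega>) (\<lambda>z. u (z + h)) (\<lambda>z. p (z + h)) (\<lambda>z. q (z + h))
    (\<lambda>z. r (z + h)) (\<lambda>z. s (z + h)) (\<lambda>z. t (z + h))"
proof -
  have "open ((\<lambda>z. z + h) -` \<Omega>)"
    by (rule open_vimage[OF max_graphD(1)[OF assms]]) (intro continuous_intros)
  moreover have "continuous_on ((\<lambda>z. z + h) -` \<Omega>) (\<lambda>z. f (z + h))" if "continuous_on \<Omega> f" for f :: "complex \<Rightarrow> real"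
    by (rule continuous_on_compose2[OF that]) (auto intro!: continuous_intros)
  ultimately show ?thesis
    using assms by (auto simp: max_graph_def intro!: has_grad_translate)
qed

lemma has_grad_eq: "has_grad f a b z \<Longrightarrow> a = a' \<Longrightarrow> b = b' \<Longrightarrow> has_grad f a' b' z"
  by simp

lemma wt_grad:
  assumes "has_grad p r s z" "has_grad q s' t z" "(p z)\<^sup>2 + (q z)\<^sup>2 < 1"
  shows "has_grad (\<lambda>z. wt (p z) (q z)) (- (p z * r + q z * s') / wt (p z) (q z))
    (- (p z * s + q z * t) / wt (p z) (q z)) z"
proof -
  have g: "has_grad (\<lambda>z. 1 - (p z)\<^sup>2 - (q z)\<^sup>2) (- 2 * (p z * r + q z * s')) (- 2 * (p z * s + q z * t)) z"
    using has_grad_diff[OF has_grad_diff[OF has_grad_const[of 1] has_grad_mult[OF assms(1) assms(1)]]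
        has_grad_mult[OF assms(2) assms(2)]]
    by (simp add: power2_eq_square algebra_simps)
  have "(sqrt has_real_derivative inverse (wt (p z) (q z)) / 2) (at (1 - (p z)\<^sup>2 - (q z)\<^sup>2))"
    by (rule DERIV_real_sqrt) (use assms(3) in simp)
  note G = has_grad_compose[OF g this]
  have "inverse W / 2 * (- 2 * X) = - X / W" for W X :: real by (simp add: field_simps)
  with G show ?thesis by (simp only:)
qed

lemma has_grad_divide:
  assumes "has_grad f a b z" "has_grad g c d z" "g z \<noteq> 0"
  shows "has_grad (\<lambda>z. f z / g z) ((a * g z - f z * c) / (g z)\<^sup>2) ((b * g z - f z * d) / (g z)\<^sup>2) z"
proof -
  have "((\<lambda>x. inverse x) has_real_derivative - inverse ((g z)\<^sup>2)) (at (g z))"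
    using DERIV_inverse[OF assms(3)] by (simp add: power2_eq_square)
  from has_grad_mult[OF assms(1) has_grad_compose[OF assms(2) this]]
  show ?thesis using assms(3) by (simp add: field_simps power2_eq_square)
qed

lemma flux_grad:
  assumes "has_grad p r s z" "has_grad q s t z" "(p z)\<^sup>2 + (q z)\<^sup>2 < 1"
  shows "has_grad (\<lambda>z. p z / wt (p z) (q z)) (((1 - (q z)\<^sup>2) * r + p z * q z * s) / wt (p z) (q z) ^ 3)
           (((1 - (q z)\<^sup>2) * s + p z * q z * t) / wt (p z) (q z) ^ 3) z"
    and "has_grad (\<lambda>z. q z / wt (p z) (q z)) (((1 - (p z)\<^sup>2) * s + p z * q z * r) / wt (p z) (q z) ^ 3)
           (((1 - (p z)\<^sup>2) * t + p z * q z * s) / wt (p z) (q z) ^ 3) z"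
proof -
  define w where "w = wt (p z) (q z)"
  have w: "w \<noteq> 0" "w\<^sup>2 = 1 - (p z)\<^sup>2 - (q z)\<^sup>2" using assms(3) by (auto simp: w_def)
  have e: "(a * w - b * (- c / w)) / w\<^sup>2 = (a * w\<^sup>2 + b * c) / w ^ 3" for a b c
    using w(1) by (simp add: field_simps power2_eq_square power3_eq_cube)
  have w0: "wt (p z) (q z) \<noteq> 0" using w by (simp add: w_def)
  have ww: "w * w = 1 - p z * p z - q z * q z" using w(2) by (simp add: power2_eq_square)
  note g = wt_grad[OF assms]
  show "has_grad (\<lambda>z. p z / wt (p z) (q z)) (((1 - (q z)\<^sup>2) * r + p z * q z * s) / wt (p z) (q z) ^ 3)
           (((1 - (q z)\<^sup>2) * s + p z * q z * t) / wt (p z) (q z) ^ 3) z"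
    using has_grad_divide[OF assms(1) g w0] unfolding w_def[symmetric] e
    by (rule has_grad_eq) (simp_all add: ww algebra_simps power2_eq_square)
  show "has_grad (\<lambda>z. q z / wt (p z) (q z)) (((1 - (p z)\<^sup>2) * s + p z * q z * r) / wt (p z) (q z) ^ 3)
           (((1 - (p z)\<^sup>2) * t + p z * q z * s) / wt (p z) (q z) ^ 3) z"
    using has_grad_divide[OF assms(2) g w0] unfolding w_def[symmetric] e
    by (rule has_grad_eq) (simp_all add: ww algebra_simps power2_eq_square)
qed

text \<open>The divergence form: multiplied by the cube of the weight, the divergence of the flux is
  the left side of the non-divergence equation.\<close>

lemma max_graph_flux:
  assumes "max_graph \<Omega> u p q r s t"
  obtains N1x N1y N2x N2y where
    "\<And>z. z \<in> \<Omega> \<Longrightarrow> has_grad (\<lambda>z. p z / wt (p z) (q z)) (N1x z) (N1y z) z"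
    "\<And>z. z \<in> \<Omega> \<Longrightarrow> has_grad (\<lambda>z. q z / wt (p z) (q z)) (N2x z) (N2y z) z"
    "\<And>z. z \<in> \<Omega> \<Longrightarrow> N1x z + N2y z = 0"
    "continuous_on \<Omega> N1x" "continuous_on \<Omega> N2y"
proof -
  note D = max_graphD[OF assms] and c = max_graph_continuous[OF assms]
  have w: "wt (p z) (q z) \<noteq> 0" if "z \<in> \<Omega>" for z using D(5)[OF that] by auto
  show thesis
  proof (rule that)
    show "has_grad (\<lambda>z. p z / wt (p z) (q z)) (((1 - (q z)\<^sup>2) * r z + p z * q z * s z) / wt (p z) (q z) ^ 3)
           (((1 - (q z)\<^sup>2) * s z + p z * q z * t z) / wt (p z) (q z) ^ 3) z" if "z \<in> \<Omega>" for z
      by (rule flux_grad(1)[OF D(3,4,5)]) (fact that)+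
    show "has_grad (\<lambda>z. q z / wt (p z) (q z)) (((1 - (p z)\<^sup>2) * s z + p z * q z * r z) / wt (p z) (q z) ^ 3)
           (((1 - (p z)\<^sup>2) * t z + p z * q z * s z) / wt (p z) (q z) ^ 3) z" if "z \<in> \<Omega>" for z
      by (rule flux_grad(2)[OF D(3,4,5)]) (fact that)+
    show "((1 - (q z)\<^sup>2) * r z + p z * q z * s z) / wt (p z) (q z) ^ 3 +
        ((1 - (p z)\<^sup>2) * t z + p z * q z * s z) / wt (p z) (q z) ^ 3 = 0" if "z \<in> \<Omega>" for z
      using D(6)[OF that] by (simp add: algebra_simps flip: add_divide_distrib)
    show "continuous_on \<Omega> (\<lambda>z. ((1 - (q z)\<^sup>2) * r z + p z * q z * s z) / wt (p z) (q z) ^ 3)"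
      "continuous_on \<Omega> (\<lambda>z. ((1 - (p z)\<^sup>2) * t z + p z * q z * s z) / wt (p z) (q z) ^ 3)"
      by (intro continuous_intros c D ballI; use w in simp)+
  qed
qed

text \<open>Lets a product with a truncation count as continuous on the whole rectangle although its
  other factor makes no sense on the singular set.\<close>

lemma continuous_on_glue_zero:
  fixes h :: "'a::t2_space \<Rightarrow> real"
  assumes "closed \<Sigma>" "continuous_on (R - \<Sigma>) h"
    and "\<And>z. z \<in> R \<Longrightarrow> z \<in> \<Sigma> \<Longrightarrow> \<forall>\<^sub>F y in nhds z. h y = 0"
  shows "continuous_on R h"
  unfolding continuous_on_eq_continuous_within
proof
  fix z assume z: "z \<in> R"
  show "continuous (at z within R) h"
  proof (cases "z \<in> \<Sigma>")
    case True
    have ev: "\<forall>\<^sub>F y in nhds z. h y = 0" by (rule assms(3)[OF z True])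
    then have "h z = 0" by (rule eventually_nhds_x_imp_x)
    moreover have "\<forall>\<^sub>F y in at z. h y = 0" using ev by (simp add: eventually_at_filter eventually_mono)
    ultimately have "isCont h z" unfolding isCont_def by (simp add: tendsto_eventually)
    then show ?thesis by (rule continuous_at_imp_continuous_at_within)
  next
    case False
    have "at z within R = at z within (R - \<Sigma>)"
      by (rule at_within_nhd[of z "- \<Sigma>"]) (use False assms(1) in auto)
    then show ?thesis using assms(2) z False by (auto simp: continuous_on_eq_continuous_within)
  qed
qed

text \<open>The basic energy estimate: testing the difference of the flux field of \<open>u\<close> and a vector field
  \<open>(K1, K2)\<close> that almost is the flux field of \<open>u'\<close> with a truncation of \<open>\<sigma> (u - u') - M\<close> vanishing
  near the singularities \<open>\<Sigma>\<close>.\<close>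

lemma cut_energy:
  fixes \<sigma> M x0 x1 a b :: real and u u' p q r s t p' q' K1 K2 K1x K1y K2x K2y E :: "complex \<Rightarrow> real"
  defines "v \<equiv> \<lambda>z. \<sigma> * (u z - u' z) - M"
  assumes x: "x0 \<le> x1" "a \<le> b" and \<Sigma>: "closed \<Sigma>" and \<sigma>: "\<sigma> = 1 \<or> \<sigma> = -1"
    and u: "max_graph \<Omega> u p q r s t" and R\<Omega>: "rect x0 x1 a b - \<Sigma> \<subseteq> \<Omega>"
    and u'0: "\<forall>z\<in>rect x0 x1 a b - \<Sigma>. has_grad u' (p' z) (q' z) z"
    and u'c: "continuous_on (rect x0 x1 a b - \<Sigma>) p'" "continuous_on (rect x0 x1 a b - \<Sigma>) q'"
    and u'10: "\<forall>z\<in>rect x0 x1 a b - \<Sigma>. (p' z)\<^sup>2 + (q' z)\<^sup>2 < 1"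
    and K10: "\<forall>z\<in>rect x0 x1 a b - \<Sigma>. has_grad K1 (K1x z) (K1y z) z"
    and K20: "\<forall>z\<in>rect x0 x1 a b - \<Sigma>. has_grad K2 (K2x z) (K2y z) z"
    and Kc: "continuous_on (rect x0 x1 a b - \<Sigma>) K1x" "continuous_on (rect x0 x1 a b - \<Sigma>) K2y"
    and E0: "continuous_on (rect x0 x1 a b) E"
      "\<forall>z\<in>rect x0 x1 a b - \<Sigma>. cut (v z) * \<bar>K1x z + K2y z\<bar> +
         \<bar>(p z - p' z) * (p' z / wt (p' z) (q' z) - K1 z) + (q z - q' z) * (q' z / wt (p' z) (q' z) - K2 z)\<bar> \<le> E z"
      "\<forall>z\<in>rect x0 x1 a b. 0 \<le> E z"
    and neg0: "\<forall>z\<in>rect x0 x1 a b \<inter> \<Sigma>. \<forall>\<^sub>F y in nhds z. v y \<le> 0"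
    and side0: "\<forall>y\<in>{a..b}.
        cut (v (Complex x0 y)) * (p (Complex x0 y) / wt (p (Complex x0 y)) (q (Complex x0 y)) - K1 (Complex x0 y)) =
        cut (v (Complex x1 y)) * (p (Complex x1 y) / wt (p (Complex x1 y)) (q (Complex x1 y)) - K1 (Complex x1 y))"
  defines "B \<equiv> \<lambda>y. integral {x0..x1} (\<lambda>x. cut (v (Complex x y)) * (\<sigma> * (q (Complex x y) /
      wt (p (Complex x y)) (q (Complex x y)) - K2 (Complex x y))))"
  shows "\<And>z. z \<in> rect x0 x1 a b \<Longrightarrow>
      has_grad (\<lambda>z. cut (v z)) (cut' (v z) * (\<sigma> * (p z - p' z))) (cut' (v z) * (\<sigma> * (q z - q' z))) z"
    and "continuous_on (rect x0 x1 a b) (\<lambda>z. cut' (v z) * (\<sigma> * (p z - p' z)))"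
    and "continuous_on (rect x0 x1 a b) (\<lambda>z. cut' (v z) * (\<sigma> * (q z - q' z)))"
    and "rint x0 x1 a b (\<lambda>z. (cut' (v z) * (\<sigma> * (p z - p' z)))\<^sup>2 + (cut' (v z) * (\<sigma> * (q z - q' z)))\<^sup>2)
      \<le> B b - B a + rint x0 x1 a b E"
proof -
  let ?R = "rect x0 x1 a b"
  note D = max_graphD[OF u] and u' = bspec[OF u'0] and u'1 = bspec[OF u'10] and K1 = bspec[OF K10]
    and K2 = bspec[OF K20] and E = E0(1) bspec[OF E0(2)] bspec[OF E0(3)] and neg = bspec[OF neg0, OF IntI]
  obtain N1x N1y N2x N2y where N:
    "\<And>z. z \<in> \<Omega> \<Longrightarrow> has_grad (\<lambda>z. p z / wt (p z) (q z)) (N1x z) (N1y z) z"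
    "\<And>z. z \<in> \<Omega> \<Longrightarrow> has_grad (\<lambda>z. q z / wt (p z) (q z)) (N2x z) (N2y z) z"
    "\<And>z. z \<in> \<Omega> \<Longrightarrow> N1x z + N2y z = 0"
    "continuous_on \<Omega> N1x" "continuous_on \<Omega> N2y"
    by (rule max_graph_flux[OF u]) (rule that)
  define G1 where "G1 = (\<lambda>z. \<sigma> * (p z / wt (p z) (q z) - K1 z))"
  define G2 where "G2 = (\<lambda>z. \<sigma> * (q z / wt (p z) (q z) - K2 z))"
  have cmul: "has_grad (\<lambda>z. \<sigma> * f z) (\<sigma> * c) (\<sigma> * d) z" if "has_grad f c d z" for f c d z
    using has_grad_mult[OF has_grad_const[of \<sigma>] that] by simp
  have vg: "has_grad v (\<sigma> * (p z - p' z)) (\<sigma> * (q z - q' z)) z" if "z \<in> ?R - \<Sigma>" for z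
    using has_grad_diff[OF cmul[OF has_grad_diff[OF D(2) u'[OF that]]] has_grad_const[of M]] that R\<Omega>
    by (auto simp: v_def)
  have G1g: "has_grad G1 (\<sigma> * (N1x z - K1x z)) (\<sigma> * (N1y z - K1y z)) z" if "z \<in> ?R - \<Sigma>" for z
    unfolding G1_def using cmul[OF has_grad_diff[OF N(1) K1[OF that]]] that R\<Omega> by auto
  have G2g: "has_grad G2 (\<sigma> * (N2x z - K2x z)) (\<sigma> * (N2y z - K2y z)) z" if "z \<in> ?R - \<Sigma>" for z
    unfolding G2_def using cmul[OF has_grad_diff[OF N(2) K2[OF that]]] that R\<Omega> by auto
  \<comment> \<open>The gradients mean nothing on \<Sigma>, but the truncation vanishes on a whole
    neighbourhood of each point there, so every product with it or with its derivative is locally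
    zero.\<close>
  have loc: "\<forall>\<^sub>F y in nhds z. cut (v y) = 0 \<and> cut' (v y) = 0" if "z \<in> ?R" "z \<in> \<Sigma>" for z
    using neg[OF that] by eventually_elim (simp add: cut_eq_0 cut'_eq_0)
  have loc1: "cut (v z) = 0" "cut' (v z) = 0" if "z \<in> ?R" "z \<in> \<Sigma>" for z
    using eventually_nhds_x_imp_x[OF loc[OF that]] by auto
  show cg: "has_grad (\<lambda>z. cut (v z)) (cut' (v z) * (\<sigma> * (p z - p' z))) (cut' (v z) * (\<sigma> * (q z - q' z))) z"
    if "z \<in> ?R" for z
  proof (cases "z \<in> \<Sigma>")
    case True
    have "\<forall>\<^sub>F y in nhds z. 0 = cut (v y)" using loc[OF that True] by eventually_elim simp
    from has_grad_transform[OF has_grad_const this] show ?thesis using loc1[OF that True] by simp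
  next
    case False
    then show ?thesis using has_grad_compose[OF vg DERIV_cut] that by simp
  qed
  have prodg: "has_grad (\<lambda>z. cut (v z) * G z)
      (cut' (v z) * (\<sigma> * (p z - p' z)) * G z + cut (v z) * Gx z)
      (cut' (v z) * (\<sigma> * (q z - q' z)) * G z + cut (v z) * Gy z) z"
    if "z \<in> ?R" "\<And>z. z \<in> ?R - \<Sigma> \<Longrightarrow> has_grad G (Gx z) (Gy z) z" for z G Gx Gy
  proof (cases "z \<in> \<Sigma>")
    case True
    have "\<forall>\<^sub>F y in nhds z. 0 = cut (v y) * G y" using loc[OF that(1) True] by eventually_elim simp
    from has_grad_transform[OF has_grad_const this] show ?thesis using loc1[OF that(1) True] by simp
  next
    case False
    then show ?thesis using has_grad_mult[OF cg that(2)] that(1) by simp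
  qed
  have contv: "continuous_on (?R - \<Sigma>) v"
    by (intro continuous_at_imp_continuous_on ballI has_grad_imp_isCont[OF vg])
  have contG: "continuous_on (?R - \<Sigma>) G1" "continuous_on (?R - \<Sigma>) G2"
    by (intro continuous_at_imp_continuous_on ballI has_grad_imp_isCont[OF G1g] has_grad_imp_isCont[OF G2g]; assumption)+
  have contcut: "continuous_on (?R - \<Sigma>) (\<lambda>z. cut (v z))" "continuous_on (?R - \<Sigma>) (\<lambda>z. cut' (v z))"
  proof -
    have "continuous_on UNIV cut" "continuous_on UNIV cut'"
      by (auto intro!: continuous_at_imp_continuous_on isCont_cut' DERIV_isCont[OF DERIV_cut])
    then show "continuous_on (?R - \<Sigma>) (\<lambda>z. cut (v z))" "continuous_on (?R - \<Sigma>) (\<lambda>z. cut' (v z))"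
      by (auto intro!: continuous_on_compose2[OF _ contv])
  qed
  have contpq: "continuous_on (?R - \<Sigma>) p" "continuous_on (?R - \<Sigma>) q"
    "continuous_on (?R - \<Sigma>) N1x" "continuous_on (?R - \<Sigma>) N2y"
    using max_graph_continuous[OF u] N(4,5) continuous_on_subset[OF _ R\<Omega>] by auto
  have glue: "continuous_on ?R (\<lambda>z. cut' (v z) * f z)" "continuous_on ?R (\<lambda>z. cut (v z) * f z)"
    if "continuous_on (?R - \<Sigma>) f" for f
    by (rule continuous_on_glue_zero[OF \<Sigma>], intro continuous_intros that contcut,
        rule eventually_mono[OF loc], auto)+
  show c1: "continuous_on ?R (\<lambda>z. cut' (v z) * (\<sigma> * (p z - p' z)))"
    and c2: "continuous_on ?R (\<lambda>z. cut' (v z) * (\<sigma> * (q z - q' z)))"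
    by (intro glue continuous_intros contpq u'c)+
  \<comment> \<open>The test field is the truncation times the difference of the two flux fields,
    (\<open>G1\<close>, \<open>G2\<close>). The sides of the rectangle cancel by
    \<open>side0\<close>.\<close>
  have div: "rint x0 x1 a b (\<lambda>z. (cut' (v z) * (\<sigma> * (p z - p' z)) * G1 z + cut (v z) * (\<sigma> * (N1x z - K1x z)))
       + (cut' (v z) * (\<sigma> * (q z - q' z)) * G2 z + cut (v z) * (\<sigma> * (N2y z - K2y z))))
     = integral {x0..x1} (\<lambda>x. cut (v (Complex x b)) * G2 (Complex x b)) - integral {x0..x1} (\<lambda>x. cut (v (Complex x a)) * G2 (Complex x a))"
  proof (rule divergence_rect[OF x prodg[OF _ G1g] prodg[OF _ G2g]])
    show "cut (v (Complex x0 y)) * G1 (Complex x0 y) = cut (v (Complex x1 y)) * G1 (Complex x1 y)"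
      if "a \<le> y" "y \<le> b" for y
      unfolding G1_def mult.left_commute[of _ \<sigma>] bspec[OF side0, of y, unfolded atLeastAtMost_iff, OF conjI[OF that]] ..
    have "continuous_on ?R (\<lambda>z. cut' (v z) * ((\<sigma> * (p z - p' z)) * G1 z) + cut (v z) * (\<sigma> * (N1x z - K1x z)))"
      by (rule continuous_on_add; rule glue; intro continuous_intros contpq u'c contG Kc)
    then show "continuous_on ?R (\<lambda>z. cut' (v z) * (\<sigma> * (p z - p' z)) * G1 z + cut (v z) * (\<sigma> * (N1x z - K1x z)))"
      by (simp add: mult.assoc)
    have "continuous_on ?R (\<lambda>z. cut' (v z) * ((\<sigma> * (q z - q' z)) * G2 z) + cut (v z) * (\<sigma> * (N2y z - K2y z)))"
      by (rule continuous_on_add; rule glue; intro continuous_intros contpq u'c contG Kc)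
    then show "continuous_on ?R (\<lambda>z. cut' (v z) * (\<sigma> * (q z - q' z)) * G2 z + cut (v z) * (\<sigma> * (N2y z - K2y z)))"
      by (simp add: mult.assoc)
  qed
  have ss: "\<sigma> * \<sigma> = 1" using \<sigma> by auto
  let ?I = "\<lambda>z. (cut' (v z) * (\<sigma> * (p z - p' z)) * G1 z + cut (v z) * (\<sigma> * (N1x z - K1x z)))
       + (cut' (v z) * (\<sigma> * (q z - q' z)) * G2 z + cut (v z) * (\<sigma> * (N2y z - K2y z)))"
  have Ic: "continuous_on ?R ?I"
  proof -
    have "continuous_on ?R (\<lambda>z. cut' (v z) * ((\<sigma> * (p z - p' z)) * G1 z + (\<sigma> * (q z - q' z)) * G2 z)
       + cut (v z) * (\<sigma> * (N1x z - K1x z) + \<sigma> * (N2y z - K2y z)))"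
      by (rule continuous_on_add; rule glue; intro continuous_intros contpq u'c contG Kc)
    then show ?thesis by (simp add: algebra_simps)
  qed
  have point: "(cut' (v z) * (\<sigma> * (p z - p' z)))\<^sup>2 + (cut' (v z) * (\<sigma> * (q z - q' z)))\<^sup>2 \<le> ?I z + E z"
    if z: "z \<in> ?R" for z
  proof (cases "z \<in> \<Sigma>")
    case True
    then show ?thesis using loc1[OF z True] E(3)[OF z] by simp
  next
    case False
    then have zi: "z \<in> ?R - \<Sigma>" "z \<in> \<Omega>" using z R\<Omega> by auto
    \<comment> \<open>As c lies between 0 and 1, c^2 <= c; hence the squared gradient of the
      truncation is at most c times the monotone product \<open>X\<close>, which is what the
      divergence produces.\<close>
    define c where "c = cut' (v z)"
    have c: "0 \<le> c" "c \<le> 1" by (simp_all add: c_def cut'_nonneg cut'_le_1)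
    define P Q where "P = p z - p' z" and "Q = q z - q' z"
    \<comment> \<open>The product splits into the monotone part \<open>X\<close> and the defect
      \<open>Y\<close> of (\<open>K1\<close>, \<open>K2\<close>) from being the flux of the
      comparison function. The defect, together with the divergence of (\<open>K1\<close>,
      \<open>K2\<close>), is absorbed by \<open>E\<close>.\<close>
    define X where "X = P * (p z / wt (p z) (q z) - p' z / wt (p' z) (q' z)) + Q * (q z / wt (p z) (q z) - q' z / wt (p' z) (q' z))"
    define Y where "Y = P * (p' z / wt (p' z) (q' z) - K1 z) + Q * (q' z / wt (p' z) (q' z) - K2 z)"
    have X: "P\<^sup>2 + Q\<^sup>2 \<le> X"
      using flux_monotone[OF D(5)[OF zi(2)] u'1[OF zi(1)]] by (simp add: X_def P_def Q_def)
    have "c\<^sup>2 \<le> c" using c by (simp add: power2_eq_square mult_left_le)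
    have "(c * (\<sigma> * P))\<^sup>2 + (c * (\<sigma> * Q))\<^sup>2 = c\<^sup>2 * (P\<^sup>2 + Q\<^sup>2)"
      using ss by (simp add: power_mult_distrib power2_eq_square[of \<sigma>] algebra_simps)
    also have "\<dots> \<le> c * (P\<^sup>2 + Q\<^sup>2)"
      using \<open>c\<^sup>2 \<le> c\<close> by (rule mult_right_mono) simp
    also have "\<dots> \<le> c * X" using X c by (intro mult_left_mono) auto
    finally have 1: "(c * (\<sigma> * P))\<^sup>2 + (c * (\<sigma> * Q))\<^sup>2 \<le> c * X" .
    have N0: "N2y z = - N1x z" using N(3)[OF zi(2)] by simp
    have "?I z = c * (\<sigma> * \<sigma> * (X + Y)) + cut (v z) * (\<sigma> * - (K1x z + K2y z))"
      unfolding G1_def G2_def X_def Y_def P_def Q_def c_def[symmetric] N0 by (simp add: algebra_simps)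
    then have 2: "?I z = c * X + c * Y - \<sigma> * (cut (v z) * (K1x z + K2y z))"
      unfolding ss by (simp add: algebra_simps)
    have "\<bar>c * Y\<bar> \<le> \<bar>Y\<bar>" using c by (simp add: abs_mult mult_left_le_one_le)
    moreover have "\<bar>\<sigma> * (cut (v z) * (K1x z + K2y z))\<bar> = cut (v z) * \<bar>K1x z + K2y z\<bar>"
      using \<sigma> cut_nonneg[of "v z"] by (auto simp: abs_mult)
    moreover have "cut (v z) * \<bar>K1x z + K2y z\<bar> + \<bar>Y\<bar> \<le> E z"
      using E(2)[OF zi(1)] by (simp add: Y_def P_def Q_def)
    ultimately have "c * X \<le> ?I z + E z" unfolding 2 by linarith
    with 1 show ?thesis unfolding c_def P_def Q_def by linarith
  qed
  have "rint x0 x1 a b (\<lambda>z. (cut' (v z) * (\<sigma> * (p z - p' z)))\<^sup>2 + (cut' (v z) * (\<sigma> * (q z - q' z)))\<^sup>2)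
      \<le> rint x0 x1 a b (\<lambda>z. ?I z + E z)"
    by (rule rint_mono) (use point in \<open>auto intro!: continuous_on_add continuous_on_power c1 c2 Ic E(1)\<close>)
  also have "\<dots> = rint x0 x1 a b ?I + rint x0 x1 a b E" by (rule rint_add[OF Ic E(1)])
  also have "rint x0 x1 a b ?I = B b - B a" unfolding div by (simp add: B_def G2_def)
  finally show "rint x0 x1 a b (\<lambda>z. (cut' (v z) * (\<sigma> * (p z - p' z)))\<^sup>2 + (cut' (v z) * (\<sigma> * (q z - q' z)))\<^sup>2)
      \<le> B b - B a + rint x0 x1 a b E" .
qed

section \<open>Comparison and stability\<close>

lemma cut_pos_lower:
  assumes "0 < h" "h \<le> t"
  shows "h\<^sup>2 / (1 + h) \<le> cut t"
proof -
  have "h * h + h * h * t \<le> t * t + t * t * h"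
  proof -
    have "h * h \<le> t * t" using assms by (intro mult_mono) auto
    moreover have "h * t * h \<le> h * t * t" using assms by (intro mult_left_mono) auto
    ultimately show ?thesis by (simp add: algebra_simps)
  qed
  then show ?thesis
    using assms by (simp add: cut_def field_simps power2_eq_square)
qed

text \<open>The value of \<open>cut\<close> at h is h^2/(1+h); half of it serves as tolerance
  throughout, to leave room for a strict inequality.\<close>

lemma le_if_cut_small:
  assumes "0 < h" "\<bar>cut t\<bar> \<le> h\<^sup>2 / (2 * (1 + h))"
  shows "t \<le> h"
proof (rule ccontr)
  assume "\<not> t \<le> h"
  then have "h\<^sup>2 / (1 + h) \<le> cut t" using assms(1) by (intro cut_pos_lower) auto
  moreover have "h\<^sup>2 / (2 * (1 + h)) < h\<^sup>2 / (1 + h)"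
    using assms(1) by (intro divide_strict_left_mono) auto
  moreover have "cut t \<le> h\<^sup>2 / (2 * (1 + h))" using assms(2) by (rule order_trans[OF abs_ge_self])
  ultimately show False by (meson leD order_trans)
qed

lemma grad_less_1:
  assumes "p\<^sup>2 + q\<^sup>2 < (1::real)" shows "\<bar>p\<bar> < 1" "\<bar>q\<bar> < 1"
proof -
  have "p\<^sup>2 < 1" "q\<^sup>2 < 1" using assms zero_le_power2[of p] zero_le_power2[of q] by linarith+
  then show "\<bar>p\<bar> < 1" "\<bar>q\<bar> < 1" by (simp_all add: abs_square_less_1)
qed

lemma abs_cut'_mult_le:
  assumes "\<bar>x\<bar> \<le> 2" "\<sigma> = 1 \<or> \<sigma> = (-1::real)"
  shows "\<bar>cut' t * (\<sigma> * x)\<bar> \<le> 2"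
proof -
  have "\<bar>cut' t * (\<sigma> * x)\<bar> = cut' t * \<bar>x\<bar>"
    using assms(2) cut'_nonneg[of t] by (auto simp: abs_mult)
  also have "\<dots> \<le> 1 * 2" using assms(1) cut'_le_1[of t] cut'_nonneg[of t] by (intro mult_mono) auto
  finally show ?thesis by simp
qed

text \<open>The truncation of u - u' - M vanishes on the boundary and the comparison field is the
  exact flux of u', so the energy is at most 0. The truncation is thus smaller than every tolerance,
  without linearizing the equation.\<close>

lemma comparison_rect:
  assumes x: "x0 < x1" "a < b"
    and u: "max_graph \<Omega> u p q r s t" "rect x0 x1 a b \<subseteq> \<Omega>"
    and u': "max_graph \<Omega>' u' p' q' r' s' t'" "rect x0 x1 a b \<subseteq> \<Omega>'"
    and bd: "\<And>z. z \<in> rect x0 x1 a b \<Longrightarrow> Re z = x0 \<or> Re z = x1 \<or> Im z = a \<or> Im z = b \<Longrightarrow> u z - u' z \<le> M"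
    and z: "z \<in> rect x0 x1 a b"
  shows "u z - u' z \<le> M"
proof (rule field_le_epsilon)
  fix h :: real assume h: "0 < h"
  let ?R = "rect x0 x1 a b"
  let ?v = "\<lambda>z. u z - u' z - M"
  note D = max_graphD[OF u(1)] and D' = max_graphD[OF u'(1)]
  obtain K1x K1y K2x K2y where K:
    "\<And>z. z \<in> \<Omega>' \<Longrightarrow> has_grad (\<lambda>z. p' z / wt (p' z) (q' z)) (K1x z) (K1y z) z"
    "\<And>z. z \<in> \<Omega>' \<Longrightarrow> has_grad (\<lambda>z. q' z / wt (p' z) (q' z)) (K2x z) (K2y z) z"
    "\<And>z. z \<in> \<Omega>' \<Longrightarrow> K1x z + K2y z = 0"
    "continuous_on \<Omega>' K1x" "continuous_on \<Omega>' K2y"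
    by (rule max_graph_flux[OF u'(1)]) (rule that)
  have cut0: "cut (?v z) = 0" if "z \<in> ?R" "Re z = x0 \<or> Re z = x1 \<or> Im z = a \<or> Im z = b" for z
    using bd[OF that] by (intro cut_eq_0) (simp)
  have inR: "z \<in> \<Omega>'" if "z \<in> ?R - {}" for z using u'(2) that by auto
  have sub': "?R - {} \<subseteq> \<Omega>'" "?R - {} \<subseteq> \<Omega>" using u' u by auto
  have x': "x0 \<le> x1" "a \<le> b" using x by auto
  have pre: "\<forall>z\<in>?R - {}. cut (1 * (u z - u' z) - M) * \<bar>K1x z + K2y z\<bar> +
         \<bar>(p z - p' z) * (p' z / wt (p' z) (q' z) - p' z / wt (p' z) (q' z)) + (q z - q' z) * (q' z / wt (p' z) (q' z) - q' z / wt (p' z) (q' z))\<bar> \<le> 0"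
    using K(3) inR by simp
  have side: "\<forall>y\<in>{a..b}. cut (1 * (u (Complex x0 y) - u' (Complex x0 y)) - M) * (p (Complex x0 y) / wt (p (Complex x0 y)) (q (Complex x0 y)) - p' (Complex x0 y) / wt (p' (Complex x0 y)) (q' (Complex x0 y))) =
        cut (1 * (u (Complex x1 y) - u' (Complex x1 y)) - M) * (p (Complex x1 y) / wt (p (Complex x1 y)) (q (Complex x1 y)) - p' (Complex x1 y) / wt (p' (Complex x1 y)) (q' (Complex x1 y)))"
    using cut0[of "Complex x0 _"] cut0[of "Complex x1 _"] x by (simp add: rect_def)
  note energy = cut_energy[where \<Sigma>="{}" and \<sigma>=1 and M=M and E="\<lambda>z. 0", OF x' closed_empty disjI1[OF refl] u(1) sub'(2)
      ballI[OF D'(2)[OF inR]] continuous_on_subset[OF max_graph_continuous(2)[OF u'(1)] sub'(1)]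
      continuous_on_subset[OF max_graph_continuous(3)[OF u'(1)] sub'(1)] ballI[OF D'(5)[OF inR]]
      ballI[OF K(1)[OF inR]] ballI[OF K(2)[OF inR]]
      continuous_on_subset[OF K(4) sub'(1)] continuous_on_subset[OF K(5) sub'(1)] continuous_on_const pre _ _ side,
      simplified]
  have "rint x0 x1 a b (\<lambda>z. (cut' (?v z) * (p z - p' z))\<^sup>2 + (cut' (?v z) * (q z - q' z))\<^sup>2) \<le> 0"
  proof -
    have "integral {x0..x1} (\<lambda>x. cut (?v (Complex x y)) * f x) = 0" if "y = a \<or> y = b" for f y
    proof -
      have "integral {x0..x1} (\<lambda>x. cut (?v (Complex x y)) * f x) = integral {x0..x1} (\<lambda>x. 0)"
        by (rule integral_cong) (use cut0 that x in \<open>auto simp: rect_def\<close>)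
      then show ?thesis by simp
    qed
    then show ?thesis using energy(4) x by (simp add: rint_const)
  qed
  moreover obtain \<epsilon> where "0 < \<epsilon>" and small: "\<And>H H1 H2 z0 z. (\<And>z. z \<in> ?R \<Longrightarrow> has_grad H (H1 z) (H2 z) z) \<Longrightarrow>
       continuous_on ?R H1 \<Longrightarrow> continuous_on ?R H2 \<Longrightarrow>
       (\<And>z. z \<in> ?R \<Longrightarrow> \<bar>H1 z\<bar> \<le> 2 \<and> \<bar>H2 z\<bar> \<le> 2) \<Longrightarrow>
       rint x0 x1 a b (\<lambda>z. (H1 z)\<^sup>2 + (H2 z)\<^sup>2) \<le> \<epsilon> \<Longrightarrow>
       z0 \<in> ?R \<Longrightarrow> H z0 = 0 \<Longrightarrow> z \<in> ?R \<Longrightarrow> \<bar>H z\<bar> \<le> h\<^sup>2 / (2 * (1 + h))"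
    using small_if_small_gradient[OF x, of "h\<^sup>2 / (2 * (1 + h))" 2] h by auto
  ultimately have "\<bar>cut (?v z)\<bar> \<le> h\<^sup>2 / (2 * (1 + h))"
  proof (intro small[OF energy(1,2,3), of "Complex x0 a" z])
    show "Complex x0 a \<in> ?R" "cut (?v (Complex x0 a)) = 0"
      using x by (auto simp: rect_def intro!: cut0)
    show "\<bar>cut' (?v z) * (p z - p' z)\<bar> \<le> 2 \<and> \<bar>cut' (?v z) * (q z - q' z)\<bar> \<le> 2" if "z \<in> ?R" for z
    proof -
      have "\<bar>p z - p' z\<bar> \<le> 2" "\<bar>q z - q' z\<bar> \<le> 2"
        using grad_less_1[OF D(5)[of z]] grad_less_1[OF D'(5)[of z]] that u(2) u'(2) by (auto simp: subset_iff)
      then show ?thesis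
        using abs_cut'_mult_le[of "p z - p' z" 1] abs_cut'_mult_le[of "q z - q' z" 1] by simp
    qed
  qed (use z in auto)
  then have "?v z \<le> h" by (rule le_if_cut_small[OF h])
  then show "u z - u' z \<le> M + h" by (simp)
qed

text \<open>The lower end has slope \<open>a\<close>, the upper one slope 0. The true decay is
  exponential; the power chosen here is one whose square root 1/(1+y^2) is still integrable and
  still beats linear growth, which is all that the energy estimates use.\<close>

definition cyl_graph ::
  "complex set \<Rightarrow> (complex \<Rightarrow> real) \<Rightarrow> (complex \<Rightarrow> real) \<Rightarrow> (complex \<Rightarrow> real) \<Rightarrow>
   (complex \<Rightarrow> real) \<Rightarrow> (complex \<Rightarrow> real) \<Rightarrow> (complex \<Rightarrow> real) \<Rightarrow> real \<Rightarrow> real \<Rightarrow> real \<Rightarrow> bool" where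
  "cyl_graph \<Sigma> u p q r s t a Y C \<longleftrightarrow>
     closed \<Sigma> \<and> max_graph (- \<Sigma>) u p q r s t \<and> (\<forall>z w. \<bar>u z - u w\<bar> \<le> dist z w) \<and>
     (\<forall>z. u (z + 1) = u z \<and> p (z + 1) = p z \<and> q (z + 1) = q z \<and> (z + 1 \<in> \<Sigma> \<longleftrightarrow> z \<in> \<Sigma>)) \<and>
     \<bar>a\<bar> < 1 \<and> (\<forall>z\<in>\<Sigma>. \<bar>Im z\<bar> < Y) \<and>
     (\<forall>z. Im z \<le> - Y \<longrightarrow> \<bar>p z\<bar> + \<bar>q z - a\<bar> \<le> C / (1 + (Im z)\<^sup>2)\<^sup>2) \<and>
     (\<forall>z. Y \<le> Im z \<longrightarrow> \<bar>p z\<bar> + \<bar>q z\<bar> \<le> C / (1 + (Im z)\<^sup>2)\<^sup>2)"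

lemma cyl_graphD:
  assumes "cyl_graph \<Sigma> u p q r s t a Y C"
  shows "closed \<Sigma>" "max_graph (- \<Sigma>) u p q r s t" "\<bar>u z - u w\<bar> \<le> dist z w"
    "u (z + 1) = u z" "p (z + 1) = p z" "q (z + 1) = q z" "\<bar>a\<bar> < 1"
    "z \<in> \<Sigma> \<Longrightarrow> \<bar>Im z\<bar> < Y"
    "Im z \<le> - Y \<Longrightarrow> \<bar>p z\<bar> + \<bar>q z - a\<bar> \<le> C / (1 + (Im z)\<^sup>2)\<^sup>2"
    "Y \<le> Im z \<Longrightarrow> \<bar>p z\<bar> + \<bar>q z\<bar> \<le> C / (1 + (Im z)\<^sup>2)\<^sup>2"
  using assms unfolding cyl_graph_def by blast+

lemma cyl_graph_cong_u: "cyl_graph \<Sigma> u p q r s t a Y C \<Longrightarrow> continuous_on A u"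
  unfolding continuous_on_iff using cyl_graphD(3)
  by (metis dist_commute dist_real_def order.strict_trans1)

lemma rint_subset:
  assumes "continuous_on (rect x0 x1 a b) f" "\<And>z. z \<in> rect x0 x1 a b \<Longrightarrow> 0 \<le> f z" "a \<le> a'" "b' \<le> b"
  shows "rint x0 x1 a' b' f \<le> rint x0 x1 a b f"
  unfolding rint_def
proof (rule integral_subset_le)
  show sub: "cbox (x0, a') (x1, b') \<subseteq> cbox (x0, a) (x1, b)" using assms(3,4) by (auto simp: cbox_Pair_eq)
  show "(\<lambda>(x, y). f (Complex x y)) integrable_on cbox (x0, a) (x1, b)"
    by (rule integrable_continuous[OF continuous_on_rect_pair[OF assms(1)]])
  show "(\<lambda>(x, y). f (Complex x y)) integrable_on cbox (x0, a') (x1, b')"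
    by (rule integrable_continuous[OF continuous_on_subset[OF continuous_on_rect_pair[OF assms(1)] sub]])
qed (use assms(2) in \<open>auto simp: cbox_Pair_eq rect_def\<close>)

text \<open>The flux is Lipschitz as soon as the gradient is so close to (0,a) that p^2 + q^2 <= 1 -
  \<delta>, where 2\<delta> = 1 - a^2. This holds from a certain height on.\<close>

lemma flux_decay:
  assumes "\<bar>a\<bar> < 1" "0 \<le> C"
  obtains C' S0 where "0 < C'" "0 < S0" "\<And>p q y. \<bar>p\<bar> + \<bar>q - a\<bar> \<le> C / (1 + y\<^sup>2)\<^sup>2 \<Longrightarrow> S0 \<le> \<bar>y\<bar> \<Longrightarrow>
    \<bar>q / wt p q - a / wt 0 a\<bar> \<le> C' / (1 + y\<^sup>2)\<^sup>2"
proof -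
  define \<delta> where "\<delta> = (1 - a\<^sup>2) / 2"
  have a2: "a\<^sup>2 < 1" using assms(1) by (simp add: abs_square_less_1)
  then have \<delta>: "0 < \<delta>" by (simp add: \<delta>_def)
  \<comment> \<open>Forces the deviation D of the gradient below \<delta>/3: the expansion of p^2 +
    q^2 around a^2 costs at most 3D. The summand 1 gives 1 <= \<open>S0\<close>, hence
    \<open>S0\<close> <= (1+y^2)^2 for |y| >= \<open>S0\<close>.\<close>
  define S0 where "S0 = 3 * (C + 1) / \<delta> + 1"
  have S0: "0 < S0" using \<delta> assms(2) by (simp add: S0_def add_pos_pos)
  show thesis
  proof (rule that[of "2 / (\<delta> * sqrt \<delta>) * (C + 1)" S0])
    show "0 < 2 / (\<delta> * sqrt \<delta>) * (C + 1)" using \<delta> assms(2) by simp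
    show "0 < S0" by (fact S0)
    fix p q y :: real assume d: "\<bar>p\<bar> + \<bar>q - a\<bar> \<le> C / (1 + y\<^sup>2)\<^sup>2" and y: "S0 \<le> \<bar>y\<bar>"
    have y2: "S0 \<le> (1 + y\<^sup>2)\<^sup>2"
    proof -
      have "S0 * 1 \<le> S0 * S0" using \<delta> assms(2) by (intro mult_left_mono) (auto simp: S0_def)
      also have "\<dots> \<le> \<bar>y\<bar> * \<bar>y\<bar>" using y S0 by (intro mult_mono) auto
      also have "\<dots> \<le> (1 + y\<^sup>2) * 1" by (simp add: power2_eq_square)
      also have "\<dots> \<le> (1 + y\<^sup>2) * (1 + y\<^sup>2)" by (intro mult_left_mono) auto
      finally show ?thesis by (simp add: power2_eq_square)
    qed
    define D where "D = \<bar>p\<bar> + \<bar>q - a\<bar>"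
    have "D \<le> C / S0"
      using d y2 S0 assms(2) by (simp add: D_def) (meson divide_left_mono order_trans mult_pos_pos less_le_trans)
    also have "C / S0 \<le> \<delta> / 3"
    proof -
      have "3 * (C + 1) / \<delta> \<le> S0" by (simp add: S0_def)
      then have "3 * (C + 1) \<le> S0 * \<delta>" using \<delta> by (simp add: pos_divide_le_eq)
      moreover have "3 * C \<le> 3 * (C + 1)" by simp
      ultimately have "3 * C \<le> S0 * \<delta>" by (rule order_trans[rotated])
      then show ?thesis using S0 by (simp add: field_simps)
    qed
    finally have D: "D \<le> \<delta> / 3" .
    have \<delta>1: "\<delta> \<le> 1" proof -
      have "1 - a\<^sup>2 \<le> 2" using zero_le_power2[of a] by linarith
      then show ?thesis unfolding \<delta>_def by simp
    qed
    have Db: "\<bar>p\<bar> \<le> D" "\<bar>q - a\<bar> \<le> D" "0 \<le> D" by (auto simp: D_def)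
    have pq: "p\<^sup>2 + q\<^sup>2 \<le> 1 - \<delta>"
    proof -
      have q: "\<bar>q\<bar> \<le> \<bar>a\<bar> + D" using Db by linarith
      have "p\<^sup>2 + (q - a)\<^sup>2 \<le> D\<^sup>2"
      proof -
        have "p\<^sup>2 + (q - a)\<^sup>2 \<le> (\<bar>p\<bar> + \<bar>q - a\<bar>)\<^sup>2" by (simp add: power2_sum)
        then show ?thesis by (simp add: D_def)
      qed
      moreover have "D\<^sup>2 \<le> D" using D \<delta>1 Db by (simp add: power2_eq_square mult_left_le)
      moreover have "q\<^sup>2 = a\<^sup>2 + 2 * (a * (q - a)) + (q - a)\<^sup>2" by (simp add: power2_eq_square algebra_simps)
      moreover have "a * (q - a) \<le> D"
      proof -
        have "a * (q - a) \<le> \<bar>a\<bar> * \<bar>q - a\<bar>" by (metis abs_ge_self abs_mult)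
        also have "\<dots> \<le> 1 * D" using assms(1) Db by (intro mult_mono) auto
        finally show ?thesis by simp
      qed
      moreover have "a\<^sup>2 = 1 - 2 * \<delta>" by (simp add: \<delta>_def field_simps)
      ultimately show ?thesis using D by linarith
    qed
    have a: "0\<^sup>2 + a\<^sup>2 \<le> 1 - \<delta>" using a2 by (simp add: \<delta>_def field_simps)
    have "\<bar>q / wt p q - a / wt 0 a\<bar> \<le> 2 / (\<delta> * sqrt \<delta>) * (\<bar>p - 0\<bar> + \<bar>q - a\<bar>)"
      by (rule flux_Lipschitz(2)[OF pq a \<delta>])
    also have "\<dots> \<le> 2 / (\<delta> * sqrt \<delta>) * ((C + 1) / (1 + y\<^sup>2)\<^sup>2)"
    proof (rule mult_left_mono)
      have "C / (1 + y\<^sup>2)\<^sup>2 \<le> (C + 1) / (1 + y\<^sup>2)\<^sup>2" by (rule divide_right_mono) auto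
      then show "\<bar>p - 0\<bar> + \<bar>q - a\<bar> \<le> (C + 1) / (1 + y\<^sup>2)\<^sup>2" using d by simp
    qed (use \<delta> in simp)
    finally show "\<bar>q / wt p q - a / wt 0 a\<bar> \<le> 2 / (\<delta> * sqrt \<delta>) * (C + 1) / (1 + y\<^sup>2)\<^sup>2" by simp
  qed
qed

text \<open>Integrability need not be checked: a function that is not integrable has integral 0 by
  convention.\<close>

lemma integral_bound_unit:
  fixes f :: "real \<Rightarrow> real"
  assumes "\<And>x. x \<in> {0..1} \<Longrightarrow> \<bar>f x\<bar> \<le> B"
  shows "\<bar>integral {0..1} f\<bar> \<le> B"
proof (cases "f integrable_on {0..1}")
  case True
  have "norm (integral {0..1} f) \<le> integral {0..1} (\<lambda>x::real. B)"
    by (rule integral_norm_bound_integral[OF True]) (use assms in auto)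
  then show ?thesis by simp
next
  case False
  then have "integral {0..1} f = 0" by (rule not_integrable_integral)
  moreover have "0 \<le> B" using assms[of 0] by simp
  ultimately show ?thesis by simp
qed

lemma periodic_int:
  assumes "\<And>z::complex. f (z + 1) = f z"
  shows "f (z + of_int k) = f z"
proof -
  have nat: "f (z + of_nat n) = f z" for n z
  proof (induction n)
    case (Suc n)
    then show ?case using assms[of "z + of_nat n"] by (simp add: add_ac)
  qed simp
  show ?thesis
  proof (cases "0 \<le> k")
    case True
    then show ?thesis using nat[of z "nat k"] by simp
  next
    case False
    then show ?thesis using nat[of "z + of_int k" "nat (- k)"] by simp
  qed
qed

lemma periodic_reduce:
  obtains k :: int where "0 \<le> Re (z + of_int k)" "Re (z + of_int k) \<le> 1" "Im (z + of_int k) = Im z"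
proof -
  have "0 \<le> Re z - of_int \<lfloor>Re z\<rfloor>" "Re z - of_int \<lfloor>Re z\<rfloor> \<le> 1" by linarith+
  then show thesis using that[of "- \<lfloor>Re z\<rfloor>"] by simp
qed

lemma has_grad_linear_Im: "has_grad (\<lambda>z. a * Im z) 0 a z"
  unfolding has_grad_def by (auto intro!: derivative_eq_intros)

text \<open>A maximum principle on a half cylinder without a condition at infinity. The plane of
  slope \<open>a\<close> has constant flux, the flux of the graph converges to it faster than the
  truncated difference can grow, and so the boundary term at height -S disappears as S
  grows.\<close>

lemma end_comparison:
  assumes u: "cyl_graph \<Sigma> u p q r s t a Y C" and \<sigma>: "\<sigma> = 1 \<or> \<sigma> = (-1::real)"
    and \<Sigma>: "\<And>z. z \<in> \<Sigma> \<Longrightarrow> b < Im z"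
    and bd: "\<And>z. Im z = b \<Longrightarrow> \<sigma> * (u z - a * Im z) \<le> M"
    and z: "Im z \<le> b"
  shows "\<sigma> * (u z - a * Im z) \<le> M"
proof (rule field_le_epsilon)
  fix h :: real assume h: "0 < h"
  note D = cyl_graphD[OF u] and M = max_graphD[OF cyl_graphD(2)[OF u]]
  obtain k where k: "0 \<le> Re (z + of_int k)" "Re (z + of_int k) \<le> 1" "Im (z + of_int k) = Im z"
    by (rule periodic_reduce)
  define z' where "z' = z + of_int k"
  have uz: "u z' = u z" unfolding z'_def by (rule periodic_int) (rule D(4))
  \<comment> \<open>The tolerance \<epsilon> belongs to this fixed rectangle; the energy on it is
    bounded by the energy on the growing rectangle down to -S.\<close>
  define a0 where "a0 = Im z - 1"
  have a0b: "a0 < b" using z by (simp add: a0_def)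
  let ?v = "\<lambda>z. \<sigma> * (u z - a * Im z) - M"
  have a1: "0\<^sup>2 + a\<^sup>2 < 1" using D(7) by (simp add: abs_square_less_1)
  let ?g = "\<lambda>z. (cut' (?v z) * (\<sigma> * (p z - 0)))\<^sup>2 + (cut' (?v z) * (\<sigma> * (q z - a)))\<^sup>2"
  let ?G = "\<lambda>z. \<sigma> * (q z / wt (p z) (q z) - a / wt 0 a)"
  have energy: "(\<forall>z\<in>rect 0 1 S b. has_grad (\<lambda>z. cut (?v z)) (cut' (?v z) * (\<sigma> * (p z - 0))) (cut' (?v z) * (\<sigma> * (q z - a))) z)
      \<and> continuous_on (rect 0 1 S b) (\<lambda>z. cut' (?v z) * (\<sigma> * (p z - 0)))
      \<and> continuous_on (rect 0 1 S b) (\<lambda>z. cut' (?v z) * (\<sigma> * (q z - a)))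
      \<and> rint 0 1 S b ?g \<le> - integral {0..1} (\<lambda>x. cut (?v (Complex x S)) * ?G (Complex x S))"
    if S: "S \<le> b" for S
  proof -
    have R: "rect 0 1 S b - {} \<subseteq> - \<Sigma>" using \<Sigma> by (force simp: rect_def)
    have g0: "\<forall>z\<in>rect 0 1 S b - {}. has_grad (\<lambda>z. a * Im z) 0 a z" by (simp add: has_grad_linear_Im)
    have gc: "\<forall>z\<in>rect 0 1 S b - {}. has_grad (\<lambda>z. c) 0 0 z" for c by (simp add: has_grad_const)
    have per: "f (Complex 0 y) = f (Complex 1 y)" if "\<And>z. f (z + 1) = f z" for f :: "complex \<Rightarrow> real" and y
      using that[of "Complex 0 y"] by (simp add: complex_eq_iff Complex_eq add.commute)
    have side: "\<forall>y\<in>{S..b}. cut (?v (Complex 0 y)) * (p (Complex 0 y) / wt (p (Complex 0 y)) (q (Complex 0 y)) - 0)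
       = cut (?v (Complex 1 y)) * (p (Complex 1 y) / wt (p (Complex 1 y)) (q (Complex 1 y)) - 0)"
      using per[of u] per[of p] per[of q] D(4,5,6) by simp
    have b0: "integral {0..1} (\<lambda>x. cut (?v (Complex x b)) * ?G (Complex x b)) = 0"
    proof -
      have "integral {0..1} (\<lambda>x. cut (?v (Complex x b)) * ?G (Complex x b)) = integral {0..1} (\<lambda>x::real. 0)"
        by (rule integral_cong) (use bd[of "Complex _ b"] in \<open>simp add: cut_eq_0\<close>)
      then show ?thesis by simp
    qed
    have E2: "\<forall>z\<in>rect 0 1 S b - {}. cut (?v z) * \<bar>0 + 0\<bar> + \<bar>(p z - 0) * (0 / wt 0 a - 0) + (q z - a) * (a / wt 0 a - a / wt 0 a)\<bar> \<le> 0"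
      by simp
    note e = cut_energy[where \<Sigma>="{}" and E="\<lambda>z. 0" and M=M and \<sigma>=\<sigma> and ?x0.0=0 and ?x1.0=1 and a=S and b=b, OF zero_le_one S closed_empty \<sigma> D(2) R g0 continuous_on_const
        continuous_on_const ballI[OF a1] gc[of 0] gc[of "a / wt 0 a"] continuous_on_const continuous_on_const
        continuous_on_const E2 _ _ side]
    show ?thesis using e b0 by (simp add: rint_const[OF zero_le_one S])
  qed
  have zR: "z' \<in> rect 0 1 a0 b" using k z by (simp add: rect_def z'_def a0_def)
  obtain \<epsilon> where \<epsilon>: "0 < \<epsilon>" and small: "\<And>H H1 H2 z0 z. (\<And>z. z \<in> rect 0 1 a0 b \<Longrightarrow> has_grad H (H1 z) (H2 z) z) \<Longrightarrow>
       continuous_on (rect 0 1 a0 b) H1 \<Longrightarrow> continuous_on (rect 0 1 a0 b) H2 \<Longrightarrow>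
       (\<And>z. z \<in> rect 0 1 a0 b \<Longrightarrow> \<bar>H1 z\<bar> \<le> 2 \<and> \<bar>H2 z\<bar> \<le> 2) \<Longrightarrow>
       rint 0 1 a0 b (\<lambda>z. (H1 z)\<^sup>2 + (H2 z)\<^sup>2) \<le> \<epsilon> \<Longrightarrow>
       z0 \<in> rect 0 1 a0 b \<Longrightarrow> H z0 = 0 \<Longrightarrow> z \<in> rect 0 1 a0 b \<Longrightarrow> \<bar>H z\<bar> \<le> h\<^sup>2 / (2 * (1 + h))"
    using small_if_small_gradient[of 0 1 a0 b "h\<^sup>2 / (2 * (1 + h))" 2] a0b h by auto
  have C0: "0 \<le> C"
  proof -
    have "\<bar>p (Complex 0 (- \<bar>Y\<bar>))\<bar> + \<bar>q (Complex 0 (- \<bar>Y\<bar>)) - a\<bar> \<le> C / (1 + (Im (Complex 0 (- \<bar>Y\<bar>)))\<^sup>2)\<^sup>2"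
      by (rule D(9)) simp
    then have "0 \<le> C / (1 + (- \<bar>Y\<bar>)\<^sup>2)\<^sup>2" by simp
    moreover have "0 < (1 + (- \<bar>Y\<bar>)\<^sup>2)\<^sup>2" by (intro zero_less_power add_pos_nonneg) auto
    ultimately show ?thesis using pos_le_divide_eq[of "(1 + (- \<bar>Y\<bar>)\<^sup>2)\<^sup>2" 0 C] by simp
  qed
  obtain C' S0 where C': "0 < C'" "0 < S0" "\<And>p q y. \<bar>p\<bar> + \<bar>q - a\<bar> \<le> C / (1 + y\<^sup>2)\<^sup>2 \<Longrightarrow> S0 \<le> \<bar>y\<bar> \<Longrightarrow>
    \<bar>q / wt p q - a / wt 0 a\<bar> \<le> C' / (1 + y\<^sup>2)\<^sup>2"
    using flux_decay[OF D(7) C0] by blast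
  \<comment> \<open>The truncated difference at height -S is at most the linear factor, by the
    Lipschitz bound and |a| < 1; the second factor bounds the difference of the fluxes.\<close>
  have ev1: "\<forall>\<^sub>F S in at_top. (\<bar>u 0\<bar> + \<bar>M\<bar> + 1 + 2 * S) * (C' / (1 + S\<^sup>2)\<^sup>2) < \<epsilon>"
  proof -
    have "((\<lambda>S::real. (\<bar>u 0\<bar> + \<bar>M\<bar> + 1 + 2 * S) * (C' / (1 + S\<^sup>2)\<^sup>2)) \<longlongrightarrow> 0) at_top"
      by real_asymp
    then show ?thesis using \<epsilon> by (simp add: order_tendstoD)
  qed
  have ev2: "\<forall>\<^sub>F S in at_top. S0 \<le> S \<and> \<bar>Y\<bar> \<le> S \<and> - a0 \<le> S \<and> -b \<le> S \<and> 0 \<le> S"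
    by (intro eventually_conj eventually_ge_at_top)
  have "\<exists>S. (\<bar>u 0\<bar> + \<bar>M\<bar> + 1 + 2 * S) * (C' / (1 + S\<^sup>2)\<^sup>2) < \<epsilon> \<and>
      (S0 \<le> S \<and> \<bar>Y\<bar> \<le> S \<and> - a0 \<le> S \<and> -b \<le> S \<and> 0 \<le> S)"
    using eventually_happens[OF eventually_conj[OF ev1 ev2]] by auto
  then obtain S where S: "(\<bar>u 0\<bar> + \<bar>M\<bar> + 1 + 2 * S) * (C' / (1 + S\<^sup>2)\<^sup>2) < \<epsilon>" "S0 \<le> S" "\<bar>Y\<bar> \<le> S" "- a0 \<le> S" "-b \<le> S" "0 \<le> S"
    by blast
  have "\<bar>integral {0..1} (\<lambda>x. cut (?v (Complex x (-S))) * ?G (Complex x (-S)))\<bar> \<le> (\<bar>u 0\<bar> + \<bar>M\<bar> + 1 + 2 * S) * (C' / (1 + S\<^sup>2)\<^sup>2)"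
  proof (rule integral_bound_unit)
    fix x :: real assume x: "x \<in> {0..1}"
    let ?z = "Complex x (- S)"
    have "\<bar>u ?z - u 0\<bar> \<le> 1 + S"
    proof -
      have "\<bar>u ?z - u 0\<bar> \<le> norm ?z" using D(3)[of ?z 0] by simp
      also have "\<dots> \<le> \<bar>x\<bar> + \<bar>- S\<bar>" using cmod_le[of ?z] by simp
      finally show ?thesis using x S(6) by simp
    qed
    moreover have "\<bar>a * S\<bar> \<le> S" using D(7) S(6) by (simp add: abs_mult mult_left_le_one_le)
    moreover have "\<bar>\<sigma> * y - M\<bar> \<le> \<bar>y\<bar> + \<bar>M\<bar>" for y using \<sigma> by auto
    then have "\<bar>?v ?z\<bar> \<le> \<bar>u ?z - a * Im ?z\<bar> + \<bar>M\<bar>" .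
    ultimately have v: "\<bar>?v ?z\<bar> \<le> \<bar>u 0\<bar> + \<bar>M\<bar> + 1 + 2 * S" by simp
    have "\<bar>?G ?z\<bar> \<le> C' / (1 + S\<^sup>2)\<^sup>2"
      using C'(3)[of "p ?z" "q ?z" "- S"] D(9)[of ?z] S \<sigma> by (auto simp: abs_minus_commute)
    then show "\<bar>cut (?v ?z) * ?G ?z\<bar> \<le> (\<bar>u 0\<bar> + \<bar>M\<bar> + 1 + 2 * S) * (C' / (1 + S\<^sup>2)\<^sup>2)"
      unfolding abs_mult[of "cut _"]
      using v cut_le[of "?v ?z"] cut_nonneg[of "?v ?z"] S(6) by (intro mult_mono) auto
  qed
  then have "rint 0 1 (-S) b ?g \<le> \<epsilon>"
    using energy[of "-S"] S by linarith
  moreover have "rint 0 1 a0 b ?g \<le> rint 0 1 (-S) b ?g"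
  proof (rule rint_subset)
    have "- S \<le> b" using S by simp
    note e = energy[OF this]
    show "continuous_on (rect 0 1 (-S) b) ?g"
      by (intro continuous_on_add continuous_on_power) (use e in blast)+
  qed (use S in auto)
  ultimately have "rint 0 1 a0 b ?g \<le> \<epsilon>" by linarith
  then have "\<bar>cut (?v z')\<bar> \<le> h\<^sup>2 / (2 * (1 + h))"
  proof (intro small[of "\<lambda>z. cut (?v z)" "\<lambda>z. cut' (?v z) * (\<sigma> * (p z - 0))" "\<lambda>z. cut' (?v z) * (\<sigma> * (q z - a))" "Complex 0 b"])
    show "cut (?v (Complex 0 b)) = 0" using bd[of "Complex 0 b"] by (simp add: cut_eq_0)
    fix z assume "z \<in> rect 0 1 a0 b"
    then have "z \<in> - \<Sigma>" using \<Sigma> by (force simp: rect_def)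
    then have "\<bar>p z - 0\<bar> \<le> 2" "\<bar>q z - a\<bar> \<le> 2"
      using grad_less_1[OF M(5)[of z]] D(7) by auto
    then show "\<bar>cut' (?v z) * (\<sigma> * (p z - 0))\<bar> \<le> 2 \<and> \<bar>cut' (?v z) * (\<sigma> * (q z - a))\<bar> \<le> 2"
      using abs_cut'_mult_le[OF _ \<sigma>] by blast
  qed (use energy[of a0] a0b zR in \<open>auto simp: rect_def\<close>)
  then have "?v z' \<le> h" by (rule le_if_cut_small[OF h])
  then show "\<sigma> * (u z - a * Im z) \<le> M + h" using uz k by (simp add: z'_def)
qed

section \<open>Ends with different slopes\<close>

lemma has_grad_scale: "has_grad f a b z \<Longrightarrow> has_grad (\<lambda>z. c * f z) (c * a) (c * b) z"
  using has_grad_mult[OF has_grad_const[of c]] by fastforce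

text \<open>An explicit transition from 1 at the lower end to 0 at the upper end. It approaches both
  limits at the rate 1/(1+y^2), and its derivative decays like |y|^-3, which stays integrable
  against linear growth.\<close>

definition ramp :: "real \<Rightarrow> real" where "ramp y = (1 - y / sqrt (1 + y\<^sup>2)) / 2"

definition ramp' :: "real \<Rightarrow> real" where "ramp' y = - 1 / (2 * (1 + y\<^sup>2) * sqrt (1 + y\<^sup>2))"

lemma ramp_bounds:
  "0 \<le> ramp y" "ramp y \<le> 1" "0 \<le> y \<Longrightarrow> ramp y \<le> 1 / (1 + y\<^sup>2)" "y \<le> 0 \<Longrightarrow> 1 - ramp y \<le> 1 / (1 + y\<^sup>2)"
proof -
  define w where "w = sqrt (1 + y\<^sup>2)"
  have w: "w\<^sup>2 = 1 + y\<^sup>2" "0 < w" "\<bar>y\<bar> \<le> w" "1 \<le> w"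
    by (auto simp: w_def real_le_rsqrt add_pos_nonneg)
  have r: "ramp y = (1 - y / w) / 2" by (simp add: ramp_def w_def)
  have "y / w \<le> 1" "- 1 \<le> y / w" using w by (simp_all add: pos_divide_le_eq pos_le_divide_eq)
  then show "0 \<le> ramp y" "ramp y \<le> 1" unfolding r by simp_all
  have key: "1 - \<bar>y\<bar> / w \<le> 1 / w\<^sup>2"
  proof -
    have "(1 - \<bar>y\<bar> / w) * w\<^sup>2 = w * (w - \<bar>y\<bar>)" using w(2) by (simp add: power2_eq_square field_simps)
    also have "\<dots> \<le> (w + \<bar>y\<bar>) * (w - \<bar>y\<bar>)" using w by (intro mult_right_mono) auto
    also have "\<dots> = w\<^sup>2 - y\<^sup>2" by (simp add: algebra_simps power2_eq_square)
    also have "\<dots> = 1" using w by simp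
    finally have "(1 - \<bar>y\<bar> / w) * w\<^sup>2 \<le> 1" by simp
    moreover have "0 < w\<^sup>2" using w(2) by simp
    ultimately show ?thesis by (simp only: pos_le_divide_eq)
  qed
  have pos: "0 \<le> 1 / w\<^sup>2" by simp
  have half: "(1 - X) / 2 \<le> P" if "1 - X \<le> P" "0 \<le> P" for X P :: real using that by (simp add: field_simps)
  show "ramp y \<le> 1 / (1 + y\<^sup>2)" if "0 \<le> y"
  proof -
    have "ramp y = (1 - \<bar>y\<bar> / w) / 2" using that unfolding r by simp
    then show ?thesis using half[OF key pos] unfolding w(1)[symmetric] by simp
  qed
  show "1 - ramp y \<le> 1 / (1 + y\<^sup>2)" if "y \<le> 0"
  proof -
    have "1 - ramp y = (1 - \<bar>y\<bar> / w) / 2" using that unfolding r by (simp add: field_simps)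
    then show ?thesis using half[OF key pos] unfolding w(1)[symmetric] by simp
  qed
qed

lemma DERIV_ramp: "(ramp has_real_derivative ramp' y) (at y)"
proof -
  define w where "w = sqrt (1 + y\<^sup>2)"
  have p: "0 < 1 + y\<^sup>2" by (simp add: add_pos_nonneg)
  have w: "w * w = 1 + y\<^sup>2" "0 < w" using p by (auto simp: w_def)
  have "((\<lambda>y. 1 + y\<^sup>2) has_real_derivative 2 * y) (at y)"
    by (auto intro!: derivative_eq_intros)
  from DERIV_chain2[OF DERIV_real_sqrt[OF p] this]
  have "((\<lambda>y. sqrt (1 + y\<^sup>2)) has_real_derivative y / w) (at y)"
    using w(2) by (simp add: w_def field_simps)
  from DERIV_divide[OF DERIV_ident this]
  have "((\<lambda>y. y / sqrt (1 + y\<^sup>2)) has_real_derivative (w - y * (y / w)) / (w * w)) (at y)"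
    using w(2) by (simp add: w_def)
  from DERIV_cdivide[OF DERIV_diff[OF DERIV_const[of 1] this], of 2]
  have "(ramp has_real_derivative - ((w - y * (y / w)) / (w * w)) / 2) (at y)"
    by (simp add: ramp_def[abs_def])
  moreover have "- ((w - y * (y / w)) / (w * w)) / 2 = ramp' y"
  proof -
    have "w - y * (y / w) = (w * w - y\<^sup>2) / w" using w(2) by (simp add: field_simps power2_eq_square)
    also have "\<dots> = 1 / w" unfolding w(1) by simp
    finally show ?thesis unfolding ramp'_def w_def[symmetric] w(1)[symmetric] using w(2) by (simp add: mult_ac)
  qed
  ultimately show ?thesis by simp
qed

text \<open>The factor A + 4|y| is the shape of the a priori bound for the truncated difference of
  two graphs whose slopes differ.\<close>

lemma abs_ramp'_le: "(A + 4 * \<bar>y\<bar>) * \<bar>ramp' y\<bar> \<le> (A + 4) / (1 + y\<^sup>2)" if "0 \<le> A"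
proof -
  have w: "1 \<le> sqrt (1 + y\<^sup>2)" "\<bar>y\<bar> \<le> sqrt (1 + y\<^sup>2)" by (auto intro!: real_le_rsqrt)
  have p: "0 < 1 + y\<^sup>2" by (simp add: add_pos_nonneg)
  have e: "\<bar>ramp' y\<bar> = 1 / (2 * (1 + y\<^sup>2) * sqrt (1 + y\<^sup>2))"
    using p unfolding ramp'_def by (simp add: abs_divide abs_mult)
  have "A + 4 * \<bar>y\<bar> \<le> (A + 4) * sqrt (1 + y\<^sup>2)"
    using mult_left_mono[OF w(1) that] w(2) by (simp add: algebra_simps)
  then have "(A + 4 * \<bar>y\<bar>) / (2 * (1 + y\<^sup>2) * sqrt (1 + y\<^sup>2)) \<le> (A + 4) * sqrt (1 + y\<^sup>2) / (2 * (1 + y\<^sup>2) * sqrt (1 + y\<^sup>2))"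
    using p by (intro divide_right_mono) auto
  also have "\<dots> = (A + 4) / (2 * (1 + y\<^sup>2))" using w by simp
  also have "\<dots> \<le> (A + 4) / (1 + y\<^sup>2)" using that p by (intro divide_left_mono) auto
  finally show ?thesis unfolding e by simp
qed

lemma abs_le_sqrt_abs:
  fixes x :: real
  assumes "\<bar>x\<bar> \<le> 1" shows "\<bar>x\<bar> \<le> sqrt \<bar>x\<bar>"
proof (rule real_le_rsqrt)
  have "\<bar>x\<bar> * \<bar>x\<bar> \<le> \<bar>x\<bar> * 1" using assms by (intro mult_left_mono) auto
  then show "\<bar>x\<bar>\<^sup>2 \<le> \<bar>x\<bar>" by (simp only: power2_eq_square mult_1_right)
qed

lemma le_sqrt_if_le_both:
  fixes T A B :: real
  assumes "0 \<le> T" "T \<le> A" "T \<le> B" shows "T \<le> sqrt (A * B)"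
proof -
  have "T * T \<le> A * B" using assms by (intro mult_mono) auto
  then show ?thesis by (intro real_le_rsqrt) (simp add: power2_eq_square)
qed

text \<open>An arctangent primitive; what counts is that the bound does not depend on
  \<open>S\<close>.\<close>

lemma rint_inverse_square_le:
  assumes "0 \<le> S" shows "rint 0 1 (-S) S (\<lambda>z. 1 / (1 + (Im z)\<^sup>2)) \<le> pi"
proof -
  have p: "1 + y\<^sup>2 \<noteq> 0" for y :: real by (metis add_pos_nonneg less_irrefl zero_le_power2 zero_less_one)
  have c: "continuous_on (rect 0 1 (-S) S) (\<lambda>z. 1 / (1 + (Im z)\<^sup>2))"
    by (intro continuous_intros ballI) (use p in auto)
  have "((\<lambda>y. 1 / (1 + y\<^sup>2)) has_integral arctan S - arctan (-S)) {-S..S}"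
    by (rule fundamental_theorem_of_calculus)
       (use assms in \<open>auto simp: inverse_eq_divide simp flip: has_real_derivative_iff_has_vector_derivative
         intro!: derivative_eq_intros\<close>)
  then have "rint 0 1 (-S) S (\<lambda>z. 1 / (1 + (Im z)\<^sup>2)) = arctan S - arctan (-S)"
    unfolding rint_iterated(1)[OF c] by (simp add: integral_unique)
  also have "\<dots> \<le> pi" using arctan_ubound[of S] arctan_lbound[of "-S"] by linarith
  finally show ?thesis .
qed

lemma one_minus_cut': "0 \<le> t \<Longrightarrow> 1 - cut' t = 1 / (1 + t)\<^sup>2"
proof -
  assume t: "0 \<le> t"
  have "(1 + t)\<^sup>2 \<noteq> 0" using t by simp
  moreover have "cut' t = ((1 + t)\<^sup>2 - 1) / (1 + t)\<^sup>2"
    using t by (simp add: cut'_def power2_eq_square algebra_simps)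
  ultimately show ?thesis by (simp add: diff_divide_distrib)
qed

lemma grad_room:
  fixes \<epsilon> D q a p x :: real
  assumes "a\<^sup>2 \<le> 1 - 4 * \<epsilon>" "\<bar>p\<bar> + \<bar>q - a\<bar> \<le> D" "D + \<bar>x\<bar> \<le> \<epsilon> / 2" "0 < \<epsilon>"
  shows "p\<^sup>2 + (q + x)\<^sup>2 \<le> 1 - \<epsilon>"
proof -
  have e1: "\<epsilon> \<le> 1" using assms(1,4) zero_le_power2[of a] by linarith
  have "a\<^sup>2 \<le> 1" using assms(1,4) by linarith
  then have a1: "\<bar>a\<bar> \<le> 1" by (simp add: abs_square_le_1)
  define b where "b = q + x - a"
  have pb: "\<bar>p\<bar> + \<bar>b\<bar> \<le> \<epsilon> / 2" using assms(2,3) unfolding b_def by linarith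
  have "p\<^sup>2 + b\<^sup>2 \<le> (\<bar>p\<bar> + \<bar>b\<bar>)\<^sup>2" by (simp add: power2_sum)
  also have "\<dots> \<le> (\<epsilon> / 2)\<^sup>2" by (rule power_mono[OF pb]) simp
  also have "\<dots> \<le> \<epsilon>"
  proof -
    have "\<epsilon> * \<epsilon> \<le> \<epsilon> * 1" using e1 assms(4) by (intro mult_left_mono) auto
    then show ?thesis using assms(4) by (simp add: power2_eq_square)
  qed
  finally have 1: "p\<^sup>2 + b\<^sup>2 \<le> \<epsilon>" .
  have "a * b \<le> \<bar>a\<bar> * \<bar>b\<bar>" by (metis abs_ge_self abs_mult)
  also have "\<dots> \<le> 1 * (\<epsilon> / 2)" using a1 pb by (intro mult_mono) auto
  finally have 2: "a * b \<le> \<epsilon> / 2" by simp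
  have "(q + x)\<^sup>2 = a\<^sup>2 + 2 * (a * b) + b\<^sup>2" by (simp add: b_def power2_eq_square algebra_simps)
  moreover have "2 * (a * b) \<le> \<epsilon>" using 2 by simp
  ultimately show ?thesis using 1 assms(1,4) by linarith
qed

text \<open>Changing the slope of the end by \<open>x\<close> changes the flux field by a constant up to an error that
  is integrable along the end and small with \<open>x\<close>: it is both \<open>O(x)\<close> and rapidly decaying, and we
  take the geometric mean of both bounds.\<close>

lemma end_flux_error:
  assumes a0: "\<bar>a0\<bar> < 1" and C0: "0 \<le> C0"
  obtains Y A d \<Lambda> where "Y0 \<le> Y" "0 \<le> Y" "0 < A" "0 < d" "d \<le> 1" "0 < \<Lambda>"
    "\<And>x. \<bar>x\<bar> \<le> d \<Longrightarrow> \<bar>(a0 + x) / wt 0 (a0 + x) - a0 / wt 0 a0\<bar> \<le> \<Lambda> * \<bar>x\<bar>"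
    "\<And>x y p q. \<bar>x\<bar> \<le> d \<Longrightarrow> y \<le> - Y \<Longrightarrow> \<bar>p\<bar> + \<bar>q - a0\<bar> \<le> C0 / (1 + y\<^sup>2)\<^sup>2 \<Longrightarrow>
      p\<^sup>2 + (q + x * cut' (- Y - y))\<^sup>2 < 1 \<and>
      \<bar>p / wt p (q + x * cut' (- Y - y)) - p / wt p q\<bar> +
      \<bar>(q + x * cut' (- Y - y)) / wt p (q + x * cut' (- Y - y)) - q / wt p q -
        ((a0 + x) / wt 0 (a0 + x) - a0 / wt 0 a0) * ramp y\<bar> \<le> A * sqrt \<bar>x\<bar> / (1 + y\<^sup>2)"
proof -
  define \<epsilon> where "\<epsilon> = (1 - a0\<^sup>2) / 4"
  have a2: "a0\<^sup>2 < 1" using a0 by (simp add: abs_square_less_1)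
  then have \<epsilon>: "0 < \<epsilon>" "a0\<^sup>2 \<le> 1 - 4 * \<epsilon>" by (simp_all add: \<epsilon>_def field_simps)
  have \<epsilon>1: "\<epsilon> \<le> 1" using \<epsilon> zero_le_power2[of a0] by linarith
  \<comment> \<open>One half of the budget \<epsilon>/2 in \<open>grad_room\<close> is for the
    change of slope, the other half for the decaying part of the gradient.\<close>
  define d where "d = \<epsilon> / 4"
  have d: "0 < d" "d \<le> 1" using \<epsilon> \<epsilon>1 by (simp_all add: d_def)
  have "((\<lambda>y::real. C0 / (1 + y\<^sup>2)\<^sup>2) \<longlongrightarrow> 0) at_top" by real_asymp
  then have "\<forall>\<^sub>F y::real in at_top. C0 / (1 + y\<^sup>2)\<^sup>2 < d" using d by (simp add: order_tendstoD)
  then obtain Y1 where Y1: "\<And>y. Y1 \<le> y \<Longrightarrow> C0 / (1 + y\<^sup>2)\<^sup>2 < d"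
    by (auto simp: eventually_at_top_linorder)
  define Y where "Y = max Y0 (max Y1 0)"
  define \<Lambda> where "\<Lambda> = 2 / (\<epsilon> * sqrt \<epsilon>)"
  have L: "0 < \<Lambda>" using \<epsilon> by (simp add: \<Lambda>_def)
  define \<Phi> where "\<Phi> = (\<lambda>a. a / wt 0 a)"
  define A where "A = \<Lambda> * sqrt (2 * C0) + 2 * \<Lambda> * sqrt C0 + \<Lambda> * (1 + (Y + 1)\<^sup>2) + \<Lambda>"
  have A: "0 < A" using L C0 unfolding A_def by (intro add_nonneg_pos add_nonneg_nonneg) auto
  have room0: "0\<^sup>2 + (a0 + x)\<^sup>2 \<le> 1 - \<epsilon>" if "\<bar>x\<bar> \<le> d" for x
    using grad_room[of a0 \<epsilon> 0 a0 0 x] \<epsilon> that by (simp add: d_def)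
  have Phi: "\<bar>\<Phi> (a0 + x) - \<Phi> (a0 + y)\<bar> \<le> \<Lambda> * \<bar>x - y\<bar>" if "\<bar>x\<bar> \<le> d" "\<bar>y\<bar> \<le> d" for x y
    using flux_Lipschitz(2)[OF room0[OF that(1)] room0[OF that(2)] \<epsilon>(1)] by (simp add: \<Phi>_def \<Lambda>_def)
  show thesis
  proof (rule that[of Y A d \<Lambda>])
    show "Y0 \<le> Y" "0 \<le> Y" by (auto simp: Y_def)
    show "0 < A" "0 < d" "d \<le> 1" "0 < \<Lambda>" by fact+
    show "\<bar>(a0 + x) / wt 0 (a0 + x) - a0 / wt 0 a0\<bar> \<le> \<Lambda> * \<bar>x\<bar>" if "\<bar>x\<bar> \<le> d" for x
      using Phi[OF that, of 0] d by (simp add: \<Phi>_def)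
    fix x y p q :: real
    assume x: "\<bar>x\<bar> \<le> d" and y: "y \<le> - Y" and D: "\<bar>p\<bar> + \<bar>q - a0\<bar> \<le> C0 / (1 + y\<^sup>2)\<^sup>2"
    \<comment> \<open>The fraction of the slope change already switched on at height y: 0 at -Y and
      tending to 1 further down.\<close>
    define k where "k = cut' (- Y - y)"
    define Q where "Q = q + x * k"
    have k: "0 \<le> k" "k \<le> 1" by (simp_all add: k_def cut'_nonneg cut'_le_1)
    have xk: "\<bar>x * k\<bar> \<le> \<bar>x\<bar>" using k by (simp add: abs_mult mult_left_le)
    have Dd: "C0 / (1 + y\<^sup>2)\<^sup>2 < d" using Y1[of "- y"] y by (simp add: Y_def)
    have y1: "0 < 1 + y\<^sup>2" by (simp add: add_pos_nonneg)
    have room: "p\<^sup>2 + (q + z)\<^sup>2 \<le> 1 - \<epsilon>" if "\<bar>z\<bar> \<le> d" for z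
    proof (rule grad_room[OF \<epsilon>(2) D _ \<epsilon>(1)])
      have "C0 / (1 + y\<^sup>2)\<^sup>2 + \<bar>z\<bar> \<le> d + d" using Dd that by linarith
      then show "C0 / (1 + y\<^sup>2)\<^sup>2 + \<bar>z\<bar> \<le> \<epsilon> / 2" by (simp add: d_def)
    qed
    have rQ: "p\<^sup>2 + Q\<^sup>2 \<le> 1 - \<epsilon>" using room[of "x * k"] xk x by (simp add: Q_def)
    have rq: "p\<^sup>2 + q\<^sup>2 \<le> 1 - \<epsilon>" using room[of 0] d by simp
    have xkd: "\<bar>x * k\<bar> \<le> d" using xk x by linarith
    have dd: "\<bar>0\<bar> \<le> d" using d by simp
    have ra: "0\<^sup>2 + (a0 + x * k)\<^sup>2 \<le> 1 - \<epsilon>" "0\<^sup>2 + a0\<^sup>2 \<le> 1 - \<epsilon>"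
      using room0[OF xkd] room0[OF dd] by auto
    define D' where "D' = \<bar>p\<bar> + \<bar>q - a0\<bar>"
    have lipx: "\<Lambda> * (\<bar>p - p\<bar> + \<bar>Q - q\<bar>) \<le> \<Lambda> * \<bar>x\<bar>"
      using xk L by (simp add: Q_def)
    have X1a: "\<bar>p / wt p Q - p / wt p q\<bar> \<le> \<Lambda> * \<bar>x\<bar>" "\<bar>Q / wt p Q - q / wt p q\<bar> \<le> \<Lambda> * \<bar>x\<bar>"
      using flux_Lipschitz[OF rQ rq \<epsilon>(1)] lipx unfolding \<Lambda>_def[symmetric] by linarith+
    have far1: "\<bar>p / wt p Q - 0 / wt 0 (a0 + x * k)\<bar> \<le> \<Lambda> * D'" "\<bar>Q / wt p Q - \<Phi> (a0 + x * k)\<bar> \<le> \<Lambda> * D'"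
      using flux_Lipschitz[OF rQ ra(1) \<epsilon>(1)] unfolding \<Lambda>_def[symmetric] D'_def \<Phi>_def by (simp_all add: Q_def)
    have far2: "\<bar>p / wt p q - 0 / wt 0 a0\<bar> \<le> \<Lambda> * D'" "\<bar>q / wt p q - \<Phi> a0\<bar> \<le> \<Lambda> * D'"
      using flux_Lipschitz[OF rq ra(2) \<epsilon>(1)] unfolding \<Lambda>_def[symmetric] D'_def \<Phi>_def by simp_all
    have LD: "\<Lambda> * D' \<le> \<Lambda> * (C0 / (1 + y\<^sup>2)\<^sup>2)" unfolding D'_def by (rule mult_left_mono[OF D]) (use L in simp)
    \<comment> \<open>The geometric mean of a bound proportional to |x| and one proportional to
      (1+y^2)^-2. It is used for the horizontal flux and for \<open>T\<close>; the remaining two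
      errors \<open>U\<close> and \<open>V\<close> decay at the rate 1/(1+y^2) by
      themselves.\<close>
    have sq: "sqrt (P * \<bar>x\<bar> * (R * (C0 / (1 + y\<^sup>2)\<^sup>2))) = sqrt (P * R * C0) * sqrt \<bar>x\<bar> / (1 + y\<^sup>2)" for P R
      using y1 by (simp add: real_sqrt_mult real_sqrt_divide mult_ac)
    have X1: "\<bar>p / wt p Q - p / wt p q\<bar> \<le> \<Lambda> * sqrt (2 * C0) * sqrt \<bar>x\<bar> / (1 + y\<^sup>2)"
    proof -
      have "\<bar>p / wt p Q - p / wt p q\<bar> \<le> 2 * \<Lambda> * (C0 / (1 + y\<^sup>2)\<^sup>2)"
      proof -
        have "\<bar>X - Z\<bar> \<le> 2 * \<Lambda> * V" if "\<bar>X - 0\<bar> \<le> \<Lambda> * D'" "\<bar>Z - 0\<bar> \<le> \<Lambda> * D'" "\<Lambda> * D' \<le> \<Lambda> * V" for X Z V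
          using that by linarith
        from this[OF far1(1)[unfolded div_0] far2(1)[unfolded div_0] LD] show ?thesis .
      qed
      then have "\<bar>p / wt p Q - p / wt p q\<bar> \<le> sqrt (\<Lambda> * \<bar>x\<bar> * (2 * \<Lambda> * (C0 / (1 + y\<^sup>2)\<^sup>2)))"
        by (intro le_sqrt_if_le_both X1a) auto
      also have "sqrt (\<Lambda> * (2 * \<Lambda>) * C0) = \<Lambda> * sqrt (2 * C0)"
        using L by (simp add: real_sqrt_mult mult_ac)
      then have "sqrt (\<Lambda> * \<bar>x\<bar> * (2 * \<Lambda> * (C0 / (1 + y\<^sup>2)\<^sup>2))) = \<Lambda> * sqrt (2 * C0) * sqrt \<bar>x\<bar> / (1 + y\<^sup>2)"
        unfolding sq by simp
      finally show ?thesis .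
    qed
    define T where "T = \<bar>(Q / wt p Q - \<Phi> (a0 + x * k)) - (q / wt p q - \<Phi> a0)\<bar>"
    have T: "T \<le> 2 * \<Lambda> * sqrt C0 * sqrt \<bar>x\<bar> / (1 + y\<^sup>2)"
    proof -
      have "\<bar>\<Phi> (a0 + x * k) - \<Phi> (a0 + 0)\<bar> \<le> \<Lambda> * \<bar>x * k - 0\<bar>" by (rule Phi[OF xkd dd])
      also have "\<dots> \<le> \<Lambda> * \<bar>x\<bar>" using xk L by simp
      finally have "T \<le> 2 * \<Lambda> * \<bar>x\<bar>" using X1a(2) by (simp add: T_def)
      moreover have "T \<le> 2 * \<Lambda> * (C0 / (1 + y\<^sup>2)\<^sup>2)"
        using far1(2) far2(2) LD unfolding T_def by linarith
      ultimately have "T \<le> sqrt (2 * \<Lambda> * \<bar>x\<bar> * (2 * \<Lambda> * (C0 / (1 + y\<^sup>2)\<^sup>2)))"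
        by (intro le_sqrt_if_le_both) (auto simp: T_def)
      moreover have "sqrt (2 * \<Lambda> * (2 * \<Lambda>) * C0) = 2 * \<Lambda> * sqrt C0"
      proof -
        have "2 * \<Lambda> * (2 * \<Lambda>) * C0 = (2 * \<Lambda>)\<^sup>2 * C0" by (simp add: power2_eq_square)
        then show ?thesis using L by (simp only: real_sqrt_mult real_sqrt_abs)
      qed
      ultimately show ?thesis unfolding sq by simp
    qed
    have xs: "\<bar>x\<bar> \<le> sqrt \<bar>x\<bar>" using x d by (intro abs_le_sqrt_abs) simp
    \<comment> \<open>The error made because at height y the slope is a0 + x k instead of a0 + x;
      the deficit 1 - k is 1/(1+t)^2 at depth t below -Y.\<close>
    have U: "\<bar>\<Phi> (a0 + x * k) - \<Phi> (a0 + x)\<bar> \<le> \<Lambda> * (1 + (Y + 1)\<^sup>2) * sqrt \<bar>x\<bar> / (1 + y\<^sup>2)"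
    proof -
      define t where "t = - Y - y"
      have t: "0 \<le> t" "y = - Y - t" using y by (auto simp: t_def)
      have Y0: "0 \<le> Y" by (simp add: Y_def)
      have "y\<^sup>2 \<le> ((Y + 1) * (1 + t))\<^sup>2"
      proof -
        have "\<bar>y\<bar> = Y + t" using t Y0 by linarith
        moreover have "(Y + 1) * (1 + t) = (Y + t) + (1 + Y * t)" by (simp add: algebra_simps)
        ultimately have "\<bar>y\<bar> \<le> (Y + 1) * (1 + t)" using mult_nonneg_nonneg[OF Y0 t(1)] by linarith
        then show ?thesis by (metis abs_ge_zero power2_abs power_mono)
      qed
      moreover have "1 \<le> (1 + t)\<^sup>2" using t by (simp add: power2_eq_square algebra_simps)
      ultimately have "1 + y\<^sup>2 \<le> (1 + (Y + 1)\<^sup>2) * (1 + t)\<^sup>2"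
        by (simp only: distrib_right[of 1] power_mult_distrib mult_1 add_mono)
      then have "1 / (1 + t)\<^sup>2 \<le> (1 + (Y + 1)\<^sup>2) / (1 + y\<^sup>2)"
        using t y1 by (simp add: divide_le_eq le_divide_eq mult.commute)
      then have k': "1 - k \<le> (1 + (Y + 1)\<^sup>2) / (1 + y\<^sup>2)"
        using one_minus_cut'[OF t(1)] by (simp add: k_def t_def)
      have "\<bar>\<Phi> (a0 + x * k) - \<Phi> (a0 + x)\<bar> \<le> \<Lambda> * \<bar>x * k - x\<bar>" by (rule Phi[OF xkd x])
      also have "\<bar>x * k - x\<bar> = \<bar>x\<bar> * (1 - k)" using k by (simp add: abs_mult flip: right_diff_distrib[of x k 1, simplified] abs_minus_commute)
      also have "\<Lambda> * (\<bar>x\<bar> * (1 - k)) \<le> \<Lambda> * (sqrt \<bar>x\<bar> * ((1 + (Y + 1)\<^sup>2) / (1 + y\<^sup>2)))"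
        using L xs k k' by (intro mult_left_mono mult_mono) auto
      finally show ?thesis by (simp add: mult_ac)
    qed
    \<comment> \<open>The error made because \<open>ramp\<close> has not yet reached 1.\<close>
    have V: "\<bar>(\<Phi> (a0 + x) - \<Phi> a0) * (1 - ramp y)\<bar> \<le> \<Lambda> * sqrt \<bar>x\<bar> / (1 + y\<^sup>2)"
    proof -
      have "\<bar>\<Phi> (a0 + x) - \<Phi> (a0 + 0)\<bar> \<le> \<Lambda> * \<bar>x - 0\<bar>" by (rule Phi[OF x dd])
      also have "\<dots> \<le> \<Lambda> * sqrt \<bar>x\<bar>" using xs L by simp
      finally have "\<bar>\<Phi> (a0 + x) - \<Phi> a0\<bar> \<le> \<Lambda> * sqrt \<bar>x\<bar>" by simp
      moreover have "\<bar>1 - ramp y\<bar> \<le> 1 / (1 + y\<^sup>2)"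
        using ramp_bounds(4)[of y] ramp_bounds(2)[of y] y by (simp add: Y_def)
      ultimately have "\<bar>\<Phi> (a0 + x) - \<Phi> a0\<bar> * \<bar>1 - ramp y\<bar> \<le> \<Lambda> * sqrt \<bar>x\<bar> * (1 / (1 + y\<^sup>2))"
        using L by (intro mult_mono) auto
      then show ?thesis by (simp add: abs_mult)
    qed
    have "\<bar>Q / wt p Q - q / wt p q - (\<Phi> (a0 + x) - \<Phi> a0) * ramp y\<bar> \<le> T + \<bar>\<Phi> (a0 + x * k) - \<Phi> (a0 + x)\<bar> + \<bar>(\<Phi> (a0 + x) - \<Phi> a0) * (1 - ramp y)\<bar>"
    proof -
      have "Q / wt p Q - q / wt p q - (\<Phi> (a0 + x) - \<Phi> a0) * ramp y =
        ((Q / wt p Q - \<Phi> (a0 + x * k)) - (q / wt p q - \<Phi> a0)) + (\<Phi> (a0 + x * k) - \<Phi> (a0 + x)) + (\<Phi> (a0 + x) - \<Phi> a0) * (1 - ramp y)"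
        by (simp only: right_diff_distrib mult_1_right)
      then show ?thesis unfolding T_def by linarith
    qed
    then have "\<bar>p / wt p Q - p / wt p q\<bar> + \<bar>Q / wt p Q - q / wt p q - (\<Phi> (a0 + x) - \<Phi> a0) * ramp y\<bar> \<le>
      \<Lambda> * sqrt (2 * C0) * sqrt \<bar>x\<bar> / (1 + y\<^sup>2) + 2 * \<Lambda> * sqrt C0 * sqrt \<bar>x\<bar> / (1 + y\<^sup>2)
       + \<Lambda> * (1 + (Y + 1)\<^sup>2) * sqrt \<bar>x\<bar> / (1 + y\<^sup>2) + \<Lambda> * sqrt \<bar>x\<bar> / (1 + y\<^sup>2)"
      using X1 T U V by linarith
    also have "\<dots> = A * sqrt \<bar>x\<bar> / (1 + y\<^sup>2)"
      unfolding A_def by (simp only: distrib_right add_divide_distrib)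
    finally show "p\<^sup>2 + (q + x * cut' (- Y - y))\<^sup>2 < 1 \<and>
      \<bar>p / wt p (q + x * cut' (- Y - y)) - p / wt p q\<bar> +
      \<bar>(q + x * cut' (- Y - y)) / wt p (q + x * cut' (- Y - y)) - q / wt p q -
        ((a0 + x) / wt 0 (a0 + x) - a0 / wt 0 a0) * ramp y\<bar> \<le> A * sqrt \<bar>x\<bar> / (1 + y\<^sup>2)"
      using rQ \<epsilon>(1) unfolding \<Phi>_def Q_def k_def by linarith
  qed
qed

lemma cyl_graph_C_nonneg:
  assumes "cyl_graph \<Sigma> u p q r s t a Y C" shows "0 \<le> C"
proof -
  have "\<bar>p (Complex 0 (- \<bar>Y\<bar>))\<bar> + \<bar>q (Complex 0 (- \<bar>Y\<bar>)) - a\<bar> \<le> C / (1 + (Im (Complex 0 (- \<bar>Y\<bar>)))\<^sup>2)\<^sup>2"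
    by (rule cyl_graphD(9)[OF assms]) simp
  then have "0 \<le> C / (1 + (- \<bar>Y\<bar>)\<^sup>2)\<^sup>2" by simp
  moreover have "0 < (1 + (- \<bar>Y\<bar>)\<^sup>2)\<^sup>2" by (intro zero_less_power add_pos_nonneg) auto
  ultimately show ?thesis using pos_le_divide_eq[of "(1 + (- \<bar>Y\<bar>)\<^sup>2)\<^sup>2" 0 C] by simp
qed

lemma inverse_square_le: "C / (1 + y\<^sup>2)\<^sup>2 \<le> C / (1 + y\<^sup>2)" if "0 \<le> C" for C y :: real
proof (rule divide_left_mono[OF _ that])
  have "(1 + y\<^sup>2) * 1 \<le> (1 + y\<^sup>2) * (1 + y\<^sup>2)" by (intro mult_left_mono) auto
  then show "1 + y\<^sup>2 \<le> (1 + y\<^sup>2)\<^sup>2" by (simp add: power2_eq_square)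
  show "0 < (1 + y\<^sup>2)\<^sup>2 * (1 + y\<^sup>2)" by (intro mult_pos_pos zero_less_power add_pos_nonneg) auto
qed

text \<open>This rate suffices for the boundary terms. The height \<open>S0\<close> depends on the
  graph, which is harmless because the rectangle may be chosen after the graph.\<close>

lemma cyl_graph_end_flux:
  assumes u: "cyl_graph \<Sigma> u p q r s t a Y C"
  obtains C' S0 where "0 < C'"
    "\<And>z. Im z \<le> - S0 \<Longrightarrow> \<bar>q z / wt (p z) (q z) - a / wt 0 a\<bar> \<le> C' / (1 + (Im z)\<^sup>2)"
    "\<And>z. S0 \<le> Im z \<Longrightarrow> \<bar>q z / wt (p z) (q z)\<bar> \<le> C' / (1 + (Im z)\<^sup>2)"
proof -
  note D = cyl_graphD[OF u]
  have C0: "0 \<le> C" by (rule cyl_graph_C_nonneg[OF u])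
  obtain C1 S1 where 1: "0 < C1" "0 < S1" "\<And>p q y. \<bar>p\<bar> + \<bar>q - a\<bar> \<le> C / (1 + y\<^sup>2)\<^sup>2 \<Longrightarrow> S1 \<le> \<bar>y\<bar> \<Longrightarrow>
    \<bar>q / wt p q - a / wt 0 a\<bar> \<le> C1 / (1 + y\<^sup>2)\<^sup>2"
    using flux_decay[OF D(7) C0] by blast
  obtain C2 S2 where 2: "0 < C2" "0 < S2" "\<And>p q y. \<bar>p\<bar> + \<bar>q - 0\<bar> \<le> C / (1 + y\<^sup>2)\<^sup>2 \<Longrightarrow> S2 \<le> \<bar>y\<bar> \<Longrightarrow>
    \<bar>q / wt p q - 0 / wt 0 0\<bar> \<le> C2 / (1 + y\<^sup>2)\<^sup>2"
    using flux_decay[of 0 C] C0 by auto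
  show thesis
  proof (rule that[of "C1 + C2" "max \<bar>Y\<bar> (max S1 S2)"])
    show "0 < C1 + C2" using 1 2 by simp
    have y1: "0 < 1 + y\<^sup>2" for y :: real by (simp add: add_pos_nonneg)
    show "\<bar>q z / wt (p z) (q z) - a / wt 0 a\<bar> \<le> (C1 + C2) / (1 + (Im z)\<^sup>2)" if "Im z \<le> - max \<bar>Y\<bar> (max S1 S2)" for z
    proof -
      have "\<bar>q z / wt (p z) (q z) - a / wt 0 a\<bar> \<le> C1 / (1 + (Im z)\<^sup>2)\<^sup>2"
        using that by (intro 1(3) D(9)) auto
      also have "\<dots> \<le> C1 / (1 + (Im z)\<^sup>2)" using 1 by (intro inverse_square_le) simp
      also have "\<dots> \<le> (C1 + C2) / (1 + (Im z)\<^sup>2)" using 2 y1[of "Im z"] by (intro divide_right_mono) auto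
      finally show ?thesis .
    qed
    show "\<bar>q z / wt (p z) (q z)\<bar> \<le> (C1 + C2) / (1 + (Im z)\<^sup>2)" if "max \<bar>Y\<bar> (max S1 S2) \<le> Im z" for z
    proof -
      have "\<bar>q z / wt (p z) (q z)\<bar> \<le> C2 / (1 + (Im z)\<^sup>2)\<^sup>2"
        using 2(3)[of "p z" "q z" "Im z"] D(10)[of z] that by simp
      also have "\<dots> \<le> C2 / (1 + (Im z)\<^sup>2)" using 2 by (intro inverse_square_le) simp
      also have "\<dots> \<le> (C1 + C2) / (1 + (Im z)\<^sup>2)" using 1 y1[of "Im z"] by (intro divide_right_mono) auto
      finally show ?thesis .
    qed
  qed
qed

text \<open>The constant \<delta> must serve all graphs, whatever their decay constants. These enter
  only through the boundary terms, which vanish for each fixed graph when the rectangle grows; the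
  remaining error is controlled by the decay of the reference graph u0 and by the difference of the
  slopes alone.\<close>

lemma stability:
  assumes u0: "cyl_graph \<Sigma>0 u0 p0 q0 r0 s0 t0 a0 Y0 C0" and ne: "\<Sigma>0 \<noteq> {}" and \<eta>: "0 < \<eta>" and L: "0 \<le> L"
  obtains \<delta> where "0 < \<delta>"
    "\<And>\<Sigma> u p q r s t a Y C z. cyl_graph \<Sigma> u p q r s t a Y C \<Longrightarrow> \<bar>a - a0\<bar> \<le> \<delta> \<Longrightarrow>
      (\<And>z. z \<in> \<Sigma> \<Longrightarrow> \<exists>z'\<in>\<Sigma>0. dist z z' \<le> \<delta> \<and> \<bar>u z - u0 z'\<bar> \<le> \<delta>) \<Longrightarrow>
      (\<And>z'. z' \<in> \<Sigma>0 \<Longrightarrow> \<exists>z\<in>\<Sigma>. dist z z' \<le> \<delta> \<and> \<bar>u z - u0 z'\<bar> \<le> \<delta>) \<Longrightarrow>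
      \<bar>Im z\<bar> \<le> L \<Longrightarrow> \<bar>u z - u0 z\<bar> \<le> \<eta>"
proof -
  note D0 = cyl_graphD[OF u0] and M0 = max_graphD[OF cyl_graphD(2)[OF u0]]
  obtain Y A d \<Lambda> where Y: "\<bar>Y0\<bar> + 1 \<le> Y" "0 \<le> Y" and A: "0 < A" and d: "0 < d" "d \<le> 1" and \<Lambda>: "0 < \<Lambda>"
    and Phi: "\<And>x. \<bar>x\<bar> \<le> d \<Longrightarrow> \<bar>(a0 + x) / wt 0 (a0 + x) - a0 / wt 0 a0\<bar> \<le> \<Lambda> * \<bar>x\<bar>"
    and err: "\<And>x y p q. \<bar>x\<bar> \<le> d \<Longrightarrow> y \<le> - Y \<Longrightarrow> \<bar>p\<bar> + \<bar>q - a0\<bar> \<le> C0 / (1 + y\<^sup>2)\<^sup>2 \<Longrightarrow>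
      p\<^sup>2 + (q + x * cut' (- Y - y))\<^sup>2 < 1 \<and>
      \<bar>p / wt p (q + x * cut' (- Y - y)) - p / wt p q\<bar> +
      \<bar>(q + x * cut' (- Y - y)) / wt p (q + x * cut' (- Y - y)) - q / wt p q -
        ((a0 + x) / wt 0 (a0 + x) - a0 / wt 0 a0) * ramp y\<bar> \<le> A * sqrt \<bar>x\<bar> / (1 + y\<^sup>2)"
    by (rule end_flux_error[OF D0(7) cyl_graph_C_nonneg[OF u0], of "\<bar>Y0\<bar> + 1"]) (rule that)
  obtain zs0 where zs0: "zs0 \<in> \<Sigma>0" using ne by blast
  obtain k0 where k0: "0 \<le> Re (zs0 + of_int k0)" "Re (zs0 + of_int k0) \<le> 1"
    by (rule periodic_reduce)
  \<comment> \<open>A singularity in the period strip is the anchor: the truncated difference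
    vanishes there, as \<open>small_if_small_gradient\<close> requires of one point.\<close>
  define zs where "zs = zs0 + of_int k0"
  have "(\<lambda>z. z \<in> \<Sigma>0) (zs0 + of_int k0) = (zs0 \<in> \<Sigma>0)"
    by (rule periodic_int) (use u0 in \<open>auto simp: cyl_graph_def\<close>)
  then have zs: "zs \<in> \<Sigma>0" "0 \<le> Re zs" "Re zs \<le> 1" using zs0 k0 by (simp_all add: zs_def)
  have zsY: "\<bar>Im zs\<bar> \<le> Y" using D0(8)[OF zs(1)] Y by linarith
  define L' where "L' = max L Y + 1"
  have L': "L \<le> L'" "Y \<le> L'" "0 < L'" using Y L by (auto simp: L'_def)
  define h where "h = \<eta> / 4"
  have h: "0 < h" using \<eta> by (simp add: h_def)
  let ?R = "rect 0 1 (- L') L'"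
  obtain \<epsilon> where \<epsilon>: "0 < \<epsilon>" and small: "\<And>H H1 H2 z0 z. (\<And>z. z \<in> ?R \<Longrightarrow> has_grad H (H1 z) (H2 z) z) \<Longrightarrow>
       continuous_on ?R H1 \<Longrightarrow> continuous_on ?R H2 \<Longrightarrow>
       (\<And>z. z \<in> ?R \<Longrightarrow> \<bar>H1 z\<bar> \<le> 2 \<and> \<bar>H2 z\<bar> \<le> 2) \<Longrightarrow>
       rint 0 1 (- L') L' (\<lambda>z. (H1 z)\<^sup>2 + (H2 z)\<^sup>2) \<le> \<epsilon> \<Longrightarrow>
       z0 \<in> ?R \<Longrightarrow> H z0 = 0 \<Longrightarrow> z \<in> ?R \<Longrightarrow> \<bar>H z\<bar> \<le> h\<^sup>2 / (2 * (1 + h))"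
    using small_if_small_gradient[of 0 1 "- L'" L' "h\<^sup>2 / (2 * (1 + h))" 2] h L' by auto
  \<comment> \<open>The anchor and the two Lipschitz bounds limit the truncated difference by
    \<open>B0\<close> + 4 |y| at height y.\<close>
  define B0 where "B0 = 2 + 2 * Y + \<eta>"
  have B0: "0 \<le> B0" using Y \<eta> by (simp add: B0_def)
  define A' where "A' = (B0 + 4) * \<Lambda> + 2 * A + 2 * \<Lambda> * (1 + Y\<^sup>2)"
  have A': "0 < A'" unfolding A'_def using B0 A \<Lambda> by (intro add_pos_nonneg add_nonneg_pos mult_nonneg_nonneg add_nonneg_nonneg) auto
  \<comment> \<open>In order: d for the flux error of the bent end; 1 to keep the other singular set
    within height Y; \<eta>/16 to get 2\<delta> below the truncation level \<eta>/4; \<eta>/(4 L')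
    to move the reference graph by at most \<eta>/4 on the rectangle; the last term to make the
    integral of \<open>E\<close> at most \<epsilon>/2.\<close>
  define \<delta> where "\<delta> = min (min d 1) (min (\<eta> / 16) (min (\<eta> / (4 * L')) ((\<epsilon> / (2 * A' * pi))\<^sup>2)))"
  have \<delta>: "0 < \<delta>" using d \<eta> L' \<epsilon> A' by (simp add: \<delta>_def)
  have \<delta>le: "\<delta> \<le> d" "\<delta> \<le> 1" "\<delta> \<le> \<eta> / 16" "\<delta> \<le> \<eta> / (4 * L')" "\<delta> \<le> (\<epsilon> / (2 * A' * pi))\<^sup>2"
    by (simp_all add: \<delta>_def)
  show thesis
  proof (rule that[OF \<delta>])
    fix \<Sigma> u p q r s t a Yu C z
    assume u: "cyl_graph \<Sigma> u p q r s t a Yu C" and a: "\<bar>a - a0\<bar> \<le> \<delta>"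
      and near1: "\<And>z. z \<in> \<Sigma> \<Longrightarrow> \<exists>z'\<in>\<Sigma>0. dist z z' \<le> \<delta> \<and> \<bar>u z - u0 z'\<bar> \<le> \<delta>"
      and near2: "\<And>z'. z' \<in> \<Sigma>0 \<Longrightarrow> \<exists>z\<in>\<Sigma>. dist z z' \<le> \<delta> \<and> \<bar>u z - u0 z'\<bar> \<le> \<delta>"
      and z: "\<bar>Im z\<bar> \<le> L"
    note Du = cyl_graphD[OF u] and Mu = max_graphD[OF cyl_graphD(2)[OF u]]
    define x where "x = a - a0"
    have x: "\<bar>x\<bar> \<le> \<delta>" "\<bar>x\<bar> \<le> d" "\<bar>x\<bar> \<le> 1" using a \<delta>le unfolding x_def by linarith+
    have xs: "\<bar>x\<bar> \<le> sqrt \<bar>x\<bar>" by (rule abs_le_sqrt_abs[OF x(3)])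
    define \<Phi> where "\<Phi> = a / wt 0 a - a0 / wt 0 a0"
    have \<Phi>: "\<Phi> = (a0 + x) / wt 0 (a0 + x) - a0 / wt 0 a0" by (simp add: \<Phi>_def x_def)
    have \<Phi>x: "\<bar>\<Phi>\<bar> \<le> \<Lambda> * \<bar>x\<bar>" unfolding \<Phi> by (rule Phi[OF x(2)])
    have \<Phi>s: "\<bar>\<Phi>\<bar> \<le> \<Lambda> * sqrt \<bar>x\<bar>"
      using \<Phi>x mult_left_mono[OF xs, of \<Lambda>] \<Lambda> by linarith
    define k where "k = (\<lambda>y. cut' (- Y - y))"
    \<comment> \<open>Added to u0, it changes the slope of the lower end from a0 to a, and it does
      nothing above -Y, in particular near the singularities.\<close>
    define \<rho> where "\<rho> = (\<lambda>y. - x * cut (- Y - y))"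
    have \<rho>D: "(\<rho> has_real_derivative x * k y) (at y)" for y
    proof -
      have "((\<lambda>y. - Y - y) has_real_derivative - 1) (at y)" by (auto intro!: derivative_eq_intros)
      from DERIV_chain2[OF DERIV_cut this] have "((\<lambda>y. cut (- Y - y)) has_real_derivative - k y) (at y)"
        by (simp add: k_def)
      from DERIV_cmult[OF this, of "- x"] show ?thesis by (simp add: \<rho>_def)
    qed
    have \<rho>0: "\<rho> y = 0" "k y = 0" if "- Y \<le> y" for y using that by (simp_all add: \<rho>_def k_def cut_eq_0 cut'_eq_0)
    have \<rho>le: "\<bar>\<rho> y\<bar> \<le> \<bar>x\<bar> * \<bar>y\<bar>" for y
    proof (cases "- Y \<le> y")
      case False
      then have "cut (- Y - y) \<le> \<bar>y\<bar>" using cut_le[of "- Y - y"] Y by linarith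
      then have "\<bar>x\<bar> * cut (- Y - y) \<le> \<bar>x\<bar> * \<bar>y\<bar>" by (intro mult_left_mono) auto
      then show ?thesis using cut_nonneg[of "- Y - y"] by (simp add: \<rho>_def abs_mult)
    qed (simp add: \<rho>0)
    define u' where "u' = (\<lambda>z. u0 z + \<rho> (Im z))"
    define q' where "q' = (\<lambda>z. q0 z + x * k (Im z))"
    have kc: "isCont k y" for y
      unfolding k_def by (rule isCont_o2[OF _ isCont_cut']) (intro continuous_intros)
    \<comment> \<open>The hypotheses compare values at different points; each graph being
      1-Lipschitz, moving to a common point costs another \<delta>.\<close>
    have onS: "\<bar>u z - u0 z\<bar> \<le> 2 * \<delta>" "\<bar>Im z\<bar> < Y" if "z \<in> \<Sigma> \<union> \<Sigma>0" for z
    proof -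
      have "\<exists>z1 z2. z1 \<in> \<Sigma>0 \<and> dist z2 z1 \<le> \<delta> \<and> \<bar>u z2 - u0 z1\<bar> \<le> \<delta> \<and> (z = z1 \<or> z = z2)"
        using that near1 near2 by blast
      then obtain z1 z2 where zz: "z1 \<in> \<Sigma>0" "dist z2 z1 \<le> \<delta>" "\<bar>u z2 - u0 z1\<bar> \<le> \<delta>" "z = z1 \<or> z = z2"
        by blast
      have "\<bar>u z2 - u z1\<bar> \<le> dist z2 z1" "\<bar>u0 z2 - u0 z1\<bar> \<le> dist z2 z1" by (rule Du(3) D0(3))+
      then have "\<bar>u z1 - u0 z1\<bar> \<le> 2 * \<delta>" "\<bar>u z2 - u0 z2\<bar> \<le> 2 * \<delta>" using zz(2,3) by linarith+
      then show "\<bar>u z - u0 z\<bar> \<le> 2 * \<delta>" using zz(4) by blast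
      have "\<bar>Im z1\<bar> < \<bar>Y0\<bar>" using D0(8)[OF zz(1)] by linarith
      moreover have "\<bar>Im z2 - Im z1\<bar> \<le> dist z2 z1" using abs_Im_le_cmod[of "z2 - z1"] by (simp add: dist_norm)
      ultimately have "\<bar>Im z1\<bar> < Y" "\<bar>Im z2\<bar> < Y" using zz(2) Y \<delta>le(2) by linarith+
      then show "\<bar>Im z\<bar> < Y" using zz(4) by blast
    qed
    have S: "closed (\<Sigma> \<union> \<Sigma>0)" using Du(1) D0(1) by (rule closed_Un)
    have uc: "continuous_on UNIV u" "continuous_on UNIV u0"
      using cyl_graph_cong_u[OF u] cyl_graph_cong_u[OF u0] by auto
    have bigS: "\<bar>u z - u0 z\<bar> \<le> 2 * \<delta> + 2 * (1 + \<bar>Im z\<bar> + Y)" if "0 \<le> Re z" "Re z \<le> 1" for z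
    proof -
      have "cmod (z - zs) \<le> \<bar>Re (z - zs)\<bar> + \<bar>Im (z - zs)\<bar>" by (rule cmod_le)
      also have "\<dots> \<le> 1 + (\<bar>Im z\<bar> + Y)" using that zs zsY by auto
      finally have "dist z zs \<le> 1 + \<bar>Im z\<bar> + Y" by (simp add: dist_norm)
      then show ?thesis using Du(3)[of z zs] D0(3)[of z zs] onS(1)[of zs] zs(1) by auto
    qed
    define M where "M = \<eta> / 4"
    have \<delta>M: "2 * \<delta> < M" using \<delta>le(3) \<eta> by (simp add: M_def)
    have N0: "\<exists>N1x N1y N2x N2y. (\<forall>z\<in>-\<Sigma>0. has_grad (\<lambda>z. p0 z / wt (p0 z) (q0 z)) (N1x z) (N1y z) z) \<and>
        (\<forall>z\<in>-\<Sigma>0. has_grad (\<lambda>z. q0 z / wt (p0 z) (q0 z)) (N2x z) (N2y z) z) \<and> (\<forall>z\<in>-\<Sigma>0. N1x z + N2y z = 0) \<and>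
        continuous_on (-\<Sigma>0) N1x \<and> continuous_on (-\<Sigma>0) N2y"
      by (rule max_graph_flux[OF D0(2)]) blast
    then obtain N1x N1y N2x N2y where N0: "\<forall>z\<in>-\<Sigma>0. has_grad (\<lambda>z. p0 z / wt (p0 z) (q0 z)) (N1x z) (N1y z) z"
        "\<forall>z\<in>-\<Sigma>0. has_grad (\<lambda>z. q0 z / wt (p0 z) (q0 z)) (N2x z) (N2y z) z" "\<forall>z\<in>-\<Sigma>0. N1x z + N2y z = 0"
        "continuous_on (-\<Sigma>0) N1x" "continuous_on (-\<Sigma>0) N2y"
      by blast
    \<comment> \<open>Below -Y this is the estimate for the bent end. Above, the graph is not bent
      and the only defect is the correction \<Phi> * \<open>ramp\<close>, which is bounded there by
      (1+Y^2)/(1+y^2).\<close>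
    have room: "(p0 z)\<^sup>2 + (q' z)\<^sup>2 < 1 \<and> \<bar>p0 z / wt (p0 z) (q' z) - p0 z / wt (p0 z) (q0 z)\<bar> +
        \<bar>q' z / wt (p0 z) (q' z) - (q0 z / wt (p0 z) (q0 z) + \<Phi> * ramp (Im z))\<bar> \<le> (A + \<Lambda> * (1 + Y\<^sup>2)) * sqrt \<bar>x\<bar> / (1 + (Im z)\<^sup>2)"
      if "z \<notin> \<Sigma>0" for z
    proof (cases "Im z \<le> - Y")
      case True
      then have "\<bar>p0 z\<bar> + \<bar>q0 z - a0\<bar> \<le> C0 / (1 + (Im z)\<^sup>2)\<^sup>2" using Y by (intro D0(9)) auto
      note e = err[OF x(2) True this, folded k_def \<Phi>]
      have "A * sqrt \<bar>x\<bar> / (1 + (Im z)\<^sup>2) \<le> (A + \<Lambda> * (1 + Y\<^sup>2)) * sqrt \<bar>x\<bar> / (1 + (Im z)\<^sup>2)"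
        using \<Lambda> by (intro divide_right_mono mult_right_mono) auto
      then show ?thesis using e unfolding q'_def k_def \<Phi>[symmetric] by (simp add: algebra_simps)
    next
      case False
      then have k: "k (Im z) = 0" by (intro \<rho>0) simp
      have y1: "0 < 1 + (Im z)\<^sup>2" by (simp add: add_pos_nonneg)
      have "ramp (Im z) \<le> (1 + Y\<^sup>2) / (1 + (Im z)\<^sup>2)"
      proof (cases "0 \<le> Im z")
        case True
        have "1 / (1 + (Im z)\<^sup>2) \<le> (1 + Y\<^sup>2) / (1 + (Im z)\<^sup>2)" using y1 by (intro divide_right_mono) auto
        then show ?thesis using ramp_bounds(3)[OF True] by linarith
      next
        case neg: False
        have "\<bar>Im z\<bar> \<le> \<bar>Y\<bar>" using neg False by linarith
        then have "(Im z)\<^sup>2 \<le> Y\<^sup>2" by (simp add: abs_le_square_iff)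
        then have "1 \<le> (1 + Y\<^sup>2) / (1 + (Im z)\<^sup>2)" using y1 by simp
        then show ?thesis using ramp_bounds(2)[of "Im z"] by linarith
      qed
      then have "\<bar>\<Phi>\<bar> * ramp (Im z) \<le> \<Lambda> * sqrt \<bar>x\<bar> * ((1 + Y\<^sup>2) / (1 + (Im z)\<^sup>2))"
        using \<Phi>s ramp_bounds(1)[of "Im z"] \<Lambda> by (intro mult_mono) auto
      also have "\<dots> = \<Lambda> * (1 + Y\<^sup>2) * sqrt \<bar>x\<bar> / (1 + (Im z)\<^sup>2)" by (simp add: mult_ac)
      also have "\<dots> \<le> (A + \<Lambda> * (1 + Y\<^sup>2)) * sqrt \<bar>x\<bar> / (1 + (Im z)\<^sup>2)"
        using A y1 by (intro divide_right_mono mult_right_mono) auto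
      finally show ?thesis using M0(5)[of z] that k ramp_bounds(1)[of "Im z"] by (simp add: q'_def abs_mult)
    qed
    \<comment> \<open>Every error is at most a multiple of sqrt |x| times 1/(1+y^2), so its total
      over the cylinder is at most \<open>A'\<close> sqrt |x| pi.\<close>
    define E where "E = (\<lambda>z::complex. A' * sqrt \<bar>x\<bar> * (1 / (1 + (Im z)\<^sup>2)))"
    have y1: "1 + y\<^sup>2 \<noteq> 0" for y :: real by (metis add_pos_nonneg less_irrefl zero_le_power2 zero_less_one)
    have Ec: "continuous_on X E" for X unfolding E_def by (intro continuous_intros ballI) (rule y1)
    have main: "\<sigma> * (u z - u' z) \<le> M + h" if \<sigma>: "\<sigma> = 1 \<or> \<sigma> = -1" and zR: "z \<in> ?R" for \<sigma> z
    proof -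
      let ?v = "\<lambda>z. \<sigma> * (u z - u' z) - M"
      have abs_\<sigma>: "\<bar>\<sigma> * X\<bar> = \<bar>X\<bar>" for X using \<sigma> by auto
      have vle: "\<bar>?v z\<bar> \<le> B0 + 4 * \<bar>Im z\<bar>" if "0 \<le> Re z" "Re z \<le> 1" for z
      proof -
        have "\<bar>\<rho> (Im z)\<bar> \<le> \<bar>Im z\<bar>" using \<rho>le[of "Im z"] mult_right_mono[OF x(3), of "\<bar>Im z\<bar>"] by simp
        then have "\<bar>u z - u' z\<bar> \<le> 2 * \<delta> + 2 * (1 + \<bar>Im z\<bar> + Y) + \<bar>Im z\<bar>"
          using bigS[OF that] by (simp add: u'_def)
        moreover have "\<bar>\<sigma> * (u z - u' z) - M\<bar> \<le> \<bar>u z - u' z\<bar> + M"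
          using abs_\<sigma>[of "u z - u' z"] \<eta> by (simp add: M_def)
        ultimately show ?thesis using \<delta>M \<eta> by (simp add: B0_def M_def)
      qed
      have R: "rect 0 1 (- S) S' - (\<Sigma> \<union> \<Sigma>0) \<subseteq> - \<Sigma>" "rect 0 1 (- S) S' - (\<Sigma> \<union> \<Sigma>0) \<subseteq> - \<Sigma>0" for S S' by auto
      have per: "f (Complex 0 y) = f (Complex 1 y)" if "\<And>z. f (z + 1) = f z" for f :: "complex \<Rightarrow> real" and y
        using that[of "Complex 0 y"] by (simp add: complex_eq_iff Complex_eq add.commute)
      \<comment> \<open>The correction gives this field the same limit as the flux of u at both
        ends, although the limit normals differ; without it the boundary term at -S would not
        vanish.\<close>
      let ?K2 = "\<lambda>z. q0 z / wt (p0 z) (q0 z) + \<Phi> * ramp (Im z)"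
      let ?G = "\<lambda>z. \<sigma> * (q z / wt (p z) (q z) - ?K2 z)"
      let ?g = "\<lambda>z. (cut' (?v z) * (\<sigma> * (p z - p0 z)))\<^sup>2 + (cut' (?v z) * (\<sigma> * (q z - q' z)))\<^sup>2"
      have energy: "(\<forall>z\<in>rect 0 1 (-S) S. has_grad (\<lambda>z. cut (?v z)) (cut' (?v z) * (\<sigma> * (p z - p0 z))) (cut' (?v z) * (\<sigma> * (q z - q' z))) z)
        \<and> continuous_on (rect 0 1 (-S) S) (\<lambda>z. cut' (?v z) * (\<sigma> * (p z - p0 z)))
        \<and> continuous_on (rect 0 1 (-S) S) (\<lambda>z. cut' (?v z) * (\<sigma> * (q z - q' z)))
        \<and> rint 0 1 (-S) S ?g \<le> integral {0..1} (\<lambda>x. cut (?v (Complex x S)) * ?G (Complex x S))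
           - integral {0..1} (\<lambda>x. cut (?v (Complex x (-S))) * ?G (Complex x (-S))) + rint 0 1 (-S) S E"
        if S: "0 \<le> S" for S
      proof -
        let ?RS = "rect 0 1 (- S) S - (\<Sigma> \<union> \<Sigma>0)"
        have g1: "\<forall>z\<in>?RS. has_grad u' (p0 z) (q' z) z"
        proof
          fix z assume "z \<in> ?RS"
          then have "has_grad u0 (p0 z) (q0 z) z" by (intro M0(2)) auto
          from has_grad_add[OF this has_grad_Im[OF \<rho>D]] show "has_grad u' (p0 z) (q' z) z"
            by (simp add: u'_def q'_def)
        qed
        have kcont: "continuous_on X (\<lambda>z. k (Im z))" for X
          by (rule continuous_on_compose2[of UNIV k X Im])
             (use kc in \<open>auto intro!: continuous_at_imp_continuous_on continuous_on_Im\<close>)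
        have c1: "continuous_on ?RS p0" "continuous_on ?RS q0"
          by (rule continuous_on_subset[OF max_graph_continuous(2)[OF D0(2)] R(2)],
              rule continuous_on_subset[OF max_graph_continuous(3)[OF D0(2)] R(2)])
        have c2: "continuous_on ?RS q'" unfolding q'_def by (intro continuous_intros c1 kcont)
        have n1: "\<forall>z\<in>?RS. (p0 z)\<^sup>2 + (q' z)\<^sup>2 < 1" using room by blast
        have k1: "\<forall>z\<in>?RS. has_grad (\<lambda>z. p0 z / wt (p0 z) (q0 z)) (N1x z) (N1y z) z" using N0(1) by blast
        have k2: "\<forall>z\<in>?RS. has_grad ?K2 (N2x z) (N2y z + \<Phi> * ramp' (Im z)) z"
        proof
          fix z assume "z \<in> ?RS"
          then have "has_grad (\<lambda>z. q0 z / wt (p0 z) (q0 z)) (N2x z) (N2y z) z" using N0(2) by auto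
          from has_grad_add[OF this has_grad_scale[OF has_grad_Im[OF DERIV_ramp], of \<Phi>]]
          show "has_grad ?K2 (N2x z) (N2y z + \<Phi> * ramp' (Im z)) z" by simp
        qed
        have "continuous_on UNIV ramp'"
          unfolding ramp'_def[abs_def] by (intro continuous_intros ballI) (use y1 in \<open>auto simp: add_nonneg_eq_0_iff\<close>)
        then have rc: "continuous_on X (\<lambda>z. ramp' (Im z))" for X
          by (rule continuous_on_compose2) (auto intro!: continuous_intros)
        have kc1: "continuous_on ?RS N1x" by (rule continuous_on_subset[OF N0(4) R(2)])
        have kc2: "continuous_on ?RS (\<lambda>z. N2y z + \<Phi> * ramp' (Im z))"
          by (intro continuous_intros rc continuous_on_subset[OF N0(5) R(2)])
        have e2: "\<forall>z\<in>?RS. cut (?v z) * \<bar>N1x z + (N2y z + \<Phi> * ramp' (Im z))\<bar> +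
          \<bar>(p z - p0 z) * (p0 z / wt (p0 z) (q' z) - p0 z / wt (p0 z) (q0 z)) + (q z - q' z) * (q' z / wt (p0 z) (q' z) - ?K2 z)\<bar> \<le> E z"
        proof
          fix z assume z: "z \<in> ?RS"
          then have zz: "0 \<le> Re z" "Re z \<le> 1" "z \<notin> \<Sigma>0" "z \<notin> \<Sigma>" by (auto simp: rect_def)
          have div: "N1x z + (N2y z + \<Phi> * ramp' (Im z)) = \<Phi> * ramp' (Im z)" using N0(3) zz by auto
          have "cut (?v z) * \<bar>N1x z + (N2y z + \<Phi> * ramp' (Im z))\<bar> = cut (?v z) * (\<bar>\<Phi>\<bar> * \<bar>ramp' (Im z)\<bar>)"
            unfolding div abs_mult ..
          also have "\<dots> \<le> (B0 + 4 * \<bar>Im z\<bar>) * (\<Lambda> * sqrt \<bar>x\<bar> * \<bar>ramp' (Im z)\<bar>)"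
            using cut_le[of "?v z"] vle[OF zz(1,2)] \<Phi>s cut_nonneg[of "?v z"] B0
            by (intro mult_mono) auto
          also have "\<dots> = \<Lambda> * sqrt \<bar>x\<bar> * ((B0 + 4 * \<bar>Im z\<bar>) * \<bar>ramp' (Im z)\<bar>)" by (simp add: mult_ac)
          also have "\<dots> \<le> \<Lambda> * sqrt \<bar>x\<bar> * ((B0 + 4) / (1 + (Im z)\<^sup>2))"
            using abs_ramp'_le[OF B0] \<Lambda> by (intro mult_left_mono) auto
          finally have 1: "cut (?v z) * \<bar>N1x z + (N2y z + \<Phi> * ramp' (Im z))\<bar> \<le> \<Lambda> * sqrt \<bar>x\<bar> * ((B0 + 4) / (1 + (Im z)\<^sup>2))" .
          have g: "\<bar>p z - p0 z\<bar> \<le> 2" "\<bar>q z - q' z\<bar> \<le> 2"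
            using grad_less_1[OF Mu(5)[of z]] grad_less_1[OF M0(5)[of z]] grad_less_1(2)[OF conjunct1[OF room[of z]]] zz by auto
          have "\<bar>(p z - p0 z) * (p0 z / wt (p0 z) (q' z) - p0 z / wt (p0 z) (q0 z)) + (q z - q' z) * (q' z / wt (p0 z) (q' z) - ?K2 z)\<bar>
            \<le> 2 * \<bar>p0 z / wt (p0 z) (q' z) - p0 z / wt (p0 z) (q0 z)\<bar> + 2 * \<bar>q' z / wt (p0 z) (q' z) - ?K2 z\<bar>"
            by (rule order_trans[OF abs_triangle_ineq]) (unfold abs_mult, intro add_mono mult_right_mono g abs_ge_zero)
          also have "\<dots> \<le> 2 * ((A + \<Lambda> * (1 + Y\<^sup>2)) * sqrt \<bar>x\<bar> / (1 + (Im z)\<^sup>2))"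
            unfolding distrib_left[symmetric] by (rule mult_left_mono[OF conjunct2[OF room[OF zz(3)]]]) simp
          finally have 2: "\<bar>(p z - p0 z) * (p0 z / wt (p0 z) (q' z) - p0 z / wt (p0 z) (q0 z)) + (q z - q' z) * (q' z / wt (p0 z) (q' z) - ?K2 z)\<bar>
            \<le> 2 * ((A + \<Lambda> * (1 + Y\<^sup>2)) * sqrt \<bar>x\<bar> / (1 + (Im z)\<^sup>2))" .
          have "\<Lambda> * sqrt \<bar>x\<bar> * ((B0 + 4) / (1 + (Im z)\<^sup>2)) + 2 * ((A + \<Lambda> * (1 + Y\<^sup>2)) * sqrt \<bar>x\<bar> / (1 + (Im z)\<^sup>2)) = E z"
            unfolding E_def A'_def by (simp add: add_divide_distrib[symmetric]) (simp add: algebra_simps)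
          with 1 2 show "cut (?v z) * \<bar>N1x z + (N2y z + \<Phi> * ramp' (Im z))\<bar> +
            \<bar>(p z - p0 z) * (p0 z / wt (p0 z) (q' z) - p0 z / wt (p0 z) (q0 z)) + (q z - q' z) * (q' z / wt (p0 z) (q' z) - ?K2 z)\<bar> \<le> E z"
            by linarith
        qed
        have e3: "\<forall>z\<in>rect 0 1 (- S) S. 0 \<le> E z" using A' by (simp add: E_def)
        \<comment> \<open>On both singular sets the difference is at most 2\<delta>, strictly below
          the level M, so by continuity the truncation is zero nearby.\<close>
        have neg: "\<forall>z\<in>rect 0 1 (- S) S \<inter> (\<Sigma> \<union> \<Sigma>0). \<forall>\<^sub>F y in nhds z. ?v y \<le> 0"
        proof
          fix z assume z: "z \<in> rect 0 1 (- S) S \<inter> (\<Sigma> \<union> \<Sigma>0)"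
          have "\<rho> (Im z) = 0" using onS(2)[of z] z by (intro \<rho>0) auto
          moreover have "\<bar>\<sigma> * (u z - u0 z)\<bar> \<le> 2 * \<delta>" unfolding abs_\<sigma> using onS(1)[of z] z by auto
          ultimately have neg: "?v z < 0" using \<delta>M by (simp add: u'_def)
          have "isCont (\<lambda>z. \<rho> (Im z)) z" by (rule has_grad_imp_isCont[OF has_grad_Im[OF \<rho>D]])
          moreover have "isCont u z" "isCont u0 z" using uc by (auto simp: continuous_on_eq_continuous_at)
          ultimately have "isCont ?v z" unfolding u'_def by (intro continuous_intros)
          then have "(?v \<longlongrightarrow> ?v z) (nhds z)" by (simp add: continuous_at_imp_continuous_at_within isCont_def tendsto_nhds_iff)
          from order_tendstoD(2)[OF this neg] show "\<forall>\<^sub>F y in nhds z. ?v y \<le> 0" by eventually_elim simp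
        qed
        have u'per: "u' (z + 1) = u' z" for z using D0(4) by (simp add: u'_def)
        have side: "\<forall>y\<in>{- S..S}. cut (?v (Complex 0 y)) * (p (Complex 0 y) / wt (p (Complex 0 y)) (q (Complex 0 y)) - p0 (Complex 0 y) / wt (p0 (Complex 0 y)) (q0 (Complex 0 y)))
          = cut (?v (Complex 1 y)) * (p (Complex 1 y) / wt (p (Complex 1 y)) (q (Complex 1 y)) - p0 (Complex 1 y) / wt (p0 (Complex 1 y)) (q0 (Complex 1 y)))"
          using per[of u] per[of p] per[of q] per[of u'] per[of p0] per[of q0] Du(4,5,6) D0(5,6) u'per by simp
        have mS: "- S \<le> S" using S by simp
        note e = cut_energy[where \<Sigma>="\<Sigma> \<union> \<Sigma>0" and E=E and M=M and \<sigma>=\<sigma>, OF zero_le_one mS \<open>closed (\<Sigma> \<union> \<Sigma>0)\<close> \<sigma> Du(2) R(1)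
          g1 c1(1) c2 n1 k1 k2 kc1 kc2 Ec e2 e3 neg side]
        show ?thesis using e by blast
      qed
      obtain C1 S1 where 1: "0 < C1"
        "\<And>z. Im z \<le> - S1 \<Longrightarrow> \<bar>q z / wt (p z) (q z) - a / wt 0 a\<bar> \<le> C1 / (1 + (Im z)\<^sup>2)"
        "\<And>z. S1 \<le> Im z \<Longrightarrow> \<bar>q z / wt (p z) (q z)\<bar> \<le> C1 / (1 + (Im z)\<^sup>2)"
        using cyl_graph_end_flux[OF u] by blast
      obtain C2 S2 where 2: "0 < C2"
        "\<And>z. Im z \<le> - S2 \<Longrightarrow> \<bar>q0 z / wt (p0 z) (q0 z) - a0 / wt 0 a0\<bar> \<le> C2 / (1 + (Im z)\<^sup>2)"
        "\<And>z. S2 \<le> Im z \<Longrightarrow> \<bar>q0 z / wt (p0 z) (q0 z)\<bar> \<le> C2 / (1 + (Im z)\<^sup>2)"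
        using cyl_graph_end_flux[OF u0] by blast
      define C3 where "C3 = C1 + C2 + \<bar>\<Phi>\<bar>"
      \<comment> \<open>Only here do the decay constants of u enter: S is chosen for this particular
        graph.\<close>
      have ev1: "\<forall>\<^sub>F S in at_top. (B0 + 4 * S) * (C3 / (1 + S\<^sup>2)) < \<epsilon> / 4"
      proof -
        have "((\<lambda>S::real. (B0 + 4 * S) * (C3 / (1 + S\<^sup>2))) \<longlongrightarrow> 0) at_top" by real_asymp
        from order_tendstoD(2)[OF this, of "\<epsilon> / 4"] show ?thesis using \<epsilon> by simp
      qed
      have ev2: "\<forall>\<^sub>F S in at_top. S1 \<le> S \<and> S2 \<le> S \<and> L' \<le> S"
        by (intro eventually_conj eventually_ge_at_top)
      obtain S where S: "(B0 + 4 * S) * (C3 / (1 + S\<^sup>2)) < \<epsilon> / 4" "S1 \<le> S" "S2 \<le> S" "L' \<le> S"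
        using eventually_happens[OF eventually_conj[OF ev1 ev2]] by auto
      have Spos: "0 \<le> S" using S L' by simp
      have bdry: "\<bar>integral {0..1} (\<lambda>x. cut (?v (Complex x y)) * ?G (Complex x y))\<bar> \<le> (B0 + 4 * S) * (C3 / (1 + S\<^sup>2))" if y: "y = S \<or> y = - S" for y
      proof (rule integral_bound_unit)
        fix x :: real assume xx: "x \<in> {0..1}"
        let ?z = "Complex x y"
        have ys: "y\<^sup>2 = S\<^sup>2" "\<bar>y\<bar> = S" using y Spos by auto
        have "\<bar>?G ?z\<bar> \<le> C3 / (1 + S\<^sup>2)"
        proof -
          have "\<bar>q ?z / wt (p ?z) (q ?z) - ?K2 ?z\<bar> \<le> C1 / (1 + S\<^sup>2) + C2 / (1 + S\<^sup>2) + \<bar>\<Phi>\<bar> * (1 / (1 + S\<^sup>2))"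
            using y
          proof
            assume yS: "y = S"
            have "\<bar>\<Phi> * ramp S\<bar> \<le> \<bar>\<Phi>\<bar> * (1 / (1 + S\<^sup>2))"
              unfolding abs_mult using ramp_bounds(1)[of S] ramp_bounds(3)[OF Spos] by (intro mult_left_mono) auto
            note c = this
            have a: "\<bar>q ?z / wt (p ?z) (q ?z)\<bar> \<le> C1 / (1 + S\<^sup>2)" "\<bar>q0 ?z / wt (p0 ?z) (q0 ?z)\<bar> \<le> C2 / (1 + S\<^sup>2)"
              using 1(3)[of ?z] 2(3)[of ?z] S yS by (simp_all del: abs_divide)
            have "\<bar>X - (Z + V)\<bar> \<le> b1 + b2 + b3" if "\<bar>X\<bar> \<le> b1" "\<bar>Z\<bar> \<le> b2" "\<bar>V\<bar> \<le> b3" for X Z V b1 b2 b3 :: real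
              using that by linarith
            from this[OF a c] show ?thesis using yS by (simp only: complex.sel)
          next
            assume yS: "y = - S"
            have "\<bar>\<Phi> * (1 - ramp (- S))\<bar> \<le> \<bar>\<Phi>\<bar> * (1 / (1 + S\<^sup>2))"
              unfolding abs_mult using ramp_bounds(2)[of "- S"] ramp_bounds(4)[of "- S"] Spos by (intro mult_left_mono) auto
            moreover have "q ?z / wt (p ?z) (q ?z) - ?K2 ?z = (q ?z / wt (p ?z) (q ?z) - a / wt 0 a) -
              (q0 ?z / wt (p0 ?z) (q0 ?z) - a0 / wt 0 a0) + \<Phi> * (1 - ramp (- S))"
            proof -
              have "X - (Z + (a1 - a2) * c) = (X - a1) - (Z - a2) + (a1 - a2) * (1 - c)" for X Z a1 a2 c :: real
                by (simp add: algebra_simps)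
              then show ?thesis unfolding \<Phi>_def yS complex.sel .
            qed
            moreover have "\<bar>q ?z / wt (p ?z) (q ?z) - a / wt 0 a\<bar> \<le> C1 / (1 + S\<^sup>2)" "\<bar>q0 ?z / wt (p0 ?z) (q0 ?z) - a0 / wt 0 a0\<bar> \<le> C2 / (1 + S\<^sup>2)"
              using 1(2)[of ?z] 2(2)[of ?z] S yS by (simp_all del: abs_divide)
            moreover have "\<bar>X - Z + V\<bar> \<le> b1 + b2 + b3" if "\<bar>X\<bar> \<le> b1" "\<bar>Z\<bar> \<le> b2" "\<bar>V\<bar> \<le> b3" for X Z V b1 b2 b3 :: real
              using that by linarith
            ultimately show ?thesis by metis
          qed
          then show ?thesis unfolding abs_\<sigma> by (simp add: C3_def add_divide_distrib)
        qed
        then show "\<bar>cut (?v ?z) * ?G ?z\<bar> \<le> (B0 + 4 * S) * (C3 / (1 + S\<^sup>2))"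
          unfolding abs_mult[of "cut _"]
          using vle[of ?z] cut_le[of "?v ?z"] cut_nonneg[of "?v ?z"] xx ys B0 Spos by (intro mult_mono) auto
      qed
      have rE: "rint 0 1 (-S) S E \<le> \<epsilon> / 2"
      proof -
        have "rint 0 1 (-S) S E = A' * sqrt \<bar>x\<bar> * rint 0 1 (-S) S (\<lambda>z. 1 / (1 + (Im z)\<^sup>2))"
          unfolding E_def by (rule rint_cmul)
        also have "\<dots> \<le> A' * sqrt \<bar>x\<bar> * pi"
          using rint_inverse_square_le[OF Spos] A' by (intro mult_left_mono) auto
        also have "sqrt \<bar>x\<bar> \<le> \<epsilon> / (2 * A' * pi)"
        proof -
          have "\<bar>x\<bar> \<le> (\<epsilon> / (2 * A' * pi))\<^sup>2" using x(1) \<delta>le(5) by linarith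
          then have "sqrt \<bar>x\<bar> \<le> sqrt ((\<epsilon> / (2 * A' * pi))\<^sup>2)" by (rule real_sqrt_le_mono)
          then show ?thesis using \<epsilon> A' by simp
        qed
        then have "A' * sqrt \<bar>x\<bar> * pi \<le> A' * (\<epsilon> / (2 * A' * pi)) * pi"
          using A' by (intro mult_right_mono mult_left_mono) auto
        also have "\<dots> = \<epsilon> / 2" using A' by simp
        finally show ?thesis .
      qed
      have eS: "rint 0 1 (-S) S ?g \<le> \<epsilon>"
        using energy[OF Spos] bdry[of S] bdry[of "- S"] rE S(1) by linarith
      have "rint 0 1 (- L') L' ?g \<le> rint 0 1 (-S) S ?g"
      proof (rule rint_subset)
        show "continuous_on (rect 0 1 (-S) S) ?g"
          by (intro continuous_on_add continuous_on_power) (use energy[OF Spos] in blast)+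
      qed (use S in auto)
      then have eL: "rint 0 1 (- L') L' ?g \<le> \<epsilon>" using eS by linarith
      have "\<bar>cut (?v z)\<bar> \<le> h\<^sup>2 / (2 * (1 + h))"
      proof (rule small[of "\<lambda>z. cut (?v z)" "\<lambda>z. cut' (?v z) * (\<sigma> * (p z - p0 z))" "\<lambda>z. cut' (?v z) * (\<sigma> * (q z - q' z))" zs])
        show "zs \<in> ?R" using zs zsY L' by (auto simp: rect_def)
        have "\<rho> (Im zs) = 0" using zsY by (intro \<rho>0) auto
        moreover have "\<bar>\<sigma> * (u zs - u0 zs)\<bar> \<le> 2 * \<delta>" unfolding abs_\<sigma> using onS(1)[of zs] zs by auto
        ultimately show "cut (?v zs) = 0" using \<delta>M by (intro cut_eq_0) (simp add: u'_def)
        fix z assume zr: "z \<in> ?R"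
        show "has_grad (\<lambda>z. cut (?v z)) (cut' (?v z) * (\<sigma> * (p z - p0 z))) (cut' (?v z) * (\<sigma> * (q z - q' z))) z"
          using energy[of L'] L' zr by auto
        show "\<bar>cut' (?v z) * (\<sigma> * (p z - p0 z))\<bar> \<le> 2 \<and> \<bar>cut' (?v z) * (\<sigma> * (q z - q' z))\<bar> \<le> 2"
        proof (cases "z \<in> \<Sigma> \<union> \<Sigma>0")
          case True
          have "\<rho> (Im z) = 0" using onS(2)[OF True] by (intro \<rho>0) auto
          moreover have "\<bar>\<sigma> * (u z - u0 z)\<bar> \<le> 2 * \<delta>" unfolding abs_\<sigma> using onS(1)[OF True] .
          ultimately have "cut' (?v z) = 0" using \<delta>M by (intro cut'_eq_0) (simp add: u'_def)
          then show ?thesis by simp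
        next
          case False
          then have "\<bar>p z - p0 z\<bar> \<le> 2" "\<bar>q z - q' z\<bar> \<le> 2"
            using grad_less_1[OF Mu(5)[of z]] grad_less_1[OF M0(5)[of z]] grad_less_1(2)[OF conjunct1[OF room[of z]]] by auto
          then show ?thesis using abs_cut'_mult_le[OF _ \<sigma>] by blast
        qed
      qed (use energy[of L'] L' eL zR in auto)
      then have "?v z \<le> h" by (rule le_if_cut_small[OF h])
      then show ?thesis by simp
    qed
    have \<eta>2: "\<eta> / 2 = M + h" by (simp add: M_def h_def)
    obtain k1 where k1: "0 \<le> Re (z + of_int k1)" "Re (z + of_int k1) \<le> 1" "Im (z + of_int k1) = Im z"
      by (rule periodic_reduce)
    define z' where "z' = z + of_int k1"
    have "u z' = u z" "u0 z' = u0 z" unfolding z'_def by (rule periodic_int, rule Du(4) D0(4))+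
    moreover have zR: "z' \<in> ?R" using k1 z L' by (auto simp: rect_def z'_def)
    moreover have "\<bar>u z' - u' z'\<bar> \<le> \<eta> / 2" unfolding \<eta>2 using main[of 1 z'] main[of "-1" z'] zR by auto
    moreover have "\<bar>\<rho> (Im z')\<bar> \<le> \<eta> / 4"
    proof -
      have "\<bar>x\<bar> * \<bar>Im z'\<bar> \<le> \<eta> / (4 * L') * L'"
        using x(1) \<delta>le(4) zR by (intro mult_mono) (auto simp: rect_def)
      then show ?thesis using \<rho>le[of "Im z'"] L' by simp
    qed
    moreover have "\<bar>X - Z\<bar> \<le> \<eta>" if "\<bar>X - (Z + V)\<bar> \<le> \<eta> / 2" "\<bar>V\<bar> \<le> \<eta> / 4" for X Z V
      using that \<eta> by linarith
    ultimately show "\<bar>u z - u0 z\<bar> \<le> \<eta>" unfolding u'_def by metis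
  qed
qed

section \<open>The Lewy transformation\<close>

text \<open>The Poincare lemma on a convex set; that the form is closed is expressed by the common
  partial derivative \<open>ay\<close>. The form is integrated along segments from a base point and
  differentiated under the integral sign.\<close>

lemma closed_form_primitive:
  fixes a b ax ay bz :: "complex \<Rightarrow> real"
  assumes "open D" "convex D"
    and a: "\<And>z. z \<in> D \<Longrightarrow> has_grad a (ax z) (ay z) z" and b: "\<And>z. z \<in> D \<Longrightarrow> has_grad b (ay z) (bz z) z"
    and c: "continuous_on D ax" "continuous_on D ay" "continuous_on D bz"
  obtains F where "\<And>z. z \<in> D \<Longrightarrow> has_grad F (a z) (b z) z"
proof (cases "D = {}")
  case True
  then show thesis using that by blast
next
  case False
  then obtain z0 where z0: "z0 \<in> D" by blast
  define \<gamma> where "\<gamma> = (\<lambda>z t. z0 + of_real t * (z - z0))"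
  have \<gamma>D: "\<gamma> z t \<in> D" if "z \<in> D" "t \<in> {0..1}" for z t
  proof -
    have "\<gamma> z t = (1 - t) *\<^sub>R z0 + t *\<^sub>R z" by (simp add: \<gamma>_def scaleR_conv_of_real algebra_simps)
    then show ?thesis using convexD[OF assms(2) z0 that(1), of "1 - t" t] that(2) by simp
  qed
  have ca: "continuous_on D a" "continuous_on D b"
    using a b has_grad_imp_isCont by (blast intro: continuous_at_imp_continuous_on)+
  define f where "f = (\<lambda>z t. a (\<gamma> z t) * Re (z - z0) + b (\<gamma> z t) * Im (z - z0))"
  define a' where "a' = (\<lambda>z t. a (\<gamma> z t) + t * (ax (\<gamma> z t) * Re (z - z0) + ay (\<gamma> z t) * Im (z - z0)))"
  define b' where "b' = (\<lambda>z t. b (\<gamma> z t) + t * (ay (\<gamma> z t) * Re (z - z0) + bz (\<gamma> z t) * Im (z - z0)))"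
  define fx where "fx = (\<lambda>z t. a' z t *\<^sub>R Blinfun Re + b' z t *\<^sub>R Blinfun Im)"
  have fx_apply: "blinfun_apply (fx z t) = (\<lambda>h. a' z t * Re h + b' z t * Im h)" for z t
    by (rule ext) (simp add: fx_def blinfun.add_left blinfun.scaleR_left bounded_linear_Blinfun_apply bounded_linear_Re bounded_linear_Im)
  have cg: "continuous_on (D \<times> cbox 0 1) (\<lambda>x. g (\<gamma> (fst x) (snd x)))" if "continuous_on D g" for g :: "complex \<Rightarrow> real"
    by (rule continuous_on_compose2[OF that]) (auto simp: \<gamma>D intro!: continuous_intros simp: \<gamma>_def[of] intro: \<gamma>D[unfolded \<gamma>_def, simplified])
  have ca': "continuous_on (D \<times> cbox 0 1) (\<lambda>x. a' (fst x) (snd x))" "continuous_on (D \<times> cbox 0 1) (\<lambda>x. b' (fst x) (snd x))"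
    unfolding a'_def b'_def by (intro continuous_intros cg ca c)+
  have cline: "continuous_on {0..1} (\<lambda>t. g (\<gamma> z t))" if "continuous_on D g" "z \<in> D" for g :: "complex \<Rightarrow> real" and z
    by (rule continuous_on_compose2[OF that(1)]) (use \<gamma>D[OF that(2)] in \<open>auto intro!: continuous_intros simp: \<gamma>_def\<close>)
  have ci: "continuous_on {0..1} (a' z)" "continuous_on {0..1} (b' z)" if "z \<in> D" for z
    unfolding a'_def b'_def by (intro continuous_intros cline ca c that)+
  have ia: "integral {0..1} (a' z) = a z" "integral {0..1} (b' z) = b z" if z: "z \<in> D" for z
  proof -
    have g: "((\<lambda>t. g (\<gamma> z t)) has_real_derivative gx (\<gamma> z t) * Re (z - z0) + gy (\<gamma> z t) * Im (z - z0)) (at t within {0..1})"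
      if "\<And>z. z \<in> D \<Longrightarrow> has_grad g (gx z) (gy z) z" "t \<in> {0..1}" for g gx gy t
    proof -
      have "(\<gamma> z has_derivative (\<lambda>h. of_real h * (z - z0))) (at t)"
        unfolding \<gamma>_def by (auto intro!: derivative_eq_intros)
      from has_derivative_compose[OF this that(1)[OF \<gamma>D[OF z that(2)], unfolded has_grad_def]]
      have "((\<lambda>t. g (\<gamma> z t)) has_derivative (\<lambda>h. (gx (\<gamma> z t) * Re (z - z0) + gy (\<gamma> z t) * Im (z - z0)) * h)) (at t)"
        by (simp add: algebra_simps)
      then show ?thesis by (simp add: has_field_derivative_def has_derivative_at_withinI)
    qed
    \<comment> \<open>The integrand of the differentiated integral is the derivative of t
      g(\<gamma>(t)), so its integral is g at the endpoint.\<close>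
    have i: "integral {0..1} (\<lambda>t. g (\<gamma> z t) + t * (gx (\<gamma> z t) * Re (z - z0) + gy (\<gamma> z t) * Im (z - z0))) = g z"
      if "\<And>z. z \<in> D \<Longrightarrow> has_grad g (gx z) (gy z) z" for g gx gy
    proof -
      have "((\<lambda>t. g (\<gamma> z t) + t * (gx (\<gamma> z t) * Re (z - z0) + gy (\<gamma> z t) * Im (z - z0))) has_integral
          1 * g (\<gamma> z 1) - 0 * g (\<gamma> z 0)) {0..1}"
      proof (rule fundamental_theorem_of_calculus)
        fix t :: real assume "t \<in> {0..1}"
        from DERIV_mult[OF DERIV_ident g[OF that this]]
        show "((\<lambda>t. t * g (\<gamma> z t)) has_vector_derivative g (\<gamma> z t) + t * (gx (\<gamma> z t) * Re (z - z0) + gy (\<gamma> z t) * Im (z - z0))) (at t within {0..1})"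
          by (simp add: has_real_derivative_iff_has_vector_derivative[symmetric] algebra_simps)
      qed simp
      then show ?thesis by (simp add: integral_unique \<gamma>_def)
    qed
    show "integral {0..1} (a' z) = a z" unfolding a'_def by (rule i[OF a])
    show "integral {0..1} (b' z) = b z" unfolding b'_def by (rule i[OF b])
  qed
  show thesis
  proof (rule that)
    fix z assume z: "z \<in> D"
    have "((\<lambda>z. integral (cbox 0 1) (f z)) has_derivative blinfun_apply (integral (cbox 0 1) (fx z))) (at z within D)"
    proof (rule leibniz_rule)
      show "((\<lambda>z. f z t) has_derivative blinfun_apply (fx z t)) (at z within D)" if "z \<in> D" "t \<in> cbox 0 1" for z t
      proof -
        have \<gamma>': "((\<lambda>z. \<gamma> z t) has_derivative (\<lambda>h. of_real t * h)) (at z)"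
          unfolding \<gamma>_def by (auto intro!: derivative_eq_intros)
        have gz: "\<gamma> z t \<in> D" using \<gamma>D that by simp
        note da = has_derivative_compose[OF \<gamma>' a[OF gz, unfolded has_grad_def]]
        note db = has_derivative_compose[OF \<gamma>' b[OF gz, unfolded has_grad_def]]
        have "((\<lambda>z. f z t) has_derivative blinfun_apply (fx z t)) (at z)"
          unfolding fx_apply f_def
          by (rule derivative_eq_intros da db refl)+ (simp add: a'_def b'_def algebra_simps)
        then show ?thesis by (rule has_derivative_at_withinI)
      qed
      show "f z integrable_on cbox 0 1" if "z \<in> D" for z
        unfolding f_def using that
        by (intro integrable_continuous_interval[folded cbox_interval] continuous_intros) (auto intro!: cline ca)
      show "continuous_on (D \<times> cbox 0 1) (\<lambda>(z, t). fx z t)"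
        unfolding fx_def split_beta by (intro continuous_intros ca')
    qed (use z assms(2) in auto)
    moreover have "blinfun_apply (integral (cbox 0 1) (fx z)) = (\<lambda>h. a z * Re h + b z * Im h)"
    proof -
      have "((\<lambda>t. a' z t *\<^sub>R Blinfun Re + b' z t *\<^sub>R Blinfun Im) has_integral
          (integral {0..1} (a' z) *\<^sub>R Blinfun Re + integral {0..1} (b' z) *\<^sub>R Blinfun Im)) {0..1}"
        by (intro has_integral_add has_integral_scaleR_left integrable_integral integrable_continuous_real ci z)
      then have "integral (cbox 0 1) (fx z) = a z *\<^sub>R Blinfun Re + b z *\<^sub>R Blinfun Im"
        unfolding fx_def ia[OF z] by (simp add: integral_unique)
      then show ?thesis
        by (intro ext) (simp add: blinfun.add_left blinfun.scaleR_left bounded_linear_Blinfun_apply bounded_linear_Re bounded_linear_Im)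
    qed
    ultimately show "has_grad (\<lambda>z. integral (cbox 0 1) (f z)) (a z) (b z) z"
      unfolding has_grad_def by (simp only: at_within_open[OF z assms(1)])
  qed
qed

text \<open>The differential of the Lewy transformation, an isothermal coordinate of the graph.\<close>

definition lewy :: "real \<Rightarrow> real \<Rightarrow> complex \<Rightarrow> complex" where
  "lewy p q h = Complex ((1 + (1 - p\<^sup>2) / wt p q) * Re h + (- p * q / wt p q) * Im h)
     ((- p * q / wt p q) * Re h + (1 + (1 - q\<^sup>2) / wt p q) * Im h)"

lemma linear_lewy: "linear (lewy p q)"
proof -
  have "linear (\<lambda>h. Complex (a * Re h + b * Im h) (c * Re h + d * Im h))" for a b c d
    by (rule linearI) (simp_all add: complex_eq_iff algebra_simps)
  then show ?thesis unfolding lewy_def[abs_def] .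
qed

text \<open>The matrix of \<open>lewy\<close> is I + g/w with g the induced metric of the graph, and
  g is nonnegative by the Cauchy-Schwarz inequality. The identity matrix is what makes the primitive
  expansive.\<close>

lemma lewy_positive:
  assumes "p\<^sup>2 + q\<^sup>2 < 1"
  shows "(cmod h)\<^sup>2 \<le> Re (cnj h * lewy p q h)"
proof -
  define w where "w = wt p q"
  have w: "0 < w" using assms by (simp add: w_def)
  define x y where "x = Re h" and "y = Im h"
  have "(p * x + q * y)\<^sup>2 \<le> (p\<^sup>2 + q\<^sup>2) * (x\<^sup>2 + y\<^sup>2)"
    using zero_le_power2[of "p * y - q * x"] by (simp add: power2_eq_square algebra_simps)
  also have "\<dots> \<le> 1 * (x\<^sup>2 + y\<^sup>2)" using assms by (intro mult_right_mono) auto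
  finally have "0 \<le> (x\<^sup>2 + y\<^sup>2 - (p * x + q * y)\<^sup>2) / w" using w by simp
  moreover have "Re (cnj h * lewy p q h) = x\<^sup>2 + y\<^sup>2 + (x\<^sup>2 + y\<^sup>2 - (p * x + q * y)\<^sup>2) / w"
    unfolding lewy_def w_def[symmetric] x_def y_def using w by (simp add: field_simps power2_eq_square)
  ultimately show ?thesis by (simp add: cmod_power2 x_def y_def)
qed

text \<open>Conformality. Since det g = w^2 and tr g = 1 + w^2, the theorem of Cayley and Hamilton
  gives (I + g/w)^2 = ((1+w)/w)^2 g.\<close>

lemma lewy_norm:
  assumes "p\<^sup>2 + q\<^sup>2 < 1"
  shows "(cmod (lewy p q h))\<^sup>2 = ((1 + wt p q) / wt p q)\<^sup>2 * ((cmod h)\<^sup>2 - (p * Re h + q * Im h)\<^sup>2)"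
proof -
  define w where "w = wt p q"
  have w: "0 < w" "w * w = 1 - p * p - q * q" using assms by (simp_all add: w_def power2_eq_square)
  define x y where "x = Re h" and "y = Im h"
  have "(cmod (lewy p q h))\<^sup>2 * (w * w) = ((w + 1 - p\<^sup>2) * x - p * q * y)\<^sup>2 + ((w + 1 - q\<^sup>2) * y - p * q * x)\<^sup>2"
    unfolding lewy_def w_def[symmetric] cmod_power2 x_def y_def using w(1)
    by (simp add: field_simps power2_eq_square)
  also have "\<dots> = (1 + w)\<^sup>2 * (x\<^sup>2 + y\<^sup>2 - (p * x + q * y)\<^sup>2)"
    using w(2) by algebra
  finally show ?thesis
    using w(1) unfolding w_def[symmetric] cmod_power2 x_def y_def by (simp add: field_simps power2_eq_square)
qed

lemma lewy_eq_0: "p\<^sup>2 + q\<^sup>2 < 1 \<Longrightarrow> lewy p q h = 0 \<Longrightarrow> h = 0"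
  using lewy_positive[of p q h] by simp

text \<open>The derivatives are arranged so that the cross derivatives of consecutive components
  coincide: both rows of the Lewy matrix are closed forms. The maximal surface equation enters in
  the first and the third component.\<close>

lemma lewy_components_grad:
  assumes p: "has_grad p r s z" and q: "has_grad q s t z" and 1: "(p z)\<^sup>2 + (q z)\<^sup>2 < 1"
    and pde: "(1 - (q z)\<^sup>2) * r + 2 * p z * q z * s + (1 - (p z)\<^sup>2) * t = 0"
  defines "w \<equiv> wt (p z) (q z)"
  shows "has_grad (\<lambda>z. 1 + (1 - (p z)\<^sup>2) / wt (p z) (q z))
      ((- 2 * p z * r * w\<^sup>2 + (1 - (p z)\<^sup>2) * (p z * r + q z * s)) / w ^ 3)
      ((- r * q z * (1 - (q z)\<^sup>2) - p z * s * (1 - (p z)\<^sup>2)) / w ^ 3) z"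
    and "has_grad (\<lambda>z. - p z * q z / wt (p z) (q z))
      ((- r * q z * (1 - (q z)\<^sup>2) - p z * s * (1 - (p z)\<^sup>2)) / w ^ 3)
      ((- t * p z * (1 - (p z)\<^sup>2) - q z * s * (1 - (q z)\<^sup>2)) / w ^ 3) z"
    and "has_grad (\<lambda>z. 1 + (1 - (q z)\<^sup>2) / wt (p z) (q z))
      ((- t * p z * (1 - (p z)\<^sup>2) - q z * s * (1 - (q z)\<^sup>2)) / w ^ 3)
      ((- 2 * q z * t * w\<^sup>2 + (1 - (q z)\<^sup>2) * (p z * s + q z * t)) / w ^ 3) z"
proof -
  have w: "w \<noteq> 0" "w * w = 1 - p z * p z - q z * q z" using 1 by (simp_all add: w_def power2_eq_square)
  have w0: "wt (p z) (q z) \<noteq> 0" using w(1) by (simp add: w_def)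
  have e: "(a * w - b * (- c / w)) / w\<^sup>2 = (a * w\<^sup>2 + b * c) / w ^ 3" for a b c
    using w(1) by (simp add: field_simps power2_eq_square power3_eq_cube)
  note g = wt_grad[OF p q 1]
  have pp: "has_grad (\<lambda>z. 1 - (p z)\<^sup>2) (- 2 * p z * r) (- 2 * p z * s) z"
    unfolding power2_eq_square
    by (rule has_grad_eq[OF has_grad_diff[OF has_grad_const[of 1] has_grad_mult[OF p p]]]) simp_all
  have qq: "has_grad (\<lambda>z. 1 - (q z)\<^sup>2) (- 2 * q z * s) (- 2 * q z * t) z"
    unfolding power2_eq_square
    by (rule has_grad_eq[OF has_grad_diff[OF has_grad_const[of 1] has_grad_mult[OF q q]]]) simp_all
  have pq: "has_grad (\<lambda>z. - p z * q z) (- (r * q z + p z * s)) (- (s * q z + p z * t)) z"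
    using has_grad_uminus[OF has_grad_mult[OF p q]] by simp
  have pde': "(1 - q z * q z) * r + 2 * p z * q z * s + (1 - p z * p z) * t = 0"
    using pde by (simp add: power2_eq_square)
  note A = has_grad_add[OF has_grad_const[of 1] has_grad_divide[OF pp g w0], folded w_def, unfolded e]
  show "has_grad (\<lambda>z. 1 + (1 - (p z)\<^sup>2) / wt (p z) (q z))
      ((- 2 * p z * r * w\<^sup>2 + (1 - (p z)\<^sup>2) * (p z * r + q z * s)) / w ^ 3)
      ((- r * q z * (1 - (q z)\<^sup>2) - p z * s * (1 - (p z)\<^sup>2)) / w ^ 3) z"
  proof (rule has_grad_eq[OF A])
    have "- 2 * p z * s * w\<^sup>2 + (1 - (p z)\<^sup>2) * (p z * s + q z * t) = - r * q z * (1 - (q z)\<^sup>2) - p z * s * (1 - (p z)\<^sup>2)"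
      unfolding power2_eq_square using w(2) pde' by algebra
    then show "0 + (- 2 * p z * s * w\<^sup>2 + (1 - (p z)\<^sup>2) * (p z * s + q z * t)) / w ^ 3 = (- r * q z * (1 - (q z)\<^sup>2) - p z * s * (1 - (p z)\<^sup>2)) / w ^ 3"
      by simp
  qed simp
  note G = has_grad_add[OF has_grad_const[of 1] has_grad_divide[OF qq g w0], folded w_def, unfolded e]
  show "has_grad (\<lambda>z. 1 + (1 - (q z)\<^sup>2) / wt (p z) (q z))
      ((- t * p z * (1 - (p z)\<^sup>2) - q z * s * (1 - (q z)\<^sup>2)) / w ^ 3)
      ((- 2 * q z * t * w\<^sup>2 + (1 - (q z)\<^sup>2) * (p z * s + q z * t)) / w ^ 3) z"
  proof (rule has_grad_eq[OF G])
    have "- 2 * q z * s * w\<^sup>2 + (1 - (q z)\<^sup>2) * (p z * r + q z * s) = - t * p z * (1 - (p z)\<^sup>2) - q z * s * (1 - (q z)\<^sup>2)"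
      unfolding power2_eq_square using w(2) pde' by algebra
    then show "0 + (- 2 * q z * s * w\<^sup>2 + (1 - (q z)\<^sup>2) * (p z * r + q z * s)) / w ^ 3 = (- t * p z * (1 - (p z)\<^sup>2) - q z * s * (1 - (q z)\<^sup>2)) / w ^ 3"
      by simp
  qed simp
  note B = has_grad_divide[OF pq g w0, folded w_def, unfolded e]
  show "has_grad (\<lambda>z. - p z * q z / wt (p z) (q z))
      ((- r * q z * (1 - (q z)\<^sup>2) - p z * s * (1 - (p z)\<^sup>2)) / w ^ 3)
      ((- t * p z * (1 - (p z)\<^sup>2) - q z * s * (1 - (q z)\<^sup>2)) / w ^ 3) z"
  proof (rule has_grad_eq[OF B])
    have "- (r * q z + p z * s) * w\<^sup>2 + - p z * q z * (p z * r + q z * s) = - r * q z * (1 - (q z)\<^sup>2) - p z * s * (1 - (p z)\<^sup>2)"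
      unfolding power2_eq_square using w(2) by algebra
    then show "(- (r * q z + p z * s) * w\<^sup>2 + - p z * q z * (p z * r + q z * s)) / w ^ 3 = (- r * q z * (1 - (q z)\<^sup>2) - p z * s * (1 - (p z)\<^sup>2)) / w ^ 3"
      by simp
    have "- (s * q z + p z * t) * w\<^sup>2 + - p z * q z * (p z * s + q z * t) = - t * p z * (1 - (p z)\<^sup>2) - q z * s * (1 - (q z)\<^sup>2)"
      unfolding power2_eq_square using w(2) by algebra
    then show "(- (s * q z + p z * t) * w\<^sup>2 + - p z * q z * (p z * s + q z * t)) / w ^ 3 = (- t * p z * (1 - (p z)\<^sup>2) - q z * s * (1 - (q z)\<^sup>2)) / w ^ 3"
      by simp
  qed
qed

text \<open>Convexity stands in for simple connectedness; around a singularity only local primitives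
  are used.\<close>

lemma lewy_primitive:
  assumes u: "max_graph \<Omega> u p q r s t" and D: "open D" "convex D" "D \<subseteq> \<Omega>"
  obtains \<zeta> where "\<And>z. z \<in> D \<Longrightarrow> (\<zeta> has_derivative lewy (p z) (q z)) (at z)"
proof -
  note M = max_graphD[OF u]
  have sub: "z \<in> D \<Longrightarrow> z \<in> \<Omega>" for z using D by auto
  note L = lewy_components_grad[OF M(3)[OF sub] M(4)[OF sub] M(5)[OF sub] M(6)[OF sub]]
  note c = max_graph_continuous[OF u] M(7,8,9)
  have w: "wt (p z) (q z) \<noteq> 0" if "z \<in> D" for z using M(5)[OF sub[OF that]] by auto
  obtain F1 where F1: "\<And>z. z \<in> D \<Longrightarrow> has_grad F1 (1 + (1 - (p z)\<^sup>2) / wt (p z) (q z)) (- p z * q z / wt (p z) (q z)) z"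
  proof (rule closed_form_primitive[OF D(1,2) L(1) L(2)])
    show "continuous_on D (\<lambda>z. (- 2 * p z * r z * (wt (p z) (q z))\<^sup>2 + (1 - (p z)\<^sup>2) * (p z * r z + q z * s z)) / wt (p z) (q z) ^ 3)"
      "continuous_on D (\<lambda>z. (- r z * q z * (1 - (q z)\<^sup>2) - p z * s z * (1 - (p z)\<^sup>2)) / wt (p z) (q z) ^ 3)"
      "continuous_on D (\<lambda>z. (- t z * p z * (1 - (p z)\<^sup>2) - q z * s z * (1 - (q z)\<^sup>2)) / wt (p z) (q z) ^ 3)"
      by (intro continuous_intros continuous_on_subset[OF c(2) D(3)] continuous_on_subset[OF c(3) D(3)]
          continuous_on_subset[OF c(4) D(3)] continuous_on_subset[OF c(5) D(3)] continuous_on_subset[OF c(6) D(3)] ballI;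
          use w in simp)+
  qed (rule that | assumption)+
  obtain F2 where F2: "\<And>z. z \<in> D \<Longrightarrow> has_grad F2 (- p z * q z / wt (p z) (q z)) (1 + (1 - (q z)\<^sup>2) / wt (p z) (q z)) z"
  proof (rule closed_form_primitive[OF D(1,2) L(2) L(3)])
    show "continuous_on D (\<lambda>z. (- r z * q z * (1 - (q z)\<^sup>2) - p z * s z * (1 - (p z)\<^sup>2)) / wt (p z) (q z) ^ 3)"
      "continuous_on D (\<lambda>z. (- t z * p z * (1 - (p z)\<^sup>2) - q z * s z * (1 - (q z)\<^sup>2)) / wt (p z) (q z) ^ 3)"
      "continuous_on D (\<lambda>z. (- 2 * q z * t z * (wt (p z) (q z))\<^sup>2 + (1 - (q z)\<^sup>2) * (p z * s z + q z * t z)) / wt (p z) (q z) ^ 3)"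
      by (intro continuous_intros continuous_on_subset[OF c(2) D(3)] continuous_on_subset[OF c(3) D(3)]
          continuous_on_subset[OF c(4) D(3)] continuous_on_subset[OF c(5) D(3)] continuous_on_subset[OF c(6) D(3)] ballI;
          use w in simp)+
  qed (rule that | assumption)+
  show thesis
  proof (rule that)
    fix z assume z: "z \<in> D"
    have "((\<lambda>z. of_real (F1 z) + \<i> * of_real (F2 z)) has_derivative lewy (p z) (q z)) (at z)"
      using F1[OF z] F2[OF z] unfolding has_grad_def
      by (auto intro!: derivative_eq_intros simp: lewy_def fun_eq_iff complex_eq_iff)
    then show "((\<lambda>z. of_real (F1 z) + \<i> * of_real (F2 z)) has_derivative lewy (p z) (q z)) (at z)" .
  qed
qed

text \<open>The mean value theorem for the component of \<zeta> in the direction y - x, with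
  \<open>lewy_positive\<close> at the intermediate point.\<close>

lemma lewy_expansive:
  assumes "\<And>z. z \<in> closed_segment x y \<Longrightarrow> (\<zeta> has_derivative lewy (p z) (q z)) (at z)"
    and "\<And>z. z \<in> closed_segment x y \<Longrightarrow> (p z)\<^sup>2 + (q z)\<^sup>2 < 1"
  shows "(cmod (y - x))\<^sup>2 \<le> Re (cnj (y - x) * (\<zeta> y - \<zeta> x))"
proof -
  define \<gamma> where "\<gamma> = (\<lambda>t::real. x + of_real t * (y - x))"
  define \<phi> where "\<phi> = (\<lambda>t. Re (cnj (y - x) * \<zeta> (\<gamma> t)))"
  have seg: "\<gamma> t \<in> closed_segment x y" if "0 \<le> t" "t \<le> 1" for t
    using that by (auto simp: \<gamma>_def closed_segment_def scaleR_conv_of_real algebra_simps)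
  have d: "(\<phi> has_real_derivative Re (cnj (y - x) * lewy (p (\<gamma> t)) (q (\<gamma> t)) (y - x))) (at t)"
    if "0 \<le> t" "t \<le> 1" for t
  proof -
    have "(\<gamma> has_derivative (\<lambda>h. of_real h * (y - x))) (at t)"
      unfolding \<gamma>_def by (auto intro!: derivative_eq_intros)
    from has_derivative_compose[OF this assms(1)[OF seg[OF that]]]
    have "((\<lambda>t. \<zeta> (\<gamma> t)) has_derivative (\<lambda>h. lewy (p (\<gamma> t)) (q (\<gamma> t)) (of_real h * (y - x)))) (at t)" .
    moreover have "lewy P Q (of_real h * (y - x)) = of_real h * lewy P Q (y - x)" for P Q h
      using linear_scale[OF linear_lewy, of P Q h "y - x"] by (simp add: scaleR_conv_of_real)
    ultimately have "((\<lambda>t. \<zeta> (\<gamma> t)) has_derivative (\<lambda>h. of_real h * lewy (p (\<gamma> t)) (q (\<gamma> t)) (y - x))) (at t)" by simp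
    then have "(\<phi> has_derivative (\<lambda>h. Re (cnj (y - x) * (of_real h * lewy (p (\<gamma> t)) (q (\<gamma> t)) (y - x))))) (at t)"
      unfolding \<phi>_def by (intro has_derivative_Re has_derivative_mult_right)
    moreover have "(\<lambda>h. Re (cnj (y - x) * (of_real h * V))) = (*) (Re (cnj (y - x) * V))" for V
      by (rule ext) (simp add: algebra_simps)
    ultimately show ?thesis by (simp only: has_field_derivative_def)
  qed
  obtain t where t: "0 < t" "t < 1" "\<phi> 1 - \<phi> 0 = (1 - 0) * Re (cnj (y - x) * lewy (p (\<gamma> t)) (q (\<gamma> t)) (y - x))"
    using MVT2[of 0 1 \<phi> "\<lambda>t. Re (cnj (y - x) * lewy (p (\<gamma> t)) (q (\<gamma> t)) (y - x))"] d by auto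
  have "(cmod (y - x))\<^sup>2 \<le> \<phi> 1 - \<phi> 0"
    unfolding t(3) using lewy_positive[OF assms(2)[OF seg[of t]], of "y - x"] t(1,2) by simp
  also have "\<dots> = Re (cnj (y - x) * (\<zeta> y - \<zeta> x))"
    by (simp add: \<phi>_def \<gamma>_def algebra_simps)
  finally show ?thesis .
qed

lemma dist_le_if_expansive:
  assumes "(cmod (y - x))\<^sup>2 \<le> Re (cnj (y - x) * (v - u))"
  shows "cmod (y - x) \<le> cmod (v - u)"
proof (cases "y = x")
  case False
  have "(cmod (y - x))\<^sup>2 \<le> cmod (cnj (y - x) * (v - u))"
    using assms complex_Re_le_cmod order_trans by blast
  then have "cmod (y - x) * cmod (y - x) \<le> cmod (y - x) * cmod (v - u)"
    by (simp add: norm_mult power2_eq_square del: complex_cnj_diff)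
  then show ?thesis using False by simp
qed simp

lemma has_grad_Complex:
  assumes "has_grad f a b z" "has_grad g c d z"
  shows "((\<lambda>z. Complex (f z) (g z)) has_derivative (\<lambda>h. of_real (Re h) * Complex a c + of_real (Im h) * Complex b d)) (at z)"
proof -
  have "((\<lambda>z. of_real (f z) + \<i> * of_real (g z)) has_derivative (\<lambda>h. of_real (Re h) * Complex a c + of_real (Im h) * Complex b d)) (at z)"
    using assms unfolding has_grad_def
    by (auto intro!: derivative_eq_intros simp: fun_eq_iff complex_eq_iff mult.commute)
  then show ?thesis by (simp add: Complex_eq)
qed

text \<open>The conjugate of the stereographic projection of the unit normal (p,q,1)/w. Conjugation
  makes it holomorphic, and not antiholomorphic, in the Lewy coordinate.\<close>

definition gauss :: "real \<Rightarrow> real \<Rightarrow> complex" where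
  "gauss p q = Complex (p / (1 + wt p q)) (- q / (1 + wt p q))"

text \<open>A differential that is a complex multiple of that of the Lewy map is the statement that
  the Gauss map is holomorphic in this coordinate.\<close>

lemma gauss_grad:
  assumes p: "has_grad p r s z" and q: "has_grad q s t z" and 1: "(p z)\<^sup>2 + (q z)\<^sup>2 < 1"
    and pde: "(1 - (q z)\<^sup>2) * r + 2 * p z * q z * s + (1 - (p z)\<^sup>2) * t = 0"
  obtains c where "((\<lambda>z. gauss (p z) (q z)) has_derivative (\<lambda>h. c * lewy (p z) (q z) h)) (at z)"
proof -
  define w where "w = wt (p z) (q z)"
  have w: "0 < w" "w * w = 1 - p z * p z - q z * q z" using 1 by (simp_all add: w_def power2_eq_square)
  note g = has_grad_add[OF has_grad_const[of 1] wt_grad[OF p q 1], folded w_def]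
  have w0: "1 + wt (p z) (q z) \<noteq> 0" using w(1) unfolding w_def by linarith
  define gx where "gx = Complex ((r * (1 + w) * w + p z * (p z * r + q z * s)) / (w * (1 + w)\<^sup>2)) (- (s * (1 + w) * w + q z * (p z * r + q z * s)) / (w * (1 + w)\<^sup>2))"
  define gy where "gy = Complex ((s * (1 + w) * w + p z * (p z * s + q z * t)) / (w * (1 + w)\<^sup>2)) (- (t * (1 + w) * w + q z * (p z * s + q z * t)) / (w * (1 + w)\<^sup>2))"
  have e: "(a * (1 + w) - b * (0 + - c / w)) / (1 + w)\<^sup>2 = (a * (1 + w) * w + b * c) / (w * (1 + w)\<^sup>2)" for a b c
    using w(1) by (simp add: field_simps power2_eq_square)
  note P = has_grad_divide[OF p g w0, folded w_def, unfolded e]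
  note Q = has_grad_divide[OF has_grad_uminus[OF q] g w0, folded w_def, unfolded e]
  define L1 Li where "L1 = lewy (p z) (q z) 1" and "Li = lewy (p z) (q z) \<i>"
  have L1: "L1 \<noteq> 0" using lewy_eq_0[OF 1, of 1] by (auto simp: L1_def)
  \<comment> \<open>The Cauchy-Riemann equations relative to the Lewy frame; the place where the
    maximal surface equation is used.\<close>
  have key: "gx * Li = gy * L1"
  proof -
    define k where "k = w * (1 + w)\<^sup>2"
    have k: "k \<noteq> 0" using w by (simp add: k_def)
    have pde': "(1 - q z * q z) * r + 2 * p z * q z * s + (1 - p z * p z) * t = 0"
      using pde by (simp add: power2_eq_square)
    have gx: "gx = Complex (r * (1 + w) * w + p z * (p z * r + q z * s)) (- (s * (1 + w) * w + q z * (p z * r + q z * s))) / of_real k"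
      and gy: "gy = Complex (s * (1 + w) * w + p z * (p z * s + q z * t)) (- (t * (1 + w) * w + q z * (p z * s + q z * t))) / of_real k"
      by (simp_all add: gx_def gy_def k_def complex_eq_iff Re_divide_of_real Im_divide_of_real)
    have l1: "L1 = Complex (w + 1 - p z * p z) (- p z * q z) / of_real w" and li: "Li = Complex (- p z * q z) (w + 1 - q z * q z) / of_real w"
      unfolding L1_def Li_def lewy_def w_def[symmetric] unfolding power2_eq_square
      using w(1) by (simp_all add: complex_eq_iff Re_divide_of_real Im_divide_of_real field_simps)
    have "Complex (r * (1 + w) * w + p z * (p z * r + q z * s)) (- (s * (1 + w) * w + q z * (p z * r + q z * s))) * Complex (- p z * q z) (w + 1 - q z * q z)
      = Complex (s * (1 + w) * w + p z * (p z * s + q z * t)) (- (t * (1 + w) * w + q z * (p z * s + q z * t))) * Complex (w + 1 - p z * p z) (- p z * q z)"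
      unfolding complex_eq_iff complex.sel times_complex.sel
      using w(2) pde' by (intro conjI) algebra+
    then show ?thesis unfolding gx gy l1 li by simp
  qed
  have D: "((\<lambda>z. gauss (p z) (q z)) has_derivative (\<lambda>h. of_real (Re h) * gx + of_real (Im h) * gy)) (at z)"
  proof -
    have "(\<lambda>z. gauss (p z) (q z)) = (\<lambda>z. Complex (p z / (1 + wt (p z) (q z))) (- q z / (1 + wt (p z) (q z))))"
      by (simp add: gauss_def)
    moreover have "- (s * (1 + w) * w + q z * (p z * r + q z * s)) = - s * (1 + w) * w + - q z * (p z * r + q z * s)"
      "- (t * (1 + w) * w + q z * (p z * s + q z * t)) = - t * (1 + w) * w + - q z * (p z * s + q z * t)"
      by simp_all
    ultimately show ?thesis unfolding gx_def gy_def by (simp only: has_grad_Complex[OF P Q])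
  qed
  have "of_real (Re h) * gx + of_real (Im h) * gy = gx / L1 * lewy (p z) (q z) h" for h
  proof -
    have "lewy (p z) (q z) h = of_real (Re h) * L1 + of_real (Im h) * Li"
      by (simp add: L1_def Li_def lewy_def complex_eq_iff algebra_simps)
    then have "gx / L1 * lewy (p z) (q z) h = of_real (Re h) * gx + of_real (Im h) * (gx * Li / L1)"
      using L1 by (simp add: field_simps)
    also have "gx * Li / L1 = gy" unfolding key using L1 by simp
    finally show ?thesis ..
  qed
  then show thesis using that[of "gx / L1"] D by simp
qed

section \<open>Asymptotics of the ends\<close>

lemma periodic_int_on:
  fixes f :: "complex \<Rightarrow> 'a"
  assumes "\<And>z. z \<in> H \<Longrightarrow> f (z + 1) = f z" "\<And>z. z \<in> H \<longleftrightarrow> z + 1 \<in> H" "z \<in> H"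
  shows "f (z + of_int k) = f z" "z + of_int k \<in> H"
proof -
  \<comment> \<open>Encoding the domain in an option value turns a periodic function on a periodic
    set into a total periodic function.\<close>
  let ?g = "\<lambda>z. if z \<in> H then Some (f z) else None"
  have "?g (z + of_int k) = ?g z"
    by (rule periodic_int) (use assms in auto)
  then show "f (z + of_int k) = f z" "z + of_int k \<in> H" using assms(3) by (auto split: if_splits)
qed

text \<open>The map z -> exp(2 pi i z) makes f a bounded function on a punctured disc, whose
  singularity is removable. The limit is the value at the centre, and the exponential rate is the
  Lipschitz bound near the centre.\<close>

lemma periodic_holomorphic_limit:
  assumes f: "f holomorphic_on {z. C < Im z}" and per: "\<And>z. C < Im z \<Longrightarrow> f (z + 1) = f z"
    and bd: "\<And>z. C < Im z \<Longrightarrow> cmod (f z) < 1"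
  obtains l K where "cmod l < 1" "0 < K" "\<And>z. C + 1 \<le> Im z \<Longrightarrow> cmod (f z - l) \<le> K * exp (- 2 * pi * Im z)"
proof -
  define H where "H = {z. C < Im z}"
  define E where "E = (\<lambda>z. exp (2 * of_real pi * \<i> * z))"
  define R where "R = exp (- 2 * pi * C)"
  have normE: "cmod (E z) = exp (- 2 * pi * Im z)" for z by (simp add: E_def)
  have E_nz: "E z \<noteq> 0" for z by (simp add: E_def)
  have E_R: "E z \<in> ball 0 R \<longleftrightarrow> z \<in> H" for z
    by (simp add: normE R_def H_def)
  have feq: "f a = f b" if "E a = E b" "a \<in> H" for a b
  proof -
    from that(1) obtain n :: int where "2 * of_real pi * \<i> * a = 2 * of_real pi * \<i> * b + of_real (of_int (2 * n) * pi) * \<i>"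
      unfolding E_def exp_eq by blast
    then have "2 * of_real pi * \<i> * a = 2 * of_real pi * \<i> * (b + of_int n)" by (simp add: algebra_simps)
    then have ab: "a = b + of_int n" by simp
    have b: "b \<in> H" using that ab by (simp add: H_def)
    show ?thesis unfolding ab by (rule periodic_int_on(1)[of H f, OF _ _ b]) (use per in \<open>auto simp: H_def\<close>)
  qed
  \<comment> \<open>The principal logarithm jumps across a ray, but f takes the same value on all
    logarithms by periodicity.\<close>
  define L where "L = (\<lambda>\<tau>. Ln \<tau> / (2 * of_real pi * \<i>))"
  have EL: "E (L \<tau>) = \<tau>" if "\<tau> \<noteq> 0" for \<tau> using that by (simp add: E_def L_def)
  define h where "h = (\<lambda>\<tau>. f (L \<tau>))"
  have LH: "L \<tau> \<in> H" if "\<tau> \<in> ball 0 R - {0}" for \<tau> using EL[of \<tau>] E_R[of "L \<tau>"] that by auto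
  have hE: "h (E z) = f z" if "z \<in> H" for z
    unfolding h_def by (rule feq) (use EL[OF E_nz] LH[of "E z"] E_R E_nz that in auto)
  have hol: "h holomorphic_on ball 0 R - {0}"
  proof (rule holomorphic_onI)
    fix \<tau>0 :: complex assume \<tau>0: "\<tau>0 \<in> ball 0 R - {0}"
    define z0 where "z0 = L \<tau>0"
    have z0: "z0 \<in> H" "E z0 = \<tau>0" using LH[OF \<tau>0] EL \<tau>0 by (auto simp: z0_def)
    \<comment> \<open>A branch of the logarithm that is holomorphic around the chosen point,
      wherever that point lies; it induces the same function h.\<close>
    define k where "k = (\<lambda>\<tau>. f (z0 + Ln (\<tau> / \<tau>0) / (2 * of_real pi * \<i>)))"
    have Ek: "E (z0 + Ln (\<tau> / \<tau>0) / (2 * of_real pi * \<i>)) = \<tau>" if "\<tau> \<noteq> 0" for \<tau>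
    proof -
      have "E (z0 + Ln (\<tau> / \<tau>0) / (2 * of_real pi * \<i>)) = E z0 * exp (Ln (\<tau> / \<tau>0))"
        by (simp add: E_def distrib_left exp_add)
      then show ?thesis using that \<tau>0 z0 by simp
    qed
    have op: "open (ball 0 R - {0})" by (intro open_Diff) auto
    have "f field_differentiable (at z0)"
      using holomorphic_on_imp_differentiable_at[OF f] z0(1) open_halfspace_Im_gt[of C] by (simp add: H_def)
    then have fd: "f field_differentiable (at (z0 + Ln (\<tau>0 / \<tau>0) / (2 * of_real pi * \<i>)))" using \<tau>0 by simp
    have id: "(\<lambda>\<tau>. z0 + Ln (\<tau> / \<tau>0) / (2 * of_real pi * \<i>)) field_differentiable (at \<tau>0)"
      using \<tau>0 by (intro derivative_intros field_differentiable_const) (auto intro!: field_differentiable_compose[of "\<lambda>\<tau>. \<tau> / \<tau>0" _ Ln, unfolded o_def] derivative_intros field_differentiable_at_Ln)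
    have "k field_differentiable (at \<tau>0)"
      unfolding k_def using field_differentiable_compose[OF id fd] by (simp add: o_def)
    moreover have "k \<tau> = h \<tau>" if "\<tau> \<in> ball 0 R - {0}" for \<tau>
      unfolding k_def h_def
      by (rule feq) (use that Ek[of \<tau>] EL[of \<tau>] E_R[of "z0 + Ln (\<tau> / \<tau>0) / (2 * of_real pi * \<i>)"] in auto)
    ultimately have "h field_differentiable (at \<tau>0)"
      unfolding field_differentiable_def using has_field_derivative_transform_within_open[OF _ op \<tau>0, of k _ h] by blast
    then show "h field_differentiable at \<tau>0 within ball 0 R - {0}" by (rule field_differentiable_at_within)
  qed
  have hbd: "cmod (h \<tau>) < 1" if "\<tau> \<in> ball 0 R - {0}" for \<tau>
    unfolding h_def using bd LH[OF that] by (simp add: H_def)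
  have R: "0 < R" by (simp add: R_def)
  have "\<exists>g. g holomorphic_on ball 0 R \<and> (\<forall>z\<in>ball 0 R - {0}. g z = h z)"
  proof (subst holomorphic_on_extend_bounded[OF hol])
    have "\<forall>\<^sub>F z in at 0. cmod (h z) \<le> 1"
      unfolding eventually_at using R hbd by (intro exI[of _ R]) (auto simp: dist_norm less_imp_le)
    then show "\<exists>B. \<forall>\<^sub>F z in at 0. cmod (h z) \<le> B" by blast
  qed (use R in auto)
  then obtain g where g: "g holomorphic_on ball 0 R" "\<And>z. z \<in> ball 0 R - {0} \<Longrightarrow> g z = h z" by blast
  have gf: "g (E z) = f z" if "z \<in> H" for z using g(2)[of "E z"] hE[OF that] E_R E_nz that by auto
  \<comment> \<open>The strict inequality needs the maximum principle: a centre value of modulus at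
    least 1 would make g constant, against the strict bound elsewhere.\<close>
  have l: "cmod (g 0) < 1"
  proof (rule ccontr)
    assume n: "\<not> cmod (g 0) < 1"
    have "g constant_on ball 0 R"
    proof (rule maximum_modulus_principle[OF g(1), of "ball 0 R" 0])
      show "cmod (g z) \<le> cmod (g 0)" if "z \<in> ball 0 R" for z
        using g(2)[of z] hbd[of z] that n by (cases "z = 0") auto
    qed (use R in auto)
    then have "g (of_real (R / 2)) = g 0" using R unfolding constant_on_def by (auto simp: norm_of_real)
    moreover have "complex_of_real (R / 2) \<in> ball 0 R - {0}" using R by (simp add: norm_divide)
    ultimately show False using g(2) hbd n by metis
  qed
  define r where "r = R * exp (- 2 * pi)"
  have r: "0 < r" "r < R" using R by (simp_all add: r_def)
  have cb: "cball 0 r \<subseteq> ball 0 R" using r by auto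
  have "continuous_on (cball 0 r) (deriv g)"
    by (intro holomorphic_on_imp_continuous_on holomorphic_on_subset[OF holomorphic_deriv[OF g(1)] cb]) auto
  then have "bounded (deriv g ` cball 0 r)" by (intro compact_imp_bounded compact_continuous_image) auto
  then obtain K where K: "0 < K" "\<And>z. z \<in> cball 0 r \<Longrightarrow> cmod (deriv g z) \<le> K"
    unfolding bounded_pos by (metis imageI)
  show thesis
  proof (rule that[OF l K(1)])
    fix z assume z: "C + 1 \<le> Im z"
    then have zH: "z \<in> H" by (simp add: H_def)
    have "exp (- 2 * pi * Im z) \<le> r"
      unfolding r_def R_def exp_add[symmetric] using mult_left_mono[OF z, of "2 * pi"] by (simp add: algebra_simps)
    then have Er: "E z \<in> cball 0 r" by (simp add: normE)
    have "cmod (g (E z) - g 0) \<le> K * cmod (E z - 0)"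
    proof (rule field_differentiable_bound[OF convex_cball[of 0 r], where f'="deriv g"])
      show "(g has_field_derivative deriv g x) (at x within cball 0 r)" if "x \<in> cball 0 r" for x
        using holomorphic_derivI[OF g(1) open_ball, of x] that r by simp
    qed (use K Er r in auto)
    then show "cmod (f z - g 0) \<le> K * exp (- 2 * pi * Im z)" using gf[OF zH] by (simp add: normE)
  qed
qed

text \<open>Both follow from |gauss|^2 = (1-w)/(1+w); the second recovers the gradient from the
  Gauss map, so that decay can be transferred back.\<close>

lemma gauss_norm: "p\<^sup>2 + q\<^sup>2 < 1 \<Longrightarrow> cmod (gauss p q) < 1"
  and gauss_inverse: "p\<^sup>2 + q\<^sup>2 < 1 \<Longrightarrow> Complex p (- q) = 2 * gauss p q / of_real (1 + (cmod (gauss p q))\<^sup>2)"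
proof -
  assume 1: "p\<^sup>2 + q\<^sup>2 < 1"
  define w where "w = wt p q"
  have w: "0 < w" "w\<^sup>2 = 1 - p\<^sup>2 - q\<^sup>2" using 1 by (simp_all add: w_def)
  have n: "(cmod (gauss p q))\<^sup>2 = (1 - w) / (1 + w)"
  proof -
    have "(cmod (gauss p q))\<^sup>2 = (p\<^sup>2 + q\<^sup>2) / (1 + w)\<^sup>2"
      by (simp add: gauss_def cmod_power2 w_def power_divide add_divide_distrib)
    also have "p\<^sup>2 + q\<^sup>2 = (1 - w) * (1 + w)" using w(2) by (simp add: power2_eq_square algebra_simps)
    finally show ?thesis using w by (simp add: power2_eq_square)
  qed
  have "(cmod (gauss p q))\<^sup>2 < 1" unfolding n using w by simp
  then show "cmod (gauss p q) < 1" using abs_square_less_1[of "cmod (gauss p q)"] by simp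
  have "1 + (cmod (gauss p q))\<^sup>2 = 2 / (1 + w)" unfolding n using w by (simp add: field_simps)
  then show "Complex p (- q) = 2 * gauss p q / of_real (1 + (cmod (gauss p q))\<^sup>2)"
    using w by (simp add: gauss_def w_def[symmetric] complex_eq_iff Re_divide_of_real Im_divide_of_real)
qed

lemma inverse_gauss_Lipschitz:
  assumes "cmod g \<le> 1" "cmod l \<le> 1"
  shows "cmod (2 * g / of_real (1 + (cmod g)\<^sup>2) - 2 * l / of_real (1 + (cmod l)\<^sup>2)) \<le> 8 * cmod (g - l)"
proof -
  define a b where "a = 1 + (cmod g)\<^sup>2" and "b = 1 + (cmod l)\<^sup>2"
  have ab: "1 \<le> a" "1 \<le> b" "b \<le> 2" using assms(2) by (auto simp: a_def b_def power_le_one)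
  have eq: "2 * g / of_real a - 2 * l / of_real b = 2 * ((g - l) * of_real b + l * of_real (b - a)) / of_real (a * b)"
    using ab by (simp add: field_simps)
  have "cmod (2 * g / of_real a - 2 * l / of_real b) = 2 * cmod ((g - l) * of_real b + l * of_real (b - a)) / (a * b)"
  proof -
    have gen: "cmod (2 * V / of_real k) = 2 * cmod V / k" if "0 < k" for V :: complex and k :: real
      using that by (simp add: norm_divide norm_mult)
    show ?thesis unfolding eq by (rule gen) (use ab in simp)
  qed
  also have "\<dots> \<le> 2 * cmod ((g - l) * of_real b + l * of_real (b - a)) / 1"
    using ab mult_mono[of 1 a 1 b] by (intro divide_left_mono) auto
  also have "cmod ((g - l) * of_real b + l * of_real (b - a)) \<le> cmod (g - l) * 2 + 1 * (2 * cmod (g - l))"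
  proof (rule norm_triangle_le)
    have "\<bar>b - a\<bar> \<le> 2 * cmod (g - l)"
    proof -
      have "b - a = (cmod l - cmod g) * (cmod l + cmod g)" by (simp add: a_def b_def power2_eq_square algebra_simps)
      then have "\<bar>b - a\<bar> = \<bar>cmod l - cmod g\<bar> * \<bar>cmod l + cmod g\<bar>" by (simp add: abs_mult)
      also have "\<dots> \<le> cmod (g - l) * 2"
        using assms norm_triangle_ineq3[of l g] by (intro mult_mono) (auto simp: norm_minus_commute)
      finally show ?thesis by simp
    qed
    then have "cmod l * \<bar>b - a\<bar> \<le> 1 * (2 * cmod (g - l))" using assms by (intro mult_mono) auto
    moreover have "cmod (g - l) * \<bar>b\<bar> \<le> cmod (g - l) * 2" using ab by (intro mult_left_mono) auto
    ultimately show "cmod ((g - l) * of_real b) + cmod (l * of_real (b - a)) \<le> cmod (g - l) * 2 + 1 * (2 * cmod (g - l))"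
      by (simp add: norm_mult norm_of_real del: of_real_diff)
  qed
  finally show ?thesis by (simp add: a_def b_def)
qed

text \<open>Conformally, the end of the quotient of a half plane is a punctured disc: the Lewy coordinate is
  expansive, hence a proper embedding of the half plane that commutes with a translation.\<close>

lemma half_plane_end:
  assumes u: "max_graph \<Omega> u p q r s t" and H: "{z. Im z < b} \<subseteq> \<Omega>"
    and per: "\<And>z. u (z + 1) = u z" "\<And>z. p (z + 1) = p z" "\<And>z. q (z + 1) = q z"
  obtains a C Y where "\<bar>a\<bar> < 1" "0 < C" "\<And>z. Im z \<le> - Y \<Longrightarrow> \<bar>p z\<bar> + \<bar>q z - a\<bar> \<le> C / (1 + (Im z)\<^sup>2)\<^sup>2"
proof -
  define D where "D = {z. Im z < b}"
  note M = max_graphD[OF u]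
  have D: "open D" "convex D" "D \<subseteq> \<Omega>" using H open_halfspace_Im_lt[of b] convex_halfspace_Im_lt[of b] by (simp_all add: D_def)
  have pq1: "(p z)\<^sup>2 + (q z)\<^sup>2 < 1" if "z \<in> D" for z using M(5) D that by auto
  obtain \<zeta> where \<zeta>: "\<And>z. z \<in> D \<Longrightarrow> (\<zeta> has_derivative lewy (p z) (q z)) (at z)"
    by (rule lewy_primitive[OF u D]) (rule that)
  have ex: "(cmod (y - x))\<^sup>2 \<le> Re (cnj (y - x) * (\<zeta> y - \<zeta> x))" if "x \<in> D" "y \<in> D" for x y
    by (rule lewy_expansive) (use closed_segment_subset[OF that D(2)] \<zeta> pq1 in auto)
  have exd: "cmod (y - x) \<le> cmod (\<zeta> y - \<zeta> x)" if "x \<in> D" "y \<in> D" for x y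
    by (rule dist_le_if_expansive[OF ex[OF that]])
  have inj: "inj_on \<zeta> D"
  proof (rule inj_onI)
    fix x y assume "x \<in> D" "y \<in> D" "\<zeta> x = \<zeta> y"
    then show "x = y" using exd[of x y] by simp
  qed
  have D1: "z + 1 \<in> D \<longleftrightarrow> z \<in> D" for z by (simp add: D_def)
  \<comment> \<open>The translation by 1 preserves the differential of \<zeta>, so \<zeta> changes
    by a constant; expansiveness makes this period at least 1 in modulus.\<close>
  obtain P where P: "\<And>z. z \<in> D \<Longrightarrow> \<zeta> (z + 1) - \<zeta> z = P"
  proof -
    have "((\<lambda>z. \<zeta> (z + 1) - \<zeta> z) has_derivative (\<lambda>h. 0)) (at z within D)" if "z \<in> D" for z
    proof -
      have "((\<lambda>z. z + 1) has_derivative (\<lambda>h. h)) (at z)" by (auto intro!: derivative_eq_intros)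
      from has_derivative_compose[OF this \<zeta>[of "z + 1"]] D1 that
      have "((\<lambda>z. \<zeta> (z + 1)) has_derivative lewy (p z) (q z)) (at z)" by (simp add: per)
      from has_derivative_diff[OF this \<zeta>[OF that]] show ?thesis by (simp add: has_derivative_at_withinI)
    qed
    from has_derivative_zero_constant[OF D(2) this]
    obtain c where "\<forall>z\<in>D. \<zeta> (z + 1) - \<zeta> z = c" by auto
    then show thesis by (intro that[of c]) simp
  qed
  define z0 where "z0 = Complex 0 (b - 1)"
  have z0: "z0 \<in> D" by (simp add: z0_def D_def)
  have P1: "1 \<le> cmod P" using exd[of z0 "z0 + 1"] P[OF z0] D1 z0 by simp
  then have Pnz: "P \<noteq> 0" by auto
  have Pk: "\<zeta> (z + of_int k) = \<zeta> z + of_int k * P" "z + of_int k \<in> D" if "z \<in> D" for z k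
  proof -
    have "\<zeta> (z + of_int k) - of_int k * P = (\<zeta> z - 0)"
      using periodic_int_on(1)[of D "\<lambda>w. \<zeta> w - (w - z) * P" z k] P D1 that by (simp add: algebra_simps)
    then show "\<zeta> (z + of_int k) = \<zeta> z + of_int k * P" by (simp add: algebra_simps)
    show "z + of_int k \<in> D" using that by (simp add: D_def)
  qed
  have \<zeta>c: "continuous_on D \<zeta>" by (intro continuous_at_imp_continuous_on ballI has_derivative_continuous[OF \<zeta>])
  have opn: "open (\<zeta> ` S)" if "open S" "S \<subseteq> D" for S
    using invariance_of_domain[OF continuous_on_subset[OF \<zeta>c that(2)] that(1) inj_on_subset[OF inj that(2)]] .
  define Z where "Z = inv_into D \<zeta>"
  have Z: "Z (\<zeta> z) = z" if "z \<in> D" for z unfolding Z_def by (rule inv_into_f_f[OF inj that])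
  define f where "f = (\<lambda>x. gauss (p (Z x)) (q (Z x)))"
  have fhol: "\<exists>c. (f has_field_derivative c) (at (\<zeta> z))" if z: "z \<in> D" for z
  proof -
    have z\<Omega>: "z \<in> \<Omega>" using D z by auto
    have injl: "inj (lewy (p z) (q z))"
      using lewy_eq_0[OF pq1[OF z]] linear_injective_0[OF linear_lewy] by blast
    obtain L' where L': "linear L'" "\<And>x. L' (lewy (p z) (q z) x) = x" "\<And>x. lewy (p z) (q z) (L' x) = x"
      using linear_injective_isomorphism[OF linear_lewy injl] by blast
    have "(Z has_derivative L') (at (\<zeta> z))"
      by (rule has_derivative_inverse_on[where g'="\<lambda>_. L'" and f'="\<lambda>z. lewy (p z) (q z)", OF D(1) \<zeta> Z]) (use L' z in \<open>auto simp: fun_eq_iff\<close>)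
    moreover obtain c where "((\<lambda>z. gauss (p z) (q z)) has_derivative (\<lambda>h. c * lewy (p z) (q z) h)) (at z)"
      by (rule gauss_grad[OF M(3)[OF z\<Omega>] M(4)[OF z\<Omega>] M(5)[OF z\<Omega>] M(6)[OF z\<Omega>]]) (rule that)
    ultimately have "(f has_derivative (\<lambda>h. c * lewy (p z) (q z) (L' h))) (at (\<zeta> z))"
      unfolding f_def using has_derivative_compose[of Z L' "\<zeta> z" UNIV "\<lambda>z. gauss (p z) (q z)"] Z[OF z] by simp
    then show ?thesis using L' by (auto simp: has_field_derivative_def)
  qed
  \<comment> \<open>Retreating by 1 keeps the boundary line \<open>Im z = b1\<close> inside the
    domain, so limits of points of \<open>D'\<close> are still points where \<zeta> is
    defined.\<close>
  define b1 where "b1 = b - 1"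
  define D' where "D' = {z. Im z < b1}"
  have D': "D' \<subseteq> D" "open D'" using open_halfspace_Im_lt[of b1] by (auto simp: D'_def D_def b1_def)
  \<comment> \<open>The height in the Lewy coordinate, rescaled to have period 1; it is invariant
    under integer translations.\<close>
  define N where "N = (\<lambda>z. Im (\<zeta> z / P))"
  have Nk: "N (z + of_int k) = N z" if "z \<in> D" for z k
    unfolding N_def Pk(1)[OF that] using Pnz by (simp add: add_divide_distrib)
  obtain C0 where C0: "\<And>z. Im z = b1 \<Longrightarrow> \<bar>N z\<bar> \<le> C0"
  proof -
    define sg where "sg = closed_segment (Complex 0 b1) (Complex 1 b1)"
    have sgI: "z \<in> sg" if "0 \<le> Re z" "Re z \<le> 1" "Im z = b1" for z
      unfolding sg_def closed_segment_def using that by (auto intro!: exI[of _ "Re z"] simp: complex_eq_iff algebra_simps)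
    have sgD: "sg \<subseteq> D" unfolding sg_def by (rule closed_segment_subset[OF _ _ D(2)]) (auto simp: D_def b1_def)
    have "continuous_on sg N" unfolding N_def using Pnz
      by (intro continuous_intros continuous_on_subset[OF \<zeta>c sgD]) auto
    then have "bounded (N ` sg)" unfolding sg_def by (intro compact_imp_bounded compact_continuous_image) auto
    then obtain C where C: "\<And>z. z \<in> sg \<Longrightarrow> \<bar>N z\<bar> \<le> C" unfolding bounded_iff by (metis imageI real_norm_def)
    show thesis
    proof (rule that)
      fix z assume z: "Im z = b1"
      obtain k where k: "0 \<le> Re (z + of_int k)" "Re (z + of_int k) \<le> 1" "Im (z + of_int k) = Im z"
        by (rule periodic_reduce)
      have "\<bar>N (z + of_int k)\<bar> \<le> C" by (rule C[OF sgI]) (use k z in auto)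
      then show "\<bar>N z\<bar> \<le> C" using Nk[of z k] z by (simp add: D_def b1_def)
    qed
  qed
  \<comment> \<open>After an integer shift the real part of the rescaled displacement lies in the
    unit interval, so the expansion of distances must go into the height.\<close>
  have grow: "(b1 - Im z) / cmod P - 1 - \<bar>N z0\<bar> \<le> \<bar>N z\<bar>" if z: "z \<in> D" for z
  proof -
    define X where "X = (\<zeta> z - \<zeta> z0) / P"
    define k where "k = - \<lfloor>Re X\<rfloor>"
    have zk: "\<zeta> (z + of_int k) - \<zeta> z0 = P * (X + of_int k)" unfolding Pk(1)[OF z] X_def using Pnz by (simp add: field_simps)
    have "b1 - Im z \<le> cmod (z + of_int k - z0)"
      using abs_Im_le_cmod[of "z + of_int k - z0"] by (simp add: z0_def b1_def)
    also have "\<dots> \<le> cmod (P * (X + of_int k))" using exd[OF z0 Pk(2)[OF z]] zk by metis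
    also have "\<dots> \<le> cmod P * (1 + \<bar>Im X\<bar>)"
    proof -
      have "cmod (X + of_int k) \<le> \<bar>Re (X + of_int k)\<bar> + \<bar>Im (X + of_int k)\<bar>" by (rule cmod_le)
      also have "\<bar>Re (X + of_int k)\<bar> \<le> 1" by (simp add: k_def) linarith
      finally show ?thesis unfolding norm_mult by (intro mult_left_mono) auto
    qed
    finally have "(b1 - Im z) / cmod P \<le> 1 + \<bar>Im X\<bar>" using P1 by (simp add: divide_le_eq mult.commute)
    moreover have "Im X = N z - N z0" by (simp add: X_def N_def diff_divide_distrib)
    ultimately show ?thesis by linarith
  qed
  define C where "C = max C0 0"
  define Y2 where "Y2 = \<bar>b1\<bar> + cmod P * (C + 3 + \<bar>N z0\<bar>)"
  have far: "C + 1 < \<bar>N z\<bar>" "z \<in> D'" if "Im z < - Y2" for z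
  proof -
    have "0 \<le> cmod P * (C + 3 + \<bar>N z0\<bar>)" unfolding C_def by (intro mult_nonneg_nonneg add_nonneg_nonneg) auto
    then have zb: "Im z < b1" using that unfolding Y2_def by linarith
    then show "z \<in> D'" by (simp add: D'_def)
    then have zD: "z \<in> D" using D' by auto
    have "cmod P * (C + 3 + \<bar>N z0\<bar>) \<le> b1 - Im z" using that unfolding Y2_def by linarith
    then have "C + 3 + \<bar>N z0\<bar> \<le> (b1 - Im z) / cmod P" using P1 Pnz by (simp add: le_divide_eq mult.commute)
    then show "C + 1 < \<bar>N z\<bar>" using grow[OF zD] by linarith
  qed
  define W where "W = {z. Im z < - Y2}"
  have WD: "W \<subseteq> D" using far(2) D' by (auto simp: W_def)
  \<comment> \<open>It is not known beforehand whether the end goes up or down in the Lewy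
    coordinate; as N does not vanish far out, connectedness fixes one sign.\<close>
  obtain \<sigma> :: real where \<sigma>: "\<sigma> = 1 \<or> \<sigma> = -1" "\<And>z. z \<in> W \<Longrightarrow> C + 1 < \<sigma> * N z"
  proof -
    have Wc: "connected W" unfolding W_def by (intro convex_connected convex_halfspace_Im_lt)
    have "continuous_on W N" unfolding N_def using Pnz
      by (intro continuous_intros continuous_on_subset[OF \<zeta>c WD]) auto
    then have cN: "connected (N ` W)" using Wc by (rule connected_continuous_image)
    have n0: "N z \<noteq> 0" if "z \<in> W" for z using far(1)[of z] that by (auto simp: W_def C_def)
    have "(\<forall>z\<in>W. 0 < N z) \<or> (\<forall>z\<in>W. N z < 0)"
    proof (rule ccontr)
      assume "\<not> ?thesis"
      then obtain x y where "x \<in> W" "y \<in> W" "N x \<le> 0" "0 \<le> N y" by (auto simp: not_less)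
      then have "0 \<in> N ` W" using connectedD_interval[OF cN, of "N x" "N y" 0] by auto
      then show False using n0 by auto
    qed
    then show thesis
    proof
      assume "\<forall>z\<in>W. 0 < N z"
      then show thesis using far(1) by (intro that[of 1]) (force simp: W_def)+
    next
      assume "\<forall>z\<in>W. N z < 0"
      then show thesis using far(1) by (intro that[of "-1"]) (force simp: W_def)+
    qed
  qed
  define X where "X = {x. C < \<sigma> * Im (x / P)}"
  \<comment> \<open>Properness. At a frontier point of the image inside the half plane,
    expansiveness makes the preimages of an approximating sequence Cauchy. Their limit lies in
    \<open>D'\<close> or on the line \<open>Im z = b1\<close>; the latter is excluded because there
    |N| <= C.\<close>
  have XD: "X \<subseteq> \<zeta> ` D'"
  proof (rule ccontr)
    assume n: "\<not> X \<subseteq> \<zeta> ` D'"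
    have Xc: "connected X"
    proof (rule convex_connected)
      have "X = (\<lambda>x. \<sigma> * Im (x / P)) -` {C<..}" by (auto simp: X_def)
      moreover have "linear (\<lambda>x. \<sigma> * Im (x / P))"
        unfolding divide_inverse
        by (rule linearI) (simp_all only: distrib_right distrib_left mult_scaleR_left plus_complex.sel scaleR_complex.sel mult.left_commute real_scaleR_def)
      ultimately show "convex X" by (simp add: convex_linear_vimage)
    qed
    define y where "y = Complex 0 (- Y2 - 1)"
    have y: "y \<in> W" by (simp add: y_def W_def)
    then have "\<zeta> y \<in> X \<inter> \<zeta> ` D'" using \<sigma>(2)[OF y] far(2)[of y] by (auto simp: X_def N_def W_def)
    with n Xc have "X \<inter> frontier (\<zeta> ` D') \<noteq> {}" by (intro connected_Int_frontier) auto
    then obtain x where x: "x \<in> X" "x \<in> frontier (\<zeta> ` D')" by blast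
    have xc: "x \<in> closure (\<zeta> ` D')" "x \<notin> \<zeta> ` D'"
      using x(2) opn[OF D'(2,1)] by (auto simp: frontier_def interior_open)
    obtain yn where yn: "\<And>n. yn n \<in> \<zeta> ` D'" "yn \<longlonglongrightarrow> x" using xc(1) unfolding closure_sequential by blast
    define zn where "zn = (\<lambda>n. Z (yn n))"
    have zn: "zn n \<in> D'" "yn n = \<zeta> (zn n)" for n
      using yn(1)[of n] Z D'(1) by (auto simp: zn_def)
    have "Cauchy zn"
      unfolding Cauchy_def
    proof (intro allI impI)
      fix e :: real assume "0 < e"
      then obtain n0 where n0: "\<forall>m\<ge>n0. \<forall>n\<ge>n0. dist (yn m) (yn n) < e"
        using LIMSEQ_imp_Cauchy[OF yn(2)] unfolding Cauchy_def by blast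
      have "dist (zn m) (zn n) \<le> dist (yn m) (yn n)" for m n
        using exd[of "zn n" "zn m"] zn(1)[of m] zn(1)[of n] D'(1) unfolding dist_norm zn(2) by blast
      then have "\<forall>m\<ge>n0. \<forall>n\<ge>n0. dist (zn m) (zn n) < e"
        using n0 by (blast intro: order.strict_trans1)
      then show "\<exists>M. \<forall>m\<ge>M. \<forall>n\<ge>M. dist (zn m) (zn n) < e" by blast
    qed
    then obtain zl where zl: "zn \<longlonglongrightarrow> zl" using Cauchy_convergent convergent_def by blast
    have "Im zl \<le> b1"
      by (rule LIMSEQ_le_const2[OF tendsto_Im[OF zl]]) (use zn(1) in \<open>auto simp: D'_def intro: less_imp_le\<close>)
    then have zlD: "zl \<in> D" by (simp add: D_def b1_def)
    have "isCont \<zeta> zl" using \<zeta>[OF zlD] by (rule has_derivative_continuous)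
    then have "(\<lambda>n. \<zeta> (zn n)) \<longlonglongrightarrow> \<zeta> zl" using zl by (rule isCont_tendsto_compose)
    then have "yn \<longlonglongrightarrow> \<zeta> zl" by (simp flip: zn(2))
    then have "\<zeta> zl = x" using yn(2) by (rule LIMSEQ_unique)
    moreover have "Im zl \<noteq> b1" 
    proof
      assume "Im zl = b1"
      then have "\<bar>N zl\<bar> \<le> C" using C0 by (auto simp: C_def le_max_iff_disj)
      moreover have "C < \<sigma> * N zl" using x(1) \<open>\<zeta> zl = x\<close> by (simp add: X_def N_def)
      ultimately show False using \<sigma>(1) by auto
    qed
    ultimately show False using xc(2) \<open>Im zl \<le> b1\<close> by (auto simp: D'_def)
  qed
  \<comment> \<open>The Gauss map in the Lewy coordinate, turned and rescaled so that the end is an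
    upper half plane with period 1.\<close>
  define F where "F = (\<lambda>x. f (of_real \<sigma> * P * x))"
  have \<sigma>\<sigma>: "\<sigma> * \<sigma> = 1" using \<sigma>(1) by auto
  have inX: "of_real \<sigma> * P * x \<in> X" if "C < Im x" for x
  proof -
    have "\<sigma> * Im (of_real \<sigma> * P * x / P) = \<sigma> * \<sigma> * Im x" using Pnz by simp
    then show ?thesis using that \<sigma>\<sigma> by (simp add: X_def)
  qed
  have Fhol: "F holomorphic_on {x. C < Im x}"
  proof (rule holomorphic_onI)
    fix x assume x: "x \<in> {x. C < Im x}"
    then obtain z where z: "z \<in> D" "\<zeta> z = of_real \<sigma> * P * x" using inX XD D' by (metis imageE mem_Collect_eq subsetD)
    obtain c where "(f has_field_derivative c) (at (of_real \<sigma> * P * x))" using fhol[OF z(1)] z(2) by auto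
    then have "(F has_field_derivative c * (of_real \<sigma> * P)) (at x)"
      unfolding F_def by (rule DERIV_chain2) (auto intro!: derivative_eq_intros)
    then show "F field_differentiable at x within {x. C < Im x}"
      using field_differentiable_at_within field_differentiable_def by blast
  qed
  have Fz: "F (of_real \<sigma> * \<zeta> z / P) = gauss (p z) (q z)" if "z \<in> D" for z
  proof -
    have "of_real \<sigma> * P * (of_real \<sigma> * \<zeta> z / P) = of_real (\<sigma> * \<sigma>) * \<zeta> z" using Pnz by simp
    then show ?thesis using Z[OF that] \<sigma>\<sigma> by (simp add: F_def f_def)
  qed
  have Fx: "\<exists>z\<in>D. x = of_real \<sigma> * \<zeta> z / P" if x: "C < Im x" for x
  proof -
    obtain z where z: "z \<in> D" "\<zeta> z = of_real \<sigma> * P * x" using inX[OF x] XD D' by (metis imageE subsetD)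
    have "of_real \<sigma> * \<zeta> z / P = of_real (\<sigma> * \<sigma>) * x" using z(2) Pnz by simp
    then show ?thesis using z(1) \<sigma>\<sigma> by (intro bexI[of _ z]) auto
  qed
  have Fper: "F (x + 1) = F x" if x: "C < Im x" for x
  proof -
    obtain z where z: "z \<in> D" "x = of_real \<sigma> * \<zeta> z / P" using Fx[OF x] by blast
    show ?thesis using \<sigma>(1)
    proof
      assume s: "\<sigma> = 1"
      have "x + 1 = of_real \<sigma> * \<zeta> (z + 1) / P" using P[OF z(1)] z(2) s Pnz by (simp add: field_simps)
      then show ?thesis using Fz[of "z + 1"] Fz[OF z(1)] D1 z per by simp
    next
      \<comment> \<open>With the orientation reversed, translation by 1 in the normalized coordinate
        is translation by -1 of the graph.\<close>
      assume s: "\<sigma> = - 1"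
      have z1: "z - 1 \<in> D" using D1[of "z - 1"] z by simp
      have \<zeta>z: "\<zeta> z = \<zeta> (z - 1) + P" using P[OF z1] by (simp add: algebra_simps)
      have "x + 1 = of_real \<sigma> * \<zeta> (z - 1) / P"
        unfolding z(2) \<zeta>z s using Pnz by (simp add: add_divide_distrib diff_divide_distrib)
      then show ?thesis using Fz[OF z1] Fz[OF z(1)] z per(2)[of "z - 1"] per(3)[of "z - 1"] by simp
    qed
  qed
  have Fbd: "cmod (F x) < 1" if "C < Im x" for x
    using Fx[OF that] Fz gauss_norm[OF pq1] by auto
  obtain l K where l: "cmod l < 1" "0 < K" "\<And>x. C + 1 \<le> Im x \<Longrightarrow> cmod (F x - l) \<le> K * exp (- 2 * pi * Im x)"
    by (rule periodic_holomorphic_limit[OF Fhol Fper Fbd]) (simp_all add: that)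
  define v where "v = 2 * l / of_real (1 + (cmod l)\<^sup>2)"
  define c where "c = 2 * pi / cmod P"
  have cpos: "0 < c" using Pnz by (simp add: c_def)
  define K1 where "K1 = 8 * K * exp (2 * pi * (1 + \<bar>N z0\<bar> + \<bar>b1\<bar> / cmod P))"
  have K1: "0 < K1" using l by (simp add: K1_def)
  have dec: "cmod (Complex (p z) (- q z) - v) \<le> K1 * exp (c * Im z)" if z: "z \<in> W" for z
  proof -
    have zD: "z \<in> D" using z WD by auto
    have N1: "C + 1 \<le> \<sigma> * N z" using \<sigma>(2)[OF z] by simp
    have im: "Im (of_real \<sigma> * \<zeta> z / P) = \<sigma> * N z" by (simp add: N_def flip: times_divide_eq_right)
    have "cmod (Complex (p z) (- q z) - v) \<le> 8 * cmod (gauss (p z) (q z) - l)"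
      unfolding v_def gauss_inverse[OF pq1[OF zD]]
      using gauss_norm[OF pq1[OF zD]] l by (intro inverse_gauss_Lipschitz) auto
    also have "\<dots> \<le> 8 * (K * exp (- 2 * pi * (\<sigma> * N z)))"
      using l(3)[of "of_real \<sigma> * \<zeta> z / P"] N1 unfolding im Fz[OF zD] by simp
    also have "exp (- 2 * pi * (\<sigma> * N z)) \<le> exp (2 * pi * (1 + \<bar>N z0\<bar> + \<bar>b1\<bar> / cmod P)) * exp (c * Im z)"
    proof -
      have "(b1 - Im z) / cmod P - 1 - \<bar>N z0\<bar> \<le> \<sigma> * N z"
        using grow[OF zD] N1 \<sigma>(1) unfolding C_def by auto
      moreover have "- (\<bar>b1\<bar> / cmod P) - Im z / cmod P \<le> (b1 - Im z) / cmod P"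
      proof -
        have "- \<bar>b1\<bar> / cmod P \<le> b1 / cmod P" by (rule divide_right_mono) auto
        then show ?thesis unfolding diff_divide_distrib by simp
      qed
      ultimately have "- (\<sigma> * N z) \<le> (1 + \<bar>N z0\<bar> + \<bar>b1\<bar> / cmod P) + Im z / cmod P" by linarith
      from mult_left_mono[OF this, of "2 * pi"]
      have "- 2 * pi * (\<sigma> * N z) \<le> 2 * pi * (1 + \<bar>N z0\<bar> + \<bar>b1\<bar> / cmod P) + c * Im z"
        by (simp add: c_def algebra_simps)
      then show ?thesis by (simp add: exp_add[symmetric])
    qed
    finally show ?thesis using l(2) by (simp add: K1_def mult_left_mono mult.assoc)
  qed
  have tend0: "((\<lambda>y. K1 * exp (c * y)) \<longlongrightarrow> 0) at_bot" using cpos by real_asymp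
  \<comment> \<open>On each period u returns to its value, so its horizontal derivative vanishes
    somewhere on every line far out, and its limit is 0.\<close>
  have Rev: "Re v = 0"
  proof (rule ccontr)
    assume "Re v \<noteq> 0"
    then have "\<forall>\<^sub>F y in at_bot. K1 * exp (c * y) < \<bar>Re v\<bar>" using order_tendstoD(2)[OF tend0] by simp
    moreover have "\<forall>\<^sub>F y in at_bot. y < - Y2" by (rule eventually_gt_at_bot)
    ultimately have "\<forall>\<^sub>F y in at_bot. K1 * exp (c * y) < \<bar>Re v\<bar> \<and> y < - Y2" by eventually_elim simp
    then obtain y where y: "K1 * exp (c * y) < \<bar>Re v\<bar>" "y < - Y2" using eventually_happens by force
    have d: "((\<lambda>x. u (Complex x y)) has_real_derivative p (Complex x y)) (at x)" for x
    proof (rule has_grad_Re_line[OF M(2)])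
      have "Complex x y \<in> W" using y by (simp add: W_def)
      then show "Complex x y \<in> \<Omega>" using WD D by blast
    qed
    obtain x where x: "0 < x" "x < 1" "u (Complex 1 y) - u (Complex 0 y) = (1 - 0) * p (Complex x y)"
      using MVT2[of 0 1 "\<lambda>x. u (Complex x y)" "\<lambda>x. p (Complex x y)"] d by auto
    have "Complex 0 y + 1 = Complex 1 y" by (simp add: complex_eq_iff)
    then have "p (Complex x y) = 0" using x(3) per(1)[of "Complex 0 y"] by simp
    then have "\<bar>Re v\<bar> \<le> K1 * exp (c * y)"
      using dec[of "Complex x y"] abs_Re_le_cmod[of "Complex (p (Complex x y)) (- q (Complex x y)) - v"] y by (simp add: W_def)
    then show False using y by simp
  qed
  define a where "a = - Im v"
  have "cmod v < 1"
  proof -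
    have "0 < (1 - cmod l)\<^sup>2" using l by simp
    then have "2 * cmod l < 1 + (cmod l)\<^sup>2" by (simp add: power2_eq_square algebra_simps)
    moreover have "0 < 1 + (cmod l)\<^sup>2" by (simp add: add_pos_nonneg)
    moreover have "cmod v = 2 * cmod l / (1 + (cmod l)\<^sup>2)"
      unfolding v_def norm_divide norm_of_real norm_mult using \<open>0 < 1 + (cmod l)\<^sup>2\<close> by simp
    ultimately show ?thesis by simp
  qed
  then have a1: "\<bar>a\<bar> < 1" using abs_Im_le_cmod[of v] by (simp add: a_def)
  \<comment> \<open>The exponential decay is weakened to the power required by
    \<open>cyl_graph\<close>.\<close>
  have "((\<lambda>y. exp (c * y) * (1 + y\<^sup>2)\<^sup>2) \<longlongrightarrow> 0) at_bot" using cpos by real_asymp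
  then have "\<forall>\<^sub>F y in at_bot. exp (c * y) * (1 + y\<^sup>2)\<^sup>2 < 1" by (rule order_tendstoD) simp
  then obtain Y3 where Y3: "\<And>y. y \<le> Y3 \<Longrightarrow> exp (c * y) * (1 + y\<^sup>2)\<^sup>2 < 1"
    unfolding eventually_at_bot_linorder by blast
  show thesis
  proof (rule that[OF a1, of "2 * K1" "max (Y2 + 1) (- Y3)"])
    show "0 < 2 * K1" using K1 by simp
    fix z assume z: "Im z \<le> - max (Y2 + 1) (- Y3)"
    then have zW: "z \<in> W" and z3: "Im z \<le> Y3" by (auto simp: W_def)
    have y1: "0 < (1 + (Im z)\<^sup>2)\<^sup>2" by (intro zero_less_power add_pos_nonneg) auto
    have "exp (c * Im z) \<le> 1 / (1 + (Im z)\<^sup>2)\<^sup>2" using Y3[OF z3] y1 by (simp add: pos_le_divide_eq)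
    then have "K1 * exp (c * Im z) \<le> K1 * (1 / (1 + (Im z)\<^sup>2)\<^sup>2)" using K1 by (intro mult_left_mono) auto
    then have d: "cmod (Complex (p z) (- q z) - v) \<le> K1 / (1 + (Im z)\<^sup>2)\<^sup>2" using dec[OF zW] by simp
    have "\<bar>p z\<bar> \<le> cmod (Complex (p z) (- q z) - v)" "\<bar>q z - a\<bar> \<le> cmod (Complex (p z) (- q z) - v)"
      using abs_Re_le_cmod[of "Complex (p z) (- q z) - v"] abs_Im_le_cmod[of "Complex (p z) (- q z) - v"] Rev
      by (simp_all add: a_def abs_minus_commute)
    then have "\<bar>p z\<bar> + \<bar>q z - a\<bar> \<le> 2 * (K1 / (1 + (Im z)\<^sup>2)\<^sup>2)" using d by linarith
    then show "\<bar>p z\<bar> + \<bar>q z - a\<bar> \<le> 2 * K1 / (1 + (Im z)\<^sup>2)\<^sup>2" by simp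
  qed
qed

section \<open>Graphs in the quotient\<close>

definition pt :: "complex \<Rightarrow> real \<Rightarrow> real^3" where "pt z h = vector [Re z, Im z, h]"

definition hor :: "real^3 \<Rightarrow> complex" where "hor v = Complex (v$1) (v$2)"

definition pr :: "complex \<Rightarrow> real \<Rightarrow> l3quot" where "pr z h = proj (pt z h)"

definition uf :: "l3quot set \<Rightarrow> complex \<Rightarrow> real" where "uf S z = graph_fun S (pr z 0)"

lemma pt_nth [simp]: "pt z h $ 1 = Re z" "pt z h $ 2 = Im z" "pt z h $ 3 = h"
  by (simp_all add: pt_def)

lemma hor_pt [simp]: "hor (pt z h) = z" and pt_hor: "pt (hor v) (v$3) = v"
  by (simp_all add: hor_def vec_eq_iff forall_3 complex_eq_iff)

lemma proj_eq_pr: "proj v = pr (hor v) (v$3)"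
  by (simp add: pr_def pt_hor)

lemma pr_eq_iff: "pr z h = pr z' h' \<longleftrightarrow> h = h' \<and> (\<exists>k::int. z' = z + of_int k)"
  unfolding pr_def l3quot.abs_eq_iff by (auto simp: vec_eq_iff forall_3 complex_eq_iff)

lemma pr_cases: obtains z h where "q = pr z h"
  using proj_eq_pr[of "rep_l3quot q"] Quotient3_abs_rep[OF Quotient3_l3quot, of q] by metis

lemma vshift_pr: "vshift (pr z h) t = pr z (h + t)"
proof -
  have "pt z h + vector [0, 0, t] = pt z (h + t)" by (simp add: vec_eq_iff forall_3)
  then show ?thesis by (simp add: pr_def vshift.abs_eq)
qed

lemma x2_pr [simp]: "x2 (pr z h) = Im z" and x3_pr [simp]: "x3 (pr z h) = h"
  by (simp_all add: pr_def x2.abs_eq x3.abs_eq)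

lemma pr_in_cylinder: "pr z h \<in> cylinder \<longleftrightarrow> h = 0"
  by (simp add: cylinder_def)

lemma continuous_proj: "continuous_on A proj"
proof -
  have "continuous_on UNIV proj"
    by (simp add: continuous_on_open_vimage open_l3quot_def)
  then show ?thesis by (rule continuous_on_subset) simp
qed

text \<open>The preimage of the image is the union of the integer translates, as for every quotient
  by a group acting by homeomorphisms.\<close>

lemma open_proj_image:
  assumes "open T" shows "open (proj ` T)"
proof -
  have "proj -` (proj ` T) = (\<Union>k::int. (\<lambda>v. v + vector [of_int k, 0, 0]) -` T)"
  proof (intro set_eqI iffI)
    fix x assume "x \<in> proj -` (proj ` T)"
    then obtain v where "v \<in> T" "proj x = proj v" by auto
    then show "x \<in> (\<Union>k::int. (\<lambda>v. v + vector [of_int k, 0, 0]) -` T)" by (auto simp: l3quot.abs_eq_iff)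
  next
    fix x assume "x \<in> (\<Union>k::int. (\<lambda>v. v + vector [of_int k, 0, 0]) -` T)"
    then obtain k :: int where "x + vector [of_int k, 0, 0] \<in> T" by auto
    moreover have "proj x = proj (x + vector [of_int k, 0, 0])" by (auto simp: l3quot.abs_eq_iff)
    ultimately show "x \<in> proj -` (proj ` T)" by auto
  qed
  moreover have "open ((\<lambda>v. v + vector [of_int k, 0, 0]) -` T)" for k :: int
    by (rule open_vimage[OF assms]) (intro continuous_intros)
  ultimately show ?thesis by (simp add: open_l3quot_def open_UN)
qed

lemma continuous_hor: "continuous_on A hor"
  unfolding hor_def Complex_eq by (intro continuous_intros)

lemma continuous_nth3: "continuous_on A (\<lambda>v::real^3. v$i)"
  by (intro continuous_intros)

lemma continuous_on_pt:
  assumes "continuous_on A f" "continuous_on A g" shows "continuous_on A (\<lambda>x. pt (f x) (g x))"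
proof -
  have "pt z h = Re z *\<^sub>R axis 1 1 + Im z *\<^sub>R axis 2 1 + h *\<^sub>R axis 3 1" for z h
    by (simp add: vec_eq_iff forall_3 axis_def)
  then show ?thesis using assms by (simp add: continuous_intros)
qed

lemma continuous_on_pr:
  assumes "continuous_on A f" "continuous_on A g" shows "continuous_on A (\<lambda>x. pr (f x) (g x))"
  unfolding pr_def by (rule continuous_on_compose2[OF continuous_proj continuous_on_pt[OF assms]]) auto

lemma graph_iff:
  assumes "graph_over_cylinder S" shows "pr z h \<in> S \<longleftrightarrow> h = uf S z"
proof -
  have "\<exists>!t. vshift (pr z 0) t \<in> S" using assms by (simp add: graph_over_cylinder_def pr_in_cylinder)
  then have ex: "\<exists>!t. pr z t \<in> S" by (simp add: vshift_pr)
  have "uf S z = (THE t. pr z t \<in> S)" by (simp add: uf_def graph_fun_def vshift_pr)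
  then show ?thesis using theI'[OF ex] ex by auto
qed

lemma graph_mem: "graph_over_cylinder S \<Longrightarrow> pr z (uf S z) \<in> S"
  by (simp add: graph_iff)

lemma uf_periodic: "uf S (z + 1) = uf S z"
proof -
  have "pr (z + 1) 0 = pr z 0" unfolding pr_eq_iff by (auto intro!: exI[of _ "-1"])
  then show ?thesis by (simp add: uf_def)
qed

lemma int_shift_unique:
  fixes z z' :: complex
  assumes "z' = z + of_int k" "\<bar>Re z - x\<bar> < 1/4" "\<bar>Re z' - x\<bar> < 1/4"
  shows "z' = z"
proof -
  have "Re z' = Re z + of_int k" using assms(1) by simp
  then have "real_of_int k < 1" "- 1 < real_of_int k" using assms(2,3) by linarith+
  then have "k = 0" by linarith
  then show ?thesis using assms by simp
qed

text \<open>Being a graph says nothing about continuity; it comes from invariance of domain. A chart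
  of the surface restricted to a small box and followed by the horizontal projection is continuous
  and injective, hence open, so all points near \<open>z0\<close> have their heights in the
  box.\<close>

lemma continuous_uf:
  assumes S: "graph_over_cylinder S" "topological_surface S"
  shows "continuous_on UNIV (uf S)"
proof -
  have "\<exists>N. open N \<and> z0 \<in> N \<and> (\<forall>z\<in>N. \<bar>uf S z - uf S z0\<bar> < e)" if e: "0 < e" for z0 e
  proof -
    define u0 where "u0 = uf S z0"
    obtain V where V: "pr z0 u0 \<in> V" "openin (top_of_set S) V" "V homeomorphic (ball 0 1 :: complex set)"
      using S(2) graph_mem[OF S(1), of z0] unfolding topological_surface_def u0_def by blast
    obtain f g where fg: "homeomorphism V (ball 0 1 :: complex set) f g"
      using V(3) unfolding homeomorphic_def by blast
    have VS: "V \<subseteq> S" using V(2) openin_imp_subset by blast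
    \<comment> \<open>The box is narrower than the period, so each point of its image has exactly
      one lift in it and the projection \<open>r\<close> is well defined.\<close>
    define T where "T = {v::real^3. \<bar>v$1 - Re z0\<bar> < 1/4 \<and> \<bar>v$3 - u0\<bar> < e}"
    have "open T" unfolding T_def by (intro open_Collect_conj open_Collect_less continuous_intros)
    define r where "r = (\<lambda>q. THE z. \<bar>Re z - Re z0\<bar> < 1/4 \<and> (\<exists>h. q = pr z h))"
    have r: "r (proj v) = hor v" if "v \<in> T" for v
      unfolding r_def
    proof (rule the_equality)
      show "\<bar>Re (hor v) - Re z0\<bar> < 1/4 \<and> (\<exists>h. proj v = pr (hor v) h)"
        using that by (auto simp: T_def hor_def proj_eq_pr)
      show "z = hor v" if "\<bar>Re z - Re z0\<bar> < 1/4 \<and> (\<exists>h. proj v = pr z h)" for z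
        using that \<open>v \<in> T\<close> int_shift_unique[of z "hor v" _ "Re z0"]
        by (auto simp: T_def hor_def proj_eq_pr pr_eq_iff)
    qed
    have opT: "open (proj ` T)" by (rule open_proj_image[OF \<open>open T\<close>])
    have rc: "continuous_on (proj ` T) r"
      unfolding continuous_on_open_vimage[OF opT]
    proof (intro allI impI)
      fix B :: "complex set" assume B: "open B"
      have "r -` B \<inter> proj ` T = proj ` (T \<inter> hor -` B)" using r by auto
      moreover have "open (T \<inter> hor -` B)"
        using \<open>open T\<close> open_vimage[OF B continuous_hor] by (rule open_Int)
      ultimately show "open (r -` B \<inter> proj ` T)" using open_proj_image by simp
    qed
    define U where "U = ball 0 1 \<inter> g -` (proj ` T)"
    have gc: "continuous_on (ball 0 1) g" and gV: "g ` ball 0 1 = V" and gi: "\<And>b. b \<in> ball 0 1 \<Longrightarrow> f (g b) = b"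
      and fV: "\<And>q. q \<in> V \<Longrightarrow> g (f q) = q \<and> f q \<in> ball 0 1"
      using fg by (auto simp: homeomorphism_def)
    have "open U" unfolding U_def by (rule continuous_open_preimage[OF gc open_ball opT])
    have kc: "continuous_on U (\<lambda>b. r (g b))"
      by (rule continuous_on_compose2[OF rc continuous_on_subset[OF gc]]) (auto simp: U_def)
    have key: "\<exists>z. r (g b) = z \<and> g b = pr z (uf S z) \<and> \<bar>uf S z - u0\<bar> < e" if bU: "b \<in> U" for b
    proof -
      obtain v where v: "v \<in> T" "g b = proj v" using bU by (auto simp: U_def)
      have "b \<in> ball 0 1" using bU by (simp add: U_def)
      then have "g b \<in> S" using gV VS by blast
      then have "v$3 = uf S (hor v)" unfolding v(2) proj_eq_pr graph_iff[OF S(1)] .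
      then show ?thesis using v r[OF v(1)] by (auto simp: T_def proj_eq_pr)
    qed
    have "inj_on (\<lambda>b. r (g b)) U"
    proof (rule inj_onI)
      fix b b' assume b: "b \<in> U" "b' \<in> U" "r (g b) = r (g b')"
      then have "g b = g b'" using key[OF b(1)] key[OF b(2)] by auto
      then have "f (g b) = f (g b')" by simp
      then show "b = b'" using gi b by (simp add: U_def)
    qed
    then have "open ((\<lambda>b. r (g b)) ` U)" by (rule invariance_of_domain[OF kc \<open>open U\<close>])
    moreover have "z0 \<in> (\<lambda>b. r (g b)) ` U"
    proof -
      have "pt z0 u0 \<in> T" using e by (simp add: T_def)
      then have "f (pr z0 u0) \<in> U" "r (g (f (pr z0 u0))) = z0"
        using fV[OF V(1)] r[of "pt z0 u0"] by (auto simp: U_def pr_def)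
      then show ?thesis by (metis imageI)
    qed
    moreover have "\<bar>uf S z - uf S z0\<bar> < e" if "z \<in> (\<lambda>b. r (g b)) ` U" for z
      using key that unfolding u0_def by blast
    ultimately show ?thesis by blast
  qed
  note nhd = this
  have "isCont (uf S) z0" for z0
    unfolding isCont_def tendsto_iff
  proof (intro allI impI)
    fix e :: real assume "0 < e"
    from nhd[OF this, of z0] obtain N where "open N" "z0 \<in> N" "\<forall>z\<in>N. \<bar>uf S z - uf S z0\<bar> < e" by blast
    then show "\<forall>\<^sub>F x in at z0. dist (uf S x) (uf S z0) < e"
      unfolding eventually_at_topological by (intro exI[of _ N]) (simp add: dist_real_def)
  qed
  then show ?thesis by (simp add: continuous_at_imp_continuous_on)
qed

section \<open>Planar changes of coordinates of class \<open>C^1\<close>\<close>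

definition C1_on :: "complex set \<Rightarrow> (complex \<Rightarrow> real) \<Rightarrow> bool" where
  "C1_on U f \<longleftrightarrow> (\<exists>a b. (\<forall>z\<in>U. has_grad f (a z) (b z) z) \<and> continuous_on U a \<and> continuous_on U b)"

lemma C1_onI: "(\<And>z. z \<in> U \<Longrightarrow> has_grad f (a z) (b z) z) \<Longrightarrow> continuous_on U a \<Longrightarrow> continuous_on U b \<Longrightarrow> C1_on U f"
  unfolding C1_on_def by blast

lemma C1_on_continuous: "C1_on U f \<Longrightarrow> continuous_on U f"
  unfolding C1_on_def using has_grad_imp_isCont by (blast intro: continuous_at_imp_continuous_on)

lemma C1_on_mult:
  assumes f: "C1_on U f" and g: "C1_on U g" shows "C1_on U (\<lambda>z. f z * g z)"
proof -
  note c = C1_on_continuous[OF f] C1_on_continuous[OF g]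
  obtain a b where 1: "\<And>z. z \<in> U \<Longrightarrow> has_grad f (a z) (b z) z" "continuous_on U a" "continuous_on U b"
    using f unfolding C1_on_def by blast
  obtain a' b' where 2: "\<And>z. z \<in> U \<Longrightarrow> has_grad g (a' z) (b' z) z" "continuous_on U a'" "continuous_on U b'"
    using g unfolding C1_on_def by blast
  show ?thesis by (rule C1_onI[OF has_grad_mult[OF 1(1) 2(1)]]) (intro continuous_intros c 1 2 | assumption)+
qed

lemma C1_on_diff:
  assumes f: "C1_on U f" and g: "C1_on U g" shows "C1_on U (\<lambda>z. f z - g z)"
proof -
  obtain a b where 1: "\<And>z. z \<in> U \<Longrightarrow> has_grad f (a z) (b z) z" "continuous_on U a" "continuous_on U b"
    using f unfolding C1_on_def by blast
  obtain a' b' where 2: "\<And>z. z \<in> U \<Longrightarrow> has_grad g (a' z) (b' z) z" "continuous_on U a'" "continuous_on U b'"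
    using g unfolding C1_on_def by blast
  show ?thesis by (rule C1_onI[OF has_grad_diff[OF 1(1) 2(1)]]) (intro continuous_intros 1 2 | assumption)+
qed

lemma C1_on_divide:
  assumes f: "C1_on U f" and g: "C1_on U g" and nz: "\<And>z. z \<in> U \<Longrightarrow> g z \<noteq> 0" shows "C1_on U (\<lambda>z. f z / g z)"
proof -
  note c = C1_on_continuous[OF f] C1_on_continuous[OF g]
  obtain a b where 1: "\<And>z. z \<in> U \<Longrightarrow> has_grad f (a z) (b z) z" "continuous_on U a" "continuous_on U b"
    using f unfolding C1_on_def by blast
  obtain a' b' where 2: "\<And>z. z \<in> U \<Longrightarrow> has_grad g (a' z) (b' z) z" "continuous_on U a'" "continuous_on U b'"
    using g unfolding C1_on_def by blast
  have "continuous_on U (\<lambda>z. (a z * g z - f z * a' z) / (g z)\<^sup>2)" "continuous_on U (\<lambda>z. (b z * g z - f z * b' z) / (g z)\<^sup>2)"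
    by (intro continuous_intros c 1 2 ballI; use nz in simp)+
  moreover have "has_grad (\<lambda>z. f z / g z) ((a z * g z - f z * a' z) / (g z)\<^sup>2) ((b z * g z - f z * b' z) / (g z)\<^sup>2) z" if "z \<in> U" for z
    by (rule has_grad_divide[OF 1(1) 2(1) nz]) (fact that)+
  ultimately show ?thesis by (rule C1_onI[rotated])
qed

text \<open>A planar change of coordinates \<open>Y = (Y1, Y2)\<close> with the partial derivatives of functions
  transformed by Cramer's rule.\<close>

lemma chart_inverse:
  assumes U: "open U" and Y1: "\<And>z. z \<in> U \<Longrightarrow> has_grad Y1 (a z) (b z) z" and Y2: "\<And>z. z \<in> U \<Longrightarrow> has_grad Y2 (c z) (d z) z"
    and J: "\<And>z. z \<in> U \<Longrightarrow> a z * d z - b z * c z \<noteq> 0"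
    and inj: "inj_on (\<lambda>z. Complex (Y1 z) (Y2 z)) U"
  obtains Z where "open ((\<lambda>z. Complex (Y1 z) (Y2 z)) ` U)"
    "\<And>z. z \<in> U \<Longrightarrow> Z (Complex (Y1 z) (Y2 z)) = z"
    "continuous_on ((\<lambda>z. Complex (Y1 z) (Y2 z)) ` U) Z"
    "\<And>z. z \<in> U \<Longrightarrow> (Z has_derivative (\<lambda>h. Complex ((d z * Re h - b z * Im h) / (a z * d z - b z * c z))
        ((a z * Im h - c z * Re h) / (a z * d z - b z * c z)))) (at (Complex (Y1 z) (Y2 z)))"
proof -
  define Y where "Y = (\<lambda>z. Complex (Y1 z) (Y2 z))"
  define D where "D = (\<lambda>z h. of_real (Re h) * Complex (a z) (c z) + of_real (Im h) * Complex (b z) (d z))"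
  define E where "E = (\<lambda>z h. Complex ((d z * Re h - b z * Im h) / (a z * d z - b z * c z)) ((a z * Im h - c z * Re h) / (a z * d z - b z * c z)))"
  have dY: "(Y has_derivative D z) (at z)" if "z \<in> U" for z
    unfolding Y_def D_def by (rule has_grad_Complex[OF Y1[OF that] Y2[OF that]])
  define Z where "Z = inv_into U Y"
  have Z: "Z (Y z) = z" if "z \<in> U" for z unfolding Z_def by (rule inv_into_f_f) (use inj that in \<open>auto simp: Y_def\<close>)
  have Yc: "continuous_on U Y" by (intro continuous_at_imp_continuous_on ballI has_derivative_continuous[OF dY])
  have op: "open (Y ` U)" using invariance_of_domain[OF Yc U] inj by (simp add: Y_def)
  have dZ: "(Z has_derivative E z) (at (Y z))" if z: "z \<in> U" for z
  proof -
    have "D z \<circ> E z = id"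
    proof
      fix h
      define j where "j = a z * d z - b z * c z"
      have j: "j \<noteq> 0" using J[OF z] by (simp add: j_def)
      have "a z * (d z * Re h - b z * Im h) + b z * (a z * Im h - c z * Re h) = j * Re h"
        "c z * (d z * Re h - b z * Im h) + d z * (a z * Im h - c z * Re h) = j * Im h"
        by (simp_all add: j_def algebra_simps)
      then have "(d z * Re h - b z * Im h) / j * a z + (a z * Im h - c z * Re h) / j * b z = Re h"
        "(d z * Re h - b z * Im h) / j * c z + (a z * Im h - c z * Re h) / j * d z = Im h"
        using j by (simp_all add: mult.commute add_divide_distrib[symmetric])
      then show "(D z \<circ> E z) h = id h" by (simp add: D_def E_def j_def[symmetric] complex_eq_iff)
    qed
    from has_derivative_inverse_on[where g'=E and f'=D, OF U dY Z this z] show ?thesis .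
  qed
  have "continuous_on (Y ` U) Z"
    by (intro continuous_at_imp_continuous_on ballI) (use dZ has_derivative_continuous in blast)
  then show thesis using that[of Z] op Z dZ unfolding Y_def E_def by blast
qed

lemma chart_grad:
  assumes Z: "(Z has_derivative (\<lambda>h. Complex ((d * Re h - b * Im h) / j) ((a * Im h - c * Re h) / j))) (at y)"
    and "Z y = z" "open W" "y \<in> W" and f: "\<And>x. x \<in> W \<Longrightarrow> f x = g (Z x)" and g: "has_grad g gs gt z"
  shows "has_grad f ((gs * d - gt * c) / j) ((gt * a - gs * b) / j) y"
proof -
  have "((\<lambda>x. g (Z x)) has_derivative (\<lambda>h. gs * ((d * Re h - b * Im h) / j) + gt * ((a * Im h - c * Re h) / j))) (at y)"
    using has_derivative_compose[OF Z, of g "\<lambda>h. gs * Re h + gt * Im h"] g assms(2) by (simp add: has_grad_def)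
  then have "has_grad (\<lambda>x. g (Z x)) ((gs * d - gt * c) / j) ((gt * a - gs * b) / j) y"
    unfolding has_grad_def by (rule has_derivative_eq_rhs) (auto simp: fun_eq_iff algebra_simps diff_divide_distrib add_divide_distrib)
  then show ?thesis
    by (rule has_grad_transform) (use assms f in \<open>auto intro!: eventually_mono[OF eventually_nhds_in_open]\<close>)
qed

text \<open>Schwarz's theorem. Patches provide the two first derivatives as separate
  \<open>C^1\<close> functions, while \<open>max_graph\<close> demands a common mixed
  derivative.\<close>

lemma mixed_partials_eq:
  assumes W: "open W" "z \<in> W" and u: "\<And>z. z \<in> W \<Longrightarrow> has_grad u (p z) (q z) z"
    and p: "\<And>z. z \<in> W \<Longrightarrow> has_grad p (r z) (s z) z" and q: "\<And>z. z \<in> W \<Longrightarrow> has_grad q (s' z) (t z) z"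
    and c: "continuous_on W s" "continuous_on W s'"
  shows "s z = s' z"
proof -
  have "\<bar>s z - s' z\<bar> \<le> e" if e: "0 < e" for e
  proof -
    have "isCont s z" "isCont s' z" using c W by (auto simp: continuous_on_eq_continuous_at)
    then have "\<forall>\<^sub>F x in nhds z. dist (s x) (s z) < e / 2" "\<forall>\<^sub>F x in nhds z. dist (s' x) (s' z) < e / 2"
      using e tendstoD[of s "s z" "nhds z" "e / 2"] tendstoD[of s' "s' z" "nhds z" "e / 2"]
      by (auto simp: isCont_def tendsto_nhds_iff)
    moreover have "\<forall>\<^sub>F x in nhds z. x \<in> W" by (rule eventually_nhds_in_open[OF W])
    ultimately have "\<forall>\<^sub>F x in nhds z. x \<in> W \<and> dist (s x) (s z) < e / 2 \<and> dist (s' x) (s' z) < e / 2"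
      by eventually_elim simp
    then obtain d where d: "0 < d" "\<And>x. dist x z < d \<Longrightarrow> x \<in> W \<and> dist (s x) (s z) < e / 2 \<and> dist (s' x) (s' z) < e / 2"
      unfolding eventually_nhds_metric by blast
    define h where "h = d / 4"
    have h: "0 < h" using d by (simp add: h_def)
    define x y where "x = Re z" and "y = Im z"
    have near: "dist (Complex (x + a) (y + b)) z < d" if "0 \<le> a" "a \<le> h" "0 \<le> b" "b \<le> h" for a b
    proof -
      have "cmod (Complex (x + a) (y + b) - z) \<le> \<bar>a\<bar> + \<bar>b\<bar>"
        using cmod_le[of "Complex (x + a) (y + b) - z"] by (simp add: x_def y_def)
      then show ?thesis using that h by (simp add: dist_norm h_def)
    qed
    have inW: "Complex (x + a) (y + b) \<in> W" if "0 \<le> a" "a \<le> h" "0 \<le> b" "b \<le> h" for a b using near[OF that] d by blast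
    \<comment> \<open>The second difference over a small square, evaluated by the mean value theorem
      in both orders.\<close>
    define \<Delta> where "\<Delta> = u (Complex (x + h) (y + h)) - u (Complex x (y + h)) - u (Complex (x + h) y) + u (Complex x y)"
    have shift: "((\<lambda>a. f (x + a)) has_real_derivative D) (at a)" if "(f has_real_derivative D) (at (x + a))" for f :: "real \<Rightarrow> real" and D x a
      using that DERIV_shift[of f D a x] by (simp add: add.commute)
    obtain a1 where a1: "0 < a1" "a1 < h" "\<Delta> = h * (p (Complex (x + a1) (y + h)) - p (Complex (x + a1) y))"
    proof -
      have "((\<lambda>a. u (Complex (x + a) (y + h)) - u (Complex (x + a) y)) has_real_derivative p (Complex (x + a) (y + h)) - p (Complex (x + a) y)) (at a)"
        if "0 \<le> a" "a \<le> h" for a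
        by (intro DERIV_diff shift[where f="\<lambda>x. u (Complex x _)"] has_grad_Re_line[OF u])
           (use inW[OF that, of h] inW[OF that, of 0] h in auto)
      from MVT2[OF h this] show thesis using that by (auto simp: \<Delta>_def)
    qed
    obtain b1 where b1: "0 < b1" "b1 < h" "p (Complex (x + a1) (y + h)) - p (Complex (x + a1) y) = h * s (Complex (x + a1) (y + b1))"
    proof -
      have "((\<lambda>b. p (Complex (x + a1) (y + b))) has_real_derivative s (Complex (x + a1) (y + b))) (at b)" if "0 \<le> b" "b \<le> h" for b
        by (intro shift[where f="\<lambda>y. p (Complex _ y)"] has_grad_Im_line[OF p]) (use inW[of a1 b] a1 that in auto)
      from MVT2[OF h this] show thesis using that by auto
    qed
    obtain b2 where b2: "0 < b2" "b2 < h" "\<Delta> = h * (q (Complex (x + h) (y + b2)) - q (Complex x (y + b2)))"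
    proof -
      have "((\<lambda>b. u (Complex (x + h) (y + b)) - u (Complex x (y + b))) has_real_derivative q (Complex (x + h) (y + b)) - q (Complex x (y + b))) (at b)"
        if "0 \<le> b" "b \<le> h" for b
        by (intro DERIV_diff shift[where f="\<lambda>y. u (Complex _ y)"] has_grad_Im_line[OF u])
           (use inW[of h b] inW[of 0 b] that h in auto)
      from MVT2[OF h this] show thesis using that by (auto simp: \<Delta>_def)
    qed
    obtain a2 where a2: "0 < a2" "a2 < h" "q (Complex (x + h) (y + b2)) - q (Complex x (y + b2)) = h * s' (Complex (x + a2) (y + b2))"
    proof -
      have "((\<lambda>a. q (Complex (x + a) (y + b2))) has_real_derivative s' (Complex (x + a) (y + b2))) (at a)" if "0 \<le> a" "a \<le> h" for a
        by (intro shift[where f="\<lambda>x. q (Complex x _)"] has_grad_Re_line[OF q]) (use inW[of a b2] b2 that in auto)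
      from MVT2[OF h this] show thesis using that by auto
    qed
    have "s (Complex (x + a1) (y + b1)) = s' (Complex (x + a2) (y + b2))"
      using a1(3) b1(3) b2(3) a2(3) h by simp
    moreover have "dist (s (Complex (x + a1) (y + b1))) (s z) < e / 2" "dist (s' (Complex (x + a2) (y + b2))) (s' z) < e / 2"
      using d(2)[OF near[of a1 b1]] d(2)[OF near[of a2 b2]] a1(1,2) b1(1,2) a2(1,2) b2(1,2) by auto
    ultimately show ?thesis unfolding dist_real_def by linarith
  qed
  then have "\<bar>s z - s' z\<bar> \<le> 0" by (rule field_le_epsilon) simp
  then show ?thesis by simp
qed

section \<open>Patches and the maximal surface equation\<close>


lemma smooth_on_dir:
  assumes "smooth_on U X" "open U"
  shows "z \<in> U \<Longrightarrow> has_grad (\<lambda>z. X z $ i) (dir X 1 z $ i) (dir X \<i> z $ i) z"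
    and "z \<in> U \<Longrightarrow> has_grad (\<lambda>z. dir X v z $ i) (dir (dir X v) 1 z $ i) (dir (dir X v) \<i> z $ i) z"
    and "continuous_on U (\<lambda>z. dir (dir X v) w z $ i)"
    and "z \<in> U \<Longrightarrow> dir X h z = Re h *\<^sub>R dir X 1 z + Im h *\<^sub>R dir X \<i> z"
proof -
  have ck: "Ck_on 2 U X" using assms(1) unfolding smooth_on_def by blast
  have dirX: "(\<lambda>x. frechet_derivative X (at x) v) = dir X v" for X v by (simp add: dir_def fun_eq_iff)
  have d0: "X differentiable_on U" and d1: "dir X v differentiable_on U" and c2: "continuous_on U (dir (dir X v) w)" for v w
    using ck unfolding numeral_2_eq_2 Ck_on.simps dirX by blast+
  have g: "(f has_derivative (\<lambda>h. dir f h z)) (at z)" if "f differentiable_on U" "z \<in> U" for f :: "complex \<Rightarrow> real^3" and z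
  proof -
    have "f differentiable (at z within U)" using that unfolding differentiable_on_def by blast
    then have "f differentiable (at z)" by (simp only: at_within_open[OF that(2) assms(2)])
    then show ?thesis unfolding dir_def by (rule frechet_derivative_works[THEN iffD1])
  qed
  have lin: "dir f h z = Re h *\<^sub>R dir f 1 z + Im h *\<^sub>R dir f \<i> z" if "f differentiable_on U" "z \<in> U" for f :: "complex \<Rightarrow> real^3" and z h
  proof -
    have l: "linear (\<lambda>h. dir f h z)" using has_derivative_linear[OF g[OF that]] .
    have "h = Re h *\<^sub>R 1 + Im h *\<^sub>R \<i>" by (simp add: complex_eq_iff)
    then have "dir f h z = dir f (Re h *\<^sub>R 1 + Im h *\<^sub>R \<i>) z" by simp
    then show ?thesis using linear_add[OF l] linear_scale[OF l] by simp
  qed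
  have hg: "has_grad (\<lambda>z. f z $ i) (dir f 1 z $ i) (dir f \<i> z $ i) z" if "f differentiable_on U" "z \<in> U" for f :: "complex \<Rightarrow> real^3" and z
  proof -
    have "((\<lambda>z. f z $ i) has_derivative (\<lambda>h. dir f h z $ i)) (at z)"
      using bounded_linear.has_derivative[OF bounded_linear_vec_nth g[OF that]] .
    moreover have "(\<lambda>h. dir f h z $ i) = (\<lambda>h. dir f 1 z $ i * Re h + dir f \<i> z $ i * Im h)"
    proof
      fix h show "dir f h z $ i = dir f 1 z $ i * Re h + dir f \<i> z $ i * Im h"
        using lin[OF that, of h] by (simp add: mult.commute)
    qed
    ultimately show ?thesis unfolding has_grad_def by simp
  qed
  show "z \<in> U \<Longrightarrow> has_grad (\<lambda>z. X z $ i) (dir X 1 z $ i) (dir X \<i> z $ i) z" by (rule hg[OF d0])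
  show "z \<in> U \<Longrightarrow> has_grad (\<lambda>z. dir X v z $ i) (dir (dir X v) 1 z $ i) (dir (dir X v) \<i> z $ i) z" by (rule hg[OF d1])
  show "continuous_on U (\<lambda>z. dir (dir X v) w z $ i)" by (intro continuous_intros c2)
  show "z \<in> U \<Longrightarrow> dir X h z = Re h *\<^sub>R dir X 1 z + Im h *\<^sub>R dir X \<i> z" by (rule lin[OF d0])
qed

text \<open>The derivatives are functions of the surface alone and not of a patch, so local
  statements about patches glue without compatibility conditions. At singular points their values
  are arbitrary.\<close>

definition up :: "l3quot set \<Rightarrow> complex \<Rightarrow> real" where "up S z = frechet_derivative (uf S) (at z) 1"
definition uq :: "l3quot set \<Rightarrow> complex \<Rightarrow> real" where "uq S z = frechet_derivative (uf S) (at z) \<i>"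
definition ur :: "l3quot set \<Rightarrow> complex \<Rightarrow> real" where "ur S z = frechet_derivative (up S) (at z) 1"
definition us :: "l3quot set \<Rightarrow> complex \<Rightarrow> real" where "us S z = frechet_derivative (up S) (at z) \<i>"
definition ut :: "l3quot set \<Rightarrow> complex \<Rightarrow> real" where "ut S z = frechet_derivative (uq S) (at z) \<i>"

lemma has_grad_frechet: "has_grad f a b z \<Longrightarrow> frechet_derivative f (at z) 1 = a \<and> frechet_derivative f (at z) \<i> = b"
  unfolding has_grad_def using frechet_derivative_at by (metis (no_types, lifting) complex_i_not_zero imaginary_unit.sel mult_1_right mult_zero_right one_complex.sel add_0 add.right_neutral)

text \<open>Holds even where f is not differentiable: the derivative is a choice from a predicate,
  and the predicates at z and z + 1 are the same.\<close>

lemma frechet_periodic: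
  fixes f :: "complex \<Rightarrow> real"
  assumes "\<And>z. f (z + 1) = f z" shows "frechet_derivative f (at (z + 1)) = frechet_derivative f (at z)"
proof -
  have "(f has_derivative D) (at (z + 1)) \<longleftrightarrow> (f has_derivative D) (at z)" for D
  proof
    assume "(f has_derivative D) (at (z + 1))"
    moreover have "((\<lambda>z. z + 1) has_derivative (\<lambda>h. h)) (at z)" by (auto intro!: derivative_eq_intros)
    ultimately show "(f has_derivative D) (at z)" using has_derivative_compose[of "\<lambda>z. z + 1" "\<lambda>h. h" z UNIV f D] assms by simp
  next
    assume "(f has_derivative D) (at z)"
    moreover have "((\<lambda>z. z - 1) has_derivative (\<lambda>h. h)) (at (z + 1))" by (auto intro!: derivative_eq_intros)
    ultimately have "((\<lambda>x. f (x - 1)) has_derivative D) (at (z + 1))"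
      using has_derivative_compose[of "\<lambda>z. z - 1" "\<lambda>h. h" "z + 1" UNIV f D] by simp
    moreover have "f (x - 1) = f x" for x using assms[of "x - 1"] by simp
    ultimately show "(f has_derivative D) (at (z + 1))" by simp
  qed
  then show ?thesis unfolding frechet_derivative_def by simp
qed

lemma u_periodic:
  "up S (z + 1) = up S z" "uq S (z + 1) = uq S z" "ur S (z + 1) = ur S z" "us S (z + 1) = us S z" "ut S (z + 1) = ut S z"
proof -
  show p: "up S (z + 1) = up S z" "uq S (z + 1) = uq S z" for z
    unfolding up_def uq_def by (simp_all add: frechet_periodic uf_periodic)
  show "ur S (z + 1) = ur S z" "us S (z + 1) = us S z" "ut S (z + 1) = ut S z"
    unfolding ur_def us_def ut_def by (simp_all add: frechet_periodic p)
qed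

text \<open>In terms of a patch \<open>X = (Y, uf S \<circ> Y)\<close> of a graph \<open>S\<close>.\<close>

lemma patch_grad:
  fixes X :: "complex \<Rightarrow> real^3"
  assumes S: "graph_over_cylinder S" and X: "spacelike_patch T U X" "T \<subseteq> S"
  defines "Y \<equiv> \<lambda>z. hor (X z)"
  shows "open (Y ` U)" "inj_on Y U" "\<And>z. z \<in> U \<Longrightarrow> proj (X z) = pr (Y z) (uf S (Y z))" "\<And>z. z \<in> U \<Longrightarrow> X z $ 3 = uf S (Y z)"
    "\<And>z. z \<in> U \<Longrightarrow> has_grad (uf S) (up S (Y z)) (uq S (Y z)) (Y z)"
    "\<And>z. z \<in> U \<Longrightarrow> (up S (Y z))\<^sup>2 + (uq S (Y z))\<^sup>2 < 1"
    "\<And>z h. z \<in> U \<Longrightarrow> dir X h z $ 3 = up S (Y z) * dir X h z $ 1 + uq S (Y z) * dir X h z $ 2"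
    "\<And>z. z \<in> U \<Longrightarrow> dir X 1 z $ 1 * dir X \<i> z $ 2 - dir X \<i> z $ 1 * dir X 1 z $ 2 \<noteq> 0"
    "C1_on (Y ` U) (up S)" "C1_on (Y ` U) (uq S)"
    "\<exists>Z. (\<forall>z\<in>U. Z (Y z) = z) \<and> continuous_on (Y ` U) Z \<and>
       (\<forall>z\<in>U. (Z has_derivative (\<lambda>h. Complex
          ((dir X \<i> z $ 2 * Re h - dir X \<i> z $ 1 * Im h) / (dir X 1 z $ 1 * dir X \<i> z $ 2 - dir X \<i> z $ 1 * dir X 1 z $ 2))
          ((dir X 1 z $ 1 * Im h - dir X 1 z $ 2 * Re h) / (dir X 1 z $ 1 * dir X \<i> z $ 2 - dir X \<i> z $ 1 * dir X 1 z $ 2)))) (at (Y z)))"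
proof -
  have oU: "open U" and sm: "smooth_on U X" and pos: "\<And>z w. z \<in> U \<Longrightarrow> w \<noteq> 0 \<Longrightarrow> lorentz (dir X w z) (dir X w z) > 0"
    and im: "openin (top_of_set T) ((proj \<circ> X) ` U)" and hm: "\<exists>Y. homeomorphism U ((proj \<circ> X) ` U) (proj \<circ> X) Y"
    using X(1) by (auto simp: spacelike_patch_def)
  note sd = smooth_on_dir[OF sm oU]
  show pX: "proj (X z) = pr (Y z) (uf S (Y z))" and X3: "X z $ 3 = uf S (Y z)" if "z \<in> U" for z
  proof -
    have "proj (X z) \<in> S" using im X(2) that openin_imp_subset by fastforce
    then show "X z $ 3 = uf S (Y z)" unfolding proj_eq_pr graph_iff[OF S] Y_def .
    then show "proj (X z) = pr (Y z) (uf S (Y z))" by (simp add: proj_eq_pr Y_def)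
  qed
  show inj: "inj_on Y U"
  proof (rule inj_onI)
    fix x y assume xy: "x \<in> U" "y \<in> U" "Y x = Y y"
    obtain V where "homeomorphism U ((proj \<circ> X) ` U) (proj \<circ> X) V" using hm by blast
    then have V: "V (proj (X x)) = x" "V (proj (X y)) = y" using xy by (auto simp: homeomorphism_def)
    then show "x = y" using pX[OF xy(1)] pX[OF xy(2)] xy(3) by metis
  qed
  define Y1s Y1t Y2s Y2t where "Y1s = (\<lambda>z. dir X 1 z $ 1)" and "Y1t = (\<lambda>z. dir X \<i> z $ 1)" and "Y2s = (\<lambda>z. dir X 1 z $ 2)" and "Y2t = (\<lambda>z. dir X \<i> z $ 2)"
  have g1: "has_grad (\<lambda>z. X z $ 1) (Y1s z) (Y1t z) z" and g2: "has_grad (\<lambda>z. X z $ 2) (Y2s z) (Y2t z) z" if "z \<in> U" for z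
    using sd(1)[OF that] by (simp_all add: Y1s_def Y1t_def Y2s_def Y2t_def)
  define J where "J = (\<lambda>z. Y1s z * Y2t z - Y1t z * Y2s z)"
  \<comment> \<open>A tangent vector with vanishing horizontal part would be vertical and hence not
    spacelike, so the horizontal projection of a patch is a local diffeomorphism.\<close>
  have J: "J z \<noteq> 0" if z: "z \<in> U" for z
  proof
    assume "J z = 0"
    then have j: "Y1s z * Y2t z = Y1t z * Y2s z" by (simp add: J_def)
    have "\<exists>w. w \<noteq> 0 \<and> dir X w z $ 1 = 0 \<and> dir X w z $ 2 = 0"
    proof (cases "Y1s z = 0 \<and> Y1t z = 0")
      case True
      show ?thesis
      proof (cases "Y2s z = 0 \<and> Y2t z = 0")
        case True' : True
        show ?thesis using True True' by (intro exI[of _ 1]) (simp add: Y1s_def Y2s_def)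
      next
        case False
        then show ?thesis using True sd(4)[OF z, of "Complex (Y2t z) (- Y2s z)"]
          by (intro exI[of _ "Complex (Y2t z) (- Y2s z)"]) (auto simp: complex_eq_iff Y1s_def Y1t_def Y2s_def Y2t_def)
      qed
    next
      case False
      then show ?thesis using j sd(4)[OF z, of "Complex (Y1t z) (- Y1s z)"]
        by (intro exI[of _ "Complex (Y1t z) (- Y1s z)"]) (auto simp: complex_eq_iff Y1s_def Y1t_def Y2s_def Y2t_def mult.commute)
    qed
    then obtain w where "w \<noteq> 0" "dir X w z $ 1 = 0" "dir X w z $ 2 = 0" by blast
    then show False using pos[OF z, of w] zero_le_square[of "dir X w z $ 3"] by (auto simp: lorentz_def)
  qed
  show "\<And>z. z \<in> U \<Longrightarrow> dir X 1 z $ 1 * dir X \<i> z $ 2 - dir X \<i> z $ 1 * dir X 1 z $ 2 \<noteq> 0"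
    using J by (simp add: J_def Y1s_def Y1t_def Y2s_def Y2t_def)
  have Yz: "Complex (X z $ 1) (X z $ 2) = Y z" for z by (simp add: Y_def hor_def)
  have Jz: "Y1s z * Y2t z - Y1t z * Y2s z = J z" for z by (simp add: J_def)
  have J': "Y1s z * Y2t z - Y1t z * Y2s z \<noteq> 0" if "z \<in> U" for z using J[OF that] by (simp add: Jz)
  have inj': "inj_on (\<lambda>z. Complex (X z $ 1) (X z $ 2)) U" unfolding Yz by (rule inj)
  obtain Z where Z0: "open ((\<lambda>z. Complex (X z $ 1) (X z $ 2)) ` U)" "\<And>z. z \<in> U \<Longrightarrow> Z (Complex (X z $ 1) (X z $ 2)) = z"
    "continuous_on ((\<lambda>z. Complex (X z $ 1) (X z $ 2)) ` U) Z"
    "\<And>z. z \<in> U \<Longrightarrow> (Z has_derivative (\<lambda>h. Complex ((Y2t z * Re h - Y1t z * Im h) / (Y1s z * Y2t z - Y1t z * Y2s z))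
      ((Y1s z * Im h - Y2s z * Re h) / (Y1s z * Y2t z - Y1t z * Y2s z)))) (at (Complex (X z $ 1) (X z $ 2)))"
    by (rule chart_inverse[OF oU g1 g2 J' inj']) (assumption | rule that)+
  note Z = Z0[unfolded Yz Jz]
  show op: "open (Y ` U)" by (rule Z(1))
  show "\<exists>Z. (\<forall>z\<in>U. Z (Y z) = z) \<and> continuous_on (Y ` U) Z \<and>
       (\<forall>z\<in>U. (Z has_derivative (\<lambda>h. Complex
          ((dir X \<i> z $ 2 * Re h - dir X \<i> z $ 1 * Im h) / (dir X 1 z $ 1 * dir X \<i> z $ 2 - dir X \<i> z $ 1 * dir X 1 z $ 2))
          ((dir X 1 z $ 1 * Im h - dir X 1 z $ 2 * Re h) / (dir X 1 z $ 1 * dir X \<i> z $ 2 - dir X \<i> z $ 1 * dir X 1 z $ 2)))) (at (Y z)))"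
    using Z(2,3,4) unfolding J_def Y1s_def Y1t_def Y2s_def Y2t_def by blast
  have tr: "has_grad f ((gs * Y2t z - gt * Y2s z) / J z) ((gt * Y1s z - gs * Y1t z) / J z) (Y z)"
    if "z \<in> U" "\<And>x. x \<in> U \<Longrightarrow> f (Y x) = g x" "has_grad g gs gt z" for f g gs gt z
    by (rule chart_grad[OF Z(4)[OF that(1)] Z(2)[OF that(1)] op, where g=g]) (use that Z(2) in auto)
  have ug: "has_grad (uf S) ((dir X 1 z $ 3 * Y2t z - dir X \<i> z $ 3 * Y2s z) / J z) ((dir X \<i> z $ 3 * Y1s z - dir X 1 z $ 3 * Y1t z) / J z) (Y z)"
    if "z \<in> U" for z
    by (rule tr[OF that X3[symmetric] sd(1)[OF that]])
  have pq: "up S (Y z) = (dir X 1 z $ 3 * Y2t z - dir X \<i> z $ 3 * Y2s z) / J z" "uq S (Y z) = (dir X \<i> z $ 3 * Y1s z - dir X 1 z $ 3 * Y1t z) / J z"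
    if "z \<in> U" for z
    using has_grad_frechet[OF ug[OF that]] by (simp_all add: up_def uq_def)
  show "\<And>z. z \<in> U \<Longrightarrow> has_grad (uf S) (up S (Y z)) (uq S (Y z)) (Y z)" using ug pq by simp
  have t1: "dir X 1 z $ 3 = up S (Y z) * Y1s z + uq S (Y z) * Y2s z" "dir X \<i> z $ 3 = up S (Y z) * Y1t z + uq S (Y z) * Y2t z" if z: "z \<in> U" for z
  proof -
    define A B where "A = dir X 1 z $ 3" and "B = dir X \<i> z $ 3"
    have "(A * Y2t z - B * Y2s z) * Y1s z + (B * Y1s z - A * Y1t z) * Y2s z = A * J z"
      "(A * Y2t z - B * Y2s z) * Y1t z + (B * Y1s z - A * Y1t z) * Y2t z = B * J z" by (simp_all add: J_def algebra_simps)
    then show "dir X 1 z $ 3 = up S (Y z) * Y1s z + uq S (Y z) * Y2s z" "dir X \<i> z $ 3 = up S (Y z) * Y1t z + uq S (Y z) * Y2t z"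
      unfolding pq[OF z] A_def[symmetric] B_def[symmetric] using J[OF z] by (simp_all add: add_divide_distrib[symmetric])
  qed
  show tang: "dir X h z $ 3 = up S (Y z) * dir X h z $ 1 + uq S (Y z) * dir X h z $ 2" if "z \<in> U" for z h
    unfolding sd(4)[OF that, of h] using t1[OF that] by (simp add: Y1s_def Y1t_def Y2s_def Y2t_def algebra_simps)
  show "(up S (Y z))\<^sup>2 + (uq S (Y z))\<^sup>2 < 1" if z: "z \<in> U" for z
  proof -
    define p q where "p = up S (Y z)" and "q = uq S (Y z)"
    show ?thesis
    proof (cases "p = 0 \<and> q = 0")
      case False
      \<comment> \<open>The tangent vector above the gradient (p,q) itself: its square |P|^2 - |P|^4
        is positive only if |P| < 1.\<close>
      define w where "w = Complex ((Y2t z * p - Y1t z * q) / J z) ((Y1s z * q - Y2s z * p) / J z)"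
      have "dir X w z $ 1 = (p * J z) / J z" "dir X w z $ 2 = (q * J z) / J z"
        unfolding sd(4)[OF z, of w] by (simp_all add: w_def J_def Y1s_def Y1t_def Y2s_def Y2t_def add_divide_distrib[symmetric] algebra_simps)
      then have d: "dir X w z $ 1 = p" "dir X w z $ 2 = q" using J[OF z] by simp_all
      have "w \<noteq> 0"
      proof
        assume "w = 0"
        then have "dir X w z $ 1 = 0" "dir X w z $ 2 = 0" unfolding sd(4)[OF z, of w] by simp_all
        then show False using d False by simp
      qed
      from pos[OF z this] have "0 < p * p + q * q - (p * p + q * q) * (p * p + q * q)"
        unfolding lorentz_def tang[OF z] d p_def[symmetric] q_def[symmetric] by simp
      then have "0 < (p * p + q * q) * (1 - (p * p + q * q))" by (simp add: algebra_simps)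
      moreover have "0 \<le> p * p + q * q" by simp
      ultimately have "p * p + q * q < 1" by (simp add: zero_less_mult_iff)
      then show ?thesis by (simp add: p_def q_def power2_eq_square)
    qed (simp add: p_def q_def)
  qed
  have C1d: "C1_on U (\<lambda>z. dir X v z $ i)" for v i by (rule C1_onI[OF sd(2)]) (assumption | rule sd(3))+
  have JC: "C1_on U J" unfolding J_def Y1s_def Y1t_def Y2s_def Y2t_def by (intro C1_on_diff C1_on_mult C1d)
  have push: "C1_on (Y ` U) f" if f: "\<And>z. z \<in> U \<Longrightarrow> f (Y z) = g z" and g: "C1_on U g" for f g
  proof -
    obtain a b where ab: "\<And>z. z \<in> U \<Longrightarrow> has_grad g (a z) (b z) z" "continuous_on U a" "continuous_on U b"
      using g unfolding C1_on_def by blast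
    have c: "continuous_on U J" "continuous_on U Y1s" "continuous_on U Y1t" "continuous_on U Y2s" "continuous_on U Y2t"
      using C1_on_continuous[OF JC] C1_on_continuous[OF C1d] unfolding Y1s_def Y1t_def Y2s_def Y2t_def by auto
    have ZU: "Z ` (Y ` U) \<subseteq> U" using Z(2) by auto
    show ?thesis
    proof (rule C1_onI)
      fix y assume "y \<in> Y ` U"
      then obtain z where z: "z \<in> U" "y = Y z" by blast
      show "has_grad f (((\<lambda>z. (a z * Y2t z - b z * Y2s z) / J z) \<circ> Z) y) (((\<lambda>z. (b z * Y1s z - a z * Y1t z) / J z) \<circ> Z) y) y"
        using tr[OF z(1) f ab(1)[OF z(1)]] Z(2)[OF z(1)] z(2) by simp
    next
      have "continuous_on U (\<lambda>z. (a z * Y2t z - b z * Y2s z) / J z)" "continuous_on U (\<lambda>z. (b z * Y1s z - a z * Y1t z) / J z)"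
        by (intro continuous_intros ab c ballI; use J in simp)+
      then show "continuous_on (Y ` U) ((\<lambda>z. (a z * Y2t z - b z * Y2s z) / J z) \<circ> Z)" "continuous_on (Y ` U) ((\<lambda>z. (b z * Y1s z - a z * Y1t z) / J z) \<circ> Z)"
        using continuous_on_compose[OF Z(3)] continuous_on_subset[OF _ ZU] by blast+
    qed
  qed
  have Jnz: "\<And>z. z \<in> U \<Longrightarrow> J z \<noteq> 0" by (rule J)
  show "C1_on (Y ` U) (up S)"
    by (rule push[of "up S" "\<lambda>z. (dir X 1 z $ 3 * Y2t z - dir X \<i> z $ 3 * Y2s z) / J z", OF pq(1)]) (assumption | unfold Y1s_def Y1t_def Y2s_def Y2t_def, intro C1_on_divide C1_on_diff C1_on_mult C1d JC Jnz)+
  show "C1_on (Y ` U) (uq S)"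
    by (rule push[of "uq S" "\<lambda>z. (dir X \<i> z $ 3 * Y1s z - dir X 1 z $ 3 * Y1t z) / J z", OF pq(2)]) (assumption | unfold Y1s_def Y1t_def Y2s_def Y2t_def, intro C1_on_divide C1_on_diff C1_on_mult C1d JC Jnz)+
qed

text \<open>The numerator of the mean curvature changes by the square of the Jacobian under a change
  of parameters. On the right is its value in the coordinates of the graph.\<close>

lemma second_fundamental_form_trace:
  fixes a b c d p q r s t :: real
  shows "(r * a * a + 2 * s * a * c + t * c * c) * (b * b + d * d - (p * b + q * d) * (p * b + q * d))
    - 2 * (r * a * b + s * (a * d + b * c) + t * c * d) * (a * b + c * d - (p * a + q * c) * (p * b + q * d))
    + (r * b * b + 2 * s * b * d + t * d * d) * (a * a + c * c - (p * a + q * c) * (p * a + q * c))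
    = (a * d - b * c) * (a * d - b * c) * ((1 - q * q) * r + 2 * p * q * s + (1 - p * p) * t)"
  by algebra

text \<open>Vanishing mean curvature in an arbitrary patch becomes the maximal surface equation for
  the graph function over the horizontal image of the patch.\<close>

lemma patch_max_graph:
  fixes X :: "complex \<Rightarrow> real^3"
  assumes S: "graph_over_cylinder S" and X: "spacelike_patch T U X" "T \<subseteq> S"
    and mc: "\<And>z \<nu>. z \<in> U \<Longrightarrow> unit_normal X z \<nu> \<Longrightarrow> mean_curvature X z \<nu> = 0"
  shows "max_graph ((\<lambda>z. hor (X z)) ` U) (uf S) (up S) (uq S) (ur S) (us S) (ut S)"
proof -
  define Y where "Y = (\<lambda>z. hor (X z))"
  have Yz: "hor (X z) = Y z" for z by (simp add: Y_def)
  note P = patch_grad[OF S X, unfolded Yz]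
  have oU: "open U" and sm: "smooth_on U X" using X(1) by (auto simp: spacelike_patch_def)
  note sd = smooth_on_dir[OF sm oU]
  obtain r s where rs: "\<And>z. z \<in> Y ` U \<Longrightarrow> has_grad (up S) (r z) (s z) z" "continuous_on (Y ` U) r" "continuous_on (Y ` U) s"
    using P(9) unfolding C1_on_def by blast
  obtain s' t where st: "\<And>z. z \<in> Y ` U \<Longrightarrow> has_grad (uq S) (s' z) (t z) z" "continuous_on (Y ` U) s'" "continuous_on (Y ` U) t"
    using P(10) unfolding C1_on_def by blast
  have eqs: "ur S z = r z" "us S z = s z" "ut S z = t z" if "z \<in> Y ` U" for z
    using has_grad_frechet[OF rs(1)[OF that]] has_grad_frechet[OF st(1)[OF that]] by (simp_all add: ur_def us_def ut_def)
  have ug: "has_grad (uf S) (up S z) (uq S z) z" if "z \<in> Y ` U" for z using P(5) that by blast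
  have sym: "s z = s' z" if "z \<in> Y ` U" for z
    by (rule mixed_partials_eq[OF P(1) that ug rs(1) st(1) rs(3) st(2)])
  have gp: "has_grad (up S) (ur S z) (us S z) z" and gq: "has_grad (uq S) (us S z) (ut S z) z" if "z \<in> Y ` U" for z
    using rs(1)[OF that] st(1)[OF that] eqs[OF that] sym[OF that] by simp_all
  have pde: "(1 - (uq S x)\<^sup>2) * ur S x + 2 * up S x * uq S x * us S x + (1 - (up S x)\<^sup>2) * ut S x = 0" if xin: "x \<in> Y ` U" for x
  proof -
    obtain z where z: "z \<in> U" "x = Y z" using xin by blast
    define p q w where "p = up S x" and "q = uq S x" and "w = wt p q"
    have pq1: "p\<^sup>2 + q\<^sup>2 < 1" using P(6)[OF z(1)] by (simp add: p_def q_def z)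
    then have w: "0 < w" "w * w = 1 - p * p - q * q" by (simp_all add: w_def power2_eq_square)
    define a b c d where "a = dir X 1 z $ 1" and "b = dir X \<i> z $ 1" and "c = dir X 1 z $ 2" and "d = dir X \<i> z $ 2"
    \<comment> \<open>The future unit normal of the graph; vanishing mean curvature does not depend
      on the sign.\<close>
    define \<nu> :: "real^3" where "\<nu> = vector [p / w, q / w, 1 / w]"
    have \<nu>n: "\<nu> $ 1 = p / w" "\<nu> $ 2 = q / w" "\<nu> $ 3 = 1 / w" by (simp_all add: \<nu>_def)
    have tg: "dir X h z $ 3 = p * dir X h z $ 1 + q * dir X h z $ 2" for h
      using P(7)[OF z(1)] by (simp add: p_def q_def z)
    have "unit_normal X z \<nu>"
      unfolding unit_normal_def lorentz_def \<nu>n tg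
    proof (intro conjI allI)
      have "p / w * (p / w) + q / w * (q / w) - 1 / w * (1 / w) = (p * p + q * q - 1) / (w * w)"
        using w(1) by (simp add: field_simps)
      also have "p * p + q * q - 1 = - (w * w)" using w(2) by simp
      also have "- (w * w) / (w * w) = -1" using w(1) by simp
      finally show "p / w * (p / w) + q / w * (q / w) - 1 / w * (1 / w) = -1" .
    qed (use w(1) in \<open>simp add: field_simps\<close>)
    then have mc0: "mean_curvature X z \<nu> = 0" by (rule mc[OF z(1)])
    \<comment> \<open>One more derivative of the tangency relation. The second derivatives of the
      horizontal part are components of a tangent vector, so the normal does not see them and the
      Hessian of the graph function remains.\<close>
    have second: "dir (dir X v) h z $ 3 = p * dir (dir X v) h z $ 1 + q * dir (dir X v) h z $ 2 +
        (ur S x * dir X h z $ 1 + us S x * dir X h z $ 2) * dir X v z $ 1 + (us S x * dir X h z $ 1 + ut S x * dir X h z $ 2) * dir X v z $ 2"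
      if h: "h = 1 \<or> h = \<i>" for v h
    proof -
      have Yd: "(Y has_derivative (\<lambda>h. Complex (dir X h z $ 1) (dir X h z $ 2))) (at z)"
      proof -
        have "(\<lambda>h. of_real (Re h) * Complex (dir X 1 z $ 1) (dir X 1 z $ 2) + of_real (Im h) * Complex (dir X \<i> z $ 1) (dir X \<i> z $ 2)) = (\<lambda>h. Complex (dir X h z $ 1) (dir X h z $ 2))"
        proof
          fix h show "of_real (Re h) * Complex (dir X 1 z $ 1) (dir X 1 z $ 2) + of_real (Im h) * Complex (dir X \<i> z $ 1) (dir X \<i> z $ 2) = Complex (dir X h z $ 1) (dir X h z $ 2)"
            using sd(4)[OF z(1), of h] by (simp add: complex_eq_iff)
        qed
        then show ?thesis using has_grad_Complex[OF sd(1)[OF z(1), of 1] sd(1)[OF z(1), of 2]] by (simp add: Y_def hor_def)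
      qed
      have comp: "has_grad (\<lambda>z. f (Y z)) (fa * dir X 1 z $ 1 + fb * dir X 1 z $ 2) (fa * dir X \<i> z $ 1 + fb * dir X \<i> z $ 2) z"
        if "has_grad f fa fb x" for f fa fb
      proof -
        have "((\<lambda>z. f (Y z)) has_derivative (\<lambda>h. fa * dir X h z $ 1 + fb * dir X h z $ 2)) (at z)"
          using has_derivative_compose[OF Yd, of f "\<lambda>h. fa * Re h + fb * Im h"] that by (simp add: has_grad_def z)
        then show ?thesis unfolding has_grad_def
        proof (rule has_derivative_eq_rhs)
          show "(\<lambda>h. fa * dir X h z $ 1 + fb * dir X h z $ 2) = (\<lambda>h. (fa * dir X 1 z $ 1 + fb * dir X 1 z $ 2) * Re h + (fa * dir X \<i> z $ 1 + fb * dir X \<i> z $ 2) * Im h)"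
          proof
            fix h show "fa * dir X h z $ 1 + fb * dir X h z $ 2 = (fa * dir X 1 z $ 1 + fb * dir X 1 z $ 2) * Re h + (fa * dir X \<i> z $ 1 + fb * dir X \<i> z $ 2) * Im h"
              using sd(4)[OF z(1), of h] by (simp add: algebra_simps)
          qed
        qed
      qed
      have "has_grad (\<lambda>z. up S (Y z) * dir X v z $ 1 + uq S (Y z) * dir X v z $ 2)
         (((ur S x * dir X 1 z $ 1 + us S x * dir X 1 z $ 2) * dir X v z $ 1 + p * dir (dir X v) 1 z $ 1)
          + ((us S x * dir X 1 z $ 1 + ut S x * dir X 1 z $ 2) * dir X v z $ 2 + q * dir (dir X v) 1 z $ 2))
         (((ur S x * dir X \<i> z $ 1 + us S x * dir X \<i> z $ 2) * dir X v z $ 1 + p * dir (dir X v) \<i> z $ 1)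
          + ((us S x * dir X \<i> z $ 1 + ut S x * dir X \<i> z $ 2) * dir X v z $ 2 + q * dir (dir X v) \<i> z $ 2)) z"
        using has_grad_add[OF has_grad_mult[OF comp[OF gp[OF xin]] sd(2)[OF z(1), of v 1]] has_grad_mult[OF comp[OF gq[OF xin]] sd(2)[OF z(1), of v 2]]]
        by (simp add: p_def q_def z)
      then
      have "has_grad (\<lambda>z. dir X v z $ 3)
         (((ur S x * dir X 1 z $ 1 + us S x * dir X 1 z $ 2) * dir X v z $ 1 + p * dir (dir X v) 1 z $ 1)
          + ((us S x * dir X 1 z $ 1 + ut S x * dir X 1 z $ 2) * dir X v z $ 2 + q * dir (dir X v) 1 z $ 2))
         (((ur S x * dir X \<i> z $ 1 + us S x * dir X \<i> z $ 2) * dir X v z $ 1 + p * dir (dir X v) \<i> z $ 1)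
          + ((us S x * dir X \<i> z $ 1 + ut S x * dir X \<i> z $ 2) * dir X v z $ 2 + q * dir (dir X v) \<i> z $ 2)) z"
        by (rule has_grad_transform) (use eventually_nhds_in_open[OF oU z(1)] P(7) in \<open>auto elim!: eventually_mono\<close>)
      from has_grad_unique[OF sd(2)[OF z(1), of v 3] this] show ?thesis using h by auto
    qed
    define r s t where "r = ur S x" and "s = us S x" and "t = ut S x"
    have e: "lorentz (dir (dir X v) h z) \<nu> = - ((r * dir X h z $ 1 + s * dir X h z $ 2) * dir X v z $ 1 + (s * dir X h z $ 1 + t * dir X h z $ 2) * dir X v z $ 2) / w"
      if "h = 1 \<or> h = \<i>" for v h
      unfolding lorentz_def \<nu>n second[OF that, of v] r_def s_def t_def using w(1) by (simp add: field_simps)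
    define E F G where "E = lorentz (dir X 1 z) (dir X 1 z)" and "F = lorentz (dir X 1 z) (dir X \<i> z)" and "G = lorentz (dir X \<i> z) (dir X \<i> z)"
    have EFG: "E = a * a + c * c - (p * a + q * c) * (p * a + q * c)" "F = a * b + c * d - (p * a + q * c) * (p * b + q * d)"
      "G = b * b + d * d - (p * b + q * d) * (p * b + q * d)"
      by (simp_all add: E_def F_def G_def lorentz_def tg a_def b_def c_def d_def)
    define j where "j = a * d - b * c"
    have j: "j \<noteq> 0" using P(8)[OF z(1)] by (simp add: j_def a_def b_def c_def d_def)
    have det: "E * G - F\<^sup>2 = j * j * (w * w)" unfolding EFG w(2) j_def power2_eq_square by algebra
    have num: "(r * a * a + 2 * s * a * c + t * c * c) * G - 2 * (r * a * b + s * (a * d + b * c) + t * c * d) * F + (r * b * b + 2 * s * b * d + t * d * d) * E = 0"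
    proof -
      define e11 e12 e22 where "e11 = - ((r * a + s * c) * a + (s * a + t * c) * c) / w" and "e12 = - ((r * b + s * d) * a + (s * b + t * d) * c) / w"
        and "e22 = - ((r * b + s * d) * b + (s * b + t * d) * d) / w"
      have cancel: "w * (- x / w) = - x" for x using w(1) by simp
      have "(e11 * G - 2 * e12 * F + e22 * E) / (2 * (E * G - F\<^sup>2)) = 0"
        using mc0 e[of 1 1] e[of \<i> 1] e[of \<i> \<i>] unfolding mean_curvature_def Let_def E_def[symmetric] F_def[symmetric] G_def[symmetric]
        by (simp add: e11_def e12_def e22_def a_def b_def c_def d_def)
      moreover have "E * G - F\<^sup>2 \<noteq> 0" unfolding det using j w(1) by simp
      ultimately have "e11 * G - 2 * e12 * F + e22 * E = 0" by simp
      then have 0: "w * (e11 * G - 2 * e12 * F + e22 * E) = 0" by simp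
      have "w * e11 * G - 2 * (w * e12) * F + w * e22 * E = w * (e11 * G - 2 * e12 * F + e22 * E)" by (simp add: algebra_simps)
      then have 1: "w * e11 * G - 2 * (w * e12) * F + w * e22 * E = 0" using 0 by (rule trans)
      have m: "w * e11 = - (r * a * a + 2 * s * a * c + t * c * c)" "w * e12 = - (r * a * b + s * (a * d + b * c) + t * c * d)"
        "w * e22 = - (r * b * b + 2 * s * b * d + t * d * d)" unfolding e11_def e12_def e22_def cancel by (simp_all add: algebra_simps)
      from 1 show ?thesis unfolding m by algebra
    qed
    have "j * j * ((1 - q * q) * r + 2 * p * q * s + (1 - p * p) * t) = 0"
      using num second_fundamental_form_trace[of r a s c t b d p q] unfolding EFG j_def by simp
    then show ?thesis using j by (simp add: p_def q_def r_def s_def t_def power2_eq_square)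
  qed
  have c: "continuous_on (Y ` U) (ur S)" "continuous_on (Y ` U) (us S)" "continuous_on (Y ` U) (ut S)"
    using rs(2,3) st(3) eqs by (auto cong: continuous_on_cong)
  show ?thesis
    unfolding max_graph_def Y_def[symmetric] using P(1,6) ug gp gq pde c by blast
qed

section \<open>Surfaces in the moduli space as graphs over the plane\<close>

lemma graph_patch_exists:
  assumes "maximal_surface (S - F)" "q \<in> S - F"
  obtains U X where "spacelike_patch (S - F) U X" "q \<in> (proj \<circ> X) ` U"
    "\<And>z \<nu>. z \<in> U \<Longrightarrow> unit_normal X z \<nu> \<Longrightarrow> mean_curvature X z \<nu> = 0"
  using assms unfolding maximal_surface_def by blast

text \<open>The singular set lifted to the plane, hence invariant under integer translations and
  infinite unless it is empty.\<close>

definition sing :: "l3quot set \<Rightarrow> l3quot set \<Rightarrow> complex set" where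
  "sing S F = {z. pr z (uf S z) \<in> F}"

lemma sing_periodic: "z + 1 \<in> sing S F \<longleftrightarrow> z \<in> sing S F"
proof -
  have "pr (z + 1) (uf S (z + 1)) = pr z (uf S z)"
    unfolding uf_periodic pr_eq_iff by (auto intro!: exI[of _ "-1"])
  then show ?thesis by (simp add: sing_def)
qed

text \<open>One representative for each singular point; this gives closedness, a bound for the
  heights, and finiteness on bounded sets.\<close>

lemma sing_finite_rep:
  assumes S: "graph_over_cylinder S" and F: "finite F" "F \<subseteq> S"
  obtains A where "finite A" "F = (\<lambda>z. pr z (uf S z)) ` A" "sing S F = (\<Union>a\<in>A. (+) a ` \<int>)" "inj_on (\<lambda>z. pr z (uf S z)) A"
proof -
  have "F \<subseteq> range (\<lambda>z. pr z (uf S z))"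
  proof
    fix x assume x: "x \<in> F"
    obtain z h where zh: "x = pr z h" by (rule pr_cases)
    then have "h = uf S z" using x F(2) graph_iff[OF S] by blast
    then show "x \<in> range (\<lambda>z. pr z (uf S z))" using zh by blast
  qed
  then obtain A where A: "inj_on (\<lambda>z. pr z (uf S z)) A" "F = (\<lambda>z. pr z (uf S z)) ` A"
    using subset_image_inj[of F "\<lambda>z. pr z (uf S z)" UNIV] by auto
  have fin: "finite A" using F(1) A finite_imageD by blast
  have shift: "uf S (a + of_int k) = uf S a" for a k
    by (rule periodic_int) (rule uf_periodic)
  have "sing S F = (\<Union>a\<in>A. (+) a ` \<int>)"
  proof (intro set_eqI iffI)
    fix z assume "z \<in> sing S F"
    then obtain a where a: "a \<in> A" "pr a (uf S a) = pr z (uf S z)" unfolding sing_def A(2) by auto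
    then obtain k :: int where "z = a + of_int k" by (auto simp: pr_eq_iff)
    then show "z \<in> (\<Union>a\<in>A. (+) a ` \<int>)" using a(1) by (auto intro!: bexI[of _ a])
  next
    fix z assume "z \<in> (\<Union>a\<in>A. (+) a ` \<int>)"
    then obtain a k where a: "a \<in> A" "z = a + of_int k" by (auto elim!: Ints_cases)
    have "pr z (uf S z) = pr a (uf S a)"
      unfolding pr_eq_iff a(2) shift by (auto intro!: exI[of _ "- k"])
    then show "z \<in> sing S F" using a(1) unfolding sing_def A(2) by auto
  qed
  then show thesis using that fin A by blast
qed

lemma closed_sing:
  assumes "graph_over_cylinder S" "finite F" "F \<subseteq> S" shows "closed (sing S F)"
proof -
  obtain A where "finite A" "sing S F = (\<Union>a\<in>A. (+) a ` \<int>)" by (rule sing_finite_rep[OF assms])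
  then show ?thesis by (simp add: closed_UN closed_translation)
qed

text \<open>The property is local, and the functions involved are global and periodic. A patch may
  lie over an integer translate of the point in question and is then moved back.\<close>

lemma max_graph_uf:
  assumes S: "graph_over_cylinder S" and F: "finite F" "F \<subseteq> S" and m: "maximal_surface (S - F)"
  shows "max_graph (- sing S F) (uf S) (up S) (uq S) (ur S) (us S) (ut S)"
proof -
  have loc: "\<exists>W. x \<in> W \<and> max_graph W (uf S) (up S) (uq S) (ur S) (us S) (ut S)" if x: "x \<in> - sing S F" for x
  proof -
    have "pr x (uf S x) \<in> S - F" using x graph_mem[OF S] by (simp add: sing_def)
    then obtain U X where X: "spacelike_patch (S - F) U X" "pr x (uf S x) \<in> (proj \<circ> X) ` U"
      "\<And>z \<nu>. z \<in> U \<Longrightarrow> unit_normal X z \<nu> \<Longrightarrow> mean_curvature X z \<nu> = 0"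
      by (rule graph_patch_exists[OF m]) (rule that)
    have M: "max_graph ((\<lambda>z. hor (X z)) ` U) (uf S) (up S) (uq S) (ur S) (us S) (ut S)"
      by (rule patch_max_graph[OF S X(1) Diff_subset X(3)])
    obtain z where z: "z \<in> U" "pr x (uf S x) = proj (X z)" using X(2) by auto
    then obtain k :: int where k: "hor (X z) = x + of_int k" by (auto simp: proj_eq_pr pr_eq_iff)
    have per: "f (x + of_int k) = f x" if "\<And>z. f (z + 1) = f z" for f :: "complex \<Rightarrow> real" and x
      using that by (rule periodic_int)
    have M': "max_graph ((\<lambda>z. z + of_int k) -` ((\<lambda>z. hor (X z)) ` U)) (uf S) (up S) (uq S) (ur S) (us S) (ut S)"
      using max_graph_translate[OF M, of "of_int k"]
      by (simp add: per[of "uf S"] per[of "up S"] per[of "uq S"] per[of "ur S"] per[of "us S"] per[of "ut S"] uf_periodic u_periodic)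
    have "x + of_int k \<in> (\<lambda>z. hor (X z)) ` U" by (rule image_eqI[of _ _ z]) (use k z(1) in simp_all)
    then have "x \<in> (\<lambda>z. z + of_int k) -` ((\<lambda>z. hor (X z)) ` U)" by simp
    then show ?thesis using M' by (intro exI[of _ "(\<lambda>z. z + of_int k) -` ((\<lambda>z. hor (X z)) ` U)"] conjI)
  qed
  have cont: "continuous_on (- sing S F) f"
    if "\<And>W. max_graph W (uf S) (up S) (uq S) (ur S) (us S) (ut S) \<Longrightarrow> continuous_on W f" for f :: "complex \<Rightarrow> real"
  proof (intro continuous_at_imp_continuous_on ballI)
    fix x assume "x \<in> - sing S F"
    then obtain W where W: "x \<in> W" "max_graph W (uf S) (up S) (uq S) (ur S) (us S) (ut S)" using loc by blast
    then show "isCont f x" using that[OF W(2)] max_graphD(1)[OF W(2)] by (simp add: continuous_on_eq_continuous_at)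
  qed
  have "open (- sing S F)" using closed_sing[OF S F] by (simp add: open_Compl)
  moreover have "continuous_on (- sing S F) (ur S)" "continuous_on (- sing S F) (us S)" "continuous_on (- sing S F) (ut S)"
    by (rule cont, erule max_graphD)+
  moreover have "\<forall>z\<in>- sing S F. has_grad (uf S) (up S z) (uq S z) z \<and> has_grad (up S) (ur S z) (us S z) z \<and> has_grad (uq S) (us S z) (ut S z) z \<and>
        (up S z)\<^sup>2 + (uq S z)\<^sup>2 < 1 \<and> (1 - (uq S z)\<^sup>2) * ur S z + 2 * up S z * uq S z * us S z + (1 - (up S z)\<^sup>2) * ut S z = 0"
    using loc max_graphD by meson
  ultimately show ?thesis unfolding max_graph_def by blast
qed

text \<open>The fundamental theorem of calculus along the segment tolerates finitely many parameters
  without a derivative, so singularities on the segment do no harm.\<close>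

lemma Lipschitz_if_grad_less_1:
  assumes c: "continuous_on UNIV u" and S: "finite (\<Sigma> \<inter> closed_segment w z)"
    and g: "\<And>z. z \<notin> \<Sigma> \<Longrightarrow> has_grad u (p z) (q z) z \<and> (p z)\<^sup>2 + (q z)\<^sup>2 < 1"
  shows "\<bar>u z - u w\<bar> \<le> dist z w"
proof (cases "z = w")
  case False
  define \<gamma> where "\<gamma> = (\<lambda>t::real. w + of_real t * (z - w))"
  have inj: "inj \<gamma>" using False by (auto simp: inj_def \<gamma>_def)
  define T where "T = \<gamma> -` (\<Sigma> \<inter> closed_segment w z)"
  have T: "finite T" unfolding T_def by (rule finite_vimageI[OF S inj])
  have seg: "\<gamma> t \<in> closed_segment w z" if "t \<in> {0..1}" for t
    unfolding in_segment using that by (intro exI[of _ t]) (auto simp: \<gamma>_def scaleR_conv_of_real algebra_simps)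
  define f' where "f' = (\<lambda>t. if t \<in> T then 0 else p (\<gamma> t) * Re (z - w) + q (\<gamma> t) * Im (z - w))"
  have "(f' has_integral u (\<gamma> 1) - u (\<gamma> 0)) {0..1}"
  proof (rule fundamental_theorem_of_calculus_strong[OF T])
    show "continuous_on {0..1} (\<lambda>t. u (\<gamma> t))"
      by (rule continuous_on_compose2[OF c]) (auto simp: \<gamma>_def intro!: continuous_intros)
    fix t :: real assume t: "t \<in> {0..1} - T"
    then have "\<gamma> t \<notin> \<Sigma>" using seg[of t] by (auto simp: T_def)
    then have gg: "(u has_derivative (\<lambda>h. p (\<gamma> t) * Re h + q (\<gamma> t) * Im h)) (at (\<gamma> t))" using g by (simp add: has_grad_def)
    have "(\<gamma> has_derivative (\<lambda>h. of_real h * (z - w))) (at t)" unfolding \<gamma>_def by (auto intro!: derivative_eq_intros)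
    from has_derivative_compose[OF this gg]
    have "((\<lambda>t. u (\<gamma> t)) has_derivative (\<lambda>h. h *\<^sub>R f' t)) (at t)"
      by (rule has_derivative_eq_rhs) (use t in \<open>auto simp: f'_def fun_eq_iff algebra_simps\<close>)
    then show "((\<lambda>t. u (\<gamma> t)) has_vector_derivative f' t) (at t)"
      unfolding has_vector_derivative_def .
  qed simp
  then have "(f' has_integral u z - u w) (cbox 0 1)" by (simp add: \<gamma>_def)
  moreover have "norm (f' t) \<le> dist z w" if "t \<in> cbox 0 1" for t
  proof (cases "t \<in> T")
    case False
    then have 1: "(p (\<gamma> t))\<^sup>2 + (q (\<gamma> t))\<^sup>2 < 1" using g seg[of t] that by (auto simp: T_def)
    define P Q a b where "P = p (\<gamma> t)" and "Q = q (\<gamma> t)" and "a = Re (z - w)" and "b = Im (z - w)"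
    have "(P * a + Q * b)\<^sup>2 \<le> (P\<^sup>2 + Q\<^sup>2) * (a\<^sup>2 + b\<^sup>2)"
      using zero_le_power2[of "P * b - Q * a"] by (simp add: power2_eq_square algebra_simps)
    also have "\<dots> \<le> 1 * (a\<^sup>2 + b\<^sup>2)" using 1 by (intro mult_right_mono) (auto simp: P_def Q_def)
    finally have "\<bar>P * a + Q * b\<bar> \<le> sqrt (a\<^sup>2 + b\<^sup>2)" by (intro real_le_rsqrt) simp
    then show ?thesis using False by (simp add: f'_def dist_norm cmod_def P_def Q_def a_def b_def)
  qed (simp add: f'_def)
  ultimately have "norm (u z - u w) \<le> dist z w * measure lborel (cbox 0 (1::real))"
    by (intro has_integral_bound[where f=f']) auto
  then show ?thesis by simp
qed simp

text \<open>Conjugation exchanges the two ends, so that one analysis of a lower half plane serves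
  both.\<close>

lemma max_graph_reflect:
  assumes "max_graph \<Omega> u p q r s t"
  shows "max_graph (cnj -` \<Omega>) (\<lambda>z. u (cnj z)) (\<lambda>z. p (cnj z)) (\<lambda>z. - q (cnj z)) (\<lambda>z. r (cnj z)) (\<lambda>z. - s (cnj z)) (\<lambda>z. t (cnj z))"
proof -
  have g: "has_grad (\<lambda>z. f (cnj z)) a (- b) z" if "has_grad f a b (cnj z)" for f a b z
  proof -
    have "(cnj has_derivative cnj) (at z)" by (simp add: bounded_linear_imp_has_derivative bounded_linear_cnj)
    from has_derivative_compose[OF this that[unfolded has_grad_def]] show ?thesis by (simp add: has_grad_def)
  qed
  have "open (cnj -` \<Omega>)" by (rule open_vimage[OF max_graphD(1)[OF assms]]) (intro continuous_intros)
  moreover have "continuous_on (cnj -` \<Omega>) (\<lambda>z. f (cnj z))" if "continuous_on \<Omega> f" for f :: "complex \<Rightarrow> real"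
    by (rule continuous_on_compose2[OF that]) (auto intro!: continuous_intros)
  ultimately show ?thesis
    using assms g has_grad_uminus[OF g] unfolding max_graph_def by (auto intro!: continuous_intros)
qed

text \<open>Each end has a limit slope by \<open>half_plane_end\<close>; the condition on the first
  end is used to make the upper slope 0.\<close>

lemma cyl_graph_exists:
  assumes S: "S \<in> GG n" and F: "CMF S F"
  obtains a Y C where "cyl_graph (sing S F) (uf S) (up S) (uq S) (ur S) (us S) (ut S) a Y C"
proof -
  have gr: "graph_over_cylinder S" and E1: "E1_asymptotic_horizontal S" using S by (auto simp: GG_def)
  have F': "finite F" "F \<subseteq> S" "topological_surface S" "maximal_surface (S - F)"
    using F by (auto simp: CMF_def maximal_with_singularities_def)
  let ?\<Sigma> = "sing S F"
  obtain A where A: "finite A" "?\<Sigma> = (\<Union>a\<in>A. (+) a ` \<int>)" by (rule sing_finite_rep[OF gr F'(1,2)])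
  have cS: "finite (?\<Sigma> \<inter> closed_segment w z)" for w z
  proof -
    have "bounded (closed_segment w z)" by (rule compact_imp_bounded) (rule compact_segment)
    then obtain R where R: "\<And>x. x \<in> closed_segment w z \<Longrightarrow> cmod x \<le> R" unfolding bounded_iff by blast
    have "?\<Sigma> \<inter> closed_segment w z \<subseteq> (\<Union>a\<in>A. (\<lambda>k. a + of_int k) ` {- \<lceil>R + cmod a\<rceil>..\<lceil>R + cmod a\<rceil>})"
    proof
      fix x assume x: "x \<in> ?\<Sigma> \<inter> closed_segment w z"
      then obtain a k where ak: "a \<in> A" "x = a + of_int k" unfolding A(2) by (auto elim!: Ints_cases)
      have "cmod x \<le> R" using x by (intro R) blast
      then have "cmod (of_int k :: complex) \<le> R + cmod a" using norm_triangle_ineq4[of x a] unfolding ak(2) by simp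
      then have "k \<in> {- \<lceil>R + cmod a\<rceil>..\<lceil>R + cmod a\<rceil>}" by simp linarith
      then show "x \<in> (\<Union>a\<in>A. (\<lambda>k. a + of_int k) ` {- \<lceil>R + cmod a\<rceil>..\<lceil>R + cmod a\<rceil>})" using ak by blast
    qed
    then show ?thesis by (rule finite_subset) (use A(1) in auto)
  qed
  obtain B where B: "\<And>z. z \<in> ?\<Sigma> \<Longrightarrow> \<bar>Im z\<bar> \<le> B"
  proof -
    have "bounded (Im ` A)" using A(1) by (simp add: finite_imp_bounded)
    then obtain B where "\<And>a. a \<in> A \<Longrightarrow> \<bar>Im a\<bar> \<le> B" unfolding bounded_iff by auto
    then have "\<bar>Im z\<bar> \<le> B" if "z \<in> ?\<Sigma>" for z using that unfolding A(2) by (auto elim!: Ints_cases)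
    then show thesis by (rule that)
  qed
  note M = max_graph_uf[OF gr F'(1,2,4)]
  note D = max_graphD[OF M]
  have Lip: "\<bar>uf S z - uf S w\<bar> \<le> dist z w" for z w
    by (rule Lipschitz_if_grad_less_1[OF continuous_uf[OF gr F'(3)] cS]) (use D(2,5) in auto)
  have low: "{z. Im z < - B} \<subseteq> - ?\<Sigma>" using B by force
  have "{z. Im z < - B} \<subseteq> cnj -` (- ?\<Sigma>)" using B by force
  from half_plane_end[OF max_graph_reflect[OF M] this]
  obtain a' C' Y' where up': "\<bar>a'\<bar> < 1" "0 < C'" "\<And>z. Im z \<le> - Y' \<Longrightarrow> \<bar>up S (cnj z)\<bar> + \<bar>- uq S (cnj z) - a'\<bar> \<le> C' / (1 + (Im z)\<^sup>2)\<^sup>2"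
    using uf_periodic u_periodic(1,2) by auto
  obtain a C Y where lo: "\<bar>a\<bar> < 1" "0 < C" "\<And>z. Im z \<le> - Y \<Longrightarrow> \<bar>up S z\<bar> + \<bar>uq S z - a\<bar> \<le> C / (1 + (Im z)\<^sup>2)\<^sup>2"
    by (rule half_plane_end[OF M low uf_periodic u_periodic(1,2)]) (rule that)
  have up'': "\<bar>up S z\<bar> + \<bar>uq S z + a'\<bar> \<le> C' / (1 + (Im z)\<^sup>2)\<^sup>2" if "Y' \<le> Im z" for z
  proof -
    have "\<bar>up S z\<bar> + \<bar>- uq S z - a'\<bar> \<le> C' / (1 + (Im z)\<^sup>2)\<^sup>2" using up'(3)[of "cnj z"] that by simp
    moreover have "\<bar>- uq S z - a'\<bar> = \<bar>uq S z + a'\<bar>" by linarith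
    ultimately show ?thesis by simp
  qed
  have a'0: "a' = 0"
  proof (rule ccontr)
    assume "a' \<noteq> 0"
    \<comment> \<open>The heights at y and y + 1 both lie within e of b, so some vertical derivative
      between is below 2e; it is also within e of -a'. Together this would give |a'| < 3e.\<close>
    define e where "e = \<bar>a'\<bar> / 4"
    have e: "0 < e" using \<open>a' \<noteq> 0\<close> by (simp add: e_def)
    obtain b where b: "\<And>\<epsilon>. 0 < \<epsilon> \<Longrightarrow> \<exists>R. \<forall>p\<in>S. x2 p > R \<longrightarrow> \<bar>x3 p - b\<bar> < \<epsilon>"
      using E1 unfolding E1_asymptotic_horizontal_def by blast
    obtain R where R: "\<And>p. p \<in> S \<Longrightarrow> x2 p > R \<Longrightarrow> \<bar>x3 p - b\<bar> < e" using b[OF e] by blast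
    have "((\<lambda>y::real. C' / (1 + y\<^sup>2)\<^sup>2) \<longlongrightarrow> 0) at_top" by real_asymp
    then have "\<forall>\<^sub>F y::real in at_top. C' / (1 + y\<^sup>2)\<^sup>2 < e" using e by (rule order_tendstoD)
    then obtain Y1 where Y1: "\<And>y. Y1 \<le> y \<Longrightarrow> C' / (1 + y\<^sup>2)\<^sup>2 < e" unfolding eventually_at_top_linorder by blast
    define y where "y = max (max Y' Y1) (max B R) + 1"
    have y: "Y' \<le> y" "Y1 \<le> y" "B < y" "R < y" by (auto simp: y_def)
    have d: "((\<lambda>t. uf S (Complex 0 t)) has_real_derivative uq S (Complex 0 t)) (at t)" if "y \<le> t" "t \<le> y + 1" for t
    proof (rule has_grad_Im_line[OF D(2)])
      show "Complex 0 t \<in> - ?\<Sigma>" using B[of "Complex 0 t"] that y by auto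
    qed
    obtain t where t: "y < t" "t < y + 1" "uf S (Complex 0 (y + 1)) - uf S (Complex 0 y) = (y + 1 - y) * uq S (Complex 0 t)"
      using MVT2[of y "y + 1" "\<lambda>t. uf S (Complex 0 t)" "\<lambda>t. uq S (Complex 0 t)"] d by auto
    have near: "\<bar>uf S (Complex 0 t) - b\<bar> < e" if "R < t" for t
      using R[OF graph_mem[OF gr, of "Complex 0 t"]] that by simp
    have "\<bar>uq S (Complex 0 t)\<bar> < 2 * e" using near[of y] near[of "y + 1"] y t(3) by simp
    moreover have "\<bar>uq S (Complex 0 t) + a'\<bar> < e"
      using up''[of "Complex 0 t"] Y1[of t] y t by simp
    ultimately show False unfolding e_def using abs_triangle_ineq4[of "uq S (Complex 0 t) + a'" "uq S (Complex 0 t)"] abs_ge_zero[of a'] by simp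
  qed
  define Y2 where "Y2 = max (max Y Y') (B + 1)"
  define C2 where "C2 = max C C'"
  have mono: "c / (1 + y\<^sup>2)\<^sup>2 \<le> C2 / (1 + y\<^sup>2)\<^sup>2" if "c \<le> C2" for c y :: real
    by (rule divide_right_mono[OF that]) simp
  show thesis
  proof (rule that)
    show "cyl_graph ?\<Sigma> (uf S) (up S) (uq S) (ur S) (us S) (ut S) a Y2 C2"
      unfolding cyl_graph_def
    proof (intro conjI allI ballI impI)
      show "closed ?\<Sigma>" by (rule closed_sing[OF gr F'(1,2)])
      show "max_graph (- ?\<Sigma>) (uf S) (up S) (uq S) (ur S) (us S) (ut S)" by (rule M)
      show "\<bar>uf S z - uf S w\<bar> \<le> dist z w" for z w by (rule Lip)
      show "\<bar>Im z\<bar> < Y2" if "z \<in> ?\<Sigma>" for z using B[OF that] by (simp add: Y2_def)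
      show "\<bar>up S z\<bar> + \<bar>uq S z - a\<bar> \<le> C2 / (1 + (Im z)\<^sup>2)\<^sup>2" if "Im z \<le> - Y2" for z
        by (rule order_trans[OF lo(3) mono]) (use that in \<open>auto simp: Y2_def C2_def\<close>)
      show "\<bar>up S z\<bar> + \<bar>uq S z\<bar> \<le> C2 / (1 + (Im z)\<^sup>2)\<^sup>2" if "Y2 \<le> Im z" for z
        using order_trans[OF up''[of z] mono[of C']] that a'0 by (auto simp: Y2_def C2_def)
    qed (use lo(1) uf_periodic u_periodic sing_periodic in auto)
  qed
qed

text \<open>Every patch through the point sees the same gradient, so the tangent plane does not
  depend on the patch. For the converse a patch is needed, which exists because the surface is
  maximal away from \<open>F\<close>.\<close>

lemma past_unit_normal_iff:
  assumes S: "graph_over_cylinder S" "closedin (top_of_set S) F" "maximal_surface (S - F)" and z: "z \<in> - sing S F"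
  shows "past_unit_normal S (pr z (uf S z)) \<nu> \<longleftrightarrow>
    \<nu> = - (1 / wt (up S z) (uq S z)) *\<^sub>R vector [up S z, uq S z, 1]"
proof -
  define p q w where "p = up S z" and "q = uq S z" and "w = wt p q"
  have per: "up S (z + of_int k) = up S z" "uq S (z + of_int k) = uq S z" for k
    by (rule periodic_int, rule u_periodic)+
  have patch: "dir X h x $ 3 = p * dir X h x $ 1 + q * dir X h x $ 2" "p\<^sup>2 + q\<^sup>2 < 1"
     "dir X 1 x $ 1 * dir X \<i> x $ 2 - dir X \<i> x $ 1 * dir X 1 x $ 2 \<noteq> 0"
    if X: "spacelike_patch S U X" "x \<in> U" "proj (X x) = pr z (uf S z)" for U X x h
  proof -
    obtain k :: int where k: "hor (X x) = z + of_int k"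
      using X(3)[symmetric] by (auto simp: proj_eq_pr pr_eq_iff)
    note P = patch_grad[OF S(1) X(1) subset_refl]
    show "dir X h x $ 3 = p * dir X h x $ 1 + q * dir X h x $ 2" "p\<^sup>2 + q\<^sup>2 < 1"
     "dir X 1 x $ 1 * dir X \<i> x $ 2 - dir X \<i> x $ 1 * dir X 1 x $ 2 \<noteq> 0"
      using P(7)[OF X(2), of h] P(6)[OF X(2)] P(8)[OF X(2)] unfolding k per p_def q_def by simp_all
  qed
  have val: "(- (1 / w) *\<^sub>R vector [p, q, 1] :: real^3) $ 1 = - p / w" "(- (1 / w) *\<^sub>R vector [p, q, 1] :: real^3) $ 2 = - q / w"
    "(- (1 / w) *\<^sub>R vector [p, q, 1] :: real^3) $ 3 = - 1 / w" by simp_all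
  have "past_unit_normal S (pr z (uf S z)) \<nu> \<longleftrightarrow> \<nu> = - (1 / w) *\<^sub>R vector [p, q, 1]"
  proof
    assume "past_unit_normal S (pr z (uf S z)) \<nu>"
    then obtain U X x where n3: "\<nu> $ 3 < 0" and X: "spacelike_patch S U X" "x \<in> U" "proj (X x) = pr z (uf S z)" and un: "unit_normal X x \<nu>"
      unfolding past_unit_normal_def by blast
    note P = patch[OF X]
    define a b c d where "a = dir X 1 x $ 1" and "b = dir X \<i> x $ 1" and "c = dir X 1 x $ 2" and "d = dir X \<i> x $ 2"
    have j: "a * d - b * c \<noteq> 0" using P(3) by (simp add: a_def b_def c_def d_def)
    define A B where "A = \<nu> $ 1 - p * \<nu> $ 3" and "B = \<nu> $ 2 - q * \<nu> $ 3"
    have "lorentz \<nu> (dir X 1 x) = 0" "lorentz \<nu> (dir X \<i> x) = 0" using un unfolding unit_normal_def by blast+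
    then have "A * a + B * c = 0" "A * b + B * d = 0"
      unfolding lorentz_def P(1) A_def B_def a_def b_def c_def d_def by (simp_all add: algebra_simps)
    then have "A * (a * d - b * c) = 0" "B * (a * d - b * c) = 0" by algebra+
    then have AB: "\<nu> $ 1 = p * \<nu> $ 3" "\<nu> $ 2 = q * \<nu> $ 3" using j by (simp_all add: A_def B_def)
    have w: "0 < w" "w * w = 1 - p * p - q * q" using P(2) by (simp_all add: w_def power2_eq_square)
    have "lorentz \<nu> \<nu> = -1" using un unfolding unit_normal_def by blast
    then have "(\<nu> $ 3 * w) * (\<nu> $ 3 * w) = 1 * 1"
      unfolding lorentz_def AB using w(2) by algebra
    moreover have "\<nu> $ 3 * w < 0" using n3 w(1) by (simp add: mult_neg_pos)
    ultimately have "\<nu> $ 3 * w = -1" by (simp only: square_eq_iff) linarith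
    then have "\<nu> $ 3 = - 1 / w" using w(1) by (simp add: field_simps)
    then show "\<nu> = - (1 / w) *\<^sub>R vector [p, q, 1]"
      unfolding vec_eq_iff forall_3 val AB by simp
  next
    assume \<nu>: "\<nu> = - (1 / w) *\<^sub>R vector [p, q, 1]"
    have "pr z (uf S z) \<in> S - F" using z graph_mem[OF S(1)] by (simp add: sing_def)
    then obtain U X where X: "spacelike_patch (S - F) U X" "pr z (uf S z) \<in> (proj \<circ> X) ` U"
      by (rule graph_patch_exists[OF S(3)]) (rule that)
    \<comment> \<open>A patch of \<open>S - F\<close> is a patch of \<open>S\<close>, since
      \<open>S - F\<close> is relatively open in \<open>S\<close>.\<close>
    have op: "openin (top_of_set S) (S - F)" using S(2) by (simp add: openin_diff)
    have X': "spacelike_patch S U X"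
      using X(1) openin_trans[OF _ op, of "(proj \<circ> X) ` U"] unfolding spacelike_patch_def by blast
    obtain x where x: "x \<in> U" "proj (X x) = pr z (uf S z)" using X(2) by auto
    note P = patch[OF X' x]
    have w: "0 < w" "w * w = 1 - p * p - q * q" using P(2) by (simp_all add: w_def power2_eq_square)
    have "unit_normal X x \<nu>"
      unfolding unit_normal_def lorentz_def P(1) \<nu> val
    proof (intro conjI allI)
      have "- p / w * (- p / w) + - q / w * (- q / w) - - 1 / w * (- 1 / w) = (p * p + q * q - 1) / (w * w)"
        using w(1) by (simp add: field_simps)
      also have "p * p + q * q - 1 = - (w * w)" using w(2) by simp
      also have "- (w * w) / (w * w) = -1" using w(1) by simp
      finally show "- p / w * (- p / w) + - q / w * (- q / w) - - 1 / w * (- 1 / w) = -1" .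
    qed (use w(1) in \<open>simp add: field_simps\<close>)
    moreover have "\<nu> $ 3 < 0" unfolding \<nu> val using w(1) by simp
    ultimately show "past_unit_normal S (pr z (uf S z)) \<nu>"
      unfolding past_unit_normal_def using X' x by blast
  qed
  then show ?thesis by (simp add: p_def q_def w_def)
qed

text \<open>The vector \<open>normal_of_param c\<close> is proportional to (0,
  \<open>slope c\<close>, 1), so this is the slope of the asymptotic plane of the second end. The
  inverse \<open>unslope\<close> is a half-angle formula.\<close>

definition slope :: "real \<Rightarrow> real" where "slope c = - 2 * c / (1 + c\<^sup>2)"

definition unslope :: "real \<Rightarrow> real" where "unslope a = - a / (1 + sqrt (1 - a\<^sup>2))"

lemma slope_unslope:
  assumes "\<bar>a\<bar> < 1" shows "\<bar>unslope a\<bar> < 1" "slope (unslope a) = a"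
    "normal_of_param (unslope a) = - (1 / wt 0 a) *\<^sub>R vector [0, a, 1]"
proof -
  define w where "w = sqrt (1 - a\<^sup>2)"
  have a2: "a\<^sup>2 < 1" using assms by (simp add: abs_square_less_1)
  then have w: "0 < w" "w\<^sup>2 = 1 - a\<^sup>2" by (simp_all add: w_def)
  have c: "unslope a = - a / (1 + w)" by (simp add: unslope_def w_def)
  show "\<bar>unslope a\<bar> < 1" unfolding c using w assms by (simp add: abs_divide)
  have c2: "(unslope a)\<^sup>2 = (1 - w) / (1 + w)"
  proof -
    have "(unslope a)\<^sup>2 = a\<^sup>2 / (1 + w)\<^sup>2" by (simp add: c power_divide)
    also have "a\<^sup>2 = (1 - w) * (1 + w)" using w(2) by (simp add: power2_eq_square algebra_simps)
    finally show ?thesis using w(1) by (simp add: power2_eq_square)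
  qed
  have p: "1 + (unslope a)\<^sup>2 = 2 / (1 + w)" and m: "(unslope a)\<^sup>2 - 1 = - 2 * w / (1 + w)"
    unfolding c2 using w(1) by (simp_all add: field_simps)
  show "slope (unslope a) = a" unfolding slope_def p unfolding c using w(1) by simp
  have gen: "- 2 * (- a / v) / (- 2 * w / v) = - a / w" "2 / v / (- 2 * w / v) = - 1 / w" if "v \<noteq> 0" for v
    using that w(1) by (simp_all add: field_simps)
  have "- 2 * unslope a / ((unslope a)\<^sup>2 - 1) = - a / w"
    unfolding m unfolding c by (rule gen) (use w in simp)
  moreover have "((unslope a)\<^sup>2 + 1) / ((unslope a)\<^sup>2 - 1) = - 1 / w"
    unfolding m add.commute[of _ 1] p unfolding add.commute[of 1 w] by (rule gen) (use w in simp)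
  ultimately show "normal_of_param (unslope a) = - (1 / wt 0 a) *\<^sub>R vector [0, a, 1]"
    by (simp add: normal_of_param_def vec_eq_iff forall_3 w_def)
qed

lemma normal_of_param_inj:
  assumes "normal_of_param c = normal_of_param d" "\<bar>c\<bar> < 1" "\<bar>d\<bar> < 1" shows "c = d"
proof -
  have c1: "c\<^sup>2 - 1 < 0" "d\<^sup>2 - 1 < 0" using assms by (simp_all add: abs_square_less_1)
  have e: "- 2 * c / (c\<^sup>2 - 1) = - 2 * d / (d\<^sup>2 - 1)" "(c\<^sup>2 + 1) / (c\<^sup>2 - 1) = (d\<^sup>2 + 1) / (d\<^sup>2 - 1)"
    using arg_cong[OF assms(1), of "\<lambda>v. v $ 2"] arg_cong[OF assms(1), of "\<lambda>v. v $ 3"] by (simp_all add: normal_of_param_def)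
  have "(c\<^sup>2 + 1) * (d\<^sup>2 - 1) = (d\<^sup>2 + 1) * (c\<^sup>2 - 1)" using e(2) c1 by (simp add: frac_eq_eq)
  then have "c\<^sup>2 = d\<^sup>2" by (simp add: algebra_simps)
  with e(1) c1 show ?thesis by simp
qed

text \<open>The definite description in \<open>c_param\<close> is meaningful: the gradient converges
  along the lower end, and regular points arbitrarily far down make the limit normal unique.\<close>

lemma c_param_eq:
  assumes S: "S \<in> GG n" and F: "CMF S F" and u: "cyl_graph (sing S F) (uf S) (up S) (uq S) (ur S) (us S) (ut S) a Y C"
  shows "c_param S = unslope a"
proof -
  have gr: "graph_over_cylinder S" using S by (auto simp: GG_def)
  have F': "closedin (top_of_set S) F" "maximal_surface (S - F)" "F \<subseteq> S"
    using F by (auto simp: CMF_def maximal_with_singularities_def)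
  note D = cyl_graphD[OF u]
  note pn = past_unit_normal_iff[OF gr F'(1,2)]
  have outside: "z \<in> - sing S F" if "Im z \<le> - Y" for z using D(8)[of z] that by auto
  define N :: "real \<Rightarrow> real \<Rightarrow> real^3" where "N = (\<lambda>p q. - (1 / wt p q) *\<^sub>R vector [p, q, 1])"
  have lim: "\<exists>R. \<forall>z. Im z < R \<longrightarrow> z \<in> - sing S F \<and> dist (N (up S z) (uq S z)) (N 0 a) < \<epsilon>" if e: "0 < \<epsilon>" for \<epsilon>
  proof -
    have Nx: "N (fst x) (snd x) = (- fst x / wt (fst x) (snd x)) *\<^sub>R axis 1 1 + (- snd x / wt (fst x) (snd x)) *\<^sub>R axis 2 1 + (- 1 / wt (fst x) (snd x)) *\<^sub>R axis 3 1" for x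
      by (simp add: N_def vec_eq_iff forall_3 axis_def)
    have a1: "wt 0 a \<noteq> 0" using D(7) by (simp add: abs_square_less_1) (metis abs_square_less_1 less_irrefl)
    have "isCont (\<lambda>x. N (fst x) (snd x)) (0, a)" unfolding Nx by (intro continuous_intros) (use a1 in auto)
    then obtain d where d: "0 < d" "\<And>x. dist x (0, a) < d \<Longrightarrow> dist (N (fst x) (snd x)) (N 0 a) < \<epsilon>"
      unfolding continuous_at_eps_delta using e by fastforce
    have "((\<lambda>y::real. C / (1 + y\<^sup>2)\<^sup>2) \<longlongrightarrow> 0) at_bot" by real_asymp
    then have "\<forall>\<^sub>F y::real in at_bot. C / (1 + y\<^sup>2)\<^sup>2 < d" using d(1) by (rule order_tendstoD)
    then obtain Y1 where Y1: "\<And>y. y \<le> Y1 \<Longrightarrow> C / (1 + y\<^sup>2)\<^sup>2 < d" unfolding eventually_at_bot_linorder by blast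
    show ?thesis
    proof (intro exI[of _ "min Y1 (- Y)"] allI impI conjI)
      fix z assume z: "Im z < min Y1 (- Y)"
      show "z \<in> - sing S F" using outside z by simp
      have "dist (up S z, uq S z) (0, a) \<le> \<bar>up S z\<bar> + \<bar>uq S z - a\<bar>"
        using sqrt_sum_squares_le_sum_abs[of "up S z" "uq S z - a"] by (simp add: dist_Pair_Pair dist_real_def)
      also have "\<dots> \<le> C / (1 + (Im z)\<^sup>2)\<^sup>2" using D(9)[of z] z by simp
      also have "\<dots> < d" using Y1[of "Im z"] z by simp
      finally show "dist (N (up S z) (uq S z)) (N 0 a) < \<epsilon>" using d(2)[of "(up S z, uq S z)"] by simp
    qed
  qed
  have E2: "E2_limit_normal S (N 0 a)"
    unfolding E2_limit_normal_def
  proof (intro allI impI)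
    fix \<epsilon> :: real assume "0 < \<epsilon>"
    from lim[OF this] obtain R where R: "\<And>z. Im z < R \<Longrightarrow> z \<in> - sing S F \<and> dist (N (up S z) (uq S z)) (N 0 a) < \<epsilon>" by blast
    show "\<exists>R. \<forall>p\<in>S. x2 p < R \<longrightarrow> (\<forall>\<nu>'. past_unit_normal S p \<nu>' \<longrightarrow> dist \<nu>' (N 0 a) < \<epsilon>)"
    proof (intro exI[of _ R] ballI allI impI)
      fix p \<nu>' assume p: "p \<in> S" "x2 p < R" "past_unit_normal S p \<nu>'"
      obtain z h where zh: "p = pr z h" by (rule pr_cases)
      then have pz: "p = pr z (uf S z)" using p(1) graph_iff[OF gr] by metis
      then have "Im z < R" using p(2) by simp
      then show "dist \<nu>' (N 0 a) < \<epsilon>" using R[of z] p(3) pn[of z] unfolding pz N_def by auto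
    qed
  qed
  have uniq: "\<nu> = N 0 a" if "E2_limit_normal S \<nu>" for \<nu>
  proof (rule ccontr)
    assume "\<nu> \<noteq> N 0 a"
    then have e: "0 < dist \<nu> (N 0 a) / 2" by simp
    obtain R where R: "\<And>z. Im z < R \<Longrightarrow> z \<in> - sing S F \<and> dist (N (up S z) (uq S z)) (N 0 a) < dist \<nu> (N 0 a) / 2" using lim[OF e] by blast
    have "\<exists>R. \<forall>p\<in>S. x2 p < R \<longrightarrow> (\<forall>\<nu>'. past_unit_normal S p \<nu>' \<longrightarrow> dist \<nu>' \<nu> < dist \<nu> (N 0 a) / 2)"
      using that[unfolded E2_limit_normal_def, rule_format, OF e] by blast
    then obtain R' where R': "\<And>p \<nu>'. p \<in> S \<Longrightarrow> x2 p < R' \<Longrightarrow> past_unit_normal S p \<nu>' \<Longrightarrow> dist \<nu>' \<nu> < dist \<nu> (N 0 a) / 2"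
      by blast
    define z where "z = Complex 0 (min R R' - 1)"
    have z: "Im z < R" "Im z < R'" by (simp_all add: z_def)
    have zs: "z \<in> - sing S F" using R[OF z(1)] by simp
    have "dist (N (up S z) (uq S z)) \<nu> < dist \<nu> (N 0 a) / 2"
      by (rule R'[OF graph_mem[OF gr, of z]]) (use z pn[OF zs] in \<open>auto simp: N_def\<close>)
    then show False using R[OF z(1)] dist_triangle3[of \<nu> "N 0 a" "N (up S z) (uq S z)"] by simp
  qed
  note su = slope_unslope[OF D(7)]
  show ?thesis
    unfolding c_param_def
  proof (rule the_equality)
    show "unslope a \<in> {-1<..<1} \<and> E2_limit_normal S (normal_of_param (unslope a))"
      using su E2 by (auto simp: N_def abs_less_iff)
    fix c assume c: "c \<in> {-1<..<1} \<and> E2_limit_normal S (normal_of_param c)"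
    then have "normal_of_param c = normal_of_param (unslope a)" using uniq su(3) by (simp add: N_def)
    then show "c = unslope a" by (rule normal_of_param_inj) (use c su(1) in auto)
  qed
qed

section \<open>A point where the metric vanishes is not a regular point\<close>

lemma continuous_on_lewy:
  assumes "continuous_on A p" "continuous_on A q" "continuous_on A a" "continuous_on A b" "\<And>z. z \<in> A \<Longrightarrow> (p z)\<^sup>2 + (q z)\<^sup>2 < 1"
  shows "continuous_on A (\<lambda>z. lewy (p z) (q z) (Complex (a z) (b z)))"
proof -
  define w where "w = (\<lambda>z. wt (p z) (q z))"
  have w: "continuous_on A w" unfolding w_def by (intro continuous_intros assms)
  have w0: "\<forall>z\<in>A. w z \<noteq> 0" unfolding w_def using assms(5) by fastforce
  have eq: "lewy (p z) (q z) (Complex (a z) (b z)) = of_real ((1 + (1 - (p z)\<^sup>2) / w z) * a z + (- p z * q z / w z) * b z)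
     + \<i> * of_real ((- p z * q z / w z) * a z + (1 + (1 - (q z)\<^sup>2) / w z) * b z)" for z
    by (simp add: lewy_def w_def complex_eq_iff)
  show ?thesis unfolding eq by (intro continuous_intros assms(1-4) w w0)
qed

text \<open>The hypotheses say that a and b are orthogonal of equal length, so they differ by a
  quarter turn in one of the two directions.\<close>

lemma orthogonal_complex_cases:
  assumes "a \<noteq> 0" "cmod b = cmod a" "(cmod (a + b))\<^sup>2 = 2 * (cmod a)\<^sup>2"
  shows "b / a = \<i> \<or> b / a = - \<i>"
proof -
  define x y where "x = Re (b / a)" and "y = Im (b / a)"
  have "cmod (b / a) = 1" using assms by (simp add: norm_divide)
  then have 1: "x\<^sup>2 + y\<^sup>2 = 1" by (simp add: x_def y_def flip: cmod_power2)
  have "a + b = a * (1 + b / a)" using assms(1) by (simp add: field_simps)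
  then have "(cmod a)\<^sup>2 * (cmod (1 + b / a))\<^sup>2 = (cmod a)\<^sup>2 * 2"
    using assms(3) by (simp add: norm_mult power_mult_distrib)
  then have "(cmod (1 + b / a))\<^sup>2 = 2" using assms(1) by simp
  then have "(1 + x)\<^sup>2 + y\<^sup>2 = 2" by (simp add: cmod_power2 x_def y_def)
  then have x0: "x = 0" using 1 by (simp add: power2_eq_square algebra_simps)
  then have "y = 1 \<or> y = -1" using 1 by (simp add: power2_eq_1_iff)
  then show ?thesis using x0 by (auto simp: complex_eq_iff x_def y_def)
qed

text \<open>The Lewy primitive is a conformal coordinate, hence holomorphic or antiholomorphic in any
  other one.\<close>

lemma conformal_patch_lewy:
  fixes X :: "complex \<Rightarrow> real^3"
  assumes S: "graph_over_cylinder S" and X: "spacelike_patch T A X" "T \<subseteq> S" and conf: "conformal_on A X" and con: "connected A"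
    and M: "max_graph \<Omega> (uf S) (up S) (uq S) r s t" and sub: "\<And>z. z \<in> A \<Longrightarrow> hor (X z) \<in> \<Omega>"
  obtains \<kappa> g where "\<kappa> = (\<lambda>z. z) \<or> \<kappa> = cnj" "g holomorphic_on A"
    "\<And>z h. z \<in> A \<Longrightarrow> \<kappa> (lewy (up S (hor (X z))) (uq S (hor (X z))) (hor (dir X h z))) = g z * h"
    "\<And>z. z \<in> A \<Longrightarrow> (cmod (g z))\<^sup>2 = ((1 + wt (up S (hor (X z))) (uq S (hor (X z)))) / wt (up S (hor (X z))) (uq S (hor (X z))))\<^sup>2
       * lorentz (dir X 1 z) (dir X 1 z)"
proof -
  define Y where "Y = (\<lambda>z. hor (X z))"
  have Yz: "hor (X z) = Y z" for z by (simp add: Y_def)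
  note P = patch_grad[OF S X, unfolded Yz]
  have oA: "open A" and sm: "smooth_on A X" and pos: "\<And>z w. z \<in> A \<Longrightarrow> w \<noteq> 0 \<Longrightarrow> lorentz (dir X w z) (dir X w z) > 0"
    using X(1) by (auto simp: spacelike_patch_def)
  note sd = smooth_on_dir[OF sm oA]
  define L where "L = (\<lambda>z h. lewy (up S (Y z)) (uq S (Y z)) (hor (dir X h z)))"
  define k where "k = (\<lambda>z. ((1 + wt (up S (Y z)) (uq S (Y z))) / wt (up S (Y z)) (uq S (Y z)))\<^sup>2)"
  have hlin: "hor (a *\<^sub>R v + b *\<^sub>R w) = a *\<^sub>R hor v + b *\<^sub>R hor w" for a b v w by (simp add: hor_def complex_eq_iff)
  have hdir: "hor (dir X h z) = Re h *\<^sub>R hor (dir X 1 z) + Im h *\<^sub>R hor (dir X \<i> z)" if "z \<in> A" for z h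
    unfolding hlin[symmetric] using sd(4)[OF that, of h] by simp
  have lin: "L z h = Re h *\<^sub>R L z 1 + Im h *\<^sub>R L z \<i>" if "z \<in> A" for z h
    unfolding L_def hdir[OF that, of h] linear_add[OF linear_lewy] linear_cmul[OF linear_lewy] ..
  have norm: "(cmod (L z h))\<^sup>2 = k z * lorentz (dir X h z) (dir X h z)" if z: "z \<in> A" for z h
  proof -
    have "lorentz (dir X h z) (dir X h z) = (cmod (hor (dir X h z)))\<^sup>2 - (up S (Y z) * Re (hor (dir X h z)) + uq S (Y z) * Im (hor (dir X h z)))\<^sup>2"
      unfolding cmod_power2 using P(7)[OF z, of h] by (simp add: lorentz_def hor_def power2_eq_square)
    then show ?thesis unfolding L_def k_def using lewy_norm[OF P(6)[OF z]] by simp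
  qed
  have ratio: "L z 1 \<noteq> 0" "L z \<i> / L z 1 = \<i> \<or> L z \<i> / L z 1 = - \<i>" if z: "z \<in> A" for z
  proof -
    define w where "w = wt (up S (Y z)) (uq S (Y z))"
    have "0 < w" using P(6)[OF z] by (simp add: w_def)
    then have k: "0 < k z" unfolding k_def w_def[symmetric] by simp
    have c: "lorentz (dir X \<i> z) (dir X \<i> z) = lorentz (dir X 1 z) (dir X 1 z)" "lorentz (dir X 1 z) (dir X \<i> z) = 0"
      using conf z by (auto simp: conformal_on_def)
    have "(cmod (L z 1))\<^sup>2 > 0" unfolding norm[OF z] using k pos[OF z, of 1] by simp
    then show n0: "L z 1 \<noteq> 0" by auto
    have "(cmod (L z \<i>))\<^sup>2 = (cmod (L z 1))\<^sup>2" unfolding norm[OF z] c ..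
    then have e: "cmod (L z \<i>) = cmod (L z 1)" by simp
    have "dir X (1 + \<i>) z = dir X 1 z + dir X \<i> z" using sd(4)[OF z, of "1 + \<i>"] by simp
    then have "lorentz (dir X (1 + \<i>) z) (dir X (1 + \<i>) z) = lorentz (dir X 1 z) (dir X 1 z) + 2 * lorentz (dir X 1 z) (dir X \<i> z) + lorentz (dir X \<i> z) (dir X \<i> z)"
      by (simp add: lorentz_def algebra_simps)
    then have "(cmod (L z (1 + \<i>)))\<^sup>2 = 2 * (cmod (L z 1))\<^sup>2" unfolding norm[OF z] c by simp
    then have "(cmod (L z 1 + L z \<i>))\<^sup>2 = 2 * (cmod (L z 1))\<^sup>2" using lin[OF z, of "1 + \<i>"] by simp
    then show "L z \<i> / L z 1 = \<i> \<or> L z \<i> / L z 1 = - \<i>" by (rule orthogonal_complex_cases[OF n0 e])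
  qed
  have contX: "continuous_on A X" using sm unfolding smooth_on_def by (metis Ck_on.simps(1))
  have contY: "continuous_on A Y" unfolding Y_def by (rule continuous_on_compose2[OF continuous_hor contX]) auto
  have cpq: "continuous_on A (\<lambda>z. up S (Y z))" "continuous_on A (\<lambda>z. uq S (Y z))"
    by (rule continuous_on_compose2[OF C1_on_continuous[OF P(9)] contY] continuous_on_compose2[OF C1_on_continuous[OF P(10)] contY]; simp)+
  have cd: "continuous_on A (\<lambda>z. dir X v z $ i)" for v i
    by (intro continuous_at_imp_continuous_on ballI has_grad_imp_isCont) (rule sd(2))
  have cL: "continuous_on A (\<lambda>z. L z h)" for h
    unfolding L_def hor_def by (rule continuous_on_lewy[OF cpq cd cd P(6)])
  \<comment> \<open>The quarter turn depends continuously on the point and takes at most two values,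
    so its direction is constant on the connected domain.\<close>
  have "connected ((\<lambda>z. L z \<i> / L z 1) ` A)"
    by (rule connected_continuous_image[OF _ con]) (intro continuous_intros cL, use ratio(1) in auto)
  moreover have "finite ((\<lambda>z. L z \<i> / L z 1) ` A)" by (rule finite_subset[of _ "{\<i>, - \<i>}"]) (use ratio(2) in auto)
  ultimately have "(\<lambda>z. L z \<i> / L z 1) ` A = {} \<or> (\<exists>x. (\<lambda>z. L z \<i> / L z 1) ` A = {x})"
    using connected_finite_iff_sing by blast
  then obtain \<sigma> where \<sigma>: "\<And>z. z \<in> A \<Longrightarrow> L z \<i> / L z 1 = \<sigma>" by auto
  define \<kappa> where "\<kappa> = (if \<sigma> = \<i> then (\<lambda>z. z) else cnj)"
  have \<kappa>: "\<kappa> = (\<lambda>z. z) \<or> \<kappa> = cnj" by (simp add: \<kappa>_def)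
  have bl: "bounded_linear \<kappa>" using \<kappa> bounded_linear_cnj bounded_linear_ident by auto
  define g where "g = (\<lambda>z. \<kappa> (L z 1))"
  have g: "\<kappa> (L z h) = g z * h" if z: "z \<in> A" for z h
  proof -
    have Li: "L z \<i> = \<sigma> * L z 1" using \<sigma>[OF z] ratio(1)[OF z] by (simp add: field_simps)
    have "\<sigma> = \<i> \<or> \<sigma> = - \<i>" using \<sigma>[OF z] ratio(2)[OF z] by simp
    then show ?thesis unfolding lin[OF z, of h] Li g_def \<kappa>_def by (auto simp: complex_eq_iff algebra_simps)
  qed
  have gn: "(cmod (g z))\<^sup>2 = k z * lorentz (dir X 1 z) (dir X 1 z)" if "z \<in> A" for z
    unfolding norm[OF that, symmetric] g_def using \<kappa> by auto
  have dY: "(Y has_derivative (\<lambda>h. hor (dir X h z))) (at z)" if z: "z \<in> A" for z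
  proof -
    have d: "((\<lambda>z. Complex (X z $ 1) (X z $ 2)) has_derivative (\<lambda>h. of_real (Re h) * Complex (dir X 1 z $ 1) (dir X 1 z $ 2) + of_real (Im h) * Complex (dir X \<i> z $ 1) (dir X \<i> z $ 2))) (at z)"
      by (rule has_grad_Complex[OF sd(1)[OF z] sd(1)[OF z]])
    have e: "hor (dir X h z) = of_real (Re h) * Complex (dir X 1 z $ 1) (dir X 1 z $ 2) + of_real (Im h) * Complex (dir X \<i> z $ 1) (dir X \<i> z $ 2)" for h
      by (subst hdir[OF z, of h]) (simp add: hor_def scaleR_conv_of_real)
    have "Y = (\<lambda>z. Complex (X z $ 1) (X z $ 2))" by (simp add: Y_def hor_def fun_eq_iff)
    then show ?thesis using has_derivative_eq_rhs[OF d ext[OF e[symmetric]]] by (simp only:)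
  qed
  have hol: "g holomorphic_on A"
  proof (unfold holomorphic_on_def, rule ballI)
    fix z0 assume z0: "z0 \<in> A"
    have "Y z0 \<in> \<Omega>" "open \<Omega>" using sub[OF z0] max_graphD(1)[OF M] by (simp_all add: Y_def)
    then obtain e where e: "0 < e" "ball (Y z0) e \<subseteq> \<Omega>" using open_contains_ball by blast
    obtain \<zeta> where \<zeta>: "\<And>y. y \<in> ball (Y z0) e \<Longrightarrow> (\<zeta> has_derivative lewy (up S y) (uq S y)) (at y)"
      by (rule lewy_primitive[OF M open_ball convex_ball e(2)]) (rule that)
    define W where "W = A \<inter> Y -` ball (Y z0) e"
    have W: "open W" "z0 \<in> W" using continuous_open_preimage[OF contY oA open_ball] z0 e(1) by (simp_all add: W_def)
    \<comment> \<open>A local Lewy primitive in the patch coordinate has complex derivative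
      \<open>g\<close>; therefore \<open>g\<close> is holomorphic, although it was only known to be
      continuous.\<close>
    have d: "((\<lambda>z. \<kappa> (\<zeta> (Y z))) has_field_derivative g z) (at z)" if z: "z \<in> W" for z
    proof -
      have zA: "z \<in> A" and zY: "Y z \<in> ball (Y z0) e" using z by (auto simp: W_def)
      have "((\<lambda>z. \<kappa> (\<zeta> (Y z))) has_derivative (\<lambda>h. \<kappa> (L z h))) (at z)"
        unfolding L_def by (rule bounded_linear.has_derivative[OF bl has_derivative_compose[OF dY[OF zA] \<zeta>[OF zY]]])
      then show ?thesis unfolding has_field_derivative_def g[OF zA] .
    qed
    have "(\<lambda>z. \<kappa> (\<zeta> (Y z))) holomorphic_on W" unfolding holomorphic_on_open[OF W(1)] using d by blast
    then have "deriv (\<lambda>z. \<kappa> (\<zeta> (Y z))) holomorphic_on W" using W(1) by (rule holomorphic_deriv)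
    then have "g holomorphic_on W" by (rule holomorphic_transform) (rule DERIV_imp_deriv[OF d])
    then have "g field_differentiable (at z0)" by (rule holomorphic_on_imp_differentiable_at[OF _ W])
    then show "g field_differentiable (at z0 within A)" by (rule field_differentiable_at_within)
  qed
  show thesis by (rule that[OF \<kappa> hol]) (use g gn in \<open>auto simp: L_def k_def Y_def\<close>)
qed

text \<open>The exponential unrolls the annulus into a strip whose edge is the imaginary axis.
  Extended by 0 across this edge the function is continuous, hence holomorphic, and the identity
  theorem applies.\<close>

lemma annulus_boundary_zero:
  assumes g: "g holomorphic_on {z. r < norm z \<and> norm z < 1}" and r: "0 < r" "r < 1"
    and lim: "(g \<longlongrightarrow> 0) (filtercomap norm (at_left 1))" and z: "r < norm z" "norm z < 1"
  shows "g z = 0"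
proof -
  define H where "H = (\<lambda>x. if Re x < 0 then g (exp x) else 0)"
  define U where "U = {x. ln r < Re x}"
  have U: "open U" "convex U" unfolding U_def by (auto intro: open_halfspace_Re_gt convex_halfspace_Re_gt)
  have ex: "exp x \<in> {z. r < norm z \<and> norm z < 1}" if "x \<in> U" "Re x < 0" for x
  proof -
    have "exp (ln r) < exp (Re x)" using that by (simp add: U_def)
    then show ?thesis using that r by simp
  qed
  have neg: "H holomorphic_on (U \<inter> {x. 1 \<bullet> x < 0})"
  proof (rule holomorphic_transform)
    show "(\<lambda>x. g (exp x)) holomorphic_on (U \<inter> {x. 1 \<bullet> x < 0})"
      by (rule holomorphic_on_compose_gen[OF holomorphic_on_exp g, unfolded o_def]) (use ex in auto)
  qed (auto simp: H_def)
  have posi: "H holomorphic_on (U \<inter> {x. 0 < 1 \<bullet> x})"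
    by (rule holomorphic_transform[OF holomorphic_on_const[of 0]]) (auto simp: H_def)
  have "isCont H x" if x: "x \<in> U" for x
  proof (cases "Re x = 0")
    case True
    have "\<forall>\<^sub>F y in at x. dist (H y) 0 < e" if e: "0 < e" for e
    proof -
      have "\<forall>\<^sub>F z in filtercomap norm (at_left 1). dist (g z) 0 < e" using lim e by (rule tendstoD)
      then obtain Q where Q: "eventually Q (at_left 1)" "\<And>z. Q (norm z) \<Longrightarrow> dist (g z) 0 < e"
        unfolding eventually_filtercomap by blast
      from Q(1) obtain b where b: "b < 1" "\<And>y::real. b < y \<Longrightarrow> y < 1 \<Longrightarrow> Q y"
        unfolding eventually_at_left[OF zero_less_one] by blast
      have "((\<lambda>y. exp (Re y)) \<longlongrightarrow> exp (Re x)) (at x)" by (intro tendsto_intros)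
      then have "\<forall>\<^sub>F y in at x. b < exp (Re y)" by (rule order_tendstoD) (use True b in simp)
      then show ?thesis
      proof eventually_elim
        case (elim y)
        show ?case
        proof (cases "Re y < 0")
          case True
          then show ?thesis using Q(2)[of "exp y"] b(2)[of "exp (Re y)"] elim by (simp add: H_def)
        qed (use e in \<open>simp add: H_def\<close>)
      qed
    qed
    then have "(H \<longlongrightarrow> 0) (at x)" by (rule tendstoI)
    then show ?thesis using True by (simp add: isCont_def H_def)
  next
    case False
    then have "x \<in> U \<inter> {x. 1 \<bullet> x < 0} \<or> x \<in> U \<inter> {x. 0 < 1 \<bullet> x}" using x by auto
    moreover have "open (U \<inter> {x. 1 \<bullet> x < 0})" "open (U \<inter> {x. 0 < 1 \<bullet> x})" using U(1) by (auto intro!: open_Int open_halfspace_Re_lt open_halfspace_Re_gt)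
    ultimately show ?thesis using neg posi
      by (metis continuous_on_eq_continuous_at holomorphic_on_imp_continuous_on)
  qed
  then have "continuous_on U H" by (simp add: continuous_at_imp_continuous_on)
  then have hol: "H holomorphic_on U" by (rule holomorphic_on_paste_across_line[OF U(1) _ neg posi, rotated]) simp
  have zn: "z \<noteq> 0" using z r by auto
  have "H (Ln z) = 0"
  proof (rule analytic_continuation_open[of "{x. 0 < Re x}" U H "\<lambda>_. 0"])
    show "{x. 0 < Re x} \<noteq> {}" by (auto intro!: exI[of _ 1])
    show "{x. 0 < Re x} \<subseteq> U" using r by (auto simp: U_def intro: less_trans[OF ln_less_zero])
    show "Ln z \<in> U" using z r zn by (simp add: U_def)
  qed (use U hol in \<open>auto simp: H_def open_halfspace_Re_gt convex_connected\<close>)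
  then show ?thesis using z zn by (simp add: H_def)
qed
text \<open>The bound \<open>near\<close> is what ties the Lewy coordinate to the metric: with
  gradients bounded away from length 1 the conformal factor between them is bounded, so the
  derivative \<open>g\<close> of the Lewy coordinate tends to 0 along with the metric. For a genuine
  singularity the factor is unbounded and there is no contradiction.\<close>

lemma metric_does_not_vanish:
  assumes S: "graph_over_cylinder S" "topological_surface S" and F: "finite F" "F \<subseteq> S" and m: "maximal_surface (S - F)"
    and v: "metric_vanishes_at S F (pr z1 (uf S z1))" and z1: "z1 \<in> sing S F" and \<delta>: "0 < \<delta>" and \<rho>: "0 < \<rho>"
    and near: "\<And>z. z \<in> ball z1 \<rho> \<Longrightarrow> z \<noteq> z1 \<Longrightarrow> z \<notin> sing S F \<and> (up S z)\<^sup>2 + (uq S z)\<^sup>2 \<le> 1 - \<delta>"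
  shows False
proof -
  obtain A \<F> X where mo: "(A, \<F>) \<in> punctured_disc_models" and X: "spacelike_patch (S - F) A X" and conf: "conformal_on A X"
    and op: "openin (top_of_set S) (insert (pr z1 (uf S z1)) ((proj \<circ> X) ` A))"
    and tX: "((proj \<circ> X) \<longlongrightarrow> pr z1 (uf S z1)) \<F>" and tm: "((\<lambda>z. lorentz (dir X 1 z) (dir X 1 z)) \<longlongrightarrow> 0) \<F>"
    using v unfolding metric_vanishes_at_def by auto
  obtain r where r: "0 \<le> r" "r < 1" and A: "A = {z. r < norm z \<and> norm z < 1}"
    and cases: "r = 0 \<and> \<F> = at 0 \<or> 0 < r \<and> \<F> = filtercomap norm (at_left 1)"
  proof -
    have "A = {z. 0 < norm z \<and> norm z < 1} \<and> \<F> = at 0 \<or>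
      (\<exists>r. 0 < r \<and> r < 1 \<and> A = {z. r < norm z \<and> norm z < 1} \<and> \<F> = filtercomap norm (at_left 1))"
      using mo unfolding punctured_disc_models_def by auto
    then show thesis
    proof (elim disjE exE conjE)
      fix r :: real assume "0 < r" "r < 1" "A = {z. r < norm z \<and> norm z < 1}" "\<F> = filtercomap norm (at_left 1)"
      then show thesis by (intro that[of r]) simp_all
    qed (auto intro!: that[of 0])
  qed
  have evA: "\<forall>\<^sub>F z in \<F>. z \<in> A"
    using cases
  proof
    assume "r = 0 \<and> \<F> = at 0"
    then show ?thesis unfolding A by (simp add: eventually_at) (auto intro!: exI[of _ 1])
  next
    assume c: "0 < r \<and> \<F> = filtercomap norm (at_left 1)"
    have "eventually (\<lambda>y. r < y \<and> y < 1) (at_left 1)" unfolding eventually_at_left[OF zero_less_one] using r by auto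
    then show ?thesis unfolding A using c by (auto simp: eventually_filtercomap)
  qed
  have oA: "open A" and pos: "\<And>z w. z \<in> A \<Longrightarrow> w \<noteq> 0 \<Longrightarrow> lorentz (dir X w z) (dir X w z) > 0" and imA: "(proj \<circ> X) ` A \<subseteq> S - F"
    and sm: "smooth_on A X"
    using X openin_subset[of "top_of_set (S - F)"] by (auto simp: spacelike_patch_def)
  have injX: "z = z'" if "proj (X z) = proj (X z')" "z \<in> A" "z' \<in> A" for z z'
    using X that unfolding spacelike_patch_def homeomorphism_def by (metis comp_apply)
  have con: "connected A" unfolding A using connected_annulus(1)[of r "0::complex" 1] by simp
  note M = max_graph_uf[OF S(1) F m]
  define Y where "Y = (\<lambda>z. hor (X z))"
  have Yz: "hor (X z) = Y z" for z by (simp add: Y_def)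
  note P = patch_grad[OF S(1) X Diff_subset, unfolded Yz]
  have Ys: "Y z \<in> - sing S F" if "z \<in> A" for z
    using imA P(3)[OF that] that by (auto simp: sing_def)
  obtain \<kappa> g where \<kappa>: "\<kappa> = (\<lambda>z. z) \<or> \<kappa> = cnj" and hol: "g holomorphic_on A"
    and g: "\<And>z h. z \<in> A \<Longrightarrow> \<kappa> (lewy (up S (Y z)) (uq S (Y z)) (hor (dir X h z))) = g z * h"
    and gn: "\<And>z. z \<in> A \<Longrightarrow> (cmod (g z))\<^sup>2 = ((1 + wt (up S (Y z)) (uq S (Y z))) / wt (up S (Y z)) (uq S (Y z)))\<^sup>2 * lorentz (dir X 1 z) (dir X 1 z)"
    by (rule conformal_patch_lewy[OF S(1) X Diff_subset conf con M, unfolded Yz, OF Ys]) (assumption | rule that)+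
  have bl: "bounded_linear \<kappa>" using \<kappa> bounded_linear_cnj bounded_linear_ident by auto
  have \<kappa>\<kappa>: "\<kappa> (\<kappa> x) = x" for x using \<kappa> by auto
  have shift: "up S (z + of_int k) = up S z" "uq S (z + of_int k) = uq S z" "uf S (z + of_int k) = uf S z" for z k
    using periodic_int[of "up S" z k] periodic_int[of "uq S" z k] periodic_int[of "uf S" z k] u_periodic(1,2)[of S] uf_periodic[of S] by auto
  have sshift: "z + of_int k \<in> sing S F \<longleftrightarrow> z \<in> sing S F" for z k
    using periodic_int[where f="\<lambda>z. z \<in> sing S F", of z k] sing_periodic[of _ S F] by blast
  \<comment> \<open>Only the projection of the patch is known to converge; its lift may jump by
    integers, so it approaches \<open>z1\<close> only up to a translation that depends on the
    point.\<close>
  have locate: "\<forall>\<^sub>F z in \<F>. \<exists>k::int. Y z + of_int k \<in> ball z1 e" if e: "0 < e" for e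
  proof -
    have "open (proj ` (hor -` ball z1 e))" by (intro open_proj_image open_vimage open_ball continuous_hor)
    moreover have "pr z1 (uf S z1) \<in> proj ` (hor -` ball z1 e)" unfolding pr_def using e by (intro imageI) simp
    ultimately have "\<forall>\<^sub>F z in \<F>. (proj \<circ> X) z \<in> proj ` (hor -` ball z1 e)" by (rule topological_tendstoD[OF tX])
    then show ?thesis
    proof eventually_elim
      case (elim z)
      then obtain v where v: "proj (X z) = proj v" "hor v \<in> ball z1 e" by auto
      then obtain k :: int where "hor v = Y z + of_int k" by (auto simp: proj_eq_pr pr_eq_iff Yz)
      then show ?case using v(2) by auto
    qed
  qed
  have reg: "Y z + of_int k \<noteq> z1" if "z \<in> A" for z k
    using Ys[OF that] z1 sshift[of "Y z" k] by auto
  \<comment> \<open>With \<delta> <= w^2 and w <= 1, the factor ((1+w)/w)^2 is at most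
    4/\<delta>.\<close>
  have g0: "(g \<longlongrightarrow> 0) \<F>"
  proof -
    have "\<forall>\<^sub>F z in \<F>. norm ((cmod (g z))\<^sup>2) \<le> 4 / \<delta> * lorentz (dir X 1 z) (dir X 1 z)"
      using evA locate[OF \<rho>]
    proof eventually_elim
      case (elim z)
      then obtain k :: int where k: "Y z + of_int k \<in> ball z1 \<rho>" by blast
      have pq: "(up S (Y z))\<^sup>2 + (uq S (Y z))\<^sup>2 \<le> 1 - \<delta>" using near[OF k reg[OF elim(1)]] by (simp add: shift)
      define w where "w = wt (up S (Y z)) (uq S (Y z))"
      have w2: "w\<^sup>2 = 1 - (up S (Y z))\<^sup>2 - (uq S (Y z))\<^sup>2" using P(6)[OF elim(1)] by (simp add: w_def)
      have w: "\<delta> \<le> w\<^sup>2" "0 < w" "w \<le> 1"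
        using pq w2 P(6)[OF elim(1)] by (simp_all add: w_def)
      have "(1 + w)\<^sup>2 \<le> 2\<^sup>2" using w by (intro power_mono) auto
      then have "((1 + w) / w)\<^sup>2 \<le> 4 / \<delta>" unfolding power_divide using w \<delta> by (intro frac_le) auto
      then have "((1 + w) / w)\<^sup>2 * lorentz (dir X 1 z) (dir X 1 z) \<le> 4 / \<delta> * lorentz (dir X 1 z) (dir X 1 z)"
        using pos[OF elim(1), of 1] by (intro mult_right_mono) auto
      then have "(cmod (g z))\<^sup>2 \<le> 4 / \<delta> * lorentz (dir X 1 z) (dir X 1 z)" unfolding gn[OF elim(1)] w_def .
      then show ?case by simp
    qed
    moreover have "((\<lambda>z. 4 / \<delta> * lorentz (dir X 1 z) (dir X 1 z)) \<longlongrightarrow> 0) \<F>" using tendsto_mult_left[OF tm, of "4 / \<delta>"] by simp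
    ultimately have "((\<lambda>z. (cmod (g z))\<^sup>2) \<longlongrightarrow> 0) \<F>" by (rule Lim_null_comparison)
    from tendsto_real_sqrt[OF this] show ?thesis by (simp add: tendsto_norm_zero_iff)
  qed
  have gnz: "g z \<noteq> 0" if z: "z \<in> A" for z
  proof
    assume "g z = 0"
    define w where "w = wt (up S (Y z)) (uq S (Y z))"
    have w: "0 < w" using P(6)[OF z] by (simp add: w_def)
    have "0 = ((1 + w) / w)\<^sup>2 * lorentz (dir X 1 z) (dir X 1 z)" using gn[OF z] \<open>g z = 0\<close> by (simp add: w_def)
    then show False using w pos[OF z, of 1] by simp
  qed
  from cases show False
  proof
    assume c: "0 < r \<and> \<F> = filtercomap norm (at_left 1)"
    define x where "x = (1 + r) / 2"
    have x: "r < norm (of_real x :: complex)" "norm (of_real x :: complex) < 1"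
    proof -
      have "r < x" "x < 1" "0 \<le> x" using r by (auto simp: x_def)
      then show "r < norm (of_real x :: complex)" "norm (of_real x :: complex) < 1" by (simp_all add: norm_of_real)
    qed
    have "g (of_real x) = 0"
      by (rule annulus_boundary_zero[OF hol[unfolded A] _ r(2) _ x]) (use c g0 in auto)
    moreover have "of_real x \<in> A" using x by (simp add: A)
    ultimately show False using gnz by blast
  next
    assume c: "r = 0 \<and> \<F> = at 0"
    have A0: "z \<in> A \<longleftrightarrow> z \<noteq> 0 \<and> norm z < 1" for z using c by (simp add: A)
    \<comment> \<open>The puncture is a removable zero, so \<open>G\<close> has a primitive
      \<open>f\<close> on the full disc, and \<open>f\<close> has derivative 0 at the
      centre.\<close>
    define G where "G = (\<lambda>z. if z = 0 then 0 else g z)"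
    have GA: "G z = g z" if "z \<in> A" for z using that by (simp add: G_def A0)
    have holG: "G holomorphic_on A" by (rule holomorphic_transform[OF hol]) (simp add: GA)
    have "isCont G z" if z: "z \<in> ball 0 1" for z
    proof (cases "z = 0")
      case True
      have "(g \<longlongrightarrow> 0) (at 0)" using g0 c by simp
      then have "(G \<longlongrightarrow> 0) (at 0)" by (rule Lim_transform_within[of _ _ _ _ 1]) (auto simp: G_def)
      then show ?thesis using True by (simp add: isCont_def G_def)
    next
      case False
      then have "z \<in> A" using z by (simp add: A0)
      then show ?thesis using holomorphic_on_imp_continuous_on[OF holG] oA by (simp add: continuous_on_eq_continuous_at)
    qed
    then have contG: "continuous_on (ball 0 1) G" by (simp add: continuous_at_imp_continuous_on)
    have "G field_differentiable at x" if "x \<in> interior (ball 0 1) - {0}" for x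
      using holomorphic_on_imp_differentiable_at[OF holG oA, of x] that by (simp add: A0)
    then obtain f where "\<And>x. x \<in> ball 0 1 \<Longrightarrow> (f has_field_derivative G x) (at x within ball 0 1)"
      by (rule holomorphic_convex_primitive[OF convex_ball _ contG, of "{0}", rotated]) (auto intro: that)
    then have fd: "(f has_field_derivative G x) (at x)" if "x \<in> ball 0 1" for x
      using that at_within_open[OF that open_ball] by metis
    have contf: "isCont f x" if "x \<in> ball 0 1" for x using fd[OF that] by (rule DERIV_isCont)
    from P(11) obtain Z where Z: "\<And>z. z \<in> A \<Longrightarrow> Z (Y z) = z"
      and dZ: "\<And>z. z \<in> A \<Longrightarrow> (Z has_derivative (\<lambda>h. Complex
          ((dir X \<i> z $ 2 * Re h - dir X \<i> z $ 1 * Im h) / (dir X 1 z $ 1 * dir X \<i> z $ 2 - dir X \<i> z $ 1 * dir X 1 z $ 2))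
          ((dir X 1 z $ 1 * Im h - dir X 1 z $ 2 * Re h) / (dir X 1 z $ 1 * dir X \<i> z $ 2 - dir X \<i> z $ 1 * dir X 1 z $ 2)))) (at (Y z))"
      by auto
    have fZ: "((\<lambda>y. \<kappa> (f (Z y))) has_derivative lewy (up S (Y z)) (uq S (Y z))) (at (Y z))" if z: "z \<in> A" for z
    proof -
      define a b c d where "a = dir X 1 z $ 1" and "b = dir X \<i> z $ 1" and "c = dir X 1 z $ 2" and "d = dir X \<i> z $ 2"
      define D where "D = (\<lambda>h. Complex ((d * Re h - b * Im h) / (a * d - b * c)) ((a * Im h - c * Re h) / (a * d - b * c)))"
      have j: "a * d - b * c \<noteq> 0" using P(8)[OF z] by (simp add: a_def b_def c_def d_def)
      have hz: "(Z has_derivative D) (at (Y z))" using dZ[OF z] by (simp add: D_def a_def b_def c_def d_def)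
      have hf: "(f has_derivative (\<lambda>h. G z * h)) (at (Z (Y z)))"
        using fd[of z] z unfolding Z[OF z] has_field_derivative_def by (simp add: A0)
      have 1: "((\<lambda>y. \<kappa> (f (Z y))) has_derivative (\<lambda>h. \<kappa> (G z * D h))) (at (Y z))"
        by (rule bounded_linear.has_derivative[OF bl has_derivative_compose[OF hz hf]])
      have inv: "hor (dir X (D h) z) = h" for h
      proof -
        have "hor (dir X (D h) z) = Complex (Re (D h) * a + Im (D h) * b) (Re (D h) * c + Im (D h) * d)"
          unfolding smooth_on_dir(4)[OF sm oA z, of "D h"] by (simp add: hor_def a_def b_def c_def d_def)
        moreover have "Re (D h) * a + Im (D h) * b = Re h * (a * d - b * c) / (a * d - b * c)"
          "Re (D h) * c + Im (D h) * d = Im h * (a * d - b * c) / (a * d - b * c)"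
          unfolding D_def complex.sel times_divide_eq_left add_divide_distrib[symmetric] by (simp_all add: algebra_simps)
        ultimately show ?thesis using j by simp
      qed
      have "\<kappa> (G z * D h) = lewy (up S (Y z)) (uq S (Y z)) h" for h
        unfolding GA[OF z] g[OF z, symmetric] \<kappa>\<kappa> inv ..
      then show ?thesis by (rule has_derivative_eq_rhs[OF 1 ext])
    qed
    have p0F: "pr z1 (uf S z1) \<in> F" using z1 by (simp add: sing_def)
    obtain \<rho>' where \<rho>': "0 < \<rho>'" "\<rho>' \<le> \<rho>" "\<And>y. y \<in> ball z1 \<rho>' \<Longrightarrow> y \<noteq> z1 \<Longrightarrow> \<exists>z\<in>A. \<exists>k::int. Y z = y + of_int k"
    proof -
      obtain T where T: "open T" "insert (pr z1 (uf S z1)) ((proj \<circ> X) ` A) = S \<inter> T" using op unfolding openin_open by blast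
      have "open ((\<lambda>y. pr y (uf S y)) -` T)"
        by (rule open_vimage[OF T(1)]) (intro continuous_on_pr continuous_on_id continuous_uf[OF S])
      moreover have "z1 \<in> (\<lambda>y. pr y (uf S y)) -` T" using T(2) by auto
      ultimately obtain e where e: "0 < e" "ball z1 e \<subseteq> (\<lambda>y. pr y (uf S y)) -` T" using open_contains_ball by metis
      show thesis
      proof (rule that[of "min e \<rho>"])
        fix y assume y: "y \<in> ball z1 (min e \<rho>)" "y \<noteq> z1"
        then have "y \<notin> sing S F" using near by auto
        then have "pr y (uf S y) \<noteq> pr z1 (uf S z1)" using p0F by (auto simp: sing_def)
        moreover have "pr y (uf S y) \<in> S \<inter> T" using y e(2) graph_mem[OF S(1)] by auto
        ultimately obtain z where z: "z \<in> A" "pr y (uf S y) = proj (X z)" unfolding T(2)[symmetric] by auto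
        then show "\<exists>z\<in>A. \<exists>k::int. Y z = y + of_int k" using P(3)[OF z(1)] by (auto simp: pr_eq_iff)
      qed (use e \<rho> in auto)
    qed
    \<comment> \<open>The inverse of the patch modulo integer translations. It is unique because the
      patch is injective in the quotient, and it makes \<zeta> a single function on the punctured
      neighbourhood even though Y may jump.\<close>
    define \<omega> where "\<omega> = (\<lambda>y. SOME z. z \<in> A \<and> (\<exists>k::int. Y z = y + of_int k))"
    have prY: "proj (X z) = pr y (uf S y)" if "z \<in> A" "Y z = y + of_int k" for z y k
      unfolding P(3)[OF that(1)] that(2) shift pr_eq_iff by (auto intro!: exI[of _ "- k"])
    have \<omega>: "\<omega> y = z" if z: "z \<in> A" "Y z = y + of_int k" for y z k
      unfolding \<omega>_def
    proof (rule some_equality)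
      show "z \<in> A \<and> (\<exists>k::int. Y z = y + of_int k)" using z by blast
      fix z' assume "z' \<in> A \<and> (\<exists>k::int. Y z' = y + of_int k)"
      then obtain k' where z': "z' \<in> A" "Y z' = y + of_int k'" by blast
      show "z' = z" by (rule injX[OF _ z'(1) z(1)]) (simp only: prY[OF z] prY[OF z'])
    qed
    define \<zeta> where "\<zeta> = (\<lambda>y. \<kappa> (f (\<omega> y)))"
    have d\<zeta>: "(\<zeta> has_derivative lewy (up S y) (uq S y)) (at y)" if y: "y \<in> ball z1 \<rho>'" "y \<noteq> z1" for y
    proof -
      obtain z k where z: "z \<in> A" "Y z = y + of_int k" using \<rho>'(3)[OF y] by blast
      have "((\<lambda>x. x + of_int k) has_derivative (\<lambda>h. h)) (at y)" by (auto intro!: derivative_eq_intros)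
      from has_derivative_compose[OF this fZ[OF z(1), unfolded z(2) shift]]
      have 1: "((\<lambda>x. \<kappa> (f (Z (x + of_int k)))) has_derivative lewy (up S y) (uq S y)) (at y)" .
      have 2: "open ((\<lambda>x. x + of_int k) -` (Y ` A))" by (rule open_vimage[OF P(1)]) (intro continuous_intros)
      have 3: "y \<in> (\<lambda>x. x + of_int k) -` (Y ` A)" using z by (auto intro!: image_eqI[of _ _ z])
      show ?thesis
      proof (rule has_derivative_transform_within_open[OF 1 2 3])
        fix x assume "x \<in> (\<lambda>x. x + of_int k) -` (Y ` A)"
        then obtain z' where z': "z' \<in> A" "Y z' = x + of_int k" by auto
        show "\<kappa> (f (Z (x + of_int k))) = \<zeta> x" unfolding \<zeta>_def \<omega>[OF z'] z'(2)[symmetric] Z[OF z'(1)] ..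
      qed
    qed
    have expand0: "cmod (y' - y) \<le> cmod (\<zeta> y' - \<zeta> y)"
      if y: "y \<in> ball z1 \<rho>'" "y' \<in> ball z1 \<rho>'" "z1 \<notin> closed_segment y y'" for y y'
    proof (rule dist_le_if_expansive[OF lewy_expansive[where p="up S" and q="uq S"]])
      fix z assume z: "z \<in> closed_segment y y'"
      then have z': "z \<in> ball z1 \<rho>'" "z \<noteq> z1" using closed_segment_subset[OF y(1,2) convex_ball] y(3) by auto
      show "(\<zeta> has_derivative lewy (up S z) (uq S z)) (at z)" by (rule d\<zeta>[OF z'])
      show "(up S z)\<^sup>2 + (uq S z)\<^sup>2 < 1" using near[of z] z' \<rho>'(2) \<delta> by auto
    qed
    \<comment> \<open>Expansiveness needs a segment that avoids \<open>z1\<close>. If the segment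
      passes through it, the endpoint \<open>y'\<close> is moved perpendicularly; the tilted
      segments avoid \<open>z1\<close> and the inequality survives in the limit.\<close>
    have expand: "cmod (y' - y) \<le> cmod (\<zeta> y' - \<zeta> y)"
      if y: "y \<in> ball z1 \<rho>'" "y' \<in> ball z1 \<rho>'" "y \<noteq> z1" "y' \<noteq> z1" for y y'
    proof (cases "y' = y \<or> z1 \<notin> closed_segment y y'")
      case True
      then show ?thesis using expand0[OF y(1,2)] by auto
    next
      case False
      define x where "x = (\<lambda>t::real. y' + of_real t * (\<i> * (y' - y)))"
      have lim: "(x \<longlongrightarrow> y') (at 0)" unfolding x_def by (rule tendsto_eq_intros | simp)+
      have avoid: "z1 \<notin> closed_segment y (x t)" if t: "t \<noteq> 0" for t
      proof
        assume "z1 \<in> closed_segment y (x t)"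
        then obtain s' where s': "z1 = (1 - s') *\<^sub>R y + s' *\<^sub>R x t" unfolding in_segment by blast
        obtain s where s: "z1 = (1 - s) *\<^sub>R y + s *\<^sub>R y'" using False unfolding in_segment by blast
        have "of_real s * (y' - y) = z1 - y" using s by (simp add: scaleR_conv_of_real algebra_simps)
        also have "z1 - y = of_real s' * (1 + \<i> * of_real t) * (y' - y)"
          using s' by (simp add: scaleR_conv_of_real x_def algebra_simps)
        finally have e: "of_real s = of_real s' * (1 + \<i> * of_real t)" using False by simp
        have "s' * t = 0" using arg_cong[OF e, of Im] by simp
        moreover have "s = s'" using arg_cong[OF e, of Re] by simp
        ultimately have "s = 0" using t by simp
        then show False using s y(3) by simp
      qed
      have "\<forall>\<^sub>F t in at 0. x t \<in> ball z1 \<rho>'" by (rule topological_tendstoD[OF lim open_ball y(2)])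
      moreover have "\<forall>\<^sub>F t in at (0::real). t \<noteq> 0" by (simp add: eventually_at_filter)
      ultimately have ev: "\<forall>\<^sub>F t in at 0. cmod (x t - y) \<le> cmod (\<zeta> (x t) - \<zeta> y)"
        by eventually_elim (rule expand0[OF y(1) _ avoid])
      have "isCont \<zeta> y'" by (rule has_derivative_continuous[OF d\<zeta>[OF y(2,4)]])
      then have "((\<lambda>t. \<zeta> (x t)) \<longlongrightarrow> \<zeta> y') (at 0)" by (rule isCont_tendsto_compose[OF _ lim])
      then have "((\<lambda>t. cmod (\<zeta> (x t) - \<zeta> y)) \<longlongrightarrow> cmod (\<zeta> y' - \<zeta> y)) (at 0)" by (intro tendsto_intros)
      moreover have "((\<lambda>t. cmod (x t - y)) \<longlongrightarrow> cmod (y' - y)) (at 0)" by (intro tendsto_intros lim)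
      ultimately show ?thesis by (intro tendsto_le[OF _ _ _ ev]) simp_all
    qed
    have key: "cmod (y' - y) \<le> cmod (f z' - f z)"
      if z: "z \<in> A" "Y z + of_int k = y" "y \<in> ball z1 \<rho>'" and z': "z' \<in> A" "Y z' + of_int k' = y'" "y' \<in> ball z1 \<rho>'" for y y' z z' k k'
    proof -
      have o: "\<omega> y = z" "\<omega> y' = z'"
        using \<omega>[OF z(1), of y "- k"] z(2) \<omega>[OF z'(1), of y' "- k'"] z'(2) by auto
      have "cmod (y' - y) \<le> cmod (\<zeta> y' - \<zeta> y)"
        by (rule expand[OF z(3) z'(3)]) (use reg[OF z(1), of k] reg[OF z'(1), of k'] z(2) z'(2) in auto)
      also have "\<dots> = cmod (f z' - f z)" unfolding \<zeta>_def o using \<kappa> by (auto simp flip: complex_cnj_diff)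
      finally show ?thesis .
    qed
    have loc0: "\<exists>e>0. \<forall>z. z \<noteq> 0 \<and> norm z < e \<longrightarrow> (\<exists>k::int. Y z + of_int k \<in> ball z1 \<eta>)" if "0 < \<eta>" for \<eta>
      using locate[OF that] c by (simp add: eventually_at)
    obtain e where e: "0 < e" "\<And>z. z \<noteq> 0 \<Longrightarrow> norm z < e \<Longrightarrow> \<exists>k::int. Y z + of_int k \<in> ball z1 \<rho>'" using loc0[OF \<rho>'(1)] by blast
    \<comment> \<open>Otherwise points x close to 0 have f(x) close to f(z) and positions close to
      \<open>z1\<close>; expansiveness puts their positions close to that of z as well, which keeps
      a distance of at least 2\<eta> from \<open>z1\<close>.\<close>
    have ne0: "f z \<noteq> f 0" if z: "z \<noteq> 0" "norm z < min e 1" for z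
    proof
      assume eq: "f z = f 0"
      obtain k :: int where k: "Y z + of_int k \<in> ball z1 \<rho>'" using e(2)[of z] z by auto
      have zA: "z \<in> A" using z by (simp add: A0)
      define \<eta> where "\<eta> = min \<rho>' (dist z1 (Y z + of_int k) / 2)"
      have "0 < dist z1 (Y z + of_int k)" using reg[OF zA, of k] by (metis zero_less_dist_iff)
      then have \<eta>: "0 < \<eta>" "\<eta> \<le> \<rho>'" "2 * \<eta> \<le> dist z1 (Y z + of_int k)" using \<rho>'(1) unfolding \<eta>_def by simp_all
      obtain e' where e': "0 < e'" "\<And>z. z \<noteq> 0 \<Longrightarrow> norm z < e' \<Longrightarrow> \<exists>k::int. Y z + of_int k \<in> ball z1 \<eta>" using loc0[OF \<eta>(1)] by blast
      obtain d where d: "0 < d" "\<And>x. norm x < d \<Longrightarrow> dist (f x) (f 0) < \<eta>"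
        using contf[of 0] \<eta>(1) unfolding continuous_at_eps_delta by (auto simp: dist_norm)
      define x :: complex where "x = of_real (min (min e' d) 1 / 2)"
      have x: "x \<noteq> 0" "norm x < e'" "norm x < d" "norm x < 1" using e'(1) d(1) by (auto simp: x_def norm_of_real)
      obtain l :: int where l: "Y x + of_int l \<in> ball z1 \<eta>" using e'(2)[OF x(1,2)] by blast
      have "cmod ((Y x + of_int l) - (Y z + of_int k)) \<le> cmod (f x - f z)"
        by (rule key[OF zA refl k _ refl]) (use x l \<eta>(2) in \<open>auto simp: A0\<close>)
      also have "\<dots> < \<eta>" using d(2)[OF x(3)] eq by (simp add: dist_norm)
      finally have "dist (Y x + of_int l) (Y z + of_int k) < \<eta>" by (simp add: dist_norm)
      moreover have "dist z1 (Y x + of_int l) < \<eta>" using l by simp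
      ultimately show False using \<eta>(3) dist_triangle[of z1 "Y z + of_int k" "Y x + of_int l"] by simp
    qed
    have "inj_on f (ball 0 (min e 1))"
    proof (rule inj_onI)
      fix z z' assume z: "z \<in> ball 0 (min e 1)" "z' \<in> ball 0 (min e 1)" "f z = f z'"
      show "z = z'"
      proof (cases "z = 0 \<or> z' = 0")
        case True
        then show ?thesis using z ne0[of z] ne0[of z'] by (cases "z = 0"; cases "z' = 0") auto
      next
        case False
        obtain k k' :: int where k: "Y z + of_int k \<in> ball z1 \<rho>'" "Y z' + of_int k' \<in> ball z1 \<rho>'"
          using e(2)[of z] e(2)[of z'] z False by auto
        have A': "z \<in> A" "z' \<in> A" using z False by (auto simp: A0)
        have "cmod ((Y z' + of_int k') - (Y z + of_int k)) \<le> cmod (f z' - f z)"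
          by (rule key[OF A'(1) refl k(1) A'(2) refl k(2)])
        then have "Y z' + of_int k' = Y z + of_int k" using z(3) by simp
        then have yy: "Y z' = Y z + of_int (k - k')" by (simp add: algebra_simps)
        have "proj (X z') = proj (X z)" unfolding prY[OF A'(2) yy] P(3)[OF A'(1)] ..
        then show ?thesis using injX A' by metis
      qed
    qed
    moreover have "f holomorphic_on ball 0 (min e 1)" unfolding holomorphic_on_open[OF open_ball] by (intro ballI exI, rule fd) auto
    \<comment> \<open>An injective holomorphic function has no critical point, while
      \<open>f\<close> was built from a derivative vanishing at 0.\<close>
    ultimately have "deriv f 0 \<noteq> 0" using e(1) by (intro holomorphic_injective_imp_regular[where S="ball 0 (min e 1)"]) auto
    moreover have "deriv f 0 = 0" using DERIV_imp_deriv[OF fd[of 0]] by (simp add: G_def)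
    ultimately show False by simp
  qed
qed

section \<open>A surface determines its singular set\<close>

lemma isolated_sing:
  assumes S: "graph_over_cylinder S" and F: "finite F" "F \<subseteq> S"
  obtains \<rho> where "0 < \<rho>" "\<And>z. z \<in> ball z1 \<rho> \<Longrightarrow> z \<noteq> z1 \<Longrightarrow> z \<notin> sing S F"
proof -
  let ?F = "F - {pr z1 (uf S z1)}"
  have "closed (sing S ?F)" by (rule closed_sing[OF S]) (use F in auto)
  moreover have "z1 \<in> - sing S ?F" by (simp add: sing_def)
  ultimately obtain e where e: "0 < e" "ball z1 e \<subseteq> - sing S ?F" using open_contains_ball[of "- sing S ?F"] by (auto simp: open_Compl)
  show thesis
  \<comment> \<open>The radius 1/4 excludes the integer translates of \<open>z1\<close>; the other
    singular points are excluded by closedness of their lifts.\<close>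
  proof (rule that[of "min e (1/4)"])
    fix z assume z: "z \<in> ball z1 (min e (1/4))" "z \<noteq> z1"
    show "z \<notin> sing S F"
    proof
      assume "z \<in> sing S F"
      then have "pr z1 (uf S z1) = pr z (uf S z)" using z e(2) by (auto simp: sing_def)
      then obtain k :: int where k: "z = z1 + of_int k" by (auto simp: pr_eq_iff)
      have "\<bar>Re z - Re z1\<bar> < 1/4" using z(1) abs_Re_le_cmod[of "z - z1"] by (simp add: dist_norm norm_minus_commute)
      then have "z = z1" by (intro int_shift_unique[OF k, of "Re z1"]) auto
      then show False using z(2) by simp
    qed
  qed (use e in auto)
qed

lemma CMF_D:
  assumes "CMF S F"
  shows "finite F" "F \<subseteq> S" "topological_surface S" "maximal_surface (S - F)" "\<And>p. p \<in> F \<Longrightarrow> metric_vanishes_at S F p"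
    "closedin (top_of_set S) F"
  using assms by (auto simp: CMF_def maximal_with_singularities_def)

text \<open>At a point singular for one choice and regular for the other, the gradient stays away
  from length 1, so the metric cannot vanish there. Marks and singular sets chosen separately for
  the same surface can thus be identified.\<close>

lemma CMF_unique:
  assumes S: "graph_over_cylinder S" and F: "CMF S F" "CMF S F'"
  shows "F = F'"
proof -
  have "p \<in> F'" if FF: "CMF S F" "CMF S F'" and p: "p \<in> F" for F F' p
  proof (rule ccontr)
    assume pF: "p \<notin> F'"
    note D = CMF_D[OF FF(1)] and D' = CMF_D[OF FF(2)]
    obtain z1 h where "p = pr z1 h" by (rule pr_cases)
    then have z1: "p = pr z1 (uf S z1)" using p D(2) graph_iff[OF S] by (metis subsetD)
    have s: "z1 \<in> - sing S F'" "z1 \<in> sing S F" using pF p z1 by (auto simp: sing_def)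
    note M = max_graph_uf[OF S D'(1,2,4)]
    define h where "h = (\<lambda>z. (up S z)\<^sup>2 + (uq S z)\<^sup>2)"
    have c: "continuous_on (- sing S F') h" unfolding h_def by (intro continuous_intros max_graph_continuous[OF M])
    have "isCont h z1" using c s(1) max_graphD(1)[OF M] by (simp add: continuous_on_eq_continuous_at)
    moreover have h1: "h z1 < 1" using max_graphD(5)[OF M s(1)] by (simp add: h_def)
    ultimately have "\<forall>\<^sub>F z in nhds z1. h z < (1 + h z1) / 2"
      unfolding isCont_def tendsto_at_iff_tendsto_nhds by (intro order_tendstoD) auto
    then obtain e where e: "0 < e" "\<And>z. dist z z1 < e \<Longrightarrow> h z < (1 + h z1) / 2" unfolding eventually_nhds_metric by blast
    obtain \<rho> where \<rho>: "0 < \<rho>" "\<And>z. z \<in> ball z1 \<rho> \<Longrightarrow> z \<noteq> z1 \<Longrightarrow> z \<notin> sing S F" by (rule isolated_sing[OF S D(1,2)]) (rule that)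
    show False
    proof (rule metric_does_not_vanish[OF S D(3,1,2,4) D(5)[OF p, unfolded z1] s(2), of "(1 - h z1) / 2" "min e \<rho>"])
      fix z assume z: "z \<in> ball z1 (min e \<rho>)" "z \<noteq> z1"
      have "h z \<le> 1 - (1 - h z1) / 2" using e(2)[of z] z(1) by (simp add: dist_commute field_simps)
      then show "z \<notin> sing S F \<and> (up S z)\<^sup>2 + (uq S z)\<^sup>2 \<le> 1 - (1 - h z1) / 2" using \<rho>(2)[of z] z by (simp add: h_def)
    qed (use h1 e(1) \<rho>(1) in auto)
  qed
  then show ?thesis using F by blast
qed

section \<open>Convergence of the graphs implies convergence of the data\<close>

text \<open>The difference quotient in the direction of the gradient itself; one-sided bounds on
  increments are all that comparison delivers.\<close>

lemma gradient_le:
  assumes g: "has_grad u a b z" and r: "0 < r" and le: "\<And>h. cmod h \<le> r \<Longrightarrow> u (z + h) - u z \<le> \<kappa> * cmod h" and \<kappa>: "0 \<le> \<kappa>"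
  shows "a\<^sup>2 + b\<^sup>2 \<le> \<kappa>\<^sup>2"
proof (cases "Complex a b = 0")
  case True
  then show ?thesis by (simp add: complex_eq_iff)
next
  case False
  define v where "v = Complex a b"
  have v: "0 < cmod v" "(cmod v)\<^sup>2 = a\<^sup>2 + b\<^sup>2" using False by (simp_all add: v_def cmod_power2)
  have "((\<lambda>t::real. z + of_real t * v) has_derivative (\<lambda>t. of_real t * v)) (at 0)" by (auto intro!: derivative_eq_intros)
  moreover have "(u has_derivative (\<lambda>h. a * Re h + b * Im h)) (at (z + of_real 0 * v))" using g by (simp add: has_grad_def)
  ultimately have "((\<lambda>t. u (z + of_real t * v)) has_derivative (\<lambda>t. a * Re (of_real t * v) + b * Im (of_real t * v))) (at 0)"
    by (rule has_derivative_compose)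
  then have "((\<lambda>t. u (z + of_real t * v)) has_derivative (\<lambda>t. (cmod v)\<^sup>2 * t)) (at 0)"
    unfolding v(2) by (rule has_derivative_eq_rhs) (simp add: v_def fun_eq_iff power2_eq_square algebra_simps)
  then have "((\<lambda>t. u (z + of_real t * v)) has_real_derivative (cmod v)\<^sup>2) (at 0)" by (simp add: has_field_derivative_def)
  then have "((\<lambda>t. (u (z + of_real t * v) - u z) / t) \<longlongrightarrow> (cmod v)\<^sup>2) (at 0)" by (simp add: DERIV_def)
  then have lim: "((\<lambda>t. (u (z + of_real t * v) - u z) / t) \<longlongrightarrow> (cmod v)\<^sup>2) (at_right 0)"
    by (rule filterlim_mono[OF _ order_refl at_le]) simp
  have "\<forall>\<^sub>F t in at_right 0. (u (z + of_real t * v) - u z) / t \<le> \<kappa> * cmod v"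
    unfolding eventually_at_right[OF zero_less_one]
  proof (intro exI[of _ "r / cmod v"] conjI allI impI)
    show "0 < r / cmod v" using r v by simp
    fix t :: real assume t: "0 < t" "t < r / cmod v"
    then have "cmod (of_real t * v) \<le> r" using v(1) by (simp add: norm_mult field_simps)
    from le[OF this] show "(u (z + of_real t * v) - u z) / t \<le> \<kappa> * cmod v" using t by (simp add: norm_mult field_simps)
  qed
  then have "(cmod v)\<^sup>2 \<le> \<kappa> * cmod v" by (rule tendsto_upperbound[OF lim]) simp
  then have "cmod v \<le> \<kappa>" using v(1) by (simp add: power2_eq_square)
  then have "(cmod v)\<^sup>2 \<le> \<kappa>\<^sup>2" using v(1) by (intro power_mono) auto
  then show ?thesis by (simp add: v(2))
qed

lemma GG_D: "S \<in> GG n \<Longrightarrow> graph_over_cylinder S" by (simp add: GG_def)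

lemma has_grad_segment_bound:
  assumes g: "\<And>x. x \<in> closed_segment y z \<Longrightarrow> has_grad u (p x) (q x) x \<and> (p x)\<^sup>2 + (q x)\<^sup>2 \<le> \<kappa>\<^sup>2" and \<kappa>: "0 \<le> \<kappa>"
  shows "\<bar>u z - u y\<bar> \<le> \<kappa> * cmod (z - y)"
proof -
  have "norm (u z - u y) \<le> \<kappa> * norm (z - y)"
  proof (rule differentiable_bound[OF convex_closed_segment])
    fix x assume x: "x \<in> closed_segment y z"
    show "(u has_derivative (\<lambda>h. p x * Re h + q x * Im h)) (at x within closed_segment y z)"
      using g[OF x] by (auto simp: has_grad_def intro: has_derivative_at_withinI)
    show "onorm (\<lambda>h. p x * Re h + q x * Im h) \<le> \<kappa>"
    proof (rule onorm_le)
      fix h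
      have "(p x * Re h + q x * Im h)\<^sup>2 \<le> ((p x)\<^sup>2 + (q x)\<^sup>2) * ((Re h)\<^sup>2 + (Im h)\<^sup>2)"
        using zero_le_power2[of "p x * Im h - q x * Re h"] by (simp add: power2_eq_square algebra_simps)
      also have "\<dots> \<le> \<kappa>\<^sup>2 * ((Re h)\<^sup>2 + (Im h)\<^sup>2)" using g[OF x] by (intro mult_right_mono) auto
      also have "\<dots> = (\<kappa> * norm h)\<^sup>2" by (simp add: power_mult_distrib cmod_power2)
      finally show "norm (p x * Re h + q x * Im h) \<le> \<kappa> * norm h"
        using \<kappa> by (simp flip: abs_le_square_iff)
    qed
  qed auto
  then show ?thesis by simp
qed

text \<open>If the approximating graphs were regular near a singularity of the limit, the comparison
  principle for their translates would carry a gradient bound from a surrounding square to the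
  singularity.\<close>

lemma singularity_persists:
  assumes S0: "S0 \<in> GG n" "CMF S0 F0" and G: "\<And>k. G k \<in> GG n" "\<And>k. CMF (G k) (F k)"
    and conv: "\<And>L \<eta>. 0 < \<eta> \<Longrightarrow> \<forall>\<^sub>F k in sequentially. \<forall>z. \<bar>Im z\<bar> \<le> L \<longrightarrow> \<bar>uf (G k) z - uf S0 z\<bar> < \<eta>"
    and z0: "z0 \<in> sing S0 F0" and \<epsilon>: "0 < \<epsilon>"
  shows "\<forall>\<^sub>F k in sequentially. \<exists>z\<in>sing (G k) (F k). dist z z0 < \<epsilon>"
proof (rule ccontr)
  assume "\<not> (\<forall>\<^sub>F k in sequentially. \<exists>z\<in>sing (G k) (F k). dist z z0 < \<epsilon>)"
  then have freq: "\<exists>\<^sub>F k in sequentially. \<forall>z\<in>sing (G k) (F k). \<epsilon> \<le> dist z z0" by (simp add: not_eventually not_less)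
  note gr0 = GG_D[OF S0(1)] and D0 = CMF_D[OF S0(2)]
  note M0 = max_graph_uf[OF gr0 D0(1,2,4)]
  obtain \<rho> where \<rho>: "0 < \<rho>" "\<And>z. z \<in> ball z0 \<rho> \<Longrightarrow> z \<noteq> z0 \<Longrightarrow> z \<notin> sing S0 F0" by (rule isolated_sing[OF gr0 D0(1,2)]) (rule that)
  define d where "d = min \<epsilon> \<rho> / 4"
  have d: "0 < d" "4 * d \<le> \<epsilon>" "4 * d \<le> \<rho>" using \<epsilon> \<rho>(1) by (auto simp: d_def)
  \<comment> \<open>The boundary of the square Q has distance between d and 2d from
    \<open>z0\<close>; shifts by at most d/2 stay in this annulus, where the limit is regular and
    \<kappa> < 1 bounds its gradient.\<close>
  define N where "N = cball z0 (5 / 2 * d) - ball z0 (d / 2)"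
  have Ns: "N \<subseteq> - sing S0 F0"
  proof
    fix z assume z: "z \<in> N"
    then have "z \<in> ball z0 \<rho>" "z \<noteq> z0" using d by (auto simp: N_def)
    then show "z \<in> - sing S0 F0" using \<rho>(2) by blast
  qed
  have "compact N" unfolding N_def by (intro compact_diff compact_cball open_ball)
  moreover have "z0 + of_real d \<in> N" using d(1) by (simp add: N_def dist_norm)
  moreover have "continuous_on N (\<lambda>z. (up S0 z)\<^sup>2 + (uq S0 z)\<^sup>2)"
    by (intro continuous_intros continuous_on_subset[OF max_graph_continuous(2)[OF M0] Ns] continuous_on_subset[OF max_graph_continuous(3)[OF M0] Ns])
  ultimately obtain zM where zM: "zM \<in> N" "\<And>z. z \<in> N \<Longrightarrow> (up S0 z)\<^sup>2 + (uq S0 z)\<^sup>2 \<le> (up S0 zM)\<^sup>2 + (uq S0 zM)\<^sup>2"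
    using continuous_attains_sup[of N "\<lambda>z. (up S0 z)\<^sup>2 + (uq S0 z)\<^sup>2"] by blast
  define \<kappa> where "\<kappa> = sqrt ((up S0 zM)\<^sup>2 + (uq S0 zM)\<^sup>2)"
  have \<kappa>: "0 \<le> \<kappa>" "\<kappa>\<^sup>2 < 1" "\<And>z. z \<in> N \<Longrightarrow> (up S0 z)\<^sup>2 + (uq S0 z)\<^sup>2 \<le> \<kappa>\<^sup>2"
    using zM max_graphD(5)[OF M0, of zM] Ns by (auto simp: \<kappa>_def)
  define Q where "Q = rect (Re z0 - d) (Re z0 + d) (Im z0 - d) (Im z0 + d)"
  have Qd: "cmod (z - z0) \<le> 2 * d" if "z \<in> Q" for z
    using cmod_le[of "z - z0"] that by (auto simp: Q_def rect_def)
  \<comment> \<open>Increments of \<open>G k\<close> and of its limit agree up to a small error,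
    also where the limit is singular, so the bound obtained for \<open>G k\<close> by comparison
    with its translate passes to the limit. A single sufficiently late k without nearby
    singularities is enough for each e.\<close>
  have main: "uf S0 (z + h) - uf S0 z \<le> \<kappa> * cmod h" if h: "cmod h \<le> d / 2" and z: "z \<in> Q" for z h
  proof (rule field_le_epsilon)
    fix e :: real assume e: "0 < e"
    have ev: "\<forall>\<^sub>F k in sequentially. \<forall>z. \<bar>Im z\<bar> \<le> \<bar>Im z0\<bar> + 5 / 2 * d \<longrightarrow> \<bar>uf (G k) z - uf S0 z\<bar> < e / 4"
      by (rule conv) (use e in simp)
    obtain k where k: "\<forall>z\<in>sing (G k) (F k). \<epsilon> \<le> dist z z0" "\<And>z. \<bar>Im z\<bar> \<le> \<bar>Im z0\<bar> + 5 / 2 * d \<Longrightarrow> \<bar>uf (G k) z - uf S0 z\<bar> < e / 4"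
      using frequently_ex[OF frequently_eventually_frequently[OF freq ev]] by blast
    note Mk = max_graph_uf[OF GG_D[OF G(1)] CMF_D(1,2,4)[OF G(2)]]
    have near: "dist z z0 \<le> 5 / 2 * d" "dist (z + h) z0 \<le> 5 / 2 * d" if "z \<in> Q" for z
      using Qd[OF that] h d(1) norm_triangle_ineq[of "z - z0" h] by (simp_all add: dist_norm algebra_simps)
    have out: "x \<in> - sing (G k) (F k)" if "dist x z0 \<le> 5 / 2 * d" for x using k(1) that d by force
    have close: "\<bar>uf (G k) x - uf S0 x\<bar> < e / 4" if "dist x z0 \<le> 5 / 2 * d" for x
    proof (rule k(2))
      show "\<bar>Im x\<bar> \<le> \<bar>Im z0\<bar> + 5 / 2 * d" using that abs_Im_le_cmod[of "x - z0"] by (simp add: dist_norm)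
    qed
    have "uf (G k) (z + h) - uf (G k) z \<le> \<kappa> * cmod h + e / 2"
    proof (rule comparison_rect[OF _ _ max_graph_translate[OF Mk, of h] _ Mk _ _ z[unfolded Q_def]])
      show "rect (Re z0 - d) (Re z0 + d) (Im z0 - d) (Im z0 + d) \<subseteq> (\<lambda>z. z + h) -` (- sing (G k) (F k))"
        "rect (Re z0 - d) (Re z0 + d) (Im z0 - d) (Im z0 + d) \<subseteq> - sing (G k) (F k)"
        unfolding Q_def[symmetric] using out near by auto
      fix y assume y: "y \<in> rect (Re z0 - d) (Re z0 + d) (Im z0 - d) (Im z0 + d)"
        "Re y = Re z0 - d \<or> Re y = Re z0 + d \<or> Im y = Im z0 - d \<or> Im y = Im z0 + d"
      have yQ: "y \<in> Q" using y(1) by (simp add: Q_def)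
      have "d \<le> cmod (y - z0)" using y(2) d(1) abs_Re_le_cmod[of "y - z0"] abs_Im_le_cmod[of "y - z0"] by auto
      have seg: "x \<in> N" if x: "x \<in> closed_segment y (y + h)" for x
      proof -
        have "cmod (x - y) \<le> cmod (y + h - y)" by (rule segment_bound(1)[OF x])
        then have "cmod (x - y) \<le> d / 2" using h by simp
        moreover have "cmod (y - z0) \<le> cmod (x - z0) + cmod (x - y)" using norm_triangle_ineq4[of "x - z0" "x - y"] by simp
        moreover have "cmod (x - z0) \<le> cmod (x - y) + cmod (y - z0)" using norm_triangle_ineq[of "x - y" "y - z0"] by simp
        ultimately show ?thesis using Qd[OF yQ] \<open>d \<le> cmod (y - z0)\<close> by (simp add: N_def dist_norm norm_minus_commute)
      qed
      have lip: "\<bar>uf S0 (y + h) - uf S0 y\<bar> \<le> \<kappa> * cmod (y + h - y)"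
        by (rule has_grad_segment_bound[OF conjI[OF max_graphD(2)[OF M0] \<kappa>(3)] \<kappa>(1)]) (use seg Ns in auto)
      then show "uf (G k) (y + h) - uf (G k) y \<le> \<kappa> * cmod h + e / 2"
        using lip[unfolded add_diff_cancel_left'] close[OF near(1)[OF yQ]] close[OF near(2)[OF yQ]] by linarith
    qed (use d(1) in auto)
    then show "uf S0 (z + h) - uf S0 z \<le> \<kappa> * cmod h + e"
      using close[OF near(1)[OF z]] close[OF near(2)[OF z]] by linarith
  qed
  have p0: "metric_vanishes_at S0 F0 (pr z0 (uf S0 z0))" using D0(5) z0 by (simp add: sing_def)
  show False
  proof (rule metric_does_not_vanish[OF gr0 D0(3,1,2,4) p0 z0, of "1 - \<kappa>\<^sup>2" d])
    fix z assume z: "z \<in> ball z0 d" "z \<noteq> z0"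
    have s: "z \<in> - sing S0 F0" using \<rho>(2)[of z] z d by auto
    have "z \<in> Q" using z(1) abs_Re_le_cmod[of "z - z0"] abs_Im_le_cmod[of "z - z0"] by (auto simp: Q_def rect_def dist_norm norm_minus_commute)
    then have "(up S0 z)\<^sup>2 + (uq S0 z)\<^sup>2 \<le> \<kappa>\<^sup>2"
      by (intro gradient_le[OF max_graphD(2)[OF M0 s], of "d / 2"]) (use main d(1) \<kappa>(1) in auto)
    then show "z \<notin> sing S0 F0 \<and> (up S0 z)\<^sup>2 + (uq S0 z)\<^sup>2 \<le> 1 - (1 - \<kappa>\<^sup>2)" using s by simp
  qed (use \<kappa>(2) d(1) in auto)
qed

text \<open>On the line \<open>Im z = b\<close> the graph oscillates by at most 1, being 1-Lipschitz
  with period 1, and \<open>end_comparison\<close> carries this down the end from both sides. The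
  error stays 1 while H is free, and no decay constant enters; hence slopes can be read off at a
  bounded distance.\<close>

lemma slope_estimate:
  assumes u: "cyl_graph \<Sigma> u p q r s t a Y C" and \<Sigma>: "\<And>z. z \<in> \<Sigma> \<Longrightarrow> b < Im z" and H: "0 \<le> H"
  shows "\<bar>u (Complex 0 (b - H)) - u (Complex 0 b) + a * H\<bar> \<le> 1"
proof -
  note D = cyl_graphD[OF u]
  have osc: "\<bar>u z - u (Complex 0 b)\<bar> \<le> 1" if z: "Im z = b" for z
  proof -
    obtain k :: int where k: "0 \<le> Re (z + of_int k)" "Re (z + of_int k) \<le> 1" "Im (z + of_int k) = Im z" by (rule periodic_reduce) (rule that)
    have "u (z + of_int k) = u z" by (rule periodic_int) (rule D(4))
    moreover have "dist (z + of_int k) (Complex 0 b) \<le> 1"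
      using cmod_le[of "z + of_int k - Complex 0 b"] k z by (simp add: dist_norm)
    ultimately show ?thesis using D(3)[of "z + of_int k" "Complex 0 b"] by simp
  qed
  have "1 * (u (Complex 0 (b - H)) - a * Im (Complex 0 (b - H))) \<le> u (Complex 0 b) - a * b + 1"
  proof (rule end_comparison[OF u _ \<Sigma>])
    show "1 * (u z - a * Im z) \<le> u (Complex 0 b) - a * b + 1" if "Im z = b" for z using osc[OF that] that by (simp add: abs_le_iff)
  qed (use H in auto)
  moreover have "- 1 * (u (Complex 0 (b - H)) - a * Im (Complex 0 (b - H))) \<le> - (u (Complex 0 b) - a * b) + 1"
  proof (rule end_comparison[OF u _ \<Sigma>])
    show "- 1 * (u z - a * Im z) \<le> - (u (Complex 0 b) - a * b) + 1" if "Im z = b" for z using osc[OF that] that by (simp add: abs_le_iff)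
  qed (use H in auto)
  ultimately show ?thesis by (simp add: abs_le_iff algebra_simps)
qed

lemma compact_cylinder_bounded:
  assumes "compact K" obtains L where "0 \<le> L" "\<And>z h. pr z h \<in> K \<Longrightarrow> \<bar>Im z\<bar> \<le> L"
proof -
  have "continuous_on UNIV x2"
    unfolding continuous_on_open_vimage[OF open_UNIV]
  proof (intro allI impI)
    fix B :: "real set" assume B: "open B"
    have "proj -` (x2 -` B) = (\<lambda>v. v $ 2) -` B" by (auto simp: x2.abs_eq)
    then show "open (x2 -` B \<inter> UNIV)" using open_vimage[OF B, of "\<lambda>v::real^3. v $ 2"] continuous_nth3 by (simp add: open_l3quot_def)
  qed
  then have "compact (x2 ` K)" by (intro compact_continuous_image[OF _ assms]) (auto intro: continuous_on_subset)
  then have "bounded (x2 ` K)" by (rule compact_imp_bounded)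
  then obtain L where L: "\<And>q. q \<in> K \<Longrightarrow> \<bar>x2 q\<bar> \<le> L" unfolding bounded_iff by auto
  show thesis
  proof (rule that[of "max 0 L"])
    fix z h assume "pr z h \<in> K"
    from L[OF this] show "\<bar>Im z\<bar> \<le> max 0 L" by simp
  qed simp
qed

text \<open>The strip is infinite, but modulo the period it is the image of a compact
  rectangle.\<close>

lemma graphs_converge_strip:
  assumes "graphs_converge_on_compacts G G0" "0 < \<eta>"
  shows "\<forall>\<^sub>F k in sequentially. \<forall>z. \<bar>Im z\<bar> \<le> L \<longrightarrow> \<bar>uf (G k) z - uf G0 z\<bar> < \<eta>"
proof -
  define K where "K = (\<lambda>z. pr z 0) ` cbox (Complex 0 (- L)) (Complex 1 L)"
  have "compact K" unfolding K_def by (intro compact_continuous_image continuous_on_pr continuous_intros compact_cbox)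
  moreover have "K \<subseteq> cylinder" by (auto simp: K_def pr_in_cylinder)
  ultimately have "uniform_limit K (\<lambda>k. graph_fun (G k)) (graph_fun G0) sequentially" using assms(1) by (simp add: graphs_converge_on_compacts_def)
  then have "\<forall>\<^sub>F k in sequentially. \<forall>q\<in>K. dist (graph_fun (G k) q) (graph_fun G0 q) < \<eta>" using assms(2) by (rule uniform_limitD)
  then show ?thesis
  proof eventually_elim
    case (elim k)
    show ?case
    proof (intro allI impI)
      fix z assume z: "\<bar>Im z\<bar> \<le> L"
      obtain l :: int where l: "0 \<le> Re (z + of_int l)" "Re (z + of_int l) \<le> 1" "Im (z + of_int l) = Im z" by (rule periodic_reduce) (rule that)
      have "z + of_int l \<in> cbox (Complex 0 (- L)) (Complex 1 L)" using l z by (simp add: in_cbox_complex_iff abs_le_iff)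
      then have "pr (z + of_int l) 0 \<in> K" by (simp add: K_def)
      then have "\<bar>uf (G k) (z + of_int l) - uf G0 (z + of_int l)\<bar> < \<eta>" using elim by (auto simp: uf_def dist_real_def)
      then show "\<bar>uf (G k) z - uf G0 z\<bar> < \<eta>"
        using periodic_int[of "uf (G k)" z l] periodic_int[of "uf G0" z l] uf_periodic by simp
    qed
  qed
qed

section \<open>The topology of the moduli space\<close>

lemma c_param_slope:
  assumes "S \<in> GG n" "CMF S F" "cyl_graph (sing S F) (uf S) (up S) (uq S) (ur S) (us S) (ut S) a Y C"
  shows "c_param S \<in> {-1<..<1}" "slope (c_param S) = a"
  using slope_unslope[OF cyl_graphD(7)[OF assms(3)]] unfolding c_param_eq[OF assms] by auto

lemma c_param_range: "S \<in> GG n \<Longrightarrow> c_param S \<in> {-1<..<1}"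
proof -
  assume S: "S \<in> GG n"
  then obtain F where F: "CMF S F" by (auto simp: GG_def)
  obtain a Y C where "cyl_graph (sing S F) (uf S) (up S) (uq S) (ur S) (us S) (ut S) a Y C"
    by (rule cyl_graph_exists[OF S F]) (rule that)
  then show ?thesis by (rule c_param_slope(1)[OF S F])
qed

lemma MM_iff: "(S, m) \<in> MM n \<longleftrightarrow> S \<in> GG n \<and> m \<in> extensional {..n} \<and> (\<exists>F. CMF S F \<and> bij_betw m {..n} F)"
  by (simp add: MM_def)

text \<open>The basic neighbourhoods of the quotient topology. The condition asks only for some
  admissible order of the singular points, so the preimage is invariant under permutations; it is
  open because each permutation of a product of open sets is again one.\<close>

lemma open_marks:
  fixes U :: "nat \<Rightarrow> l3quot set" and J :: "real set"
  assumes U: "\<And>i. i \<le> n \<Longrightarrow> open (U i)" and J: "open J"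
  shows "openin (GG_topology n) {S \<in> GG n. \<exists>m F. CMF S F \<and> bij_betw m {..n} F \<and> (\<forall>i\<le>n. m i \<in> U i) \<and> c_param S \<in> J}" (is "openin _ ?W")
proof (unfold openin_GG_topology, intro conjI)
  show "?W \<subseteq> GG n" by blast
  show "openin (MM_topology n) {x \<in> MM n. fst x \<in> ?W}"
  proof (subst openin_subopen, intro ballI)
    fix x assume x: "x \<in> {x \<in> MM n. fst x \<in> ?W}"
    obtain S m where xe: "x = (S, m)" by (cases x)
    have xM: "(S, m) \<in> MM n" and xW: "S \<in> ?W" using x unfolding xe by simp_all
    obtain F where S: "S \<in> GG n" "m \<in> extensional {..n}" and F: "CMF S F" "bij_betw m {..n} F" using xM unfolding MM_iff by blast
    obtain m' F' where m': "CMF S F'" "bij_betw m' {..n} F'" "\<forall>i\<le>n. m' i \<in> U i" "c_param S \<in> J" using xW by blast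
    have FF: "F' = F" by (rule CMF_unique[OF GG_D[OF S(1)] m'(1) F(1)])
    \<comment> \<open>The permutation that turns the given mark into the admissible one; both
      enumerate the same set by \<open>CMF_unique\<close>.\<close>
    define \<tau> where "\<tau> = (\<lambda>i. inv_into {..n} m (m' i))"
    have \<tau>: "bij_betw \<tau> {..n} {..n}"
      unfolding \<tau>_def using bij_betw_trans[OF m'(2)[unfolded FF] bij_betw_inv_into[OF F(2)]] by (simp add: o_def)
    have m\<tau>: "m (\<tau> i) = m' i" if "i \<le> n" for i
    proof -
      have "m' i \<in> F" using m'(2) that unfolding FF bij_betw_def by auto
      then have "m' i \<in> m ` {..n}" using F(2) by (simp add: bij_betw_def)
      then show ?thesis unfolding \<tau>_def by (rule f_inv_into_f)
    qed
    define V where "V = (\<lambda>j. \<Inter>i\<in>{i\<in>{..n}. \<tau> i = j}. U i)"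
    have V: "open (V j)" for j unfolding V_def by (intro open_INT) (auto intro: U)
    define B where "B = PiE {..n} V \<times> (J \<inter> {-1<..<1})"
    have 1: "openin (product_topology (\<lambda>_. euclidean) {..n}) (PiE {..n} V)"
      by (subst openin_PiE) (use V in auto)
    have 2: "openin (top_of_set {-1<..<1}) (J \<inter> {-1<..<1})" using J by (auto simp: openin_open)
    have "openin (prod_topology (product_topology (\<lambda>_. euclidean) {..n}) (top_of_set {-1<..<1})) B"
      unfolding B_def openin_prod_Times_iff using 1 2 by blast
    then have "openin (MM_topology n) (s2 -` B \<inter> MM n)" unfolding MM_topology_def openin_pullback_topology by blast
    moreover have "x \<in> s2 -` B \<inter> MM n"
    proof -
      have "m j \<in> V j" for j unfolding V_def using m\<tau> m'(3) by auto
      then have "m \<in> PiE {..n} V" using S(2) by (simp add: PiE_iff)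
      then show ?thesis using xM m'(4) c_param_range[OF S(1)] by (simp add: xe s2_def B_def)
    qed
    moreover have "s2 -` B \<inter> MM n \<subseteq> {x \<in> MM n. fst x \<in> ?W}"
    proof
      fix y assume y: "y \<in> s2 -` B \<inter> MM n"
      obtain S1 m1 where ye: "y = (S1, m1)" by (cases y)
      have yM: "(S1, m1) \<in> MM n" and yB: "m1 \<in> PiE {..n} V" "c_param S1 \<in> J" using y by (auto simp: ye s2_def B_def)
      obtain F1 where S1: "S1 \<in> GG n" and F1: "CMF S1 F1" "bij_betw m1 {..n} F1" using yM unfolding MM_iff by blast
      have "bij_betw (m1 \<circ> \<tau>) {..n} F1" by (rule bij_betw_trans[OF \<tau> F1(2)])
      moreover have "\<forall>i\<le>n. (m1 \<circ> \<tau>) i \<in> U i"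
      proof (intro allI impI)
        fix i assume i: "i \<le> n"
        then have "\<tau> i \<in> {..n}" using \<tau> by (auto simp: bij_betw_def)
        then have "m1 (\<tau> i) \<in> V (\<tau> i)" using yB(1) by blast
        then show "(m1 \<circ> \<tau>) i \<in> U i" using i by (auto simp: V_def)
      qed
      ultimately have "S1 \<in> ?W" using S1 F1(1) yB(2) by blast
      then show "y \<in> {x \<in> MM n. fst x \<in> ?W}" using yM by (simp add: ye)
    qed
    ultimately show "\<exists>T. openin (MM_topology n) T \<and> x \<in> T \<and> T \<subseteq> {x \<in> MM n. fst x \<in> ?W}" by blast
  qed
qed

lemma mark_exists:
  assumes "S \<in> GG n" obtains F m where "CMF S F" "card F = n + 1" "bij_betw m {..n} F"
proof -
  obtain F where F: "CMF S F" "card F = n + 1" using assms by (auto simp: GG_def)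
  then obtain m where "bij_betw m {..n} F" using finite_same_card_bij[of "{..n}" F] CMF_D(1)[OF F(1)] by auto
  then show thesis using that F by blast
qed

text \<open>The moduli space itself is a set of marks without constraints.\<close>

lemma GG_topspace: assumes "S \<in> GG n" shows "S \<in> topspace (GG_topology n)"
proof -
  let ?W = "{S \<in> GG n. \<exists>m F. CMF S F \<and> bij_betw m {..n} F \<and> (\<forall>i\<le>n. m i \<in> (\<lambda>_. UNIV) i) \<and> c_param S \<in> UNIV}"
  obtain F m where m: "CMF S F" "card F = n + 1" "bij_betw m {..n} F" by (rule mark_exists[OF assms]) (rule that)
  have "S \<in> ?W" using assms m by auto
  moreover have "openin (GG_topology n) ?W" by (rule open_marks) simp_all
  ultimately show ?thesis by (meson openin_subset subsetD)
qed

text \<open>The hypotheses of \<open>stability\<close> are turned into an open set of marks and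
  slopes, which the sequence eventually enters.\<close>

lemma converges_imp_graphs_converge:
  assumes lim: "limitin (GG_topology n) G G0 sequentially" and G: "\<And>k. G k \<in> GG n" and G0: "G0 \<in> GG n"
  shows "graphs_converge_on_compacts G G0"
  unfolding graphs_converge_on_compacts_def
proof (intro allI impI)
  fix K assume K: "K \<subseteq> cylinder" "compact K"
  obtain L where L: "0 \<le> L" "\<And>z h. pr z h \<in> K \<Longrightarrow> \<bar>Im z\<bar> \<le> L" by (rule compact_cylinder_bounded[OF K(2)]) (rule that)
  obtain F0 m0 where F0: "CMF G0 F0" "card F0 = n + 1" "bij_betw m0 {..n} F0" by (rule mark_exists[OF G0]) (rule that)
  note gr0 = GG_D[OF G0]
  obtain a0 Y0 C0 where cyl0: "cyl_graph (sing G0 F0) (uf G0) (up G0) (uq G0) (ur G0) (us G0) (ut G0) a0 Y0 C0"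
    by (rule cyl_graph_exists[OF G0 F0(1)]) (rule that)
  have "\<forall>i. \<exists>z h. m0 i = pr z h" using pr_cases by metis
  then obtain y h where yh: "\<And>i. m0 i = pr (y i) (h i)" by metis
  have h: "h i = uf G0 (y i)" "y i \<in> sing G0 F0" if "i \<le> n" for i
  proof -
    have "m0 i \<in> F0" using F0(3) that by (auto simp: bij_betw_def)
    then show "h i = uf G0 (y i)" using CMF_D(2)[OF F0(1)] graph_iff[OF gr0] unfolding yh by blast
    then show "y i \<in> sing G0 F0" using \<open>m0 i \<in> F0\<close> by (simp add: sing_def yh)
  qed
  show "uniform_limit K (\<lambda>k. graph_fun (G k)) (graph_fun G0) sequentially"
  proof (rule uniform_limitI)
    fix \<eta> :: real assume \<eta>: "0 < \<eta>"
    have ne: "sing G0 F0 \<noteq> {}" using h(2)[of 0] by auto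
    have \<eta>2: "0 < \<eta> / 2" using \<eta> by simp
    from stability[OF cyl0 ne \<eta>2 L(1)] obtain \<delta> where \<delta>: "0 < \<delta>"
      and st: "\<And>\<Sigma> u p q r s t a Y C z. cyl_graph \<Sigma> u p q r s t a Y C \<Longrightarrow> \<bar>a - a0\<bar> \<le> \<delta> \<Longrightarrow>
        (\<And>z. z \<in> \<Sigma> \<Longrightarrow> \<exists>z'\<in>sing G0 F0. dist z z' \<le> \<delta> \<and> \<bar>u z - uf G0 z'\<bar> \<le> \<delta>) \<Longrightarrow>
        (\<And>z'. z' \<in> sing G0 F0 \<Longrightarrow> \<exists>z\<in>\<Sigma>. dist z z' \<le> \<delta> \<and> \<bar>u z - uf G0 z'\<bar> \<le> \<delta>) \<Longrightarrow>
        \<bar>Im z\<bar> \<le> L \<Longrightarrow> \<bar>u z - uf G0 z\<bar> \<le> \<eta> / 2"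
      by blast
    \<comment> \<open>Boxes around the singular points of the limit, controlling position and height
      at the same time, as \<open>stability\<close> requires.\<close>
    define U where "U = (\<lambda>i. proj ` {v. dist (hor v) (y i) < \<delta> \<and> \<bar>v $ 3 - h i\<bar> < \<delta>})"
    have oU: "open (U i)" for i
      unfolding U_def by (intro open_proj_image open_Collect_conj open_Collect_less continuous_intros continuous_hor continuous_nth3)
    define J where "J = {c. \<bar>slope c - a0\<bar> < \<delta>}"
    have c1: "1 + c\<^sup>2 \<noteq> 0" for c :: real using zero_le_power2[of c] by linarith
    have oJ: "open J" unfolding J_def slope_def by (intro open_Collect_less continuous_intros) (use c1 in auto)
    let ?W = "{S \<in> GG n. \<exists>m F. CMF S F \<and> bij_betw m {..n} F \<and> (\<forall>i\<le>n. m i \<in> U i) \<and> c_param S \<in> J}"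
    have "m0 i \<in> U i" for i unfolding U_def yh pr_def using \<delta> by (intro imageI) simp
    moreover have "c_param G0 \<in> J" using c_param_slope(2)[OF G0 F0(1) cyl0] \<delta> by (simp add: J_def)
    ultimately have "G0 \<in> ?W" using G0 F0 by blast
    moreover have "openin (GG_topology n) ?W" by (rule open_marks[OF oU oJ])
    ultimately have "\<forall>\<^sub>F k in sequentially. G k \<in> ?W" using lim unfolding limitin_def by blast
    then show "\<forall>\<^sub>F k in sequentially. \<forall>q\<in>K. dist (graph_fun (G k) q) (graph_fun G0 q) < \<eta>"
    proof eventually_elim
      case (elim k)
      then obtain m F where m: "CMF (G k) F" "bij_betw m {..n} F" "\<forall>i\<le>n. m i \<in> U i" "c_param (G k) \<in> J" by blast
      note gr = GG_D[OF G[of k]]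
      obtain a Y C where cyl: "cyl_graph (sing (G k) F) (uf (G k)) (up (G k)) (uq (G k)) (ur (G k)) (us (G k)) (ut (G k)) a Y C"
        by (rule cyl_graph_exists[OF G m(1)]) (rule that)
      have a: "\<bar>a - a0\<bar> \<le> \<delta>" using m(4) c_param_slope(2)[OF G m(1) cyl] by (simp add: J_def)
      have per: "uf S (z + of_int l) = uf S z" for S z l using periodic_int[of "uf S" z l] uf_periodic[of S] by blast
      have sper: "z + of_int l \<in> sing S F \<longleftrightarrow> z \<in> sing S F" for S F z l
        using periodic_int[where f="\<lambda>z. z \<in> sing S F", of z l] sing_periodic[of _ S F] by blast
      \<comment> \<open>Marks exhaust both singular sets, so closeness index by index gives
        closeness in both directions; the integer translations between lifts are undone by
        periodicity.\<close>
      have s1: "\<exists>z'\<in>sing G0 F0. dist z z' \<le> \<delta> \<and> \<bar>uf (G k) z - uf G0 z'\<bar> \<le> \<delta>" if z: "z \<in> sing (G k) F" for z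
      proof -
        have "pr z (uf (G k) z) \<in> m ` {..n}" unfolding bij_betw_imp_surj_on[OF m(2)] using z by (simp add: sing_def)
        then obtain i where i': "pr z (uf (G k) z) = m i" "i \<in> {..n}" by (rule imageE)
        have i: "i \<le> n" "m i = pr z (uf (G k) z)" using i'(2) i'(1)[symmetric] by simp_all
        obtain v where v: "m i = proj v" "dist (hor v) (y i) < \<delta>" "\<bar>v $ 3 - h i\<bar> < \<delta>" using m(3) i(1) unfolding U_def by blast
        have "pr z (uf (G k) z) = pr (hor v) (v $ 3)" using i(2) v(1) by (simp add: proj_eq_pr)
        then obtain l :: int where l: "v $ 3 = uf (G k) z" "hor v = z + of_int l" by (auto simp: pr_eq_iff)
        have A: "uf G0 (y i + of_int (- l)) = h i" unfolding per by (rule h(1)[OF i(1), symmetric])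
        have B: "y i + of_int (- l) \<in> sing G0 F0" unfolding sper by (rule h(2)[OF i(1)])
        have D: "dist z (y i + of_int (- l)) = dist (hor v) (y i)" unfolding l(2) dist_norm by (simp add: algebra_simps)
        show ?thesis
        proof (rule bexI[OF conjI B])
          show "dist z (y i + of_int (- l)) \<le> \<delta>" unfolding D using v(2) by simp
          show "\<bar>uf (G k) z - uf G0 (y i + of_int (- l))\<bar> \<le> \<delta>" unfolding A l(1)[symmetric] using v(3) by simp
        qed
      qed
      have s2: "\<exists>z\<in>sing (G k) F. dist z z' \<le> \<delta> \<and> \<bar>uf (G k) z - uf G0 z'\<bar> \<le> \<delta>" if z': "z' \<in> sing G0 F0" for z'
      proof -
        have "pr z' (uf G0 z') \<in> m0 ` {..n}" unfolding bij_betw_imp_surj_on[OF F0(3)] using z' by (simp add: sing_def)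
        then obtain i where i': "pr z' (uf G0 z') = m0 i" "i \<in> {..n}" by (rule imageE)
        have i: "i \<le> n" "m0 i = pr z' (uf G0 z')" using i'(2) i'(1)[symmetric] by simp_all
        obtain v where v: "m i = proj v" "dist (hor v) (y i) < \<delta>" "\<bar>v $ 3 - h i\<bar> < \<delta>" using m(3) i(1) unfolding U_def by blast
        obtain k' :: int where k': "h i = uf G0 z'" "z' = y i + of_int k'" using i(2) unfolding yh pr_eq_iff by blast
        define l where "l = - k'"
        have l: "h i = uf G0 z'" "y i = z' + of_int l" using k' by (simp_all add: l_def)
        have "m i \<in> F" using m(2) i(1) by (auto simp: bij_betw_def)
        then have "pr (hor v) (v $ 3) \<in> F" using v(1) by (simp add: proj_eq_pr)
        then have v3: "v $ 3 = uf (G k) (hor v)" using CMF_D(2)[OF m(1)] graph_iff[OF gr] by blast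
        have hv: "hor v \<in> sing (G k) F" using \<open>pr (hor v) (v $ 3) \<in> F\<close> unfolding sing_def v3 by simp
        have A: "uf (G k) (hor v + of_int (- l)) = v $ 3" unfolding per by (rule v3[symmetric])
        have B: "hor v + of_int (- l) \<in> sing (G k) F" unfolding sper by (rule hv)
        have D: "dist (hor v + of_int (- l)) z' = dist (hor v) (y i)" unfolding l(2) dist_norm by (simp add: algebra_simps)
        show ?thesis
        proof (rule bexI[OF conjI B])
          show "dist (hor v + of_int (- l)) z' \<le> \<delta>" unfolding D using v(2) by simp
          show "\<bar>uf (G k) (hor v + of_int (- l)) - uf G0 z'\<bar> \<le> \<delta>" unfolding A l(1)[symmetric] using v(3) by simp
        qed
      qed
      show ?case
      proof
        fix q assume q: "q \<in> K"
        obtain z t where "q = pr z t" by (rule pr_cases)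
        moreover have "q \<in> cylinder" using q K(1) by blast
        ultimately have qz: "q = pr z 0" by (simp add: pr_in_cylinder)
        have Lz: "\<bar>Im z\<bar> \<le> L" using L(2) q unfolding qz by blast
        have "\<bar>uf (G k) z - uf G0 z\<bar> \<le> \<eta> / 2"
        proof (rule st[OF cyl a _ _ Lz])
          show "\<exists>z'\<in>sing G0 F0. dist x z' \<le> \<delta> \<and> \<bar>uf (G k) x - uf G0 z'\<bar> \<le> \<delta>" if "x \<in> sing (G k) F" for x by (rule s1[OF that])
          show "\<exists>x\<in>sing (G k) F. dist x z' \<le> \<delta> \<and> \<bar>uf (G k) x - uf G0 z'\<bar> \<le> \<delta>" if "z' \<in> sing G0 F0" for z' by (rule s2[OF that])
        qed
        then show "dist (graph_fun (G k) q) (graph_fun G0 q) < \<eta>" using \<eta> by (simp add: qz uf_def dist_real_def)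
      qed
    qed
  qed
qed

section \<open>From converging graphs to converging marks and normals\<close>

lemma tendsto_pr:
  assumes "(f \<longlongrightarrow> z) \<F>" "(g \<longlongrightarrow> h) \<F>" shows "((\<lambda>k. pr (f k) (g k)) \<longlongrightarrow> pr z h) \<F>"
proof -
  have "continuous_on UNIV (\<lambda>x. pr (fst x) (snd x))" by (intro continuous_on_pr continuous_intros)
  then have "isCont (\<lambda>x. pr (fst x) (snd x)) (z, h)" by (simp add: continuous_on_eq_continuous_at)
  from isCont_tendsto_compose[OF this tendsto_Pair[OF assms]] show ?thesis by simp
qed

text \<open>A common line below all singularities lets \<open>slope_estimate\<close> run with the
  same b and H for the sequence and the limit.\<close>

lemma slopes_converge:
  assumes S0: "S0 \<in> GG n" "CMF S0 F0" and G: "\<And>k. G k \<in> GG n" "\<And>k. CMF (G k) (F k)"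
    and conv: "\<And>L \<eta>. 0 < \<eta> \<Longrightarrow> \<forall>\<^sub>F k in sequentially. \<forall>z. \<bar>Im z\<bar> \<le> L \<longrightarrow> \<bar>uf (G k) z - uf S0 z\<bar> < \<eta>"
    and low: "\<forall>\<^sub>F k in sequentially. \<forall>z\<in>sing (G k) (F k). b < Im z" "\<forall>z\<in>sing S0 F0. b < Im z"
  shows "(\<lambda>k. c_param (G k)) \<longlonglongrightarrow> c_param S0"
proof -
  have ex: "\<exists>a Y C. cyl_graph (sing S F) (uf S) (up S) (uq S) (ur S) (us S) (ut S) a Y C" if "S \<in> GG n" "CMF S F" for S F
    using cyl_graph_exists[OF that] by metis
  obtain a0 Y0 C0 where cyl0: "cyl_graph (sing S0 F0) (uf S0) (up S0) (uq S0) (ur S0) (us S0) (ut S0) a0 Y0 C0" using ex[OF S0] by blast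
  have "\<forall>k. \<exists>a. \<exists>Y C. cyl_graph (sing (G k) (F k)) (uf (G k)) (up (G k)) (uq (G k)) (ur (G k)) (us (G k)) (ut (G k)) a Y C" using ex[OF G] by blast
  then obtain a where a: "\<And>k. \<exists>Y C. cyl_graph (sing (G k) (F k)) (uf (G k)) (up (G k)) (uq (G k)) (ur (G k)) (us (G k)) (ut (G k)) (a k) Y C" by metis
  have "a \<longlonglongrightarrow> a0"
  proof (rule tendstoI)
    fix e :: real assume e: "0 < e"
    \<comment> \<open>The two slope estimates and the two height comparisons contribute at most 1
      each, so the slopes differ by less than 5/H = e.\<close>
    define H where "H = 5 / e"
    have H: "0 < H" using e by (simp add: H_def)
    have "\<forall>\<^sub>F k in sequentially. \<forall>z. \<bar>Im z\<bar> \<le> \<bar>b\<bar> + H \<longrightarrow> \<bar>uf (G k) z - uf S0 z\<bar> < 1" by (rule conv) simp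
    with low(1) show "\<forall>\<^sub>F k in sequentially. dist (a k) a0 < e"
    proof eventually_elim
      case (elim k)
      obtain Y C where cyl: "cyl_graph (sing (G k) (F k)) (uf (G k)) (up (G k)) (uq (G k)) (ur (G k)) (us (G k)) (ut (G k)) (a k) Y C" using a by blast
      have 1: "\<bar>uf (G k) (Complex 0 (b - H)) - uf (G k) (Complex 0 b) + a k * H\<bar> \<le> 1"
        by (rule slope_estimate[OF cyl]) (use elim(1) H in auto)
      have 2: "\<bar>uf S0 (Complex 0 (b - H)) - uf S0 (Complex 0 b) + a0 * H\<bar> \<le> 1"
        by (rule slope_estimate[OF cyl0]) (use low(2) H in auto)
      have 3: "\<bar>uf (G k) (Complex 0 (b - H)) - uf S0 (Complex 0 (b - H))\<bar> < 1" by (rule elim(2)[rule_format]) (use H in auto)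
      have 4: "\<bar>uf (G k) (Complex 0 b) - uf S0 (Complex 0 b)\<bar> < 1" by (rule elim(2)[rule_format]) (use H in auto)
      have "\<bar>a k * H - a0 * H\<bar> < 5" using 1 2 3 4 by linarith
      then have "\<bar>a k - a0\<bar> * H < 5" using H by (simp add: abs_mult flip: left_diff_distrib)
      then show ?case using e by (simp add: H_def dist_real_def field_simps)
    qed
  qed
  have "1 + sqrt (1 - x\<^sup>2) \<noteq> 0" if "\<bar>x\<bar> < 1" for x :: real
    using that real_sqrt_ge_zero[of "1 - x\<^sup>2"] abs_square_less_1[of x] by linarith
  then have "(\<lambda>k. unslope (a k)) \<longlonglongrightarrow> unslope a0"
    unfolding unslope_def using cyl_graphD(7)[OF cyl0] by (intro tendsto_intros \<open>a \<longlonglongrightarrow> a0\<close>) auto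
  moreover have "c_param (G k) = unslope (a k)" for k using a[of k] c_param_eq[OF G] by blast
  ultimately show ?thesis using c_param_eq[OF S0 cyl0] by simp
qed

text \<open>Convergence in a quotient requires a lift: marks of \<open>G k\<close> are constructed
  that converge to a chosen mark of the limit.\<close>

lemma graphs_converge_imp_converges:
  assumes conv: "graphs_converge_on_compacts G G0" and G: "\<And>k. G k \<in> GG n" and G0: "G0 \<in> GG n"
  shows "limitin (GG_topology n) G G0 sequentially"
proof -
  note strip = graphs_converge_strip[OF conv]
  obtain F0 m where F0: "CMF G0 F0" "card F0 = n + 1" "bij_betw m {..n} F0" by (rule mark_exists[OF G0]) (rule that)
  define m0 where "m0 = restrict m {..n}"
  have m0: "m0 \<in> extensional {..n}" "bij_betw m0 {..n} F0" using F0(3) bij_betw_cong[of "{..n}" m0 m F0] by (simp_all add: m0_def)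
  note gr0 = GG_D[OF G0] and gr = GG_D[OF G]
  have "\<forall>k. \<exists>F. CMF (G k) F \<and> card F = n + 1" using G by (auto simp: GG_def)
  then obtain F where F: "\<And>k. CMF (G k) (F k)" "\<And>k. card (F k) = n + 1" by metis
  have "\<forall>i. \<exists>z h. m0 i = pr z h" using pr_cases by metis
  then obtain y h where yh: "\<And>i. m0 i = pr (y i) (h i)" by metis
  have h: "h i = uf G0 (y i)" "y i \<in> sing G0 F0" if "i \<le> n" for i
  proof -
    have "m0 i \<in> F0" using m0(2) that by (auto simp: bij_betw_def)
    then show "h i = uf G0 (y i)" using CMF_D(2)[OF F0(1)] graph_iff[OF gr0] unfolding yh by blast
    then show "y i \<in> sing G0 F0" using \<open>m0 i \<in> F0\<close> by (simp add: sing_def yh)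
  qed
  \<comment> \<open>Taking the nearest singularity gives one choice for each k that works for all
    tolerances at once.\<close>
  have "\<exists>z\<in>sing (G k) (F k). \<forall>w\<in>sing (G k) (F k). dist (y i) z \<le> dist (y i) w" for k i
  proof -
    have "F k \<noteq> {}" using F(2)[of k] by auto
    then obtain q where q: "q \<in> F k" by blast
    obtain z t where zt: "q = pr z t" by (rule pr_cases)
    have "t = uf (G k) z" using q CMF_D(2)[OF F(1)] graph_iff[OF gr] unfolding zt by blast
    then have "z \<in> sing (G k) (F k)" using q by (simp add: sing_def zt)
    then have ne: "sing (G k) (F k) \<noteq> {}" by blast
    obtain w where "w \<in> sing (G k) (F k)" "\<And>x. x \<in> sing (G k) (F k) \<Longrightarrow> dist (y i) w \<le> dist (y i) x"
      by (rule distance_attains_inf[OF closed_sing[OF gr CMF_D(1,2)[OF F(1)]] ne, where a="y i"]) (rule that)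
    then show ?thesis by blast
  qed
  then obtain Z where Z: "\<And>k i. Z k i \<in> sing (G k) (F k)" "\<And>k i w. w \<in> sing (G k) (F k) \<Longrightarrow> dist (y i) (Z k i) \<le> dist (y i) w" by metis
  have Zlim: "\<forall>\<^sub>F k in sequentially. dist (Z k i) (y i) < \<epsilon>" if "i \<le> n" "0 < \<epsilon>" for i \<epsilon>
  proof -
    have "\<forall>\<^sub>F k in sequentially. \<exists>z\<in>sing (G k) (F k). dist z (y i) < \<epsilon>"
      by (rule singularity_persists[OF G0 F0(1) G F(1) strip h(2)[OF that(1)] that(2)])
    then show ?thesis by eventually_elim (metis Z(2) dist_commute order.strict_trans1)
  qed
  then have Zt: "(\<lambda>k. Z k i) \<longlonglongrightarrow> y i" if "i \<le> n" for i using that by (auto intro: tendstoI)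
  have Lip: "\<bar>uf (G k) z - uf (G k) w\<bar> \<le> dist z w" for k z w
    using cyl_graph_exists[OF G F(1)] cyl_graphD(3) by metis
  have ut: "(\<lambda>k. uf (G k) (Z k i)) \<longlonglongrightarrow> h i" if i: "i \<le> n" for i
  proof (rule tendstoI)
    fix e :: real assume e: "0 < e"
    then have "\<forall>\<^sub>F k in sequentially. dist (Z k i) (y i) < e / 2" by (intro Zlim i) simp
    moreover have "\<forall>\<^sub>F k in sequentially. \<forall>z. \<bar>Im z\<bar> \<le> \<bar>Im (y i)\<bar> \<longrightarrow> \<bar>uf (G k) z - uf G0 z\<bar> < e / 2" by (rule strip) (use e in simp)
    ultimately show "\<forall>\<^sub>F k in sequentially. dist (uf (G k) (Z k i)) (h i) < e"
    proof eventually_elim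
      case (elim k)
      have "\<bar>uf (G k) (y i) - uf G0 (y i)\<bar> < e / 2" using elim(2) by blast
      then show ?case using Lip[of k "Z k i" "y i"] elim(1) h(1)[OF i] unfolding dist_real_def by linarith
    qed
  qed
  define M where "M = (\<lambda>k. restrict (\<lambda>i. pr (Z k i) (uf (G k) (Z k i))) {..n})"
  \<comment> \<open>Distinct marks must be separated together with all their integer translates,
    since injectivity is needed in the quotient.\<close>
  have sep: "\<exists>\<rho>>0. \<forall>i\<le>n. \<forall>l::int. i \<noteq> j \<longrightarrow> \<rho> \<le> dist (y i + of_int l) (y j)" if j: "j \<le> n" for j
  proof -
    obtain \<rho> where \<rho>: "0 < \<rho>" "\<And>z. z \<in> ball (y j) \<rho> \<Longrightarrow> z \<noteq> y j \<Longrightarrow> z \<notin> sing G0 F0"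
      by (rule isolated_sing[OF gr0 CMF_D(1,2)[OF F0(1)]]) (rule that)
    have "\<rho> \<le> dist (y i + of_int l) (y j)" if i: "i \<le> n" "i \<noteq> j" for i and l :: int
    proof (rule ccontr)
      assume n: "\<not> \<rho> \<le> dist (y i + of_int l) (y j)"
      have "y i + of_int l \<in> sing G0 F0"
        using periodic_int[where f="\<lambda>z. z \<in> sing G0 F0", of "y i" l] sing_periodic[of _ G0 F0] h(2)[OF i(1)] by blast
      moreover have "y i + of_int l \<in> ball (y j) \<rho>" using n by (simp add: dist_commute)
      ultimately have e: "y j = y i + of_int l" using \<rho>(2) by metis
      have "uf G0 (y j) = uf G0 (y i)" unfolding e using periodic_int[of "uf G0" "y i" l] uf_periodic by blast
      then have "m0 i = m0 j" unfolding yh pr_eq_iff using h(1) i(1) j e by auto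
      then show False using m0(2) i j by (auto simp: bij_betw_def inj_on_def)
    qed
    then show ?thesis using \<rho>(1) by blast
  qed
  then obtain \<rho> where \<rho>: "\<And>j. j \<le> n \<Longrightarrow> 0 < \<rho> j" "\<And>i j l. j \<le> n \<Longrightarrow> i \<le> n \<Longrightarrow> i \<noteq> j \<Longrightarrow> \<rho> j \<le> dist (y i + of_int (l::int)) (y j)" by metis
  \<comment> \<open>Half of the separation, so that two nearest singularities that coincide modulo
    the period would violate it. The bound 1 keeps every singularity of \<open>G k\<close> above the
    line at height b.\<close>
  define \<epsilon> where "\<epsilon> = min 1 (Min (\<rho> ` {..n})) / 2"
  have \<epsilon>: "0 < \<epsilon>" "\<epsilon> \<le> 1" "\<And>j. j \<le> n \<Longrightarrow> 2 * \<epsilon> \<le> \<rho> j" using \<rho>(1) by (auto simp: \<epsilon>_def min_le_iff_disj)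
  have "\<forall>\<^sub>F k in sequentially. \<forall>i\<in>{..n}. dist (Z k i) (y i) < \<epsilon>"
    by (rule eventually_ball_finite) (use Zlim \<epsilon>(1) in auto)
  then have bij: "\<forall>\<^sub>F k in sequentially. bij_betw (M k) {..n} (F k) \<and> (\<forall>i\<in>{..n}. dist (Z k i) (y i) < \<epsilon>)"
  proof eventually_elim
    case (elim k)
    have inj: "inj_on (M k) {..n}"
    proof (rule inj_onI, rule ccontr)
      fix i j assume ij: "i \<in> {..n}" "j \<in> {..n}" "M k i = M k j" "i \<noteq> j"
      then obtain l :: int where l: "Z k j = Z k i + of_int l" by (auto simp: M_def pr_eq_iff)
      have "dist (y i + of_int l) (y j) \<le> dist (y i + of_int l) (Z k i + of_int l) + dist (Z k j) (y j)"
        unfolding l by (rule dist_triangle)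
      also have "\<dots> < 2 * \<epsilon>"
      proof -
        have "dist (Z k i) (y i) < \<epsilon>" "dist (Z k j) (y j) < \<epsilon>" using elim ij(1,2) by blast+
        moreover have "dist (y i + of_int l) (Z k i + of_int l) = dist (Z k i) (y i)" by (simp add: dist_commute)
        ultimately show ?thesis by linarith
      qed
      finally show False using \<epsilon>(3)[of j] \<rho>(2)[of j i l] ij by auto
    qed
    have "M k ` {..n} \<subseteq> F k" using Z(1) by (auto simp: M_def sing_def)
    \<comment> \<open>Injectivity and equal cardinality: n + 1 distinct singularities close to those
      of the limit are all there are.\<close>
    then have "M k ` {..n} = F k" by (intro card_subset_eq CMF_D(1)[OF F(1)]) (simp_all add: card_image[OF inj] F(2))
    then show ?case using inj elim by (simp add: bij_betw_def)
  qed
  define b where "b = Min ((\<lambda>i. Im (y i)) ` {..n}) - 1"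
  have b: "b + 1 \<le> Im (y i)" if "i \<le> n" for i unfolding b_def using that by simp
  have low: "\<forall>\<^sub>F k in sequentially. \<forall>z\<in>sing (G k) (F k). b < Im z"
    using bij
  proof eventually_elim
    case (elim k)
    show ?case
    proof
      fix z assume "z \<in> sing (G k) (F k)"
      then have "pr z (uf (G k) z) \<in> M k ` {..n}" using elim by (simp add: sing_def bij_betw_def)
      then obtain i where i: "i \<le> n" "pr z (uf (G k) z) = pr (Z k i) (uf (G k) (Z k i))" by (auto simp: M_def)
      then have "Im z = Im (Z k i)" by (auto simp: pr_eq_iff)
      moreover have "\<bar>Im (Z k i) - Im (y i)\<bar> < 1"
      proof -
        have "dist (Z k i) (y i) < \<epsilon>" using elim i(1) by blast
        then show ?thesis using abs_Im_le_cmod[of "Z k i - y i"] \<epsilon>(2) by (simp add: dist_norm)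
      qed
      ultimately show "b < Im z" using b[OF i(1)] by linarith
    qed
  qed
  have low0: "\<forall>z\<in>sing G0 F0. b < Im z"
  proof
    fix z assume "z \<in> sing G0 F0"
    then have "pr z (uf G0 z) \<in> m0 ` {..n}" using m0(2) by (simp add: sing_def bij_betw_def)
    then obtain i where i: "i \<le> n" "pr z (uf G0 z) = pr (y i) (h i)" by (auto simp: yh)
    then have "Im z = Im (y i)" by (auto simp: pr_eq_iff)
    then show "b < Im z" using b[OF i(1)] by simp
  qed
  have cp: "(\<lambda>k. c_param (G k)) \<longlonglongrightarrow> c_param G0" by (rule slopes_converge[OF G0 F0(1) G F(1) strip low low0])
  let ?P = "product_topology (\<lambda>_. euclidean :: l3quot topology) {..n}" and ?T = "top_of_set {-1<..<1::real}"
  have lM: "limitin ?P M m0 sequentially"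
    unfolding limitin_componentwise
  proof (intro conjI ballI)
    show "m0 \<in> extensional {..n}" by (rule m0)
    show "\<forall>\<^sub>F k in sequentially. M k \<in> topspace ?P" by (simp add: M_def PiE_def)
    fix i assume i: "i \<in> {..n}"
    have "(\<lambda>k. pr (Z k i) (uf (G k) (Z k i))) \<longlonglongrightarrow> pr (y i) (h i)" using i by (intro tendsto_pr Zt ut) auto
    then show "limitin euclidean (\<lambda>k. M k i) (m0 i) sequentially" using i by (simp add: M_def yh)
  qed
  have lc: "limitin ?T (\<lambda>k. c_param (G k)) (c_param G0) sequentially"
    unfolding limitin_subtopology using cp c_param_range[OF G0] c_param_range[OF G] by simp
  have ls: "limitin (prod_topology ?P ?T) (\<lambda>k. s2 (G k, M k)) (s2 (G0, m0)) sequentially"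
    unfolding limitin_pairwise using lM lc by (simp add: s2_def o_def)
  show ?thesis
    unfolding limitin_def
  proof (intro conjI allI impI)
    show "G0 \<in> topspace (GG_topology n)" by (rule GG_topspace[OF G0])
    fix W assume W: "openin (GG_topology n) W \<and> G0 \<in> W"
    then have "openin (MM_topology n) {x \<in> MM n. fst x \<in> W}" by (simp add: openin_GG_topology)
    then obtain B where B: "openin (prod_topology ?P ?T) B" "{x \<in> MM n. fst x \<in> W} = s2 -` B \<inter> MM n"
      unfolding MM_topology_def openin_pullback_topology by blast
    have "(G0, m0) \<in> MM n" unfolding MM_iff using G0 m0 F0(1) by blast
    then have "(G0, m0) \<in> {x \<in> MM n. fst x \<in> W}" using W by simp
    then have "s2 (G0, m0) \<in> B" unfolding B(2) by blast
    then have "\<forall>\<^sub>F k in sequentially. s2 (G k, M k) \<in> B" using ls B(1) unfolding limitin_def by blast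
    with bij show "\<forall>\<^sub>F k in sequentially. G k \<in> W"
    proof eventually_elim
      case (elim k)
      have "M k \<in> extensional {..n}" by (simp add: M_def)
      then have "(G k, M k) \<in> MM n" unfolding MM_iff using G[of k] F(1)[of k] elim(1) by blast
      then have "(G k, M k) \<in> s2 -` B \<inter> MM n" using elim(2) by simp
      then show ?case unfolding B(2)[symmetric] by simp
    qed
  qed
qed

theorem theorem3p3:
  fixes n :: nat and G :: "nat \<Rightarrow> l3quot set" and G0 :: "l3quot set"
  assumes "n \<ge> 1"
    and "\<And>k. G k \<in> GG n"
    and "G0 \<in> GG n"
  shows "limitin (GG_topology n) G G0 sequentially \<longleftrightarrow> graphs_converge_on_compacts G G0"
  using converges_imp_graphs_converge graphs_converge_imp_converges assms(2,3) by blast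

end
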